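(* Let $G$ be a graph. Given a nice tree-cut decomposition $(S,\mathcal{D})$ of $G$ of width $w$, one can compute a friendly tree-cut decomposition of $G$ of width at most $\max(4,w)$ in time $O(w|G|+|S|)$.
   Context: $|G|=|V(G)|+|E(G)|$ and $|S|$ is the number of nodes of $S$. A tree-cut decomposition of $G$ is a rooted tree $S$ with a family of pairwise disjoint (possibly empty) bags $X_s$, $s\in V(S)$, whose union is $V(G)$. For a node $s$, $Y_s$ is the union of bags in the subtree rooted at $s$ and the adhesion $\mathrm{adh}(s)$ is the number of edges with exactly one endpoint in $Y_s$. The torso $H_s$ is obtained from $G$ by contracting, for each component $C$ of $S-s$, the union of bags of $C$ into one peripheral vertex (keeping parallel edges). The 3-center of $H_s$ is obtained by repeatedly suppressing peripheral vertices (those not in $X_s$) of degree at most 2 and deleting loops. The width is the maximum over nodes of the adhesion and the number of vertices of the 3-center. A node is thin if its adhesion is at most 2 and bold otherwise. The decomposition is nice if for every thin node $t$, $N_G(Y_t)$ is disjoint from the union of $Y_{t'}$ over all siblings $t'$ of $t$. A decomposition of width $w'$ is friendly if it is nice and for every node $s$, (number of bold children of $s$) $+|X_s|\le w'+2$. *)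

theory Defs
  imports Main "HOL-Library.Multiset"
begin

section \<open>Graphs and tree-cut decompositions\<close>

record 'v sgraph =
  gverts :: "'v set"
  gedges :: "'v set set"

definition simple_graph :: "'v sgraph \<Rightarrow> bool" where
  "simple_graph G \<longleftrightarrow> finite (gverts G) \<and> (\<forall>e\<in>gedges G. e \<subseteq> gverts G \<and> card e = 2)"

definition gsize :: "'v sgraph \<Rightarrow> nat" where
  "gsize G = card (gverts G) + card (gedges G)"

definition gneighbours :: "'v sgraph \<Rightarrow> 'v set \<Rightarrow> 'v set" where
  "gneighbours G Y = {v \<in> gverts G - Y. \<exists>u\<in>Y. {u, v} \<in> gedges G}"

text \<open>The rooted tree is given by parent pointers; the parent of the root is irrelevant.\<close>

record ('v, 's) tcdecomp =
  tnodes :: "'s set"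
  troot :: 's
  tparent :: "'s \<Rightarrow> 's"
  tbag :: "'s \<Rightarrow> 'v set"

definition parent_rel :: "('v, 's) tcdecomp \<Rightarrow> ('s \<times> 's) set" where
  "parent_rel D = {(t, tparent D t) |t. t \<in> tnodes D - {troot D}}"

definition rooted_tree :: "('v, 's) tcdecomp \<Rightarrow> bool" where
  "rooted_tree D \<longleftrightarrow> finite (tnodes D) \<and> troot D \<in> tnodes D \<and>
     (\<forall>t\<in>tnodes D - {troot D}. tparent D t \<in> tnodes D) \<and>
     (\<forall>t\<in>tnodes D. (t, troot D) \<in> (parent_rel D)\<^sup>*)"

definition tree_cut_decomposition :: "'v sgraph \<Rightarrow> ('v, 's) tcdecomp \<Rightarrow> bool" where
  "tree_cut_decomposition G D \<longleftrightarrow> rooted_tree D \<and>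
     (\<forall>s\<in>tnodes D. \<forall>t\<in>tnodes D. s \<noteq> t \<longrightarrow> tbag D s \<inter> tbag D t = {}) \<and>
     (\<Union>s\<in>tnodes D. tbag D s) = gverts G"

definition tchildren :: "('v, 's) tcdecomp \<Rightarrow> 's \<Rightarrow> 's set" where
  "tchildren D s = {t \<in> tnodes D - {troot D}. tparent D t = s}"

definition tsiblings :: "('v, 's) tcdecomp \<Rightarrow> 's \<Rightarrow> 's set" where
  "tsiblings D t = (if t = troot D then {} else tchildren D (tparent D t) - {t})"

text \<open>\<open>below D s\<close> is the set called \<open>Y\<^sub>s\<close> in the literature.\<close>

definition below :: "('v, 's) tcdecomp \<Rightarrow> 's \<Rightarrow> 'v set" where
  "below D s = (\<Union>t \<in> {t \<in> tnodes D. (t, s) \<in> (parent_rel D)\<^sup>*}. tbag D t)"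

definition adhesion :: "'v sgraph \<Rightarrow> ('v, 's) tcdecomp \<Rightarrow> 's \<Rightarrow> nat" where
  "adhesion G D s = card {e \<in> gedges G. card (e \<inter> below D s) = 1}"

abbreviation thin :: "'v sgraph \<Rightarrow> ('v, 's) tcdecomp \<Rightarrow> 's \<Rightarrow> bool" where
  "thin G D s \<equiv> adhesion G D s \<le> 2"

abbreviation bold :: "'v sgraph \<Rightarrow> ('v, 's) tcdecomp \<Rightarrow> 's \<Rightarrow> bool" where
  "bold G D s \<equiv> \<not> thin G D s"


section \<open>Torso, 3-center, width\<close>

text \<open>Multigraphs: an edge is the set of its endpoints, so a loop is a singleton.\<close>

record 'a mgraph =
  mverts :: "'a set"
  medges :: "'a set multiset"

definition node_components :: "('v, 's) tcdecomp \<Rightarrow> 's \<Rightarrow> 's set set" where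
  "node_components D s =
     (let N = tnodes D - {s};
          R = (parent_rel D \<union> (parent_rel D)\<inverse>) \<inter> N \<times> N
      in (\<lambda>t. {t'. (t, t') \<in> R\<^sup>*}) ` N)"

text \<open>The peripheral vertices of the torso are the \<open>Inr C\<close>, where \<open>C\<close> is a component of the
  tree without \<open>s\<close>. A component all of whose bags are empty yields an isolated peripheral vertex,
  which disappears in the 3-center.\<close>

definition torso_map :: "('v, 's) tcdecomp \<Rightarrow> 's \<Rightarrow> 'v \<Rightarrow> 'v + 's set" where
  "torso_map D s v =
     (if v \<in> tbag D s then Inl v
      else Inr (THE C. C \<in> node_components D s \<and> v \<in> (\<Union>t\<in>C. tbag D t)))"

definition torso :: "'v sgraph \<Rightarrow> ('v, 's) tcdecomp \<Rightarrow> 's \<Rightarrow> ('v + 's set) mgraph" where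
  "torso G D s =
     \<lparr> mverts = Inl ` tbag D s \<union> Inr ` node_components D s,
       medges = {#e \<in># image_mset (\<lambda>e. torso_map D s ` e) (mset_set (gedges G)). card e = 2#} \<rparr>"

text \<open>One step towards the 3-center, where the vertices in \<open>K\<close> must not be suppressed.
  Suppressing a vertex whose two edges lead to the same neighbour creates a loop.\<close>

inductive center_step :: "'a set \<Rightarrow> 'a mgraph \<Rightarrow> 'a mgraph \<Rightarrow> bool" for K :: "'a set" where
  delete_loop:
    "{x} \<in># medges H \<Longrightarrow>
     center_step K H \<lparr> mverts = mverts H, medges = medges H - {#{x}#} \<rparr>"
| suppress_le_1:
    "v \<in> mverts H - K \<Longrightarrow> {v} \<notin># medges H \<Longrightarrow> size {#e \<in># medges H. v \<in> e#} \<le> 1 \<Longrightarrow>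
     center_step K H \<lparr> mverts = mverts H - {v}, medges = {#e \<in># medges H. v \<notin> e#} \<rparr>"
| suppress_2:
    "v \<in> mverts H - K \<Longrightarrow> a \<noteq> v \<Longrightarrow> b \<noteq> v \<Longrightarrow>
     {#e \<in># medges H. v \<in> e#} = {#{v, a}, {v, b}#} \<Longrightarrow>
     center_step K H
       \<lparr> mverts = mverts H - {v}, medges = {#e \<in># medges H. v \<notin> e#} + {#{a, b}#} \<rparr>"

lemma center_step_decreases:
  "center_step K H H' \<Longrightarrow> finite (mverts H) \<Longrightarrow>
   finite (mverts H') \<and>
   card (mverts H') + size (medges H') < card (mverts H) + size (medges H)"
proof (induction rule: center_step.induct)
  case (delete_loop x H)
  then have "size (medges H) = Suc (size (medges H - {#{x}#}))"
    by (metis insert_DiffM size_add_mset)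
  with delete_loop show ?case by simp
next
  case (suppress_le_1 v H)
  have "size {#e \<in># medges H. v \<notin> e#} \<le> size (medges H)"
    by (simp add: size_filter_mset_lesseq)
  moreover have "card (mverts H - {v}) < card (mverts H)"
    using suppress_le_1 by (intro card_Diff1_less) auto
  ultimately show ?case using suppress_le_1.prems
    by (simp only: mgraph.simps) (blast intro: finite_Diff add_less_le_mono)
next
  case (suppress_2 v H a b)
  have "size (medges H) = size {#e \<in># medges H. v \<in> e#} + size {#e \<in># medges H. v \<notin> e#}"
    by (metis multiset_partition size_union)
  then have "size (medges H) = 2 + size {#e \<in># medges H. v \<notin> e#}"
    using suppress_2.hyps by simp
  moreover have "card (mverts H - {v}) < card (mverts H)"
    using suppress_2 by (intro card_Diff1_less) auto
  ultimately show ?case using suppress_2.prems by simp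
qed

text \<open>Steps terminate and have the diamond property (up to deletion of loops), so the
  result of exhaustive suppression does not depend on the order; the choice is immaterial.\<close>

definition is_center :: "'a set \<Rightarrow> 'a mgraph \<Rightarrow> 'a mgraph \<Rightarrow> bool" where
  "is_center K H C \<longleftrightarrow> (center_step K)\<^sup>*\<^sup>* H C \<and> (\<nexists>C'. center_step K C C')"

lemma is_center_exists:
  "finite (mverts H) \<Longrightarrow> \<exists>C. is_center K H C"
proof (induction "card (mverts H) + size (medges H)" arbitrary: H rule: less_induct)
  case less
  show ?case
  proof (cases "\<exists>H'. center_step K H H'")
    case True
    then obtain H' where H': "center_step K H H'" by blast
    have "\<exists>C. is_center K H' C"
      by (rule less.hyps) (use center_step_decreases[OF H' less.prems] in auto)
    with H' show ?thesis
      unfolding is_center_def by (blast intro: converse_rtranclp_into_rtranclp)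
  next
    case False
    then show ?thesis unfolding is_center_def by blast
  qed
qed

definition three_center :: "'v sgraph \<Rightarrow> ('v, 's) tcdecomp \<Rightarrow> 's \<Rightarrow> ('v + 's set) mgraph" where
  "three_center G D s = (SOME C. is_center (Inl ` tbag D s) (torso G D s) C)"

definition tcwidth :: "'v sgraph \<Rightarrow> ('v, 's) tcdecomp \<Rightarrow> nat" where
  "tcwidth G D = Max ((\<lambda>s. max (adhesion G D s) (card (mverts (three_center G D s)))) ` tnodes D)"


section \<open>Nice and friendly decompositions\<close>

definition nice :: "'v sgraph \<Rightarrow> ('v, 's) tcdecomp \<Rightarrow> bool" where
  "nice G D \<longleftrightarrow> (\<forall>t\<in>tnodes D. thin G D t \<longrightarrow>
     gneighbours G (below D t) \<inter> (\<Union>t'\<in>tsiblings D t. below D t') = {})"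

definition friendly :: "'v sgraph \<Rightarrow> ('v, 's) tcdecomp \<Rightarrow> bool" where
  "friendly G D \<longleftrightarrow> nice G D \<and>
     (\<forall>s\<in>tnodes D. card {t \<in> tchildren D s. bold G D t} + card (tbag D s) \<le> tcwidth G D + 2)"


section \<open>Machine model\<close>

text \<open>A structured random access machine: a program uses finitely many registers and
  finitely many arrays with unit-cost random access, and has addition, truncated subtraction
  and comparison as arithmetic operations. Each operation, memory access and test costs one
  time unit. All values, including intermediate results and addresses, must be less than the
  word bound \<open>W\<close>: an overflowing program has no execution.\<close>

type_synonym ident = string

datatype rexp =
    Const nat
  | Reg ident
  | Load ident rexp
  | Add rexp rexp
  | Sub rexp rexp
  | Less rexp rexp
  | Equal rexp rexp

datatype rcom =
    Skip
  | Assign ident rexp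
  | Store ident rexp rexp
  | Seq rcom rcom
  | Cond rexp rcom rcom
  | Loop rexp rcom

record rstate =
  sreg :: "ident \<Rightarrow> nat"
  sarr :: "ident \<Rightarrow> nat \<Rightarrow> nat"

fun rval :: "rstate \<Rightarrow> rexp \<Rightarrow> nat" where
  "rval s (Const n) = n"
| "rval s (Reg x) = sreg s x"
| "rval s (Load a e) = sarr s a (rval s e)"
| "rval s (Add e f) = rval s e + rval s f"
| "rval s (Sub e f) = rval s e - rval s f"
| "rval s (Less e f) = of_bool (rval s e < rval s f)"
| "rval s (Equal e f) = of_bool (rval s e = rval s f)"

fun subexps :: "rexp \<Rightarrow> rexp set" where
  "subexps (Const n) = {Const n}"
| "subexps (Reg x) = {Reg x}"
| "subexps (Load a e) = insert (Load a e) (subexps e)"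
| "subexps (Add e f) = insert (Add e f) (subexps e \<union> subexps f)"
| "subexps (Sub e f) = insert (Sub e f) (subexps e \<union> subexps f)"
| "subexps (Less e f) = insert (Less e f) (subexps e \<union> subexps f)"
| "subexps (Equal e f) = insert (Equal e f) (subexps e \<union> subexps f)"

definition fits :: "nat \<Rightarrow> rstate \<Rightarrow> rexp \<Rightarrow> bool" where
  "fits W s e \<longleftrightarrow> (\<forall>f\<in>subexps e. rval s f < W)"

fun rcost :: "rexp \<Rightarrow> nat" where
  "rcost (Const n) = 1"
| "rcost (Reg x) = 1"
| "rcost (Load a e) = 1 + rcost e"
| "rcost (Add e f) = 1 + rcost e + rcost f"
| "rcost (Sub e f) = 1 + rcost e + rcost f"
| "rcost (Less e f) = 1 + rcost e + rcost f"
| "rcost (Equal e f) = 1 + rcost e + rcost f"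

text \<open>\<open>rexec W c s k s'\<close>: started in state \<open>s\<close>, program \<open>c\<close> halts in state \<open>s'\<close> after \<open>k\<close> time
  units. Tests succeed on nonzero values.\<close>

inductive rexec :: "nat \<Rightarrow> rcom \<Rightarrow> rstate \<Rightarrow> nat \<Rightarrow> rstate \<Rightarrow> bool" for W :: nat where
  Skip: "rexec W Skip s 1 s"
| Assign:
    "fits W s e \<Longrightarrow>
     rexec W (Assign x e) s (1 + rcost e) (s\<lparr> sreg := (sreg s)(x := rval s e) \<rparr>)"
| Store:
    "fits W s i \<Longrightarrow> fits W s e \<Longrightarrow>
     rexec W (Store a i e) s (1 + rcost i + rcost e)
       (s\<lparr> sarr := (sarr s)(a := (sarr s a)(rval s i := rval s e)) \<rparr>)"
| Seq: "rexec W c s k s' \<Longrightarrow> rexec W d s' l s'' \<Longrightarrow> rexec W (Seq c d) s (k + l) s''"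
| Cond_True:
    "fits W s e \<Longrightarrow> rval s e \<noteq> 0 \<Longrightarrow> rexec W c s k s' \<Longrightarrow>
     rexec W (Cond e c d) s (1 + rcost e + k) s'"
| Cond_False:
    "fits W s e \<Longrightarrow> rval s e = 0 \<Longrightarrow> rexec W d s k s' \<Longrightarrow>
     rexec W (Cond e c d) s (1 + rcost e + k) s'"
| Loop_True:
    "fits W s e \<Longrightarrow> rval s e \<noteq> 0 \<Longrightarrow> rexec W c s k s' \<Longrightarrow> rexec W (Loop e c) s' l s'' \<Longrightarrow>
     rexec W (Loop e c) s (1 + rcost e + k + l) s''"
| Loop_False:
    "fits W s e \<Longrightarrow> rval s e = 0 \<Longrightarrow> rexec W (Loop e c) s (1 + rcost e) s"


inductive_cases rexec_SkipE: "rexec W Skip s k t"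
inductive_cases rexec_AssignE: "rexec W (Assign x e) s k t"
inductive_cases rexec_StoreE: "rexec W (Store a i e) s k t"
inductive_cases rexec_SeqE: "rexec W (Seq c d) s k t"
inductive_cases rexec_CondE: "rexec W (Cond e c d) s k t"
inductive_cases rexec_LoopE: "rexec W (Loop e c) s k t"

lemma rexec_deterministic:
  "rexec W c s k s' \<Longrightarrow> rexec W c s l s'' \<Longrightarrow> k = l \<and> s' = s''"
proof (induction arbitrary: l s'' rule: rexec.induct)
  case (Skip s)
  then show ?case by (auto elim: rexec_SkipE)
next
  case (Assign s e x)
  from Assign.prems show ?case by (auto elim: rexec_AssignE)
next
  case (Store s i e a)
  from Store.prems show ?case by (auto elim: rexec_StoreE)
next
  case (Seq c s k s' d l s'' l' r)
  from Seq.prems show ?case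
  proof (rule rexec_SeqE)
    fix k2 t l2
    assume l': "l' = k2 + l2" and c: "rexec W c s k2 t" and d: "rexec W d t l2 r"
    have "k = k2" "s' = t" using Seq.IH(1)[OF c] by simp_all
    moreover from this d have "l = l2" "s'' = r" using Seq.IH(2) by simp_all
    ultimately show ?thesis using l' by simp
  qed
next
  case (Cond_True s e c k s' d)
  from Cond_True.prems show ?case by (rule rexec_CondE) (use Cond_True.hyps in \<open>auto dest: Cond_True.IH\<close>)
next
  case (Cond_False s e d k s' c)
  from Cond_False.prems show ?case by (rule rexec_CondE) (use Cond_False.hyps in \<open>auto dest: Cond_False.IH\<close>)
next
  case (Loop_True s e c k s' l s'' l' r)
  note IH = Loop_True.IH and nz = Loop_True.hyps(2)
  obtain k2 t l2 where l': "l' = 1 + rcost e + k2 + l2" and c: "rexec W c s k2 t"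
      and w: "rexec W (Loop e c) t l2 r"
    using Loop_True.prems nz by (auto elim: rexec_LoopE)
  have "k = k2" "s' = t" using IH(1)[OF c] by simp_all
  moreover from this w have "l = l2" "s'' = r" using IH(2) by simp_all
  ultimately show ?case using l' by simp
next
  case (Loop_False s e c)
  from Loop_False.prems show ?case by (rule rexec_LoopE) (use Loop_False.hyps in auto)
qed

section \<open>Representation of inputs and outputs\<close>

text \<open>Vertices and nodes are numbered consecutively from 0. A graph is stored as a list of its
  edges without repetition, in arbitrary order and orientation; a decomposition is stored by
  parent pointers together with, for every vertex, the node whose bag contains it.\<close>

definition stores_graph :: "rstate \<Rightarrow> nat sgraph \<Rightarrow> bool" where
  "stores_graph s G \<longleftrightarrow>
     gverts G = {..<sreg s ''vertices''} \<and>
     bij_betw (\<lambda>i. {sarr s ''end1'' i, sarr s ''end2'' i}) {..<sreg s ''edges''} (gedges G)"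

definition stores_decomp :: "rstate \<Rightarrow> (nat, nat) tcdecomp \<Rightarrow> bool" where
  "stores_decomp s D \<longleftrightarrow>
     tnodes D = {..<sreg s ''nodes''} \<and>
     troot D = sreg s ''root'' \<and>
     (\<forall>t \<in> tnodes D - {troot D}. sarr s ''parent'' t = tparent D t) \<and>
     (\<forall>t \<in> tnodes D. \<forall>v \<in> tbag D t. sarr s ''bag'' v = t)"

definition rest_zero :: "rstate \<Rightarrow> bool" where
  "rest_zero s \<longleftrightarrow>
     (\<forall>x. x \<notin> {''vertices'', ''edges'', ''nodes'', ''root''} \<longrightarrow> sreg s x = 0) \<and>
     (\<forall>a i. \<not> (a \<in> {''end1'', ''end2''} \<and> i < sreg s ''edges'') \<and>
            \<not> (a = ''parent'' \<and> i < sreg s ''nodes'' \<and> i \<noteq> sreg s ''root'') \<and>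
            \<not> (a = ''bag'' \<and> i < sreg s ''vertices'') \<longrightarrow> sarr s a i = 0)"

definition initial_state :: "rstate \<Rightarrow> nat sgraph \<Rightarrow> (nat, nat) tcdecomp \<Rightarrow> bool" where
  "initial_state s G D \<longleftrightarrow> stores_graph s G \<and> stores_decomp s D \<and> rest_zero s"

end

theory Submission
  imports Defs
begin

text \<open>
  Two siblings of adhesion 3 or 4 that share edges, and whose union again has adhesion 3 or 4, are
  given a new common parent with an empty bag. In the torso of the old parent this contracts an
  edge between two peripheral vertices, which cannot enlarge the 3-center, and the torso of the new
  node has at most three vertices; so the width stays below \<open>max 4 w\<close>. If no such pair is left, then
  suppressing the thin children and afterwards the vertices whose degree has dropped deletes at
  most two bold children, so the 3-center bounds the number of bold children plus the size of the
  bag by \<open>w' + 2\<close>. Every merge adds one node and lowers the number of nodes below an old parent,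
  hence there are at most as many merges as nodes.

  For the running time, it suffices to know, for every node of adhesion at most 4, the edges that
  leave its subtree, and for every edge the two siblings it joins. Both are found by walking from
  the ends of each edge towards their lowest common ancestor. Chains of nodes with equal
  \<open>Y\<^sub>s\<close> are jumped over, so that only \<open>O(|V(G)|)\<close> nodes are ever visited, each of them once for
  each of its at most \<open>w\<close> edges.
\<close>

section \<open>Confluence of suppression\<close>

text \<open>The obstacle is a chain reaction. With the thin children gone, only the component above
  the node can have degree at most 2; its suppression may pull one bold child down to degree at most
  2, that child the next one, and so on. Suppose that bold children b1, b2, b3 are hit in turn, and
  let r0 be the degree of the outer component and r1, r2, r3 the degrees to which b1, b2, b3 have
  dropped. Then bi has adhesion r(i-1) + ri and shares ri edges with its successor, so uniting b1
  and b2 gives adhesion r0 + r2 and uniting b2 and b3 gives r1 + r3. As every r is at most 2 and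
  bold adhesions are at least 3, one of the two sums is 3 or 4. Both the range of mergeable
  adhesions and the additive 2 in \<open>friendly\<close> come from here. The 3-center is an
  arbitrarily chosen result of exhaustive suppression. Confluence is therefore needed before any
  convenient order of suppressions, or a comparison of two torsos, says something about it. Pairs
  are merged only below nodes of the input: a new node has an empty bag and two children, which is
  within the bound of \<open>friendly\<close> anyway.\<close>

definition incident :: "'a mgraph \<Rightarrow> 'a \<Rightarrow> 'a set multiset" where
  "incident H v = {#e \<in># medges H. v \<in> e#}"

definition degree :: "'a mgraph \<Rightarrow> 'a \<Rightarrow> nat" where
  "degree H v = size (incident H v)"

definition replace_vertex :: "'a mgraph \<Rightarrow> 'a \<Rightarrow> 'a set multiset \<Rightarrow> 'a mgraph" where
  "replace_vertex H v N = \<lparr> mverts = mverts H - {v}, medges = {#e \<in># medges H. v \<notin> e#} + N \<rparr>"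

definition drop_edge :: "'a mgraph \<Rightarrow> 'a set \<Rightarrow> 'a mgraph" where
  "drop_edge H e = \<lparr> mverts = mverts H, medges = medges H - {#e#} \<rparr>"

text \<open>\<open>N\<close> holds the edges that replace those at \<open>v\<close>: none if there
  is at most one edge, otherwise the bypass edge, which is a loop if \<open>a = b\<close>. With
  \<open>N\<close> as an argument both suppression rules become instances of
  \<open>replace_vertex\<close>.\<close>

definition suppressible :: "'a set \<Rightarrow> 'a mgraph \<Rightarrow> 'a \<Rightarrow> 'a set multiset \<Rightarrow> bool" where
  "suppressible K H v N \<longleftrightarrow> v \<in> mverts H - K \<and> {v} \<notin># medges H \<and>
     (degree H v \<le> 1 \<and> N = {#} \<or>
      (\<exists>a b. a \<noteq> v \<and> b \<noteq> v \<and> incident H v = {#{v, a}, {v, b}#} \<and> N = {#{a, b}#}))"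

lemma center_step_iff:
  "center_step K H H' \<longleftrightarrow>
     (\<exists>x. {x} \<in># medges H \<and> H' = drop_edge H {x}) \<or>
     (\<exists>v N. suppressible K H v N \<and> H' = replace_vertex H v N)"
proof
  assume "center_step K H H'"
  then show "(\<exists>x. {x} \<in># medges H \<and> H' = drop_edge H {x}) \<or>
     (\<exists>v N. suppressible K H v N \<and> H' = replace_vertex H v N)"
  proof cases
    case (suppress_2 v a b)
    have "{v} \<notin># medges H"
    proof
      assume "{v} \<in># medges H"
      then have "{v} \<in># {#e \<in># medges H. v \<in> e#}" by simp
      then show False using suppress_2 by auto
    qed
    then show ?thesis
      using suppress_2 unfolding suppressible_def replace_vertex_def incident_def by blast
  qed (auto simp: suppressible_def replace_vertex_def drop_edge_def degree_def incident_def)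
next
  assume "(\<exists>x. {x} \<in># medges H \<and> H' = drop_edge H {x}) \<or>
     (\<exists>v N. suppressible K H v N \<and> H' = replace_vertex H v N)"
  then show "center_step K H H'"
    by (auto simp: suppressible_def replace_vertex_def drop_edge_def degree_def incident_def
        intro: center_step.intros center_step.suppress_le_1[unfolded One_nat_def])
qed

lemma center_step_drop: "{x} \<in># medges H \<Longrightarrow> center_step K H (drop_edge H {x})"
  unfolding center_step_iff by blast

lemma center_step_suppress: "suppressible K H v N \<Longrightarrow> center_step K H (replace_vertex H v N)"
  unfolding center_step_iff by blast

lemma mverts_replace [simp]: "mverts (replace_vertex H v N) = mverts H - {v}"
  and medges_replace [simp]: "medges (replace_vertex H v N) = {#e \<in># medges H. v \<notin> e#} + N"
  and mverts_drop [simp]: "mverts (drop_edge H e) = mverts H"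
  and medges_drop [simp]: "medges (drop_edge H e) = medges H - {#e#}"
  by (simp_all add: replace_vertex_def drop_edge_def)

lemma incident_replace:
  "u \<noteq> v \<Longrightarrow> incident (replace_vertex H v N) u = {#e \<in># incident H u. v \<notin> e#} + {#e \<in># N. u \<in> e#}"
  by (simp add: incident_def filter_filter_mset conj_commute)

lemma filter_mset_none: "(\<And>x. x \<in># M \<Longrightarrow> \<not> P x) \<Longrightarrow> filter_mset P M = {#}"
  by (simp add: filter_mset_eq_conv)

lemma filter_mset_all: "(\<And>x. x \<in># M \<Longrightarrow> P x) \<Longrightarrow> filter_mset P M = M"
  by (simp add: filter_mset_eq_conv)

lemma mem_incident: "e \<in># incident H v \<longleftrightarrow> e \<in># medges H \<and> v \<in> e"
  by (simp add: incident_def)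

lemma incident_inter:
  "{#e \<in># incident H u. v \<in> e#} = {#e \<in># incident H v. u \<in> e#}"
  by (simp add: incident_def filter_filter_mset conj_commute)

lemma incident_restrict:
  "incident H u = {#e \<in># incident H u. v \<notin> e#} + {#e \<in># incident H v. u \<in> e#}"
  by (metis (no_types) incident_inter multiset_partition union_commute)

lemma mgraph_eqI:
  fixes H H' :: "'a mgraph"
  shows "mverts H = mverts H' \<Longrightarrow> medges H = medges H' \<Longrightarrow> H = H'"
  by simp

text \<open>A suppressible vertex carries no loop, so the loop sits at another vertex and the two
  operations act on disjoint sets of edges.\<close>

lemma drop_replace_commute:
  assumes "{x} \<in># medges H" and "suppressible K H v N"
  shows "suppressible K (drop_edge H {x}) v N \<and> {x} \<in># medges (replace_vertex H v N) \<and>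
    replace_vertex (drop_edge H {x}) v N = drop_edge (replace_vertex H v N) {x}"
proof -
  have vx: "v \<noteq> x" using assms by (auto simp: suppressible_def)
  have "incident (drop_edge H {x}) v = incident H v"
    using vx by (simp add: incident_def)
  then have "suppressible K (drop_edge H {x}) v N"
    using assms(2) by (auto simp: suppressible_def degree_def dest: in_diffD)
  moreover have "{x} \<in># {#e \<in># medges H. v \<notin> e#}"
    using vx assms(1) by simp
  ultimately show ?thesis
    using vx by (auto intro!: mgraph_eqI)
qed

text \<open>If \<open>u\<close> is one of the neighbours of \<open>v\<close>, removing
  \<open>u\<close> turns \<open>v\<close> into a vertex with one edge, and suppressing
  \<open>v\<close> merely exchanges the only edge of \<open>u\<close> for the bypass edge; both
  continue with the rule for low degree. That both edges of \<open>v\<close> lead to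
  \<open>u\<close> is excluded by the degree of \<open>u\<close>.\<close>

lemma supp1_supp2_commute:
  assumes uv: "u \<noteq> v" and u: "u \<in> mverts H - K" "{u} \<notin># medges H" "degree H u \<le> 1"
    and v: "v \<in> mverts H - K" "{v} \<notin># medges H" "a \<noteq> v" "b \<noteq> v" "incident H v = {#{v, a}, {v, b}#}"
  shows "\<exists>H3. center_step K (replace_vertex H u {#}) H3 \<and>
    center_step K (replace_vertex H v {#{a, b}#}) H3"
proof -
  let ?H1 = "replace_vertex H u {#}" and ?H2 = "replace_vertex H v {#{a, b}#}"
  have i1: "incident ?H1 v = {#e \<in># {#{v, a}, {v, b}#}. u \<notin> e#}"
    using uv v(5) by (simp add: incident_replace)
  have uin: "incident H u = {#e \<in># incident H u. v \<notin> e#} + {#e \<in># {#{v, a}, {v, b}#}. u \<in> e#}"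
    using incident_restrict[of H u v] v(5) by simp
  have i2: "incident ?H2 u = {#e \<in># incident H u. v \<notin> e#} + {#e \<in># {#{a, b}#}. u \<in> e#}"
    using uv by (simp add: incident_replace)
  consider "u \<notin> {a, b}" | "u = a" "u \<noteq> b" | "u = b" "u \<noteq> a" | "u = a" "u = b" by blast
  then show ?thesis
  proof cases
    case 1
    have s1: "suppressible K ?H1 v {#{a, b}#}"
      using v i1 1 uv by (auto simp: suppressible_def)
    have "size (incident ?H2 u) \<le> 1"
      using i2 1 u(3) by (simp add: degree_def)
        (metis le_trans size_filter_mset_lesseq One_nat_def)
    then have s2: "suppressible K ?H2 u {#}"
      using u uv 1 by (auto simp: suppressible_def degree_def)
    have "replace_vertex ?H1 v {#{a, b}#} = replace_vertex ?H2 u {#}"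
      using 1 by (intro mgraph_eqI) (auto simp: filter_filter_mset conj_commute)
    then show ?thesis using s1 s2 center_step_suppress by metis
  next
    case 2
    have "degree ?H1 v \<le> 1" using i1 2 uv by (simp add: degree_def)
    then have s1: "suppressible K ?H1 v {#}" using v uv by (auto simp: suppressible_def)
    have "size (incident H u) = size {#e \<in># incident H u. v \<notin> e#} + 1"
      using 2 uv by (subst uin) simp
    then have "degree ?H2 u \<le> 1" using i2 2 u(3) by (simp add: degree_def)
    then have s2: "suppressible K ?H2 u {#}"
      using u uv 2 by (auto simp: suppressible_def)
    have "replace_vertex ?H1 v {#} = replace_vertex ?H2 u {#}"
      using 2 by (intro mgraph_eqI) (auto simp: filter_filter_mset conj_commute)
    then show ?thesis using s1 s2 center_step_suppress by metis
  next
    case 3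
    have "degree ?H1 v \<le> 1" using i1 3 uv by (simp add: degree_def)
    then have s1: "suppressible K ?H1 v {#}" using v uv by (auto simp: suppressible_def)
    have "size (incident H u) = size {#e \<in># incident H u. v \<notin> e#} + 1"
      using 3 uv by (subst uin) simp
    then have "degree ?H2 u \<le> 1" using i2 3 u(3) by (simp add: degree_def)
    then have s2: "suppressible K ?H2 u {#}"
      using u uv 3 by (auto simp: suppressible_def)
    have "replace_vertex ?H1 v {#} = replace_vertex ?H2 u {#}"
      using 3 by (intro mgraph_eqI) (auto simp: filter_filter_mset conj_commute)
    then show ?thesis using s1 s2 center_step_suppress by metis
  next
    case 4
    have "size (incident H u) \<ge> 2" using 4 by (subst uin) simp
    then show ?thesis using u(3) by (simp add: degree_def)
  qed
qed

text \<open>The statement allows several steps because of a double edge between \<open>u\<close> and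
  \<open>v\<close>: suppressing one of them leaves a loop at the other, and the loop has to be
  deleted before that vertex can go.\<close>

lemma supp2_supp2_commute:
  assumes uv: "u \<noteq> v"
    and u: "u \<in> mverts H - K" "{u} \<notin># medges H" "a \<noteq> u" "b \<noteq> u" "incident H u = {#{u, a}, {u, b}#}"
    and v: "v \<in> mverts H - K" "{v} \<notin># medges H" "c \<noteq> v" "d \<noteq> v" "incident H v = {#{v, c}, {v, d}#}"
  shows "\<exists>H3. (center_step K)\<^sup>*\<^sup>* (replace_vertex H u {#{a, b}#}) H3 \<and>
    (center_step K)\<^sup>*\<^sup>* (replace_vertex H v {#{c, d}#}) H3"
proof -
  let ?H1 = "replace_vertex H u {#{a, b}#}" and ?H2 = "replace_vertex H v {#{c, d}#}"
  have eq: "{#e \<in># {#{u, a}, {u, b}#}. v \<in> e#} = {#e \<in># {#{v, c}, {v, d}#}. u \<in> e#}"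
    using incident_inter[where H = H and u = u and v = v] u(5) v(5) by simp
  have i1: "incident ?H1 v = {#e \<in># {#{v, c}, {v, d}#}. u \<notin> e#} + {#e \<in># {#{a, b}#}. v \<in> e#}"
    using uv v(5) by (simp add: incident_replace)
  have i2: "incident ?H2 u = {#e \<in># {#{u, a}, {u, b}#}. v \<notin> e#} + {#e \<in># {#{c, d}#}. u \<in> e#}"
    using uv u(5) by (simp add: incident_replace)
  have sz: "size {#e \<in># {#{u, a}, {u, b}#}. v \<in> e#} = size {#e \<in># {#{v, c}, {v, d}#}. u \<in> e#}"
    using eq by simp
  \<comment> \<open>The number of edges joining \<open>u\<close> and \<open>v\<close> is 0, 2 or 1;
    by \<open>sz\<close> it is the same seen from either vertex.\<close>
  consider "v \<notin> {a, b}" "u \<notin> {c, d}" | "v = a" "v = b" "u = c" "u = d"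
    | "v \<in> {a, b}" "a \<noteq> b" "u \<in> {c, d}" "c \<noteq> d"
    using sz uv by (auto split: if_splits)
  then show ?thesis
  proof cases
    case 1
    have s1: "suppressible K ?H1 v {#{c, d}#}"
      using v i1 1 uv by (auto simp: suppressible_def)
    have s2: "suppressible K ?H2 u {#{a, b}#}"
      using u i2 1 uv by (auto simp: suppressible_def)
    have "replace_vertex ?H1 v {#{c, d}#} = replace_vertex ?H2 u {#{a, b}#}"
      using 1 by (intro mgraph_eqI) (auto simp: filter_filter_mset conj_commute add_mset_commute)
    then show ?thesis using s1 s2 center_step_suppress by (metis r_into_rtranclp)
  next
    case 2
    let ?D1 = "drop_edge ?H1 {v}" and ?D2 = "drop_edge ?H2 {u}"
    have d1: "center_step K ?H1 ?D1" and d2: "center_step K ?H2 ?D2"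
      using 2 by (auto intro!: center_step_drop)
    have "incident ?D1 v = {#}" "incident ?D2 u = {#}"
      using i1 i2 2 uv by (auto simp: incident_def)
    then have s1: "suppressible K ?D1 v {#}" and s2: "suppressible K ?D2 u {#}"
      using u v uv 2 by (auto simp: suppressible_def degree_def)
    have "replace_vertex ?D1 v {#} = replace_vertex ?D2 u {#}"
      using 2 by (intro mgraph_eqI) (auto simp: filter_filter_mset conj_commute)
    moreover have "(center_step K)\<^sup>*\<^sup>* ?H1 (replace_vertex ?D1 v {#})"
      using d1 center_step_suppress[OF s1] by (meson converse_rtranclp_into_rtranclp r_into_rtranclp)
    moreover have "(center_step K)\<^sup>*\<^sup>* ?H2 (replace_vertex ?D2 u {#})"
      using d2 center_step_suppress[OF s2] by (meson converse_rtranclp_into_rtranclp r_into_rtranclp)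
    ultimately show ?thesis by metis
  next
    case 3
    obtain b' where b': "{#{a, b}#} = {#{v, b'}#}" "{#{u, a}, {u, b}#} = {#{u, v}, {u, b'}#}"
        "b' \<noteq> v" "b' \<noteq> u"
      using 3(1,2) u(3,4) by (intro that[of "if v = a then b else a"]) (auto simp: insert_commute add_mset_commute)
    obtain d' where d': "{#{c, d}#} = {#{u, d'}#}" "{#{v, c}, {v, d}#} = {#{v, u}, {v, d'}#}"
        "d' \<noteq> v" "d' \<noteq> u"
      using 3(3,4) v(3,4) by (intro that[of "if u = c then d else c"]) (auto simp: insert_commute add_mset_commute)
    have j1: "incident ?H1 v = {#{v, d'}, {v, b'}#}" and j2: "incident ?H2 u = {#{u, b'}, {u, d'}#}"
      using i1 i2 b' d' uv by simp_all
    have "{v} \<notin># medges ?H1" "{u} \<notin># medges ?H2" using b' d' u v by auto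
    then have s1: "suppressible K ?H1 v {#{d', b'}#}" and s2: "suppressible K ?H2 u {#{b', d'}#}"
      using j1 j2 b' d' u v uv by (auto simp: suppressible_def)
    have "replace_vertex ?H1 v {#{d', b'}#} = replace_vertex ?H2 u {#{b', d'}#}"
      using b' d' uv by (intro mgraph_eqI) (auto simp: filter_filter_mset conj_commute insert_commute)
    then show ?thesis using s1 s2 center_step_suppress by (metis r_into_rtranclp)
  qed
qed

lemma supp1_supp1_commute:
  assumes uv: "u \<noteq> v" and u: "u \<in> mverts H - K" "{u} \<notin># medges H" "degree H u \<le> 1"
    and v: "v \<in> mverts H - K" "{v} \<notin># medges H" "degree H v \<le> 1"
  shows "\<exists>H3. center_step K (replace_vertex H u {#}) H3 \<and> center_step K (replace_vertex H v {#}) H3"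
proof -
  let ?H1 = "replace_vertex H u {#}" and ?H2 = "replace_vertex H v {#}"
  have "degree ?H1 v \<le> 1" "degree ?H2 u \<le> 1"
    using uv u v by (auto simp: degree_def incident_replace intro: le_trans[OF size_filter_mset_lesseq])
  then have s1: "suppressible K ?H1 v {#}" and s2: "suppressible K ?H2 u {#}"
    using u v uv by (auto simp: suppressible_def)
  have "replace_vertex ?H1 v {#} = replace_vertex ?H2 u {#}"
    by (intro mgraph_eqI) (auto simp: filter_filter_mset conj_commute)
  then show ?thesis using s1 s2 center_step_suppress by metis
qed

lemma center_step_locally_confluent:
  assumes "center_step K H H1" "center_step K H H2"
  shows "\<exists>H3. (center_step K)\<^sup>*\<^sup>* H1 H3 \<and> (center_step K)\<^sup>*\<^sup>* H2 H3"
proof -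
  have mixed: "\<exists>H3. (center_step K)\<^sup>*\<^sup>* (drop_edge H {x}) H3 \<and> (center_step K)\<^sup>*\<^sup>* (replace_vertex H v N) H3"
    if "{x} \<in># medges H" "suppressible K H v N" for x v N
    using drop_replace_commute[OF that] by (metis center_step_drop center_step_suppress r_into_rtranclp)
  have supp: "\<exists>H3. (center_step K)\<^sup>*\<^sup>* (replace_vertex H u M) H3 \<and> (center_step K)\<^sup>*\<^sup>* (replace_vertex H v N) H3"
    if u: "suppressible K H u M" and v: "suppressible K H v N" for u v M N
  proof (cases "u = v")
    case True
    have "M = N" using u v True by (auto simp: suppressible_def degree_def add_eq_conv_ex doubleton_eq_iff)
    then show ?thesis using True by blast
  next
    case False
    have vu: "v \<noteq> u" using False by simp
    have u': "u \<in> mverts H - K" "{u} \<notin># medges H" and v': "v \<in> mverts H - K" "{v} \<notin># medges H"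
      using u v by (auto simp: suppressible_def)
    consider (11) "degree H u \<le> 1" "M = {#}" "degree H v \<le> 1" "N = {#}"
      | (12) a b where "degree H u \<le> 1" "M = {#}"
          "a \<noteq> v" "b \<noteq> v" "incident H v = {#{v, a}, {v, b}#}" "N = {#{a, b}#}"
      | (21) a b where "degree H v \<le> 1" "N = {#}"
          "a \<noteq> u" "b \<noteq> u" "incident H u = {#{u, a}, {u, b}#}" "M = {#{a, b}#}"
      | (22) a b c d where "a \<noteq> u" "b \<noteq> u" "incident H u = {#{u, a}, {u, b}#}" "M = {#{a, b}#}"
          "c \<noteq> v" "d \<noteq> v" "incident H v = {#{v, c}, {v, d}#}" "N = {#{c, d}#}"
      using u v unfolding suppressible_def by blast
    then show ?thesis
    proof cases
      case 11
      then show ?thesis using supp1_supp1_commute[OF False u' _ v'] by (blast intro: r_into_rtranclp)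
    next
      case 12
      then show ?thesis using supp1_supp2_commute[OF False u' _ v'] by (blast intro: r_into_rtranclp)
    next
      case 21
      then show ?thesis using supp1_supp2_commute[OF vu v' _ u'] by (blast intro: r_into_rtranclp)
    next
      case 22
      then show ?thesis using supp2_supp2_commute[OF False u' _ _ _ v'] by blast
    qed
  qed
  have loops: "\<exists>H3. (center_step K)\<^sup>*\<^sup>* (drop_edge H {x}) H3 \<and> (center_step K)\<^sup>*\<^sup>* (drop_edge H {y}) H3"
    if "{x} \<in># medges H" "{y} \<in># medges H" for x y
  proof (cases "x = y")
    case False
    then have "{y} \<in># medges (drop_edge H {x})" "{x} \<in># medges (drop_edge H {y})"
      using that by (auto simp: in_diff_count)
    moreover have "drop_edge (drop_edge H {x}) {y} = drop_edge (drop_edge H {y}) {x}"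
      by (intro mgraph_eqI) (auto simp: diff_diff_add_mset add_mset_commute)
    ultimately show ?thesis by (metis center_step_drop r_into_rtranclp)
  qed auto
  show ?thesis
    using assms[unfolded center_step_iff] mixed supp loops by blast
qed

text \<open>Newman's lemma. Every step lowers the number of vertices plus the number of edges, which
  is the induction measure.\<close>

lemma center_step_confluent:
  assumes "finite (mverts H)" "(center_step K)\<^sup>*\<^sup>* H H1" "(center_step K)\<^sup>*\<^sup>* H H2"
  shows "\<exists>H3. (center_step K)\<^sup>*\<^sup>* H1 H3 \<and> (center_step K)\<^sup>*\<^sup>* H2 H3"
  using assms
proof (induction "card (mverts H) + size (medges H)" arbitrary: H H1 H2 rule: less_induct)
  case less
  show ?case
  proof (cases "H = H1 \<or> H = H2")
    case True
    then show ?thesis using less.prems by blast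
  next
    case False
    obtain A where A: "center_step K H A" "(center_step K)\<^sup>*\<^sup>* A H1"
      using False less.prems(2) by (metis converse_rtranclpE)
    obtain B where B: "center_step K H B" "(center_step K)\<^sup>*\<^sup>* B H2"
      using False less.prems(3) by (metis converse_rtranclpE)
    obtain C where C: "(center_step K)\<^sup>*\<^sup>* A C" "(center_step K)\<^sup>*\<^sup>* B C"
      using center_step_locally_confluent[OF A(1) B(1)] by blast
    obtain H1' where H1': "(center_step K)\<^sup>*\<^sup>* H1 H1'" "(center_step K)\<^sup>*\<^sup>* C H1'"
      using less.hyps[OF _ _ A(2) C(1)] center_step_decreases[OF A(1) less.prems(1)] by blast
    have "(center_step K)\<^sup>*\<^sup>* B H1'" using C H1' by simp
    then obtain H3 where "(center_step K)\<^sup>*\<^sup>* H1' H3" "(center_step K)\<^sup>*\<^sup>* H2 H3"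
      using less.hyps[OF _ _ _ B(2)] center_step_decreases[OF B(1) less.prems(1)] by blast
    then show ?thesis using H1'(1) by (meson rtranclp_trans)
  qed
qed

lemma center_step_mverts: "center_step K H H' \<Longrightarrow> mverts H' \<subseteq> mverts H"
  by (auto simp: center_step_iff)

lemma center_steps_mverts: "(center_step K)\<^sup>*\<^sup>* H H' \<Longrightarrow> mverts H' \<subseteq> mverts H"
  by (induction rule: rtranclp_induct) (auto dest: center_step_mverts)

lemma center_steps_keep: "(center_step K)\<^sup>*\<^sup>* H H' \<Longrightarrow> K \<subseteq> mverts H \<Longrightarrow> K \<subseteq> mverts H'"
  by (induction rule: rtranclp_induct) (auto simp: center_step_iff suppressible_def)

text \<open>A center admits no further step, so the common successor provided by confluence is the
  center itself. Hence any preliminary suppressions may be carried out first.\<close>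

lemma is_center_reachable:
  assumes "finite (mverts H)" "is_center K H C" "(center_step K)\<^sup>*\<^sup>* H H'"
  shows "(center_step K)\<^sup>*\<^sup>* H' C"
  using center_step_confluent[OF assms(1) _ assms(3)] assms(2) unfolding is_center_def
  by (metis converse_rtranclpE)

text \<open>Thus the choice operator in \<open>three_center\<close> has only one candidate, whatever
  the order of suppressions.\<close>

lemma is_center_unique:
  assumes "finite (mverts H)" "is_center K H C" "is_center K H C'"
  shows "C = C'"
  using is_center_reachable[OF assms(1,2)] assms(3) unfolding is_center_def
  by (metis converse_rtranclpE)

section \<open>Contraction of adjacent peripheral vertices\<close>

definition map_mgraph :: "('a \<Rightarrow> 'b) \<Rightarrow> 'a mgraph \<Rightarrow> 'b mgraph" where
  "map_mgraph f H = \<lparr> mverts = f ` mverts H, medges = image_mset ((`) f) (medges H) \<rparr>"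

lemma mverts_map [simp]: "mverts (map_mgraph f H) = f ` mverts H"
  and medges_map [simp]: "medges (map_mgraph f H) = image_mset ((`) f) (medges H)"
  by (simp_all add: map_mgraph_def)

definition wf_mgraph :: "'a mgraph \<Rightarrow> bool" where
  "wf_mgraph H \<longleftrightarrow> (\<forall>e\<in>#medges H. e \<subseteq> mverts H \<and> (card e = 1 \<or> card e = 2))"

text \<open>The fibres of \<open>f\<close> with more than one vertex are required to avoid
  \<open>K\<close> and to be cliques. The clique condition is inherited by subsets, so it survives
  the suppression of a vertex, and this makes it an invariant of the simulation.\<close>

definition contracts :: "'a set \<Rightarrow> ('a \<Rightarrow> 'b) \<Rightarrow> 'a mgraph \<Rightarrow> bool" where
  "contracts K f H \<longleftrightarrow> wf_mgraph H \<and> K \<subseteq> mverts H \<and>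
     (\<forall>x\<in>mverts H. \<forall>y\<in>mverts H. x \<noteq> y \<longrightarrow> f x = f y \<longrightarrow> x \<notin> K \<and> y \<notin> K \<and> {x, y} \<in># medges H)"

lemma incident_plus_rest: "medges H = incident H v + {#e \<in># medges H. v \<notin> e#}"
  unfolding incident_def by (rule multiset_partition)

lemma suppressible_2_vertices:
  assumes "wf_mgraph H" "incident H v = {#{v, a}, {v, b}#}"
  shows "a \<in> mverts H" "b \<in> mverts H"
proof -
  have "{v, a} \<in># incident H v" "{v, b} \<in># incident H v" using assms(2) by simp_all
  then show "a \<in> mverts H" "b \<in> mverts H" using assms(1) by (auto simp: mem_incident wf_mgraph_def)
qed

lemma card_doubleton: "card {x, y} = 1 \<or> card {x, y} = 2"
  by (cases "x = y") simp_all

lemma contracts_step: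
  assumes c: "contracts K f H" and s: "center_step K H H1"
  shows "contracts K f H1"
proof -
  from s[unfolded center_step_iff] show ?thesis
  proof (elim disjE exE conjE)
    fix x assume x: "{x} \<in># medges H" "H1 = drop_edge H {x}"
    then show ?thesis
      using c by (auto simp: contracts_def wf_mgraph_def dest: in_diffD)
        (auto simp: in_diff_count)
  next
    fix v N assume v: "suppressible K H v N" "H1 = replace_vertex H v N"
    have wf: "wf_mgraph H" using c by (simp add: contracts_def)
    have "e \<subseteq> mverts H - {v} \<and> (card e = 1 \<or> card e = 2)" if "e \<in># N" for e
      using v(1) that suppressible_2_vertices[OF wf] card_doubleton
      unfolding suppressible_def by fastforce
    then have "wf_mgraph H1" using wf v(2) by (auto simp: wf_mgraph_def)
    then show ?thesis using c v by (auto simp: contracts_def suppressible_def)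
  qed
qed

text \<open>A suppressed vertex that is alone in its fibre is suppressed in the image as well.
  Otherwise an edge joins it to a vertex with the same image, and after the contraction its
  suppression is nothing but the deletion of one loop.\<close>

lemma contracts_simulates:
  assumes c: "contracts K f H" and s: "center_step K H H1"
  shows "(center_step (f ` K))\<^sup>*\<^sup>* (map_mgraph f H) (map_mgraph f H1)"
proof -
  have wf: "wf_mgraph H" and K: "K \<subseteq> mverts H"
    and col: "\<And>x y. x \<in> mverts H \<Longrightarrow> y \<in> mverts H \<Longrightarrow> x \<noteq> y \<Longrightarrow> f x = f y \<Longrightarrow>
      x \<notin> K \<and> y \<notin> K \<and> {x, y} \<in># medges H"
    using c by (auto simp: contracts_def)
  from s[unfolded center_step_iff] show ?thesis
  proof (elim disjE exE conjE)
    fix x assume x: "{x} \<in># medges H" "H1 = drop_edge H {x}"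
    have "map_mgraph f H1 = drop_edge (map_mgraph f H) {f x}"
      using x by (intro mgraph_eqI) (simp_all add: image_mset_Diff)
    moreover have "{f x} \<in># medges (map_mgraph f H)"
      using x(1) by force
    ultimately show ?thesis by (metis center_step_drop r_into_rtranclp)
  next
    fix v N assume v: "suppressible K H v N" "H1 = replace_vertex H v N"
    have vV: "v \<in> mverts H" and vK: "v \<notin> K" and nl: "{v} \<notin># medges H"
      using v by (auto simp: suppressible_def)
    show ?thesis
    proof (cases "\<exists>y\<in>mverts H. y \<noteq> v \<and> f y = f v")
      case False
      have iff: "f v \<in> f ` e \<longleftrightarrow> v \<in> e" if "e \<in># medges H" for e
        using wf that False unfolding wf_mgraph_def by (fastforce simp: image_iff subset_iff)
      have inc: "incident (map_mgraph f H) (f v) = image_mset ((`) f) (incident H v)"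
        unfolding incident_def medges_map filter_mset_image_mset
        by (rule arg_cong[of _ _ "image_mset _"], rule filter_mset_cong) (auto simp: iff)
      have rest: "{#e \<in># medges (map_mgraph f H). f v \<notin> e#} = image_mset ((`) f) {#e \<in># medges H. v \<notin> e#}"
        unfolding medges_map filter_mset_image_mset
        by (rule arg_cong[of _ _ "image_mset _"], rule filter_mset_cong) (auto simp: iff)
      have fK: "f v \<notin> f ` K" using K vK col vV by (metis imageE subsetD)
      have nl': "{f v} \<notin># medges (map_mgraph f H)"
      proof
        assume "{f v} \<in># medges (map_mgraph f H)"
        then obtain e where e: "e \<in># medges H" "f ` e = {f v}" by auto
        have "e \<subseteq> mverts H" using e wf by (auto simp: wf_mgraph_def)
        then have "e \<subseteq> {v}" using e False by blast
        moreover have "e \<noteq> {}" using e(2) by blast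
        ultimately have "e = {v}" by blast
        then show False using nl e by simp
      qed
      have "suppressible (f ` K) (map_mgraph f H) (f v) (image_mset ((`) f) N)"
      proof (cases "degree H v \<le> 1 \<and> N = {#}")
        case True
        then show ?thesis using vV fK nl' inc by (auto simp: suppressible_def degree_def)
      next
        case N: False
        then obtain a b where ab: "a \<noteq> v" "b \<noteq> v" "incident H v = {#{v, a}, {v, b}#}" "N = {#{a, b}#}"
          using v by (auto simp: suppressible_def)
        have "f a \<noteq> f v" "f b \<noteq> f v"
          using False ab(1,2) suppressible_2_vertices[OF wf ab(3)] by metis+
        then show ?thesis using vV fK nl' inc ab(3,4) by (auto simp: suppressible_def)
      qed
      moreover have "f ` mverts H - {f v} = f ` (mverts H - {v})" using False by auto
      then have "map_mgraph f H1 = replace_vertex (map_mgraph f H) (f v) (image_mset ((`) f) N)"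
        using v(2) rest by (intro mgraph_eqI) simp_all
      ultimately show ?thesis by (metis center_step_suppress r_into_rtranclp)
    next
      case True
      then obtain y where y: "y \<in> mverts H" "y \<noteq> v" "f y = f v" by blast
      have ye: "{v, y} \<in># incident H v" using col[OF vV y(1)] y by (simp add: mem_incident)
      have E: "image_mset ((`) f) (medges H) =
          image_mset ((`) f) (incident H v) + image_mset ((`) f) {#e \<in># medges H. v \<notin> e#}"
        by (subst incident_plus_rest[of H v]) simp
      \<comment> \<open>The edge from \<open>v\<close> to \<open>y\<close> becomes the loop. A
        second edge at \<open>v\<close> has the same image as the bypass edge, because
        \<open>v\<close> and \<open>y\<close> are identified.\<close>
      have key: "image_mset ((`) f) (incident H v) = add_mset {f v} (image_mset ((`) f) N)"
      proof (cases "degree H v \<le> 1 \<and> N = {#}")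
        case True
        moreover obtain M where "incident H v = add_mset {v, y} M" using ye by (metis multi_member_split)
        ultimately have "incident H v = {#{v, y}#}" by (simp add: degree_def)
        then show ?thesis using True y by simp
      next
        case N: False
        then obtain a b where ab: "a \<noteq> v" "b \<noteq> v" "incident H v = {#{v, a}, {v, b}#}" "N = {#{a, b}#}"
          using v by (auto simp: suppressible_def)
        have "y = a \<or> y = b" using ye ab y by (auto simp: doubleton_eq_iff)
        then show ?thesis using ab y by (auto simp: insert_commute add_mset_commute)
      qed
      have "f v \<in> f ` (mverts H - {v})" using y by (metis Diff_iff image_eqI singletonD)
      then have vs: "f ` (mverts H - {v}) = f ` mverts H" by blast
      have "{f v} \<in># medges (map_mgraph f H)" using E key by simp
      moreover have "map_mgraph f H1 = drop_edge (map_mgraph f H) {f v}"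
        using v(2) vs E key by (intro mgraph_eqI) simp_all
      ultimately show ?thesis by (metis center_step_drop r_into_rtranclp)
    qed
  qed
qed

lemma contracts_simulates_steps:
  assumes "(center_step K)\<^sup>*\<^sup>* H C" and "contracts K f H"
  shows "(center_step (f ` K))\<^sup>*\<^sup>* (map_mgraph f H) (map_mgraph f C)"
  using assms
proof (induction rule: converse_rtranclp_induct)
  case (step H H1)
  then show ?case using contracts_step contracts_simulates by (metis rtranclp_trans)
qed simp

text \<open>The steps from \<open>H\<close> to its center \<open>C\<close> are simulated after
  contraction, so the contraction of \<open>C\<close> is reachable; it has at most as many vertices
  as \<open>C\<close> and still reduces to \<open>C'\<close>. The graph \<open>H'\<close> leaves
  room for steps after the contraction, namely for the deletion of the loops it creates.\<close>

lemma contraction_center_card: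
  assumes "finite (mverts H)" "contracts K f H" "is_center K H C" "is_center (f ` K) H' C'"
    and "(center_step (f ` K))\<^sup>*\<^sup>* (map_mgraph f H) H'"
  shows "card (mverts C') \<le> card (mverts C)"
proof -
  have steps: "(center_step K)\<^sup>*\<^sup>* H C" using assms(3) by (simp add: is_center_def)
  have "is_center (f ` K) (map_mgraph f H) C'"
    using assms(4,5) by (auto simp: is_center_def)
  then have "(center_step (f ` K))\<^sup>*\<^sup>* (map_mgraph f C) C'"
    using is_center_reachable[OF _ _ contracts_simulates_steps[OF steps assms(2)]] assms(1) by simp
  from center_steps_mverts[OF this] have "mverts C' \<subseteq> f ` mverts C" by simp
  moreover have "finite (mverts C)"
    using center_steps_mverts[OF steps] assms(1) finite_subset by blast
  ultimately show ?thesis by (meson card_image_le card_mono finite_imageI le_trans)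
qed

text \<open>Torsos are defined without loops whereas \<open>map_mgraph\<close> keeps them; these
  steps lead from the contracted torso to the torso of the merged decomposition.\<close>

lemma delete_loops:
  assumes "\<forall>e\<in>#medges H. card e = 1 \<or> card e = 2"
  shows "(center_step K)\<^sup>*\<^sup>* H \<lparr> mverts = mverts H, medges = {#e \<in># medges H. card e = 2#} \<rparr>"
  using assms
proof (induction "size (medges H)" arbitrary: H rule: less_induct)
  case less
  show ?case
  proof (cases "\<exists>e\<in>#medges H. card e = 1")
    case True
    then obtain x where x: "{x} \<in># medges H" by (auto simp: card_1_singleton_iff)
    have "size (medges (drop_edge H {x})) < size (medges H)"
      using x by (simp add: size_Diff1_less)
    then have "(center_step K)\<^sup>*\<^sup>* (drop_edge H {x})
        \<lparr> mverts = mverts H, medges = {#e \<in># medges (drop_edge H {x}). card e = 2#} \<rparr>"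
      using less.hyps[of "drop_edge H {x}"] less.prems by (auto dest: in_diffD)
    moreover have "{#e \<in># medges (drop_edge H {x}). card e = 2#} = {#e \<in># medges H. card e = 2#}"
      by simp
    ultimately show ?thesis using center_step_drop[OF x] by (metis converse_rtranclp_into_rtranclp)
  next
    case False
    then have "{#e \<in># medges H. card e = 2#} = medges H"
      using less.prems by (intro filter_mset_all) blast
    then have "\<lparr> mverts = mverts H, medges = {#e \<in># medges H. card e = 2#} \<rparr> = H"
      by (intro mgraph_eqI) simp_all
    then show ?thesis by simp
  qed
qed

section \<open>Torsos without mergeable pairs\<close>

definition loop_free :: "'a mgraph \<Rightarrow> bool" where
  "loop_free H \<longleftrightarrow> (\<forall>e\<in>#medges H. e \<subseteq> mverts H \<and> card e = 2)"

lemma loop_free_no_loop: "loop_free H \<Longrightarrow> {x} \<notin># medges H"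
  by (auto simp: loop_free_def)

lemma is_center_if_degrees_ge_3:
  assumes "loop_free H" "\<forall>x\<in>mverts H - K. degree H x \<ge> 3"
  shows "is_center K H H"
proof -
  have "\<not> suppressible K H v N" for v N
  proof
    assume s: "suppressible K H v N"
    then have "degree H v \<le> 2" by (auto simp: suppressible_def degree_def)
    moreover have "3 \<le> degree H v" using s assms(2) by (auto simp: suppressible_def)
    ultimately show False by simp
  qed
  then show ?thesis
    using loop_free_no_loop[OF assms(1)] by (auto simp: is_center_def center_step_iff)
qed

lemma degree_replace:
  assumes "u \<noteq> v"
  shows "degree (replace_vertex H v N) u + size {#e \<in># incident H v. u \<in> e#} =
    degree H u + size {#e \<in># N. u \<in> e#}"
  using assms incident_restrict[of H u v]
  by (simp add: degree_def incident_replace) (metis add.assoc add.commute size_union)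

lemma size_2_mset: "size M = 2 \<Longrightarrow> \<exists>x y. M = {#x, y#}"
  by (metis One_nat_def Suc_1 size_1_singleton_mset size_eq_Suc_imp_eq_union nat.inject size_add_mset)

text \<open>In the last alternative all edges at \<^term>\<open>v\<close> lead to the same neighbour \<^term>\<open>u\<close>, the only
  vertex whose degree drops.\<close>

lemma suppress_loop_free:
  assumes lf: "loop_free F" and v: "v \<in> mverts F - K" and d: "degree F v \<le> 2"
  obtains N where "(center_step K)\<^sup>*\<^sup>* F (replace_vertex F v N)" "loop_free (replace_vertex F v N)"
    "\<forall>e\<in>#N. e \<subseteq> \<Union>(set_mset (incident F v)) - {v}"
    "(\<forall>x\<in>mverts F - {v}. degree (replace_vertex F v N) x = degree F x) \<or>
     (N = {#} \<and> incident F v \<noteq> {#} \<and> (\<exists>u\<in>mverts F - {v}. \<forall>e\<in>#incident F v. e = {v, u}))"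
proof -
  have edge: "\<exists>u\<in>mverts F - {v}. e = {v, u}" if "e \<in># incident F v" for e
  proof -
    have "v \<in> e" "card e = 2" "e \<subseteq> mverts F" using that lf by (auto simp: mem_incident loop_free_def)
    then show ?thesis by (auto simp: card_2_iff)
  qed
  have nl: "{x} \<notin># medges F" for x using loop_free_no_loop[OF lf] .
  have lf0: "loop_free (replace_vertex F v {#})" using lf by (auto simp: loop_free_def)
  consider "degree F v = 0" | "degree F v = 1" | "degree F v = 2" using d by linarith
  then show thesis
  proof cases
    case 1
    then have s: "suppressible K F v {#}" using v nl by (simp add: suppressible_def)
    have "degree (replace_vertex F v {#}) x = degree F x" if "x \<noteq> v" for x
      using degree_replace[OF that, of F "{#}"] 1 by (simp add: degree_def)
    then show thesis
      using s lf0 by (intro that[of "{#}"]) (auto intro: r_into_rtranclp center_step_suppress)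
  next
    case 2
    then have s: "suppressible K F v {#}" using v nl by (simp add: suppressible_def)
    obtain e where e: "incident F v = {#e#}" using 2 by (metis degree_def size_1_singleton_mset)
    then obtain u where "u \<in> mverts F - {v}" "e = {v, u}" using edge by auto
    then show thesis
      using s lf0 e by (intro that[of "{#}"]) (auto intro: r_into_rtranclp center_step_suppress)
  next
    case 3
    then obtain e1 e2 where e12: "incident F v = {#e1, e2#}"
      using size_2_mset degree_def by metis
    then obtain a b where ab: "a \<in> mverts F - {v}" "b \<in> mverts F - {v}" "incident F v = {#{v, a}, {v, b}#}"
      using edge[of e1] edge[of e2] by auto
    have s: "suppressible K F v {#{a, b}#}" using v nl ab by (auto simp: suppressible_def)
    show thesis
    proof (cases "a = b")
      \<comment> \<open>The bypass edge is a loop here and is deleted at once to keep the graph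
        loop-free. So \<open>N\<close> is empty although \<open>v\<close> had two edges, and
        \<open>a\<close> loses both.\<close>
      case True
      have "drop_edge (replace_vertex F v {#{a, b}#}) {a} = replace_vertex F v {#}"
        using True by (intro mgraph_eqI) simp_all
      moreover have "{a} \<in># medges (replace_vertex F v {#{a, b}#})" using True by simp
      ultimately have "(center_step K)\<^sup>*\<^sup>* F (replace_vertex F v {#})"
        using center_step_suppress[OF s] center_step_drop by (metis converse_rtranclp_into_rtranclp r_into_rtranclp)
      then show thesis using lf0 ab True by (intro that[of "{#}"]) auto
    next
      case False
      have "loop_free (replace_vertex F v {#{a, b}#})"
        using lf ab False by (auto simp: loop_free_def)
      moreover have "degree (replace_vertex F v {#{a, b}#}) x = degree F x" if "x \<noteq> v" for x
        using degree_replace[OF that, of F "{#{a, b}#}"] ab(3) False that by (auto split: if_splits)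
      ultimately show thesis
        using ab center_step_suppress[OF s] by (intro that[of "{#{a, b}#}"]) auto
    qed
  qed
qed

text \<open>A degree drops only if all edges of \<open>v\<close> lead to one vertex
  \<open>u\<close>. A graph with a single vertex of degree at most 2 outside \<open>K\<close>
  therefore becomes a center or again a graph with a single such vertex, and the equations record
  how many edges that vertex has lost.\<close>

lemma suppress_defective:
  assumes lf: "loop_free F" and v: "v \<in> mverts F - K" "degree F v \<le> 2"
    and ge3: "\<forall>x\<in>mverts F - K - {v}. degree F x \<ge> 3"
  obtains F' where "(center_step K)\<^sup>*\<^sup>* F F'" "loop_free F'" "mverts F' = mverts F - {v}"
    "is_center K F' F' \<or>
     (\<exists>u\<in>mverts F - K - {v}. degree F' u \<le> 2 \<and> (\<forall>x\<in>mverts F - {v, u}. degree F' x = degree F x) \<and>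
        (\<forall>e. v \<notin> e \<longrightarrow> count (medges F') e = count (medges F) e) \<and> 1 \<le> degree F v \<and>
        count (medges F) {v, u} = degree F v \<and> degree F u = degree F' u + degree F v)"
proof -
  obtain N where N: "(center_step K)\<^sup>*\<^sup>* F (replace_vertex F v N)" "loop_free (replace_vertex F v N)"
    "(\<forall>x\<in>mverts F - {v}. degree (replace_vertex F v N) x = degree F x) \<or>
     (N = {#} \<and> incident F v \<noteq> {#} \<and> (\<exists>u\<in>mverts F - {v}. \<forall>e\<in>#incident F v. e = {v, u}))"
    by (rule suppress_loop_free[OF lf v], rule that)
  let ?F = "replace_vertex F v N"
  show thesis
  proof (cases "is_center K ?F ?F")
    case True
    then show thesis using that[OF N(1,2)] by simp
  next
    case False
    have "\<not> (\<forall>x\<in>mverts F - {v}. degree ?F x = degree F x)"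
    proof
      assume "\<forall>x\<in>mverts F - {v}. degree ?F x = degree F x"
      then have "is_center K ?F ?F" using ge3 N(2) by (intro is_center_if_degrees_ge_3) auto
      then show False using False by blast
    qed
    then obtain u where u: "N = {#}" "incident F v \<noteq> {#}" "u \<in> mverts F - {v}"
        "\<forall>e\<in>#incident F v. e = {v, u}" using N(3) by blast
    have inc: "incident F v = replicate_mset (degree F v) {v, u}"
      unfolding degree_def by (rule set_mset_subset_singletonD) (use u(4) in blast)
    have deg: "degree ?F x + size {#e \<in># incident F v. x \<in> e#} = degree F x" if "x \<noteq> v" for x
      using degree_replace[OF that, of F N] u(1) by simp
    have du: "degree F u = degree ?F u + degree F v"
    proof -
      have "{#e \<in># incident F v. u \<in> e#} = incident F v" using u(4) by (intro filter_mset_all) blast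
      then show ?thesis using deg[of u] u(3) by (simp add: degree_def)
    qed
    have dx: "degree ?F x = degree F x" if "x \<in> mverts F - {v, u}" for x
    proof -
      have "{#e \<in># incident F v. x \<in> e#} = {#}" using u(4) that by (intro filter_mset_none) blast
      then have "size {#e \<in># incident F v. x \<in> e#} = 0" by (simp only: size_empty)
      then show ?thesis using deg[of x] that by (simp del: size_eq_0_iff_empty)
    qed
    obtain x where x: "x \<in> mverts F - K - {v}" "\<not> 3 \<le> degree ?F x"
      using False is_center_if_degrees_ge_3[OF N(2), of K] by auto
    have "x = u"
    proof (rule ccontr)
      assume "x \<noteq> u"
      then have "degree ?F x = degree F x" using dx x(1) by blast
      then show False using ge3 x by auto
    qed
    then have "u \<notin> K" "degree ?F u \<le> 2" using x by auto
    moreover have "count (medges F) {v, u} = degree F v"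
    proof -
      have "count (medges F) {v, u} = count (incident F v) {v, u}" by (simp add: incident_def)
      then show ?thesis using inc by (metis count_replicate_mset)
    qed
    moreover have "1 \<le> degree F v" using u(2) by (simp add: degree_def Suc_le_eq nonempty_has_size[symmetric])
    ultimately show thesis using that[OF N(1,2)] u(1,3) dx du by auto
  qed
qed

text \<open>Here \<open>z\<close> is the component above the node, absent at the root. The defect
  travels along \<open>z\<close>, \<open>b1\<close>, \<open>b2\<close>, \<open>b3\<close>; if the
  chain ends before \<open>b3\<close>, at most \<open>b1\<close> and \<open>b2\<close> are lost. The
  restriction of \<open>nomerge\<close> to degrees at most 4 is harmless, since each degree in the
  chain is a sum of two numbers at most 2.\<close>

lemma loop_free_center_loses_2:
  assumes fin: "finite (mverts F)" and lf: "loop_free F"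
    and V: "mverts F = K \<union> B \<union> Z" "Z \<subseteq> {z}" "K \<inter> B = {}" "Z \<inter> (K \<union> B) = {}"
    and B: "\<And>b. b \<in> B \<Longrightarrow> degree F b \<ge> 3"
    and nomerge: "\<And>b b'. b \<in> B \<Longrightarrow> b' \<in> B \<Longrightarrow> b \<noteq> b' \<Longrightarrow> {b, b'} \<in># medges F \<Longrightarrow>
      degree F b \<le> 4 \<Longrightarrow> degree F b' \<le> 4 \<Longrightarrow>
      degree F b + degree F b' \<notin> {3 + 2 * count (medges F) {b, b'}, 4 + 2 * count (medges F) {b, b'}}"
    and C: "is_center K F C"
  shows "card B \<le> card (B \<inter> mverts C) + 2"
proof -
  have finB: "finite B" using fin V by simp
  \<comment> \<open>The common exit: by uniqueness \<open>C\<close> is the graph in which the chain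
    stops, so it misses at most the two listed vertices of \<open>B\<close>.\<close>
  have final: "card B \<le> card (B \<inter> mverts C) + 2"
    if "(center_step K)\<^sup>*\<^sup>* F F'" "is_center K F' F'" "B \<subseteq> mverts F' \<union> {x, y}" for F' x y
  proof -
    have "is_center K F F'" using that(1,2) by (auto simp: is_center_def)
    then have "C = F'" using is_center_unique[OF fin C] by blast
    then have "B \<subseteq> (B \<inter> mverts C) \<union> {x, y}" using that(3) by blast
    then have "card B \<le> card ((B \<inter> mverts C) \<union> {x, y})" using finB by (intro card_mono) auto
    also have "\<dots> \<le> card (B \<inter> mverts C) + card {x, y}" by (rule card_Un_le)
    also have "card {x, y} \<le> 2" by (simp add: card_insert_le_m1)
    finally show ?thesis by simp
  qed
  show ?thesis
  proof (cases "is_center K F F")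
    case True
    moreover have "B \<subseteq> mverts F \<union> {z, z}" using V by blast
    ultimately show ?thesis using final[of F] by blast
  next
    case False
    then obtain x where x: "x \<in> mverts F - K" "\<not> 3 \<le> degree F x"
      using is_center_if_degrees_ge_3[OF lf, of K] by blast
    then have "x \<in> Z" using V(1) B by blast
    then have "x = z" "Z = {z}" using V(2) by auto
    then have z: "Z = {z}" "degree F z \<le> 2" "z \<in> mverts F - K" using x by auto
    have zB: "z \<notin> B" and BF: "B \<subseteq> mverts F" and VB: "\<And>x. x \<in> mverts F \<Longrightarrow> x \<notin> K \<Longrightarrow> x \<noteq> z \<Longrightarrow> x \<in> B"
      using V z(1) by auto
    have ge3: "\<forall>x\<in>mverts F - K - {z}. degree F x \<ge> 3" using VB B by blast
    obtain F1 where F1: "(center_step K)\<^sup>*\<^sup>* F F1" "loop_free F1" "mverts F1 = mverts F - {z}"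
      and F1': "is_center K F1 F1 \<or>
        (\<exists>u\<in>mverts F - K - {z}. degree F1 u \<le> 2 \<and> (\<forall>x\<in>mverts F - {z, u}. degree F1 x = degree F x) \<and>
        (\<forall>e. z \<notin> e \<longrightarrow> count (medges F1) e = count (medges F) e) \<and> 1 \<le> degree F z \<and>
        count (medges F) {z, u} = degree F z \<and> degree F u = degree F1 u + degree F z)"
      by (rule suppress_defective[OF lf z(3,2) ge3], rule that)
    show ?thesis
    proof (cases "is_center K F1 F1")
      case True
      moreover have "B \<subseteq> mverts F1 \<union> {z, z}" using F1(3) BF by auto
      ultimately show ?thesis using final[OF F1(1)] by blast
    next
      case False
      then obtain b1 where b1: "b1 \<in> mverts F - K - {z}" "degree F1 b1 \<le> 2"
        "\<forall>x\<in>mverts F - {z, b1}. degree F1 x = degree F x"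
        "\<forall>e. z \<notin> e \<longrightarrow> count (medges F1) e = count (medges F) e" "1 \<le> degree F z"
        "degree F b1 = degree F1 b1 + degree F z" using F1' by blast
      have b1B: "b1 \<in> B" using b1(1) VB by blast
      have ge3: "\<forall>x\<in>mverts F1 - K - {b1}. degree F1 x \<ge> 3" using b1(3) F1(3) ge3 by auto
      have b1': "b1 \<in> mverts F1 - K" using b1(1) F1(3) by blast
      obtain F2 where F2: "(center_step K)\<^sup>*\<^sup>* F1 F2" "loop_free F2" "mverts F2 = mverts F1 - {b1}"
        and F2': "is_center K F2 F2 \<or>
          (\<exists>u\<in>mverts F1 - K - {b1}. degree F2 u \<le> 2 \<and> (\<forall>x\<in>mverts F1 - {b1, u}. degree F2 x = degree F1 x) \<and>
          (\<forall>e. b1 \<notin> e \<longrightarrow> count (medges F2) e = count (medges F1) e) \<and> 1 \<le> degree F1 b1 \<and>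
          count (medges F1) {b1, u} = degree F1 b1 \<and> degree F1 u = degree F2 u + degree F1 b1)"
        by (rule suppress_defective[OF F1(2) b1' b1(2) ge3], rule that)
      have FF2: "(center_step K)\<^sup>*\<^sup>* F F2" using F1(1) F2(1) by simp
      show ?thesis
      proof (cases "is_center K F2 F2")
        case True
        moreover have "B \<subseteq> mverts F2 \<union> {b1, b1}" using F1(3) F2(3) BF zB by auto
        ultimately show ?thesis using final[OF FF2] by blast
      next
        case False
        then obtain b2 where b2: "b2 \<in> mverts F1 - K - {b1}" "degree F2 b2 \<le> 2"
          "\<forall>x\<in>mverts F1 - {b1, b2}. degree F2 x = degree F1 x"
          "\<forall>e. b1 \<notin> e \<longrightarrow> count (medges F2) e = count (medges F1) e" "1 \<le> degree F1 b1"
          "count (medges F1) {b1, b2} = degree F1 b1"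
          "degree F1 b2 = degree F2 b2 + degree F1 b1" using F2' by blast
        have b2B: "b2 \<in> B" "b2 \<noteq> b1" "b2 \<noteq> z" using b2(1) F1(3) VB by auto
        have ge3: "\<forall>x\<in>mverts F2 - K - {b2}. degree F2 x \<ge> 3" using b2(3) F2(3) ge3 by auto
        have b2': "b2 \<in> mverts F2 - K" using b2(1) F2(3) by blast
        obtain F3 where F3: "(center_step K)\<^sup>*\<^sup>* F2 F3" "mverts F3 = mverts F2 - {b2}"
          and F3': "is_center K F3 F3 \<or>
            (\<exists>u\<in>mverts F2 - K - {b2}. degree F3 u \<le> 2 \<and> (\<forall>x\<in>mverts F2 - {b2, u}. degree F3 x = degree F2 x) \<and>
            (\<forall>e. b2 \<notin> e \<longrightarrow> count (medges F3) e = count (medges F2) e) \<and> 1 \<le> degree F2 b2 \<and>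
            count (medges F2) {b2, u} = degree F2 b2 \<and> degree F2 u = degree F3 u + degree F2 b2)"
          by (rule suppress_defective[OF F2(2) b2' b2(2) ge3], rule that)
        have FF3: "(center_step K)\<^sup>*\<^sup>* F F3" using FF2 F3(1) by simp
        show ?thesis
        proof (cases "is_center K F3 F3")
          case True
          moreover have "B \<subseteq> mverts F3 \<union> {b1, b2}" using F1(3) F2(3) F3(2) BF zB by auto
          ultimately show ?thesis using final[OF FF3] by blast
        next
          case False
          then obtain b3 where b3: "b3 \<in> mverts F2 - K - {b2}" "degree F3 b3 \<le> 2"
            "1 \<le> degree F2 b2" "count (medges F2) {b2, b3} = degree F2 b2"
            "degree F2 b3 = degree F3 b3 + degree F2 b2" using F3' by blast
          have b3B: "b3 \<in> B" "b3 \<noteq> b1" "b3 \<noteq> b2" "b3 \<noteq> z" using b3(1) F1(3) F2(3) VB by auto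
          have d2: "degree F b2 = degree F2 b2 + degree F1 b1"
            using b1(3) b2(7) b2B BF by auto
          have "degree F b3 = degree F1 b3" using b1(3) b3B BF by auto
          also have "\<dots> = degree F2 b3" using b2(3) b3(1) b3B(3) F2(3) by auto
          finally have d3: "degree F b3 = degree F3 b3 + degree F2 b2" using b3(5) by simp
          have c12: "count (medges F) {b1, b2} = degree F1 b1"
            using b1(1,4) b2(6) b2B by auto
          have "count (medges F2) {b2, b3} = count (medges F) {b2, b3}"
            using b1(4) b2(4) b2B b3B by auto
          then have c23: "count (medges F) {b2, b3} = degree F2 b2" using b3(4) by simp
          have m12: "{b1, b2} \<in># medges F" and m23: "{b2, b3} \<in># medges F"
            using c12 c23 b2(5) b3(3) by (metis count_greater_zero_iff less_le_trans zero_less_one)+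
          have "degree F b3 \<ge> 3" "degree F b2 \<ge> 3" using B b3B b2B by blast+
          moreover have r: "degree F z \<in> {1, 2}" "degree F1 b1 \<in> {1, 2}" "degree F2 b2 \<in> {1, 2}"
            "degree F3 b3 \<le> 2" using b1(2,5) b2(2,5) b3(2,3) z(2) by auto
          moreover have le4: "degree F b1 \<le> 4" "degree F b2 \<le> 4" "degree F b3 \<le> 4"
            unfolding b1(6) d2 d3 using r by auto
          moreover have "degree F b1 + degree F b2 \<notin> {3 + 2 * degree F1 b1, 4 + 2 * degree F1 b1}"
            using nomerge[OF b1B b2B(1) b2B(2)[symmetric] m12 le4(1,2)] unfolding c12 .
          moreover have "degree F b2 + degree F b3 \<notin> {3 + 2 * degree F2 b2, 4 + 2 * degree F2 b2}"
            using nomerge[OF b2B(1) b3B(1) b3B(3)[symmetric] m23 le4(2,3)] unfolding c23 .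
          \<comment> \<open>Let r0, r1, r2, r3 be the degrees of \<open>z\<close> in
            \<open>F\<close>, \<open>b1\<close> in \<open>F1\<close>, \<open>b2\<close> in
            \<open>F2\<close> and \<open>b3\<close> in \<open>F3\<close>. The pair
            \<open>b1\<close>, \<open>b2\<close> forbids r0 + r2 to be 3 or 4, so r0 = r2 = 1. As
            \<open>b2\<close> and \<open>b3\<close> have degree at least 3 in \<open>F\<close>, it
            follows that r1 = r3 = 2, and the pair \<open>b2\<close>, \<open>b3\<close> is forbidden
            too.\<close>
          ultimately have False
            unfolding b1(6) d2 d3 by (elim insertE emptyE) simp_all
          then show ?thesis ..
        qed
      qed
    qed
  qed
qed

text \<open>All edges at vertices of \<open>A\<close> end in \<open>Q\<close>, hence the bypass
  edges lie within \<open>Q\<close>, and no edge that meets \<open>B\<close> is ever touched. In the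
  application \<open>Q\<close> consists of the bag and the component above the node.\<close>

lemma suppress_thin_set:
  assumes "finite A" "loop_free H" "A \<subseteq> mverts H - K" "A \<inter> B = {}" "A \<inter> Q = {}" "B \<inter> Q = {}"
    and "\<And>a. a \<in> A \<Longrightarrow> degree H a \<le> 2"
    and "\<And>a e. a \<in> A \<Longrightarrow> e \<in># incident H a \<Longrightarrow> \<exists>x\<in>Q. e = {a, x}"
  shows "\<exists>F. (center_step K)\<^sup>*\<^sup>* H F \<and> loop_free F \<and> mverts F = mverts H - A \<and>
    {#e \<in># medges F. e \<inter> B \<noteq> {}#} = {#e \<in># medges H. e \<inter> B \<noteq> {}#}"
  using assms
proof (induction A arbitrary: H rule: finite_induct)
  case empty
  then show ?case by auto
next
  case (insert a A)
  have a: "a \<in> mverts H - K" "degree H a \<le> 2" using insert.prems by auto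
  have aQ: "\<exists>x\<in>Q. e = {a, x}" if "e \<in># incident H a" for e using insert.prems(7)[of a e] that by blast
  obtain N where N: "(center_step K)\<^sup>*\<^sup>* H (replace_vertex H a N)" "loop_free (replace_vertex H a N)"
    "\<forall>e\<in>#N. e \<subseteq> \<Union>(set_mset (incident H a)) - {a}"
    by (rule suppress_loop_free[OF insert.prems(1) a], rule that)
  have NQ: "e \<subseteq> Q" if "e \<in># N" for e using N(3) that aQ by blast
  let ?H = "replace_vertex H a N"
  have inc: "incident ?H x = incident H x" if "x \<in> A" for x
  proof -
    have xa: "x \<noteq> a" using that insert.hyps by blast
    have "{#e \<in># N. x \<in> e#} = {#}" using NQ that insert.prems(4) by (intro filter_mset_none) blast
    moreover have "a \<notin> e" if "e \<in># incident H x" for e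
      using insert.prems(7)[of x e] that \<open>x \<in> A\<close> xa insert.prems(4) by blast
    then have "{#e \<in># incident H x. a \<notin> e#} = incident H x" by (intro filter_mset_all)
    ultimately show ?thesis using xa by (simp add: incident_replace)
  qed
  have "\<exists>F. (center_step K)\<^sup>*\<^sup>* ?H F \<and> loop_free F \<and> mverts F = mverts ?H - A \<and>
    {#e \<in># medges F. e \<inter> B \<noteq> {}#} = {#e \<in># medges ?H. e \<inter> B \<noteq> {}#}"
  proof (rule insert.IH[OF N(2)])
    show "A \<subseteq> mverts ?H - K" using insert.prems(2) insert.hyps by auto
    show "degree ?H x \<le> 2" if "x \<in> A" for x using insert.prems(6)[of x] inc[OF that] that by (simp add: degree_def)
    show "\<exists>y\<in>Q. e = {x, y}" if "x \<in> A" "e \<in># incident ?H x" for x e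
      using insert.prems(7)[of x e] inc[OF that(1)] that by simp
  qed (use insert.prems in auto)
  then obtain F where F: "(center_step K)\<^sup>*\<^sup>* ?H F" "loop_free F" "mverts F = mverts ?H - A"
    "{#e \<in># medges F. e \<inter> B \<noteq> {}#} = {#e \<in># medges ?H. e \<inter> B \<noteq> {}#}" by blast
  have "{#e \<in># N. e \<inter> B \<noteq> {}#} = {#}" using NQ insert.prems(5) by (intro filter_mset_none) blast
  moreover have "{#e \<in># medges H. a \<notin> e \<and> e \<inter> B \<noteq> {}#} = {#e \<in># medges H. e \<inter> B \<noteq> {}#}"
  proof (rule filter_mset_cong[OF refl])
    fix e assume "e \<in># medges H"
    then have "a \<in> e \<Longrightarrow> e \<inter> B = {}" using aQ[of e] insert.prems(3,5) by (auto simp: mem_incident)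
    then show "(a \<notin> e \<and> e \<inter> B \<noteq> {}) = (e \<inter> B \<noteq> {})" by blast
  qed
  ultimately have "{#e \<in># medges F. e \<inter> B \<noteq> {}#} = {#e \<in># medges H. e \<inter> B \<noteq> {}#}"
    using F(4) by (simp add: filter_filter_mset)
  moreover have "mverts F = mverts H - insert a A" using F(3) by auto
  ultimately show ?case using F(1,2) N(1) by (meson rtranclp_trans)
qed

text \<open>The sets \<open>K\<close>, \<open>A\<close>, \<open>B\<close>, \<open>Z\<close> are the
  bag, the thin children, the bold children and the component above the node. Suppressing
  \<open>A\<close> changes neither degrees nor multiplicities at \<open>B\<close>, so the absence of
  mergeable pairs carries over to the graph in which the chain reaction is studied.\<close>

lemma thin_bold_center:
  assumes fin: "finite (mverts H)" and lf: "loop_free H"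
    and V: "mverts H = K \<union> A \<union> B \<union> Z" "Z \<subseteq> {z}"
      "K \<inter> A = {}" "K \<inter> B = {}" "A \<inter> B = {}" "Z \<inter> (K \<union> A \<union> B) = {}"
    and A: "\<And>a. a \<in> A \<Longrightarrow> degree H a \<le> 2"
      "\<And>a e. a \<in> A \<Longrightarrow> e \<in># incident H a \<Longrightarrow> \<exists>x\<in>K \<union> Z. e = {a, x}"
    and B: "\<And>b. b \<in> B \<Longrightarrow> degree H b \<ge> 3"
    and nomerge: "\<And>b b'. b \<in> B \<Longrightarrow> b' \<in> B \<Longrightarrow> b \<noteq> b' \<Longrightarrow> {b, b'} \<in># medges H \<Longrightarrow>
      degree H b \<le> 4 \<Longrightarrow> degree H b' \<le> 4 \<Longrightarrow>
      degree H b + degree H b' \<notin> {3 + 2 * count (medges H) {b, b'}, 4 + 2 * count (medges H) {b, b'}}"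
    and C: "is_center K H C"
  shows "card K + card B \<le> card (mverts C) + 2"
proof -
  have "finite A" using fin V by simp
  then obtain F where F: "(center_step K)\<^sup>*\<^sup>* H F" "loop_free F" "mverts F = mverts H - A"
    "{#e \<in># medges F. e \<inter> B \<noteq> {}#} = {#e \<in># medges H. e \<inter> B \<noteq> {}#}"
    using suppress_thin_set[of A H K B "K \<union> Z"] lf V A by blast
  have inc: "incident F b = incident H b" if "b \<in> B" for b
  proof -
    have "incident G b = {#e \<in># {#e \<in># medges G. e \<inter> B \<noteq> {}#}. b \<in> e#}" for G
      using that unfolding incident_def filter_filter_mset by (intro filter_mset_cong) auto
    then show ?thesis using F(4) by metis
  qed
  have deg: "degree F b = degree H b" if "b \<in> B" for b using inc[OF that] by (simp add: degree_def)
  have cnt: "count (medges F) {b, b'} = count (medges H) {b, b'}" if "b \<in> B" for b b'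
  proof -
    have "count (medges G) {b, b'} = count (incident G b) {b, b'}" for G by (simp add: incident_def)
    then show ?thesis using inc[OF that] by metis
  qed
  have CF: "(center_step K)\<^sup>*\<^sup>* F C" using is_center_reachable[OF fin C F(1)] .
  then have CF': "is_center K F C" using C by (simp add: is_center_def)
  have "card B \<le> card (B \<inter> mverts C) + 2"
  proof (rule loop_free_center_loses_2[OF _ F(2), where K = K and Z = Z and z = z])
    show "mverts F = K \<union> B \<union> Z" using F(3) V by blast
    show "degree F b + degree F b' \<notin> {3 + 2 * count (medges F) {b, b'}, 4 + 2 * count (medges F) {b, b'}}"
      if "b \<in> B" "b' \<in> B" "b \<noteq> b'" "{b, b'} \<in># medges F" "degree F b \<le> 4" "degree F b' \<le> 4" for b b'
    proof -
      have "{b, b'} \<in># medges H" using that cnt[of b b'] by (metis count_greater_zero_iff)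
      then show ?thesis using nomerge[of b b'] that deg cnt by simp
    qed
  qed (use fin F V B deg CF' in auto)
  moreover have "K \<subseteq> mverts C" using center_steps_keep[OF CF] F(3) V by blast
  moreover have "finite (mverts C)" using center_steps_mverts[OF CF] F(3) fin finite_subset by fastforce
  then have "card (K \<union> (B \<inter> mverts C)) \<le> card (mverts C)" using \<open>K \<subseteq> mverts C\<close> by (intro card_mono) auto
  moreover have "card (K \<union> (B \<inter> mverts C)) = card K + card (B \<inter> mverts C)"
    using fin V by (intro card_Un_disjoint) auto
  ultimately show ?thesis by linarith
qed

section \<open>Rooted trees and torsos\<close>

definition descendants :: "('v, 's) tcdecomp \<Rightarrow> 's \<Rightarrow> 's set" where
  "descendants D x = {t \<in> tnodes D. (t, x) \<in> (parent_rel D)\<^sup>*}"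

lemma below_descendants: "below D s = (\<Union>t\<in>descendants D s. tbag D t)"
  by (simp add: below_def descendants_def)

text \<open>The distance to the root. It falls strictly along parent pointers, which yields
  antisymmetry of the ancestor relation.\<close>

definition level :: "('v, 's) tcdecomp \<Rightarrow> 's \<Rightarrow> nat" where
  "level D t = (LEAST k. (t, troot D) \<in> parent_rel D ^^ k)"

locale rooted =
  fixes D :: "('v, 's) tcdecomp"
  assumes rooted_tree: "rooted_tree D"
begin

lemma finite_nodes: "finite (tnodes D)" and root_node: "troot D \<in> tnodes D"
  and parent_node: "t \<in> tnodes D \<Longrightarrow> t \<noteq> troot D \<Longrightarrow> tparent D t \<in> tnodes D"
  and to_root: "t \<in> tnodes D \<Longrightarrow> (t, troot D) \<in> (parent_rel D)\<^sup>*"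
  using rooted_tree by (auto simp: rooted_tree_def)

lemma parent_rel_iff: "(t, x) \<in> parent_rel D \<longleftrightarrow> t \<in> tnodes D \<and> t \<noteq> troot D \<and> x = tparent D t"
  by (auto simp: parent_rel_def)

lemma parent_stepI: "t \<in> tnodes D \<Longrightarrow> t \<noteq> troot D \<Longrightarrow> (t, tparent D t) \<in> parent_rel D"
  by (simp add: parent_rel_iff)

lemma anc_node: "(t, x) \<in> (parent_rel D)\<^sup>* \<Longrightarrow> t \<in> tnodes D \<Longrightarrow> x \<in> tnodes D"
  by (induction rule: rtrancl_induct) (auto simp: parent_rel_iff parent_node)

lemma anc_cases:
  "(t, x) \<in> (parent_rel D)\<^sup>* \<Longrightarrow> t = x \<or> t \<in> tnodes D \<and> t \<noteq> troot D \<and> (tparent D t, x) \<in> (parent_rel D)\<^sup>*"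
  by (metis converse_rtranclE parent_rel_iff)

lemma anc_parent: "t \<in> tnodes D \<Longrightarrow> t \<noteq> troot D \<Longrightarrow> (tparent D t, x) \<in> (parent_rel D)\<^sup>* \<Longrightarrow> (t, x) \<in> (parent_rel D)\<^sup>*"
  by (meson converse_rtrancl_into_rtrancl parent_stepI)

lemma level_parent:
  assumes "t \<in> tnodes D" "t \<noteq> troot D"
  shows "level D t = Suc (level D (tparent D t))"
proof -
  have step: "(t, troot D) \<in> parent_rel D ^^ Suc k \<longleftrightarrow> (tparent D t, troot D) \<in> parent_rel D ^^ k" for k
    using assms parent_stepI
    by (auto simp: parent_rel_iff simp del: relpow.simps elim!: relpow_Suc_E2 intro: relpow_Suc_I2)
  obtain k where k: "(t, troot D) \<in> parent_rel D ^^ k"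
    using to_root[OF assms(1)] by (metis rtrancl_power)
  have "level D t = Suc (LEAST m. (t, troot D) \<in> parent_rel D ^^ Suc m)"
    unfolding level_def using k by (intro Least_Suc[where n = k]) (use assms in auto)
  then show ?thesis unfolding level_def step .
qed

lemma anc_level: "(t, x) \<in> (parent_rel D)\<^sup>* \<Longrightarrow> t = x \<or> level D x < level D t"
  by (induction rule: converse_rtrancl_induct) (auto simp: parent_rel_iff level_parent)

lemma anc_antisym: "(t, x) \<in> (parent_rel D)\<^sup>* \<Longrightarrow> (x, t) \<in> (parent_rel D)\<^sup>* \<Longrightarrow> t = x"
  using anc_level[of t x] anc_level[of x t] by auto

lemma anc_linear:
  assumes "(t, x) \<in> (parent_rel D)\<^sup>*" "(t, y) \<in> (parent_rel D)\<^sup>*"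
  shows "(x, y) \<in> (parent_rel D)\<^sup>* \<or> (y, x) \<in> (parent_rel D)\<^sup>*"
  by (rule single_valued_confluent[OF _ assms]) (auto simp: single_valued_def parent_rel_iff)

lemma node_induct [consumes 1, case_names root parent]:
  assumes "t \<in> tnodes D" "P (troot D)"
    and "\<And>t. t \<in> tnodes D \<Longrightarrow> t \<noteq> troot D \<Longrightarrow> P (tparent D t) \<Longrightarrow> P t"
  shows "P t"
  using to_root[OF assms(1)]
  by (induction rule: converse_rtrancl_induct) (auto simp: parent_rel_iff assms)

lemma children_node: "c \<in> tchildren D s \<Longrightarrow> c \<in> tnodes D \<and> c \<noteq> troot D \<and> tparent D c = s \<and> s \<in> tnodes D"
  using parent_node by (auto simp: tchildren_def)

lemma finite_children: "finite (tchildren D s)"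
  using finite_nodes by (auto simp: tchildren_def)

lemma child_anc: "c \<in> tchildren D s \<Longrightarrow> (c, x) \<in> (parent_rel D)\<^sup>* \<longleftrightarrow> c = x \<or> (s, x) \<in> (parent_rel D)\<^sup>*"
  using children_node anc_cases anc_parent by (metis rtrancl.rtrancl_refl)

lemma mem_descendants: "t \<in> descendants D x \<longleftrightarrow> t \<in> tnodes D \<and> (t, x) \<in> (parent_rel D)\<^sup>*"
  by (simp add: descendants_def)

lemma self_descendant: "x \<in> tnodes D \<Longrightarrow> x \<in> descendants D x"
  by (simp add: mem_descendants)

lemma parent_notin_descendants: "c \<in> tchildren D s \<Longrightarrow> s \<notin> descendants D c"
  using anc_level[of s c] children_node[of c s] level_parent[of c] by (auto simp: mem_descendants)

lemma descendants_children_disjoint: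
  assumes "c \<in> tchildren D s" "c' \<in> tchildren D s" "c \<noteq> c'"
  shows "descendants D c \<inter> descendants D c' = {}"
proof -
  have "\<not> (c, c') \<in> (parent_rel D)\<^sup>*" "\<not> (c', c) \<in> (parent_rel D)\<^sup>*"
    using child_anc[OF assms(1), of c'] child_anc[OF assms(2), of c] assms(3)
      parent_notin_descendants[OF assms(1)] parent_notin_descendants[OF assms(2)]
      children_node[OF assms(1)] by (auto simp: mem_descendants)
  then show ?thesis using anc_linear by (auto simp: mem_descendants) blast
qed

lemma descendants_unfold:
  assumes "s \<in> tnodes D"
  shows "descendants D s = insert s (\<Union>c\<in>tchildren D s. descendants D c)"
proof (intro equalityI subsetI)
  fix t assume t: "t \<in> descendants D s"
  then have "(t, s) \<in> (parent_rel D)\<^sup>*" "t \<in> tnodes D" by (auto simp: mem_descendants)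
  then show "t \<in> insert s (\<Union>c\<in>tchildren D s. descendants D c)"
    by (cases rule: rtranclE) (auto simp: mem_descendants tchildren_def parent_rel_iff)
next
  fix t assume "t \<in> insert s (\<Union>c\<in>tchildren D s. descendants D c)"
  then show "t \<in> descendants D s"
    using assms child_anc by (auto simp: mem_descendants intro: rtrancl_trans)
qed

lemma inj_on_descendants: "inj_on (descendants D) (tnodes D)"
  by (rule inj_onI) (metis anc_antisym mem_descendants self_descendant)

text \<open>A set with at most one element rather than a component, so that the root can be treated
  together with all other nodes.\<close>

definition outer_components :: "'s \<Rightarrow> 's set set" where
  "outer_components u = (if u = troot D then {} else {tnodes D - descendants D u})"

lemma descendants_root: "descendants D (troot D) = tnodes D"
  by (auto simp: mem_descendants to_root)

text \<open>A set closed under \<open>R\<close> is a component as soon as all its elements reach one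
  hub \<open>h\<close>.\<close>

lemma component_eq:
  assumes "sym R" "h \<in> C" "\<And>a b. (a, b) \<in> R \<Longrightarrow> a \<in> C \<Longrightarrow> b \<in> C" "\<And>t. t \<in> C \<Longrightarrow> (t, h) \<in> R\<^sup>*" "t \<in> C"
  shows "{t'. (t, t') \<in> R\<^sup>*} = C"
proof (intro equalityI subsetI; clarify)
  fix x assume "(t, x) \<in> R\<^sup>*"
  then show "x \<in> C" by (induction rule: rtrancl_induct) (use assms in blast)+
next
  fix x assume "x \<in> C"
  then have "(h, x) \<in> R\<^sup>*" using assms(1,4) by (meson symD sym_rtrancl)
  then show "(t, x) \<in> R\<^sup>*" using assms(4,5) by (meson rtrancl_trans)
qed

text \<open>The hub is the child \<open>c\<close> for the nodes below \<open>c\<close>, and the root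
  for the nodes outside the subtree of \<open>u\<close>.\<close>

lemma node_components_eq:
  assumes u: "u \<in> tnodes D"
  shows "node_components D u = descendants D ` tchildren D u \<union> outer_components u"
proof -
  define N where "N = tnodes D - {u}"
  define R where "R = (parent_rel D \<union> (parent_rel D)\<inverse>) \<inter> N \<times> N"
  have symR: "sym R" by (auto simp: R_def sym_def)
  have inR: "(t, tparent D t) \<in> R" if "t \<in> N" "t \<noteq> troot D" "tparent D t \<noteq> u" for t
    using that by (auto simp: R_def N_def parent_rel_iff parent_node)
  have Rcases: "a \<in> N \<and> b \<in> N \<and> (a \<noteq> troot D \<and> b = tparent D a \<or> b \<noteq> troot D \<and> a = tparent D b)"
    if "(a, b) \<in> R" for a b
    using that by (auto simp: R_def parent_rel_iff)
  have inner: "{t'. (t, t') \<in> R\<^sup>*} = descendants D c" if c: "c \<in> tchildren D u" and t: "t \<in> descendants D c" for c t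
  proof (rule component_eq[OF symR _ _ _ t])
    show "c \<in> descendants D c" using c children_node self_descendant by blast
    fix a b assume ab: "(a, b) \<in> R" "a \<in> descendants D c"
    show "b \<in> descendants D c"
    proof (cases "a \<noteq> troot D \<and> b = tparent D a")
      case True
      have "a \<noteq> c" using True Rcases[OF ab(1)] c by (auto simp: tchildren_def N_def)
      then show ?thesis using True ab(2) Rcases[OF ab(1)] anc_cases[of a c] by (auto simp: mem_descendants N_def)
    next
      case False
      then show ?thesis using ab Rcases[OF ab(1)] anc_parent[of b c] by (auto simp: mem_descendants N_def)
    qed
  next
    fix t assume "t \<in> descendants D c"
    then have "(t, c) \<in> (parent_rel D)\<^sup>*" "t \<in> tnodes D" by (auto simp: mem_descendants)
    then show "(t, c) \<in> R\<^sup>*"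
    proof (induction rule: converse_rtrancl_induct)
      case (step y z)
      then have y: "y \<noteq> troot D" "z = tparent D y" "z \<in> tnodes D" by (auto simp: parent_rel_iff parent_node)
      have "y \<noteq> u" "z \<noteq> u"
        using step parent_notin_descendants[OF c] y by (auto simp: mem_descendants intro: converse_rtrancl_into_rtrancl)
      then have "(y, z) \<in> R" using inR[of y] y step.prems by (auto simp: N_def)
      then show ?case using step.IH y by (auto intro: converse_rtrancl_into_rtrancl)
    qed simp
  qed
  have outer: "{t'. (t, t') \<in> R\<^sup>*} = tnodes D - descendants D u"
    if t: "t \<in> tnodes D - descendants D u" for t
  proof (rule component_eq[OF symR _ _ _ t])
    have "t \<in> tnodes D" using t by simp
    then have ur: "u \<noteq> troot D" using t descendants_root by auto
    then show "troot D \<in> tnodes D - descendants D u"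
      using root_node to_root[OF u] anc_antisym by (auto simp: mem_descendants)
    fix a b assume ab: "(a, b) \<in> R" "a \<in> tnodes D - descendants D u"
    show "b \<in> tnodes D - descendants D u"
      using ab Rcases[OF ab(1)] anc_parent[of a u] anc_cases[of b u] by (auto simp: mem_descendants N_def)
  next
    fix t assume "t \<in> tnodes D - descendants D u"
    then have "t \<in> tnodes D" "t \<notin> descendants D u" by auto
    then show "(t, troot D) \<in> R\<^sup>*"
    proof (induction rule: node_induct)
      case (parent t)
      have "tparent D t \<notin> descendants D u" "t \<noteq> u" "tparent D t \<noteq> u"
        using parent anc_parent[of t u] u by (auto simp: mem_descendants)
      then show ?case using parent inR[of t] by (auto simp: N_def intro: converse_rtrancl_into_rtrancl)
    qed simp
  qed
  have "node_components D u = (\<lambda>t. {t'. (t, t') \<in> R\<^sup>*}) ` N"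
    by (simp add: node_components_def Let_def N_def R_def)
  also have "\<dots> = descendants D ` tchildren D u \<union> outer_components u"
  proof (intro equalityI subsetI)
    fix C assume "C \<in> (\<lambda>t. {t'. (t, t') \<in> R\<^sup>*}) ` N"
    then obtain t where t: "t \<in> N" "C = {t'. (t, t') \<in> R\<^sup>*}" by blast
    show "C \<in> descendants D ` tchildren D u \<union> outer_components u"
    proof (cases "t \<in> descendants D u")
      case True
      then obtain c where "c \<in> tchildren D u" "t \<in> descendants D c"
        using t(1) descendants_unfold[OF u] by (auto simp: N_def)
      then show ?thesis using inner t(2) by blast
    next
      case False
      then have "u \<noteq> troot D" using t(1) descendants_root by (auto simp: N_def)
      then show ?thesis using outer[of t] False t by (auto simp: outer_components_def N_def)
    qed
  next
    fix C assume C: "C \<in> descendants D ` tchildren D u \<union> outer_components u"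
    show "C \<in> (\<lambda>t. {t'. (t, t') \<in> R\<^sup>*}) ` N"
    proof (cases "C \<in> outer_components u")
      case True
      then have ur: "u \<noteq> troot D" "C = tnodes D - descendants D u" by (auto simp: outer_components_def split: if_splits)
      then have "troot D \<in> tnodes D - descendants D u"
        using root_node to_root[OF u] anc_antisym by (auto simp: mem_descendants)
      then show ?thesis using outer[of "troot D"] ur root_node by (auto simp: N_def)
    next
      case False
      then obtain c where c: "c \<in> tchildren D u" "C = descendants D c" using C by blast
      then have "c \<in> N" "c \<in> descendants D c"
        using children_node self_descendant parent_notin_descendants[OF c(1)] by (auto simp: N_def)
      then show ?thesis using inner c by blast
    qed
  qed
  finally show ?thesis .
qed

lemma finite_components: "finite (node_components D u)"
  using finite_nodes by (auto simp: node_components_def Let_def)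

end

section \<open>Torsos of a tree-cut decomposition\<close>

locale tc_decomp =
  fixes G :: "'v sgraph" and D :: "('v, 's) tcdecomp"
  assumes simple: "simple_graph G" and tcd: "tree_cut_decomposition G D"
begin

sublocale rooted D
  by unfold_locales (use tcd in \<open>simp add: tree_cut_decomposition_def\<close>)

lemma bags_disjoint: "s \<in> tnodes D \<Longrightarrow> t \<in> tnodes D \<Longrightarrow> v \<in> tbag D s \<Longrightarrow> v \<in> tbag D t \<Longrightarrow> s = t"
  using tcd by (auto simp: tree_cut_decomposition_def)

lemma bags_cover: "(\<Union>s\<in>tnodes D. tbag D s) = gverts G"
  using tcd by (simp add: tree_cut_decomposition_def)

lemma finite_gverts: "finite (gverts G)"
  and edge_subset: "e \<in> gedges G \<Longrightarrow> e \<subseteq> gverts G"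
  and edge_card: "e \<in> gedges G \<Longrightarrow> card e = 2"
  using simple by (auto simp: simple_graph_def)

lemma finite_gedges: "finite (gedges G)"
  using finite_gverts edge_subset by (meson PowI finite_Pow_iff finite_subset subsetI)

lemma bag_subset: "s \<in> tnodes D \<Longrightarrow> tbag D s \<subseteq> gverts G"
  using bags_cover by blast

lemma below_subset: "below D s \<subseteq> gverts G"
  using bags_cover by (auto simp: below_def)

lemma mem_below: "t \<in> tnodes D \<Longrightarrow> v \<in> tbag D t \<Longrightarrow> v \<in> below D x \<longleftrightarrow> (t, x) \<in> (parent_rel D)\<^sup>*"
  using bags_disjoint by (auto simp: below_def)

lemma below_root: "below D (troot D) = gverts G"
  using bags_cover to_root by (auto simp: below_def)

lemma below_unfold:
  "s \<in> tnodes D \<Longrightarrow> below D s = tbag D s \<union> (\<Union>c\<in>tchildren D s. below D c)"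
  unfolding below_descendants using descendants_unfold by auto

lemma below_children_disjoint:
  "c \<in> tchildren D s \<Longrightarrow> c' \<in> tchildren D s \<Longrightarrow> c \<noteq> c' \<Longrightarrow> below D c \<inter> below D c' = {}"
  unfolding below_descendants using descendants_children_disjoint[of c s c'] bags_disjoint
  by (fastforce simp: mem_descendants)

lemma bag_below_disjoint: "c \<in> tchildren D s \<Longrightarrow> tbag D s \<inter> below D c = {}"
  unfolding below_descendants using parent_notin_descendants[of c s] bags_disjoint children_node
  by (fastforce simp: mem_descendants)

lemma torso_map_bag: "v \<in> tbag D u \<Longrightarrow> torso_map D u v = Inl v"
  by (simp add: torso_map_def)

lemma components_disjoint:
  assumes u: "u \<in> tnodes D" and C: "C \<in> node_components D u" "C' \<in> node_components D u"
    and t: "t \<in> C" "t \<in> C'"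
  shows "C = C'"
proof -
  have child_below: "descendants D c \<subseteq> descendants D u" if "c \<in> tchildren D u" for c
    using descendants_unfold[OF u] that by blast
  show ?thesis
  proof (cases "t \<in> descendants D u")
    case True
    then have "t \<notin> B" if "B \<in> outer_components u" for B using that by (auto simp: outer_components_def split: if_splits)
    then obtain c c' where c: "c \<in> tchildren D u" "C = descendants D c" "c' \<in> tchildren D u" "C' = descendants D c'"
      using C t unfolding node_components_eq[OF u] by blast
    then have "c = c'" using descendants_children_disjoint[OF c(1,3)] t by blast
    then show ?thesis using c by simp
  next
    case False
    then have "C \<in> outer_components u" "C' \<in> outer_components u"
      using C t child_below unfolding node_components_eq[OF u] by blast+
    then show ?thesis by (auto simp: outer_components_def split: if_splits)
  qed
qed

text \<open>Resolves the definite description in \<open>torso_map\<close>: a vertex determines its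
  node, as bags are disjoint, and the node determines its component.\<close>

lemma torso_map_component:
  assumes u: "u \<in> tnodes D" and C: "C \<in> node_components D u" "t \<in> C" "v \<in> tbag D t"
  shows "torso_map D u v = Inr C"
proof -
  have sub: "C \<subseteq> tnodes D - {u}" if "C \<in> node_components D u" for C
    using that parent_notin_descendants self_descendant[OF u] unfolding node_components_eq[OF u]
    by (auto simp: outer_components_def mem_descendants split: if_splits)
  have "v \<notin> tbag D u" using sub[OF C(1)] C bags_disjoint[OF u] by blast
  moreover have "(THE C. C \<in> node_components D u \<and> v \<in> (\<Union>t\<in>C. tbag D t)) = C"
  proof (rule the_equality)
    fix C' assume "C' \<in> node_components D u \<and> v \<in> (\<Union>t\<in>C'. tbag D t)"
    then obtain t' where "C' \<in> node_components D u" "t' \<in> C'" "v \<in> tbag D t'" by blast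
    moreover have "t = t'" using sub[OF C(1)] sub[of C'] calculation C bags_disjoint by blast
    ultimately show "C' = C" using components_disjoint[OF u _ C(1)] C(2) by blast
  qed (use C in blast)
  ultimately show ?thesis by (simp add: torso_map_def)
qed

lemma torso_map_below:
  assumes "c \<in> tchildren D u" "v \<in> below D c"
  shows "torso_map D u v = Inr (descendants D c)"
proof -
  have u: "u \<in> tnodes D" using assms children_node by blast
  then show ?thesis
    using assms torso_map_component[OF u] unfolding node_components_eq[OF u] below_descendants by blast
qed

lemma torso_map_outside:
  assumes u: "u \<in> tnodes D" and v: "v \<in> gverts G" "v \<notin> below D u"
  shows "u \<noteq> troot D" "torso_map D u v = Inr (tnodes D - descendants D u)"
proof -
  show ur: "u \<noteq> troot D" using v below_root by auto
  obtain t where "t \<in> tnodes D" "v \<in> tbag D t" using v(1) bags_cover by blast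
  then show "torso_map D u v = Inr (tnodes D - descendants D u)"
    using ur v(2) mem_below[of t v u] torso_map_component[OF u, of "tnodes D - descendants D u" t v]
    unfolding node_components_eq[OF u] by (auto simp: outer_components_def mem_descendants)
qed

lemma torso_cases:
  assumes u: "u \<in> tnodes D" and v: "v \<in> gverts G"
  obtains (bag) "v \<in> tbag D u" "torso_map D u v = Inl v"
  | (child) c where "c \<in> tchildren D u" "v \<in> below D c" "torso_map D u v = Inr (descendants D c)"
  | (outside) "u \<noteq> troot D" "v \<notin> below D u" "torso_map D u v = Inr (tnodes D - descendants D u)"
  using torso_map_bag torso_map_below torso_map_outside[OF u v] below_unfold[OF u] by blast

lemma descendants_ne_outer: "u \<in> tnodes D \<Longrightarrow> c \<in> tchildren D u \<Longrightarrow> descendants D c \<noteq> tnodes D - descendants D u"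
  using descendants_unfold self_descendant children_node by blast

lemma torso_map_eq_child:
  assumes c: "c \<in> tchildren D u" and v: "v \<in> gverts G"
  shows "torso_map D u v = Inr (descendants D c) \<longleftrightarrow> v \<in> below D c"
proof -
  have u: "u \<in> tnodes D" using c children_node by blast
  show ?thesis
    by (rule torso_cases[OF u v])
      (use c u descendants_ne_outer[OF u c] bag_below_disjoint[OF c] below_unfold[OF u] inj_on_descendants
        children_node below_children_disjoint[OF c] torso_map_below[OF c] in \<open>auto dest: inj_onD\<close>)
qed

lemma torso_map_vertex: "u \<in> tnodes D \<Longrightarrow> v \<in> gverts G \<Longrightarrow> torso_map D u v \<in> mverts (torso G D u)"
  by (cases rule: torso_cases[of u v]) (auto simp: torso_def node_components_eq outer_components_def)

lemma finite_torso: "u \<in> tnodes D \<Longrightarrow> finite (mverts (torso G D u))"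
  using finite_components finite_subset[OF bag_subset finite_gverts] by (simp add: torso_def)

lemma loop_free_torso: "u \<in> tnodes D \<Longrightarrow> loop_free (torso G D u)"
proof -
  assume u: "u \<in> tnodes D"
  have "e \<subseteq> mverts (torso G D u)" "card e = 2" if e: "e \<in># medges (torso G D u)" for e
  proof -
    from e obtain e' where "e' \<in> gedges G" "e = torso_map D u ` e'" and "card e = 2"
      by (auto simp: torso_def finite_gedges)
    then show "e \<subseteq> mverts (torso G D u)" "card e = 2" using torso_map_vertex[OF u] edge_subset by blast+
  qed
  then show ?thesis by (simp add: loop_free_def)
qed

lemma three_center_is_center:
  "u \<in> tnodes D \<Longrightarrow> is_center (Inl ` tbag D u) (torso G D u) (three_center G D u)"
  unfolding three_center_def by (rule someI_ex) (simp add: is_center_exists finite_torso)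

lemma edgeE: assumes "e \<in> gedges G" obtains x y where "e = {x, y}" "x \<noteq> y" "x \<in> gverts G" "y \<in> gverts G"
proof -
  obtain x y where "e = {x, y}" "x \<noteq> y" using edge_card[OF assms] by (auto simp: card_2_iff)
  then show thesis using that edge_subset[OF assms] by simp
qed

lemma size_torso_edges:
  "size {#e \<in># medges (torso G D u). Q e#} =
    card {e \<in> gedges G. card (torso_map D u ` e) = 2 \<and> Q (torso_map D u ` e)}"
  by (simp add: torso_def filter_filter_mset filter_mset_image_mset finite_gedges filter_mset_mset_set)

text \<open>Edges of \<open>G\<close> inside one component collapse to loops, which the torso
  discards. What remains at the vertex of \<open>c\<close> are the edges leaving
  \<open>below D c\<close>.\<close>

lemma degree_torso:
  assumes c: "c \<in> tchildren D u"
  shows "degree (torso G D u) (Inr (descendants D c)) = adhesion G D c"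
proof -
  have "card (torso_map D u ` e) = 2 \<and> Inr (descendants D c) \<in> torso_map D u ` e \<longleftrightarrow> card (e \<inter> below D c) = 1"
    if e: "e \<in> gedges G" for e
  proof -
    obtain x y where xy: "e = {x, y}" "x \<noteq> y" "x \<in> gverts G" "y \<in> gverts G" using e by (rule edgeE)
    have "Inr (descendants D c) = torso_map D u x \<longleftrightarrow> x \<in> below D c"
         "Inr (descendants D c) = torso_map D u y \<longleftrightarrow> y \<in> below D c"
      using torso_map_eq_child[OF c] xy by metis+
    then show ?thesis using xy by (auto simp: card_insert_if Int_insert_left)
  qed
  then show ?thesis
    unfolding degree_def incident_def adhesion_def size_torso_edges by (intro arg_cong[of _ _ card]) auto
qed

definition between :: "'s \<Rightarrow> 's \<Rightarrow> nat" where
  "between c c' = card {e \<in> gedges G. e \<inter> below D c \<noteq> {} \<and> e \<inter> below D c' \<noteq> {}}"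

lemma count_torso:
  assumes c: "c \<in> tchildren D u" "c' \<in> tchildren D u" "c \<noteq> c'"
  shows "count (medges (torso G D u)) {Inr (descendants D c), Inr (descendants D c')} = between c c'"
proof -
  have ne: "descendants D c \<noteq> descendants D c'"
    using c children_node inj_on_descendants by (metis inj_onD)
  have dj: "below D c \<inter> below D c' = {}" using below_children_disjoint c by blast
  have "card (torso_map D u ` e) = 2 \<and> torso_map D u ` e = {Inr (descendants D c), Inr (descendants D c')} \<longleftrightarrow>
      e \<inter> below D c \<noteq> {} \<and> e \<inter> below D c' \<noteq> {}" if e: "e \<in> gedges G" for e
  proof -
    obtain x y where xy: "e = {x, y}" "x \<noteq> y" "x \<in> gverts G" "y \<in> gverts G" using e by (rule edgeE)
    have "torso_map D u x = Inr (descendants D c) \<longleftrightarrow> x \<in> below D c"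
         "torso_map D u y = Inr (descendants D c) \<longleftrightarrow> y \<in> below D c"
         "torso_map D u x = Inr (descendants D c') \<longleftrightarrow> x \<in> below D c'"
         "torso_map D u y = Inr (descendants D c') \<longleftrightarrow> y \<in> below D c'"
      using torso_map_eq_child c xy by metis+
    then show ?thesis using xy ne dj by (auto simp: card_insert_if doubleton_eq_iff)
  qed
  moreover have "count M x = size {#e \<in># M. e = x#}" for M :: "('v + 's set) set multiset" and x
    by (simp add: filter_eq_replicate_mset)
  ultimately show ?thesis
    unfolding between_def by (simp only: size_torso_edges) (intro arg_cong[of _ _ card], auto)
qed

text \<open>In the torso, degrees are adhesions and multiplicities are the numbers
  \<open>between\<close>, so \<open>thin_bold_center\<close> applies; the formula in
  \<open>nomerge\<close> says that uniting \<open>c\<close> and \<open>c'\<close> would not give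
  adhesion 3 or 4.\<close>

lemma bold_children_bound:
  assumes nice: "nice G D" and u: "u \<in> tnodes D"
    and nomerge: "\<And>c c'. c \<in> tchildren D u \<Longrightarrow> c' \<in> tchildren D u \<Longrightarrow> c \<noteq> c' \<Longrightarrow>
      adhesion G D c \<in> {3, 4} \<Longrightarrow> adhesion G D c' \<in> {3, 4} \<Longrightarrow> between c c' \<noteq> 0 \<Longrightarrow>
      adhesion G D c + adhesion G D c' \<notin> {3 + 2 * between c c', 4 + 2 * between c c'}"
  shows "card {t \<in> tchildren D u. bold G D t} + card (tbag D u) \<le> card (mverts (three_center G D u)) + 2"
proof -
  let ?K = "Inl ` tbag D u :: ('v + 's set) set" and ?d = "\<lambda>c. Inr (descendants D c) :: 'v + 's set"
  let ?A = "?d ` {t \<in> tchildren D u. thin G D t}" and ?B = "?d ` {t \<in> tchildren D u. bold G D t}"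
  let ?Z = "Inr ` outer_components u :: ('v + 's set) set"
  have inj: "inj_on ?d (tchildren D u)"
    using inj_on_descendants children_node by (fastforce simp: inj_on_def)
  have "card ?K + card ?B \<le> card (mverts (three_center G D u)) + 2"
  proof (rule thin_bold_center[OF finite_torso[OF u] loop_free_torso[OF u], where z = "Inr (tnodes D - descendants D u)" and A = ?A and Z = ?Z])
    show "mverts (torso G D u) = ?K \<union> ?A \<union> ?B \<union> ?Z"
      unfolding torso_def node_components_eq[OF u] by auto
    show "?Z \<subseteq> {Inr (tnodes D - descendants D u)}" by (auto simp: outer_components_def)
    show "?A \<inter> ?B = {}" using inj by (auto dest: inj_onD)
    show "?Z \<inter> (?K \<union> ?A \<union> ?B) = {}"
      using descendants_ne_outer[OF u] by (auto simp: outer_components_def split: if_splits)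
    show "is_center ?K (torso G D u) (three_center G D u)" by (rule three_center_is_center[OF u])
    show "degree (torso G D u) a \<le> 2" if "a \<in> ?A" for a using that degree_torso by auto
    show "degree (torso G D u) b \<ge> 3" if "b \<in> ?B" for b using that degree_torso by auto
    \<comment> \<open>Niceness enters here: an edge that leaves a thin child cannot end below a
      sibling.\<close>
    show "\<exists>x\<in>?K \<union> ?Z. e = {a, x}" if asm: "a \<in> ?A" "e \<in># incident (torso G D u) a" for a e
    proof -
      obtain c where c: "c \<in> tchildren D u" "thin G D c" "a = ?d c" using asm(1) by blast
      have a: "a \<in> e" "e \<in># medges (torso G D u)" using asm(2) by (auto simp: mem_incident)
      obtain e' where e': "e' \<in> gedges G" "e = torso_map D u ` e'" "card e = 2"
        using a(2) by (auto simp: torso_def finite_gedges)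
      obtain x where x: "x \<in> e'" "torso_map D u x = a" using a(1) e'(2) by auto
      obtain y where y: "e' = {x, y}" "x \<noteq> y" "x \<in> gverts G" "y \<in> gverts G"
        using x(1) e'(1) edgeE by (metis doubleton_eq_iff insertE singletonD)
      have ne: "torso_map D u x \<noteq> torso_map D u y" using e' y by (auto simp: card_insert_if)
      have xc: "x \<in> below D c" using torso_map_eq_child[OF c(1) y(3)] x c by simp
      have yc: "y \<notin> below D c" using torso_map_below[OF c(1)] ne x c by auto
      have e: "e = {a, torso_map D u y}" using e' y x by simp
      show ?thesis using u y(4)
      proof (cases rule: torso_cases)
        case bag
        then show ?thesis using e by auto
      next
        case (child c')
        then have "c' \<noteq> c" using yc by blast
        then have sib: "c' \<in> tsiblings D c" using c child children_node by (auto simp: tsiblings_def)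
        have "y \<in> gneighbours G (below D c)" using y e'(1) xc yc by (auto simp: gneighbours_def)
        then show ?thesis using nice c sib child children_node unfolding nice_def by blast
      next
        case outside
        then show ?thesis using e by (auto simp: outer_components_def)
      qed
    qed
    fix b b' assume "b \<in> ?B" "b' \<in> ?B" "b \<noteq> b'" and bb: "{b, b'} \<in># medges (torso G D u)"
      "degree (torso G D u) b \<le> 4" "degree (torso G D u) b' \<le> 4"
    then obtain c c' where c: "c \<in> tchildren D u" "c' \<in> tchildren D u" "c \<noteq> c'" "b = ?d c" "b' = ?d c'"
      "bold G D c" "bold G D c'" by blast
    have cnt: "count (medges (torso G D u)) {b, b'} = between c c'" using count_torso c by simp
    then have "between c c' \<noteq> 0" using bb(1) by (metis count_eq_zero_iff)
    moreover have "adhesion G D c \<in> {3, 4}" "adhesion G D c' \<in> {3, 4}"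
      using bb(2,3) c(6,7) unfolding c(4,5) degree_torso[OF c(1)] degree_torso[OF c(2)] by auto
    ultimately show "degree (torso G D u) b + degree (torso G D u) b'
       \<notin> {3 + 2 * count (medges (torso G D u)) {b, b'}, 4 + 2 * count (medges (torso G D u)) {b, b'}}"
      using nomerge[OF c(1,2,3)] unfolding cnt unfolding c(4,5) degree_torso[OF c(1)] degree_torso[OF c(2)]
      by simp
  qed auto
  moreover have "card ?B = card {t \<in> tchildren D u. bold G D t}"
    using inj by (intro card_image) (auto simp: inj_on_def)
  moreover have "card ?K = card (tbag D u)" by (simp add: card_image)
  ultimately show ?thesis by simp
qed

end

section \<open>Merging two siblings\<close>

definition merge_siblings :: "('v, 's) tcdecomp \<Rightarrow> 's \<Rightarrow> 's \<Rightarrow> 's \<Rightarrow> ('v, 's) tcdecomp" where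
  "merge_siblings D c c' p =
     D\<lparr> tnodes := insert p (tnodes D),
       tparent := (tparent D)(c := p, c' := p, p := tparent D c),
       tbag := (tbag D)(p := {}) \<rparr>"

text \<open>Isolates what the comparison of two torsos at the same node requires: up to loops, the
  new one arises from the old one by the map \<open>\<phi>\<close> on components, and components
  identified by \<open>\<phi>\<close> are adjacent. No property of the merge itself enters.\<close>

lemma (in tc_decomp) three_center_card_le:
  assumes D1: "tc_decomp G D1" and u: "u \<in> tnodes D" "u \<in> tnodes D1" and bag: "tbag D1 u = tbag D u"
    and comps: "node_components D1 u = \<phi> ` node_components D u"
    and map1: "\<And>v. v \<in> gverts G \<Longrightarrow> torso_map D1 u v = map_sum id \<phi> (torso_map D u v)"
    and col: "\<And>C C'. C \<in> node_components D u \<Longrightarrow> C' \<in> node_components D u \<Longrightarrow> C \<noteq> C' \<Longrightarrow> \<phi> C = \<phi> C' \<Longrightarrow>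
      {Inr C, Inr C'} \<in># medges (torso G D u)"
  shows "card (mverts (three_center G D1 u)) \<le> card (mverts (three_center G D u))"
proof -
  interpret D1: tc_decomp G D1 by (rule D1)
  let ?f = "map_sum id \<phi> :: 'v + 's set \<Rightarrow> 'v + 's set" and ?K = "Inl ` tbag D u :: ('v + 's set) set" and ?H = "torso G D u"
  have fK: "?f ` ?K = Inl ` tbag D1 u" using bag by (auto simp: image_image)
  have lf: "loop_free ?H" by (rule loop_free_torso[OF u(1)])
  have con: "contracts ?K ?f ?H"
    unfolding contracts_def wf_mgraph_def
  proof (intro conjI ballI impI)
    fix x y assume "x \<in> mverts ?H" "y \<in> mverts ?H" "x \<noteq> y" "?f x = ?f y"
    then obtain C C' where "x = Inr C" "y = Inr C'" "C \<in> node_components D u" "C' \<in> node_components D u" "\<phi> C = \<phi> C'" "C \<noteq> C'"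
      by (cases x; cases y) (auto simp: torso_def)
    then show "x \<notin> ?K" "y \<notin> ?K" "{x, y} \<in># medges ?H" using col by auto
  qed (use lf in \<open>auto simp: loop_free_def torso_def\<close>)
  have c2: "card (?f ` X) = 2 \<Longrightarrow> card X \<le> 2 \<Longrightarrow> finite X \<Longrightarrow> card X = 2" for X
    using card_image_le[of X ?f] by simp
  have img: "torso_map D1 u ` e = ?f ` (torso_map D u ` e)" if "e \<in> gedges G" for e
    unfolding image_image by (rule image_cong) (use map1 edge_subset[OF that] in auto)
  have edges: "{#e \<in># image_mset ((`) ?f) (medges ?H). card e = 2#} = medges (torso G D1 u)"
  proof -
    \<comment> \<open>An edge that is no loop after the contraction was none before it, so
      discarding loops twice is the same as discarding them once.\<close>
    have fe: "{#e \<in># mset_set (gedges G). card (torso_map D u ` e) = 2 \<and> card (?f ` (torso_map D u ` e)) = 2#} =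
        {#e \<in># mset_set (gedges G). card (torso_map D1 u ` e) = 2#}"
    proof (rule filter_mset_cong[OF refl])
      fix e assume "e \<in># mset_set (gedges G)"
      then have e: "e \<in> gedges G" using finite_gedges by simp
      have "finite e" using edge_subset[OF e] finite_gverts finite_subset by blast
      then have "card (torso_map D u ` e) \<le> 2" "finite (torso_map D u ` e)"
        using edge_card[OF e] card_image_le[of e "torso_map D u"] by simp_all
      then show "(card (torso_map D u ` e) = 2 \<and> card (?f ` (torso_map D u ` e)) = 2) = (card (torso_map D1 u ` e) = 2)"
        unfolding img[OF e] using c2 by blast
    qed
    have "{#e \<in># image_mset ((`) ?f) (medges ?H). card e = 2#} =
        image_mset (\<lambda>e. ?f ` (torso_map D u ` e))
          {#e \<in># mset_set (gedges G). card (torso_map D u ` e) = 2 \<and> card (?f ` (torso_map D u ` e)) = 2#}"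
      by (simp add: torso_def filter_mset_image_mset filter_filter_mset multiset.map_comp comp_def)
    also have "\<dots> = image_mset (\<lambda>e. torso_map D1 u ` e) {#e \<in># mset_set (gedges G). card (torso_map D1 u ` e) = 2#}"
      unfolding fe by (rule image_mset_cong) (use img finite_gedges in auto)
    also have "\<dots> = medges (torso G D1 u)"
      by (simp add: torso_def filter_mset_image_mset)
    finally show ?thesis .
  qed
  have "\<lparr> mverts = mverts (map_mgraph ?f ?H), medges = {#e \<in># medges (map_mgraph ?f ?H). card e = 2#} \<rparr> = torso G D1 u"
  proof (rule mgraph_eqI)
    show "mverts \<lparr> mverts = mverts (map_mgraph ?f ?H), medges = {#e \<in># medges (map_mgraph ?f ?H). card e = 2#} \<rparr> = mverts (torso G D1 u)"
      using bag by (simp add: torso_def image_Un image_image comps)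
  qed (use edges in simp)
  moreover have "\<forall>e\<in>#medges (map_mgraph ?f ?H). card e = 1 \<or> card e = 2"
  proof
    fix e assume "e \<in># medges (map_mgraph ?f ?H)"
    then obtain e' where e': "e' \<in># medges ?H" "e = ?f ` e'" by auto
    then have "card e' = 2" using lf by (simp add: loop_free_def)
    then obtain x y where "e' = {x, y}" by (auto simp: card_2_iff)
    then show "card e = 1 \<or> card e = 2" using e' card_doubleton[of "?f x" "?f y"] by simp
  qed
  ultimately have "(center_step (?f ` ?K))\<^sup>*\<^sup>* (map_mgraph ?f ?H) (torso G D1 u)"
    using delete_loops[of "map_mgraph ?f ?H" "?f ` ?K"] by simp
  then show ?thesis
    using contraction_center_card[OF finite_torso[OF u(1)] con three_center_is_center[OF u(1)]]
      D1.three_center_is_center[OF u(2)] unfolding fK by blast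
qed

text \<open>Each assumption guards one property: \<open>adjacent\<close> makes the merge the
  contraction of an existing edge, \<open>bold\<close> and the lower bound 3 preserve niceness, and
  the upper bound 4 preserves the width.\<close>

locale sibling_merge = tc_decomp +
  fixes s c c' p
  assumes c: "c \<in> tchildren D s" and c': "c' \<in> tchildren D s" and ne: "c \<noteq> c'" and p: "p \<notin> tnodes D"
    and adjacent: "between c c' \<noteq> 0"
    and bold: "bold G D c" "bold G D c'"
    and merged_adhesion: "card {e \<in> gedges G. card (e \<inter> (below D c \<union> below D c')) = 1} \<in> {3, 4}"
begin

abbreviation "E \<equiv> merge_siblings D c c' p"

lemma c_node: "c \<in> tnodes D" "c \<noteq> troot D" "tparent D c = s" and c'_node: "c' \<in> tnodes D" "c' \<noteq> troot D" "tparent D c' = s"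
  and s_node: "s \<in> tnodes D"
  using children_node[OF c] children_node[OF c'] by auto

lemma p_ne: "p \<noteq> c" "p \<noteq> c'" "p \<noteq> s" "p \<noteq> troot D" "c \<noteq> s" "c' \<noteq> s"
  using p c_node c'_node s_node root_node parent_notin_descendants[OF c] parent_notin_descendants[OF c']
    self_descendant by auto

lemma merge_simps [simp]:
  "tnodes E = insert p (tnodes D)" "troot E = troot D" "tbag E = (tbag D)(p := {})"
  "tparent E = (tparent D)(c := p, c' := p, p := s)"
  using c_node by (simp_all add: merge_siblings_def)

lemma merge_rel: "(t, x) \<in> parent_rel E \<longleftrightarrow>
    (t, x) \<in> parent_rel D \<and> t \<noteq> c \<and> t \<noteq> c' \<or> (t = c \<or> t = c') \<and> x = p \<or> t = p \<and> x = s"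
  using p p_ne c_node c'_node by (auto simp: parent_rel_def)

lemma merge_step_anc: "(t, x) \<in> parent_rel D \<Longrightarrow> (t, x) \<in> (parent_rel E)\<^sup>*"
proof -
  assume t: "(t, x) \<in> parent_rel D"
  show ?thesis
  proof (cases "t = c \<or> t = c'")
    case True
    then have "x = s" using t c_node c'_node by (auto simp: parent_rel_iff)
    moreover have "(t, p) \<in> parent_rel E" "(p, s) \<in> parent_rel E" using True by (auto simp: merge_rel)
    ultimately show ?thesis by (meson converse_rtrancl_into_rtrancl r_into_rtrancl)
  next
    case False
    then show ?thesis using t merge_rel by blast
  qed
qed

lemma merge_anc_old: "(t, x) \<in> (parent_rel D)\<^sup>* \<Longrightarrow> (t, x) \<in> (parent_rel E)\<^sup>*"
  by (induction rule: rtrancl_induct) (auto dest: merge_step_anc)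

text \<open>Sending \<open>p\<close> to \<open>s\<close> turns paths of the new tree into paths of
  the old one. Together with \<open>merge_anc_old\<close> it shows that nothing changes in the
  ancestor relation between old nodes.\<close>

lemma merge_anc_proj:
  "(t, x) \<in> (parent_rel E)\<^sup>* \<Longrightarrow> (if t = p then s else t, if x = p then s else x) \<in> (parent_rel D)\<^sup>*"
proof (induction rule: rtrancl_induct)
  case (step y z)
  have "(if y = p then s else y, if z = p then s else z) \<in> (parent_rel D)\<^sup>*"
    using step(2) c_node c'_node p p_ne parent_stepI[of c] parent_stepI[of c'] parent_node[of y]
    unfolding merge_rel by (auto simp: parent_rel_iff)
  then show ?case using step.IH by (rule rtrancl_trans[rotated])
qed simp

lemma old_ne_p: "t \<in> tnodes D \<Longrightarrow> t \<noteq> p"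
  using p by blast

lemma merge_anc: "t \<in> tnodes D \<Longrightarrow> x \<in> tnodes D \<Longrightarrow> (t, x) \<in> (parent_rel E)\<^sup>* \<longleftrightarrow> (t, x) \<in> (parent_rel D)\<^sup>*"
  using merge_anc_proj[of t x] merge_anc_old old_ne_p by auto

lemma merge_anc_from_p: "x \<in> tnodes D \<Longrightarrow> (p, x) \<in> (parent_rel E)\<^sup>* \<longleftrightarrow> (s, x) \<in> (parent_rel D)\<^sup>*"
  using merge_anc_proj[of p x] merge_anc_old[of s x] merge_rel[of p s] old_ne_p[of x]
  by (auto intro: converse_rtrancl_into_rtrancl)

lemma merge_anc_to_p: "t \<in> tnodes D \<Longrightarrow> (t, p) \<in> (parent_rel E)\<^sup>* \<longleftrightarrow> (t, c) \<in> (parent_rel D)\<^sup>* \<or> (t, c') \<in> (parent_rel D)\<^sup>*"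
proof
  assume t: "t \<in> tnodes D" "(t, p) \<in> (parent_rel E)\<^sup>*"
  from t(2) old_ne_p[OF t(1)] show "(t, c) \<in> (parent_rel D)\<^sup>* \<or> (t, c') \<in> (parent_rel D)\<^sup>*"
  proof (cases rule: rtranclE)
    case (step y)
    then have "y = c \<or> y = c'" using p p_ne parent_node[of y] by (auto simp: merge_rel parent_rel_iff)
    then show ?thesis
      using step(1) merge_anc[OF t(1) c_node(1)] merge_anc[OF t(1) c'_node(1)] by auto
  qed simp
next
  assume "t \<in> tnodes D" "(t, c) \<in> (parent_rel D)\<^sup>* \<or> (t, c') \<in> (parent_rel D)\<^sup>*"
  moreover have "(c, p) \<in> parent_rel E" "(c', p) \<in> parent_rel E" by (simp_all add: merge_rel)
  ultimately show "(t, p) \<in> (parent_rel E)\<^sup>*"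
    using merge_anc_old[of t c] merge_anc_old[of t c'] by (blast intro: rtrancl_into_rtrancl)
qed

lemma merge_descendants: "x \<in> tnodes D \<Longrightarrow>
    descendants E x = descendants D x \<union> (if s \<in> descendants D x then {p} else {})"
proof (rule set_eqI)
  fix t assume x: "x \<in> tnodes D"
  show "t \<in> descendants E x \<longleftrightarrow> t \<in> descendants D x \<union> (if s \<in> descendants D x then {p} else {})"
    using p s_node merge_anc[of t x] merge_anc_from_p[of x] x
    by (cases "t = p") (auto simp: descendants_def)
qed

lemma merge_descendants_p: "descendants E p = insert p (descendants D c \<union> descendants D c')"
proof (rule set_eqI)
  fix t
  show "t \<in> descendants E p \<longleftrightarrow> t \<in> insert p (descendants D c \<union> descendants D c')"
    using merge_anc_to_p[of t] by (cases "t = p") (auto simp: descendants_def)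
qed

lemma merge_rooted: "rooted_tree E"
proof -
  have "(t, troot D) \<in> (parent_rel E)\<^sup>*" if "t \<in> tnodes E" for t
    using that to_root s_node root_node merge_anc[of t "troot D"] merge_anc_from_p[of "troot D"] by (cases "t = p") auto
  then show ?thesis using finite_nodes root_node parent_node s_node by (auto simp: rooted_tree_def)
qed

lemma merge_tcd: "tree_cut_decomposition G E"
  unfolding tree_cut_decomposition_def
proof (intro conjI merge_rooted)
  show "\<forall>x\<in>tnodes E. \<forall>t\<in>tnodes E. x \<noteq> t \<longrightarrow> tbag E x \<inter> tbag E t = {}"
    using bags_disjoint by auto
  have "(\<Union>x\<in>tnodes E. tbag E x) = (\<Union>x\<in>tnodes D. tbag D x)" using p by auto
  then show "(\<Union>x\<in>tnodes E. tbag E x) = gverts G" using bags_cover by simp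
qed

sublocale E: tc_decomp G E
  by unfold_locales (use simple merge_tcd in auto)

lemma merge_bag: "t \<in> descendants D x \<Longrightarrow> tbag E t = tbag D t"
  using p by (auto simp: mem_descendants)

lemma merge_below: "x \<in> tnodes D \<Longrightarrow> below E x = below D x"
proof -
  assume x: "x \<in> tnodes D"
  have "below E x = (\<Union>t\<in>descendants D x. tbag E t)"
    unfolding below_descendants merge_descendants[OF x] by simp
  also have "\<dots> = below D x" unfolding below_descendants using merge_bag by (intro SUP_cong) auto
  finally show ?thesis .
qed

lemma merge_below_p: "below E p = below D c \<union> below D c'"
proof -
  have "below E p = (\<Union>t\<in>descendants D c. tbag E t) \<union> (\<Union>t\<in>descendants D c'. tbag E t)"
    unfolding below_descendants merge_descendants_p by auto
  moreover have "(\<Union>t\<in>descendants D x. tbag E t) = below D x" for x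
    unfolding below_descendants using merge_bag by (intro SUP_cong) auto
  ultimately show ?thesis by simp
qed

lemma merge_adhesion: "x \<in> tnodes D \<Longrightarrow> adhesion G E x = adhesion G D x"
  by (simp add: adhesion_def merge_below)

lemma merge_adhesion_p: "adhesion G E p \<in> {3, 4}"
  using merged_adhesion by (simp add: adhesion_def merge_below_p)

lemma merge_children: "x \<in> tnodes D \<Longrightarrow> x \<noteq> s \<Longrightarrow> tchildren E x = tchildren D x"
  using p p_ne c_node c'_node by (auto simp: tchildren_def)

lemma merge_children_s: "tchildren E s = insert p (tchildren D s - {c, c'})"
  using p p_ne c_node c'_node by (auto simp: tchildren_def)

lemma merge_children_p: "tchildren E p = {c, c'}"
  using p p_ne c_node c'_node parent_node by (auto simp: tchildren_def)

text \<open>A thin node differs from \<open>p\<close>, \<open>c\<close> and \<open>c'\<close>, and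
  the siblings of such a node cover no more vertices than they did before the merge.\<close>

lemma merge_nice:
  assumes nice: "nice G D"
  shows "nice G E"
  unfolding nice_def
proof (intro ballI impI)
  fix t assume t: "t \<in> tnodes E" "thin G E t"
  have tp: "t \<noteq> p" using t(2) merge_adhesion_p by auto
  then have tD: "t \<in> tnodes D" "thin G D t" using t merge_adhesion by auto
  then have tc: "t \<noteq> c" "t \<noteq> c'" using bold by auto
  have "(\<Union>t'\<in>tsiblings E t. below E t') \<subseteq> (\<Union>t'\<in>tsiblings D t. below D t')"
  proof (cases "t = troot D \<or> tparent D t \<noteq> s")
    case True
    show ?thesis
    proof (cases "t = troot D")
      case False
      then have "tchildren E (tparent D t) = tchildren D (tparent D t)"
        using True tD parent_node merge_children by blast
      then show ?thesis using False tp tc merge_below children_node by (fastforce simp: tsiblings_def)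
    qed (simp add: tsiblings_def)
  next
    case False
    then have "tsiblings E t = insert p (tchildren D s - {c, c'}) - {t}"
      using tp tc merge_children_s by (simp add: tsiblings_def)
    moreover have "tsiblings D t = tchildren D s - {t}" using False by (simp add: tsiblings_def)
    moreover have "below E p \<subseteq> (\<Union>t'\<in>tchildren D s - {t}. below D t')"
      using merge_below_p c c' tc by blast
    moreover have "below E x = below D x" if "x \<in> tchildren D s" for x
      using merge_below children_node that by blast
    ultimately show ?thesis by fastforce
  qed
  then show "gneighbours G (below E t) \<inter> (\<Union>t'\<in>tsiblings E t. below E t') = {}"
    using nice tD merge_below unfolding nice_def by fastforce
qed

lemma merge_torso_map:
  assumes u: "u \<in> tnodes D"
    and \<phi>: "\<And>x. x \<in> tchildren D u \<Longrightarrow> u \<noteq> s \<Longrightarrow> \<phi> (descendants D x) = descendants E x"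
      "\<And>x. x \<in> tchildren D s \<Longrightarrow> u = s \<Longrightarrow> \<phi> (descendants D x) = (if x = c \<or> x = c' then descendants E p else descendants E x)"
      "u \<noteq> troot D \<Longrightarrow> \<phi> (tnodes D - descendants D u) = tnodes E - descendants E u"
    and v: "v \<in> gverts G"
  shows "torso_map E u v = map_sum id \<phi> (torso_map D u v)"
  using u v
proof (cases rule: torso_cases)
  case bag
  then have "v \<in> tbag E u" using u p by auto
  then show ?thesis using bag E.torso_map_bag by simp
next
  case (child x)
  show ?thesis
  proof (cases "u = s")
    case True
    define y where "y = (if x = c \<or> x = c' then p else x)"
    have "y \<in> tchildren E u" using child True merge_children_s by (auto simp: y_def)
    moreover have "v \<in> below E y" using child merge_below_p merge_below children_node by (auto simp: y_def)
    ultimately show ?thesis using \<phi>(2)[of x] child True E.torso_map_below[of y u v] by (auto simp: y_def)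
  next
    case False
    then have "x \<in> tchildren E u" using child merge_children[OF u] by simp
    moreover have "v \<in> below E x" using child merge_below children_node by blast
    ultimately show ?thesis using \<phi>(1)[of x] child False E.torso_map_below[of x u v] by simp
  qed
next
  case outside
  then have "v \<notin> below E u" using merge_below[OF u] by simp
  then show ?thesis using E.torso_map_outside[of u v] outside \<phi>(3) u v by simp
qed

text \<open>For \<open>u\<close> other than \<open>s\<close> the map \<open>\<phi>\<close> is a mere
  renaming: \<open>p\<close> joins the component that contains \<open>s\<close>. For
  \<open>u = s\<close> it identifies the components of \<open>c\<close> and \<open>c'\<close>, which
  are adjacent in the torso.\<close>

lemma merge_center:
  assumes u: "u \<in> tnodes D"
  shows "card (mverts (three_center G E u)) \<le> card (mverts (three_center G D u))"
proof -
  define \<phi> where "\<phi> = (\<lambda>C. if u = s \<and> (C = descendants D c \<or> C = descendants D c') then descendants E p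
    else if s \<in> C then insert p C else C)"
  have desc_eq: "descendants D x = descendants D y \<longleftrightarrow> x = y" if "x \<in> tnodes D" "y \<in> tnodes D" for x y
    using inj_on_descendants that by (auto dest: inj_onD)
  have phi1: "\<phi> (descendants D x) = descendants E x" if "x \<in> tchildren D u" "u \<noteq> s" for x
    using merge_descendants[of x] children_node[OF that(1)] that(2) by (auto simp: \<phi>_def)
  have phi2: "\<phi> (descendants D x) = (if x = c \<or> x = c' then descendants E p else descendants E x)"
    if "x \<in> tchildren D s" "u = s" for x
    using merge_descendants[of x] children_node[OF that(1)] that(2) desc_eq[of x c] desc_eq[of x c'] c_node c'_node
      by (auto simp: \<phi>_def)
  have phi3: "\<phi> (tnodes D - descendants D u) = tnodes E - descendants E u" if "u \<noteq> troot D"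
  proof (cases "u = s")
    case True
    then show ?thesis
      using descendants_ne_outer[OF s_node c] descendants_ne_outer[OF s_node c'] merge_descendants[OF s_node]
        self_descendant[OF s_node] p by (auto simp: \<phi>_def mem_descendants)
  next
    case False
    then show ?thesis using merge_descendants[OF u] s_node p by (auto simp: \<phi>_def mem_descendants)
  qed
  have comps: "node_components E u = \<phi> ` node_components D u"
  proof -
    have "\<phi> ` outer_components u = E.outer_components u"
      using phi3 unfolding outer_components_def E.outer_components_def by simp
    moreover have "\<phi> ` descendants D ` tchildren D u = descendants E ` tchildren E u"
    proof (cases "u = s")
      case True
      have "\<phi> ` descendants D ` tchildren D s =
          (\<lambda>x. if x = c \<or> x = c' then descendants E p else descendants E x) ` tchildren D s"
        using phi2 True by (force simp: image_image intro: image_cong)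
      also have "\<dots> = descendants E ` tchildren E s"
        unfolding merge_children_s using c by auto
      finally show ?thesis using True by simp
    next
      case False
      then show ?thesis using phi1 merge_children[OF u] by (auto simp: image_image)
    qed
    ultimately show ?thesis
      using u unfolding node_components_eq[OF u] E.node_components_eq[of u, simplified] image_Un
      by (subst E.node_components_eq) auto
  qed
  show ?thesis
  proof (rule three_center_card_le[OF _ u _ _ comps])
    show "tc_decomp G E" ..
    show "torso_map E u v = map_sum id \<phi> (torso_map D u v)" if "v \<in> gverts G" for v
      using merge_torso_map[OF u phi1 phi2 phi3 that] by blast
    fix C C' assume C: "C \<in> node_components D u" "C' \<in> node_components D u" "C \<noteq> C'" "\<phi> C = \<phi> C'"
    have nodes: "B \<subseteq> tnodes D" if "B \<in> node_components D u" for B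
      using that unfolding node_components_eq[OF u] by (auto simp: outer_components_def mem_descendants split: if_splits)
    \<comment> \<open>Removing \<open>p\<close> inverts \<open>\<phi>\<close> on all components
      except the two that are merged, so a collision can only involve those.\<close>
    have old: "\<phi> B - {p} = B" if "B \<in> node_components D u" "\<not> (u = s \<and> (B = descendants D c \<or> B = descendants D c'))" for B
      using that nodes[OF that(1)] p by (auto simp: \<phi>_def)
    have cb: "descendants D c \<in> node_components D s" "descendants D c' \<in> node_components D s"
      unfolding node_components_eq[OF s_node] using c c' by auto
    have nonemp: "B \<noteq> {}" if "B \<in> node_components D u" for B
      using that by (auto simp: node_components_def Let_def)
    have new: "\<phi> B - {p} = descendants D c \<union> descendants D c'"
      if "u = s" "B = descendants D c \<or> B = descendants D c'" for B
      using that merge_descendants_p p by (auto simp: \<phi>_def mem_descendants)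
    have other: False if "u = s" "B = descendants D c \<or> B = descendants D c'" "B' \<in> node_components D u"
      "\<not> (B' = descendants D c \<or> B' = descendants D c')" "\<phi> B = \<phi> B'" for B B'
    proof -
      have "B' = descendants D c \<union> descendants D c'" using new[OF that(1,2)] old[OF that(3)] that(4,5) by simp
      moreover have "c \<in> descendants D c" using self_descendant c_node by blast
      ultimately show False using components_disjoint[OF u that(3), of "descendants D c" c] cb that(1,4) by blast
    qed
    consider "u = s" "{C, C'} = {descendants D c, descendants D c'}" | "\<phi> C - {p} = C" "\<phi> C' - {p} = C'"
      using C old[OF C(1)] old[OF C(2)] other[of C C'] other[of C' C] by (metis insert_commute)
    then show "{Inr C, Inr C'} \<in># medges (torso G D u)"
    proof cases
      case 1
      have "count (medges (torso G D s)) {Inr (descendants D c), Inr (descendants D c')} \<noteq> 0"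
        using count_torso[OF c c' ne] adjacent by simp
      then show ?thesis using 1 by (auto simp: doubleton_eq_iff insert_commute)
    next
      case 2
      then show ?thesis using C(3,4) by metis
    qed
  qed (use u p in auto)
qed

lemma merge_center_p: "card (mverts (three_center G E p)) \<le> 3"
proof -
  have p: "p \<in> tnodes E" by simp
  have "mverts (three_center G E p) \<subseteq> mverts (torso G E p)"
    by (rule center_steps_mverts) (use E.three_center_is_center[OF p] in \<open>unfold is_center_def, blast\<close>)
  also have "\<dots> = Inr ` (descendants E ` {c, c'} \<union> E.outer_components p)"
    unfolding torso_def E.node_components_eq[OF p] merge_children_p by simp
  also have "\<dots> \<subseteq> Inr ` {descendants E c, descendants E c', tnodes E - descendants E p}"
    by (auto simp: E.outer_components_def)
  finally have "card (mverts (three_center G E p)) \<le> card (Inr ` {descendants E c, descendants E c', tnodes E - descendants E p} :: ('a + 'b set) set)"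
    by (intro card_mono) auto
  also have "\<dots> \<le> card {descendants E c, descendants E c', tnodes E - descendants E p}"
    by (rule card_image_le) simp
  also have "\<dots> \<le> 3" by (simp add: card_insert_if)
  finally show ?thesis .
qed

lemma merge_width: "tcwidth G E \<le> max 4 (tcwidth G D)"
proof -
  have "max (adhesion G E x) (card (mverts (three_center G E x))) \<le> max 4 (tcwidth G D)"
    if x: "x \<in> tnodes E" for x
  proof (cases "x = p")
    case True
    then show ?thesis using merge_adhesion_p merge_center_p by auto
  next
    case False
    then have xD: "x \<in> tnodes D" using x by simp
    have "max (adhesion G D x) (card (mverts (three_center G D x))) \<le> tcwidth G D"
      unfolding tcwidth_def using xD finite_nodes by (intro Max_ge) auto
    then show ?thesis using merge_adhesion[OF xD] merge_center[OF xD] by auto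
  qed
  then show ?thesis unfolding tcwidth_def[of G E] using E.finite_nodes by (subst Max_le_iff) auto
qed

end

section \<open>Reasoning about programs\<close>

text \<open>Execution without the word bound; the bound is recovered at the end, since a stored
  value exceeds the previous maximum by at most a constant.\<close>

inductive uexec :: "rcom \<Rightarrow> rstate \<Rightarrow> nat \<Rightarrow> rstate \<Rightarrow> bool" where
  "uexec Skip s 1 s"
| "uexec (Assign x e) s (1 + rcost e) (s\<lparr> sreg := (sreg s)(x := rval s e) \<rparr>)"
| "uexec (Store a i e) s (1 + rcost i + rcost e)
     (s\<lparr> sarr := (sarr s)(a := (sarr s a)(rval s i := rval s e)) \<rparr>)"
| "uexec c s k s' \<Longrightarrow> uexec d s' l s'' \<Longrightarrow> uexec (Seq c d) s (k + l) s''"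
| "rval s e \<noteq> 0 \<Longrightarrow> uexec c s k s' \<Longrightarrow> uexec (Cond e c d) s (1 + rcost e + k) s'"
| "rval s e = 0 \<Longrightarrow> uexec d s k s' \<Longrightarrow> uexec (Cond e c d) s (1 + rcost e + k) s'"
| "rval s e \<noteq> 0 \<Longrightarrow> uexec c s k s' \<Longrightarrow> uexec (Loop e c) s' l s'' \<Longrightarrow>
     uexec (Loop e c) s (1 + rcost e + k + l) s''"
| "rval s e = 0 \<Longrightarrow> uexec (Loop e c) s (1 + rcost e) s"

inductive_simps uexec_Skip_iff: "uexec Skip s k t"
inductive_simps uexec_Assign_iff: "uexec (Assign x e) s k t"
inductive_simps uexec_Store_iff: "uexec (Store a i e) s k t"
inductive_simps uexec_Seq_iff: "uexec (Seq c d) s k t"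
inductive_simps uexec_Cond_iff: "uexec (Cond e c d) s k t"

definition bounded_state :: "rstate \<Rightarrow> nat \<Rightarrow> bool" where
  "bounded_state s M \<longleftrightarrow> (\<forall>x. sreg s x \<le> M) \<and> (\<forall>a i. sarr s a i \<le> M)"

text \<open>A factor for bounding intermediate values and addresses: if all stored values are at
  most \<open>M\<close>, then \<open>e\<close> has a value of at most
  \<open>weight e * (M + 1)\<close>. The added 1 takes care of constants and truth values.\<close>

fun weight :: "rexp \<Rightarrow> nat" where
  "weight (Const n) = n"
| "weight (Reg x) = 1"
| "weight (Load a e) = 1 + weight e"
| "weight (Add e f) = weight e + weight f"
| "weight (Sub e f) = weight e + weight f"
| "weight (Less e f) = 1 + weight e + weight f"
| "weight (Equal e f) = 1 + weight e + weight f"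

text \<open>How far a value can exceed the largest stored one. Sums of two variable values get
  \<open>None\<close>: they are fine in addresses and tests, but storing them could double the
  maximum in every step.\<close>

fun growth :: "rexp \<Rightarrow> nat option" where
  "growth (Const n) = Some n"
| "growth (Reg x) = Some 0"
| "growth (Load a e) = Some 0"
| "growth (Add e (Const n)) = map_option (\<lambda>m. m + n) (growth e)"
| "growth (Add e f) = None"
| "growth (Sub e f) = growth e"
| "growth (Less e f) = Some 1"
| "growth (Equal e f) = Some 1"

fun limits :: "nat \<Rightarrow> nat \<Rightarrow> rcom \<Rightarrow> bool" where
  "limits A B Skip = True"
| "limits A B (Assign x e) \<longleftrightarrow> weight e \<le> A \<and> (\<exists>m\<le>B. growth e = Some m)"
| "limits A B (Store a i e) \<longleftrightarrow> weight i \<le> A \<and> weight e \<le> A \<and> (\<exists>m\<le>B. growth e = Some m)"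
| "limits A B (Seq c d) \<longleftrightarrow> limits A B c \<and> limits A B d"
| "limits A B (Cond e c d) \<longleftrightarrow> weight e \<le> A \<and> limits A B c \<and> limits A B d"
| "limits A B (Loop e c) \<longleftrightarrow> weight e \<le> A \<and> limits A B c"

lemma rval_weight:
  assumes "bounded_state s M"
  shows "rval s e \<le> weight e * (M + 1)"
proof (induction e)
  case (Load a e)
  have "sarr s a (rval s e) \<le> M" using assms by (simp add: bounded_state_def)
  also have "\<dots> \<le> weight (Load a e) * (M + 1)" by simp
  finally show ?case by simp
next
  case (Add e f)
  then show ?case by (simp add: add_mult_distrib)
next
  case (Sub e f)
  then show ?case by (simp add: add_mult_distrib trans_le_add1 le_diff_conv)
qed (use assms in \<open>auto simp: bounded_state_def of_bool_def le_SucI\<close>)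

lemma subexp_weight: "f \<in> subexps e \<Longrightarrow> weight f \<le> weight e"
  by (induction e) auto

lemma fits_weight:
  assumes "bounded_state s M" "weight e \<le> A" "A * (M + 1) < W"
  shows "fits W s e"
  unfolding fits_def
proof
  fix f assume "f \<in> subexps e"
  then have "weight f * (M + 1) \<le> A * (M + 1)"
    using subexp_weight assms(2) le_trans mult_le_mono1 by blast
  then show "rval s f < W" using rval_weight[OF assms(1), of f] assms(3) by simp
qed

lemma rval_growth:
  assumes "bounded_state s M" "growth e = Some m"
  shows "rval s e \<le> M + m"
  using assms(2)
proof (induction e arbitrary: m rule: growth.induct)
  case (3 a e)
  then show ?case using assms(1) by (simp add: bounded_state_def trans_le_add1)
next
  case (4 e n)
  then show ?case by fastforce
next
  case (6 e f)
  then show ?case by (auto intro: le_trans[OF diff_le_self])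
qed (use assms(1) in \<open>auto simp: bounded_state_def trans_le_add1\<close>)

lemma bounded_stateI_reg:
  "bounded_state s M \<Longrightarrow> v \<le> M + B \<Longrightarrow> bounded_state (s\<lparr> sreg := (sreg s)(x := v) \<rparr>) (M + B)"
  and bounded_stateI_arr:
  "bounded_state s M \<Longrightarrow> v \<le> M + B \<Longrightarrow> bounded_state (s\<lparr> sarr := (sarr s)(a := (sarr s a)(i := v)) \<rparr>) (M + B)"
  by (auto simp: bounded_state_def trans_le_add1)

lemma bounded_state_mono: "bounded_state s M \<Longrightarrow> M \<le> M' \<Longrightarrow> bounded_state s M'"
  unfolding bounded_state_def using le_trans by blast

text \<open>Every assignment or store costs time and raises the maximum by at most \<open>B\<close>.
  So \<open>M + B * k\<close> bounds all values stored within \<open>k\<close> time units, and the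
  factor \<open>A\<close> extends the bound to every subexpression.\<close>

lemma uexec_rexec:
  assumes "uexec c s k s'" "limits A B c" "bounded_state s M" "A * (M + B * k + 1) < W"
  shows "rexec W c s k s' \<and> bounded_state s' (M + B * k)"
proof -
  have tight: "A * (M + 1) < W" if "A * (M + B * k + 1) < W" for M k
    using that by (rule le_less_trans[rotated]) (simp add: add_mult_distrib2)
  have step: "M + m \<le> M + B * (1 + k)" if "m \<le> B" for m k M
    using that by (simp add: trans_le_add1)
  show ?thesis
    using assms
  proof (induction arbitrary: M rule: uexec.induct)
    case (1 s)
    then show ?case by (simp add: rexec.Skip del: One_nat_def) (rule bounded_state_mono, auto)
  next
    case (2 x e s)
    then obtain m where m: "m \<le> B" "growth e = Some m" "weight e \<le> A" by auto
    have "rval s e \<le> M + B * (1 + rcost e)"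
      using rval_growth[OF 2(2) m(2)] step[OF m(1)] le_trans by blast
    then show ?case
      using rexec.Assign[OF fits_weight[OF 2(2) m(3) tight[OF 2(3)]]] bounded_stateI_reg[OF 2(2)] by blast
  next
    case (3 a i e s)
    then obtain m where m: "m \<le> B" "growth e = Some m" "weight e \<le> A" "weight i \<le> A" by auto
    have "rval s e \<le> M + B * (1 + rcost i + rcost e)"
      using rval_growth[OF 3(2) m(2)] step[OF m(1), of M "rcost i + rcost e"] by simp
    then show ?case
      using rexec.Store[OF fits_weight[OF 3(2) m(4) tight[OF 3(3)]] fits_weight[OF 3(2) m(3) tight[OF 3(3)]]]
        bounded_stateI_arr[OF 3(2)] by blast
  next
    case (4 c s k s' d l s'')
    have "A * (M + B * k + 1) \<le> A * (M + B * (k + l) + 1)" by simp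
    then have "A * (M + B * k + 1) < W" using 4(7) by linarith
    then have 1: "rexec W c s k s'" "bounded_state s' (M + B * k)" using 4(3)[of M] 4(5,6) by auto
    have "A * (M + B * k + B * l + 1) < W" using 4(7) by (simp add: algebra_simps)
    then have "rexec W d s' l s''" "bounded_state s'' (M + B * k + B * l)"
      using 4(4)[OF _ 1(2)] 4(5) by auto
    then show ?case using 1 by (auto intro: rexec.Seq simp: algebra_simps)
  next
    case (5 s e c k s' d)
    have "A * (M + B * k + 1) \<le> A * (M + B * (1 + rcost e + k) + 1)"
      by (intro mult_le_mono2 add_le_mono order_refl) simp_all
    then have "A * (M + B * k + 1) < W" using 5(6) by linarith
    then have "rexec W c s k s'" "bounded_state s' (M + B * k)" using 5(3)[of M] 5(4,5) by auto
    moreover have "M + B * k \<le> M + B * (1 + rcost e + k)"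
      by (intro mult_le_mono2 add_le_mono order_refl) simp_all
    ultimately show ?case
      using rexec.Cond_True[OF fits_weight[OF 5(5) _ tight[OF 5(6)]] 5(1)] 5(4) bounded_state_mono
      by (metis limits.simps(5))
  next
    case (6 s e d k s' c)
    have "A * (M + B * k + 1) \<le> A * (M + B * (1 + rcost e + k) + 1)"
      by (intro mult_le_mono2 add_le_mono order_refl) simp_all
    then have "A * (M + B * k + 1) < W" using 6(6) by linarith
    then have "rexec W d s k s'" "bounded_state s' (M + B * k)" using 6(3)[of M] 6(4,5) by auto
    moreover have "M + B * k \<le> M + B * (1 + rcost e + k)"
      by (intro mult_le_mono2 add_le_mono order_refl) simp_all
    ultimately show ?case
      using rexec.Cond_False[OF fits_weight[OF 6(5) _ tight[OF 6(6)]] 6(1)] 6(4) bounded_state_mono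
      by (metis limits.simps(5))
  next
    case (7 s e c k s' l s'')
    have "A * (M + B * k + 1) \<le> A * (M + B * (1 + rcost e + k + l) + 1)"
      by (intro mult_le_mono2 add_le_mono order_refl) simp_all
    then have "A * (M + B * k + 1) < W" using 7(8) by linarith
    then have 1: "rexec W c s k s'" "bounded_state s' (M + B * k)" using 7(4)[of M] 7(6,7) by auto
    have "A * (M + B * k + B * l + 1) \<le> A * (M + B * (1 + rcost e + k + l) + 1)"
      by (simp add: algebra_simps)
    then have "A * (M + B * k + B * l + 1) < W" using 7(8) by linarith
    then have "rexec W (Loop e c) s' l s''" "bounded_state s'' (M + B * k + B * l)"
      using 7(5)[OF _ 1(2)] 7(6) by auto
    moreover have "M + B * k + B * l \<le> M + B * (1 + rcost e + k + l)" by (simp add: algebra_simps)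
    ultimately show ?case
      using rexec.Loop_True[OF fits_weight[OF 7(7) _ tight[OF 7(8)]] 7(1) 1(1)] 7(6) bounded_state_mono
      by (metis limits.simps(6))
  next
    case (8 s e c)
    then show ?case
      using rexec.Loop_False[OF fits_weight[OF 8(3) _ tight[OF 8(4)]] 8(1)] 8(2) bounded_state_mono[OF 8(3) le_add1]
      by (metis limits.simps(6))
  qed
qed

section \<open>Weakest preconditions with running time\<close>

definition wp :: "rcom \<Rightarrow> (nat \<Rightarrow> rstate \<Rightarrow> bool) \<Rightarrow> rstate \<Rightarrow> bool" where
  "wp c Q s \<longleftrightarrow> (\<exists>k s'. uexec c s k s' \<and> Q k s')"

lemma wp_Skip: "wp Skip Q s \<longleftrightarrow> Q 1 s"
  unfolding wp_def uexec_Skip_iff by simp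

lemma wp_Assign: "wp (Assign x e) Q s \<longleftrightarrow> Q (1 + rcost e) (s\<lparr> sreg := (sreg s)(x := rval s e) \<rparr>)"
  unfolding wp_def uexec_Assign_iff by simp

lemma wp_Store: "wp (Store a i e) Q s \<longleftrightarrow>
    Q (1 + rcost i + rcost e) (s\<lparr> sarr := (sarr s)(a := (sarr s a)(rval s i := rval s e)) \<rparr>)"
  unfolding wp_def uexec_Store_iff by simp

lemma wp_Seq: "wp (Seq c d) Q s \<longleftrightarrow> wp c (\<lambda>k t. wp d (\<lambda>l u. Q (k + l) u) t) s"
  unfolding wp_def uexec_Seq_iff by blast

lemma wp_Cond: "wp (Cond e c d) Q s \<longleftrightarrow>
    (if rval s e \<noteq> 0 then wp c (\<lambda>k t. Q (1 + rcost e + k) t) s else wp d (\<lambda>k t. Q (1 + rcost e + k) t) s)"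
  unfolding wp_def uexec_Cond_iff by auto

lemmas wp_simps = wp_Skip wp_Assign wp_Store wp_Seq wp_Cond

lemma wp_mono: "wp c Q s \<Longrightarrow> (\<And>k t. Q k t \<Longrightarrow> Q' k t) \<Longrightarrow> wp c Q' s"
  unfolding wp_def by blast

fun wregs :: "rcom \<Rightarrow> ident set" where
  "wregs Skip = {}"
| "wregs (Assign x e) = {x}"
| "wregs (Store a i e) = {}"
| "wregs (Seq c d) = wregs c \<union> wregs d"
| "wregs (Cond e c d) = wregs c \<union> wregs d"
| "wregs (Loop e c) = wregs c"

fun warrs :: "rcom \<Rightarrow> ident set" where
  "warrs Skip = {}"
| "warrs (Assign x e) = {}"
| "warrs (Store a i e) = {a}"
| "warrs (Seq c d) = warrs c \<union> warrs d"
| "warrs (Cond e c d) = warrs c \<union> warrs d"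
| "warrs (Loop e c) = warrs c"

definition agree :: "rcom \<Rightarrow> rstate \<Rightarrow> rstate \<Rightarrow> bool" where
  "agree c s t \<longleftrightarrow> (\<forall>x. x \<notin> wregs c \<longrightarrow> sreg t x = sreg s x) \<and> (\<forall>a. a \<notin> warrs c \<longrightarrow> sarr t a = sarr s a)"

lemma agree_refl: "agree c s s"
  by (simp add: agree_def)

lemma agree_trans: "agree c s t \<Longrightarrow> agree c t u \<Longrightarrow> agree c s u"
  by (simp add: agree_def)

lemma uexec_agree: "uexec c s k s' \<Longrightarrow> agree c s s'"
  by (induction rule: uexec.induct) (auto simp: agree_def)

text \<open>A frame rule: specifications need not mention registers and arrays that the program does
  not write.\<close>

lemma wp_frame:
  assumes "wp c Q s" "\<And>k t. Q k t \<Longrightarrow> agree c s t \<Longrightarrow> Q' k t"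
  shows "wp c Q' s"
  using assms uexec_agree unfolding wp_def by blast

text \<open>The potential \<open>\<phi>\<close> pays for the remaining iterations.\<close>

lemma wp_Loop:
  assumes "I s"
    and body: "\<And>t. I t \<Longrightarrow> agree c s t \<Longrightarrow> rval t e \<noteq> 0 \<Longrightarrow>
      wp c (\<lambda>k u. I u \<and> k + 1 + rcost e + \<phi> u \<le> \<phi> t) t"
    and final: "\<And>k u. I u \<Longrightarrow> agree c s u \<Longrightarrow> rval u e = 0 \<Longrightarrow> k + \<phi> u \<le> \<phi> s + 1 + rcost e \<Longrightarrow> Q k u"
  shows "wp (Loop e c) Q s"
proof -
  have "\<exists>k u. uexec (Loop e c) t k u \<and> I u \<and> agree c s u \<and> rval u e = 0 \<and> k + \<phi> u \<le> \<phi> t + 1 + rcost e"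
    if "I t" "agree c s t" for t
    using that
  proof (induction "\<phi> t" arbitrary: t rule: less_induct)
    case less
    show ?case
    proof (cases "rval t e = 0")
      case True
      then show ?thesis using less.prems uexec.intros(8)[OF True, of c]
        by (intro exI[of _ "1 + rcost e"] exI[of _ t]) simp
    next
      case False
      obtain k u where u: "uexec c t k u" "I u" "k + 1 + rcost e + \<phi> u \<le> \<phi> t"
        using body[OF less.prems False] unfolding wp_def by blast
      have "agree c s u" using uexec_agree[OF u(1)] less.prems agree_trans by blast
      then obtain l v where v: "uexec (Loop e c) u l v" "I v" "agree c s v" "rval v e = 0"
          "l + \<phi> v \<le> \<phi> u + 1 + rcost e"
        using less.hyps[of u] u(2,3) by auto
      have "uexec (Loop e c) t (1 + rcost e + k + l) v" using uexec.intros(7)[OF False u(1) v(1)] .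
      moreover have "1 + rcost e + k + l + \<phi> v \<le> \<phi> t + 1 + rcost e" using u(3) v(5) by linarith
      ultimately show ?thesis using v by blast
    qed
  qed
  then show ?thesis using assms(1) agree_refl final unfolding wp_def by blast
qed

section \<open>The program\<close>

abbreviation "for_upto i e c \<equiv> Seq (Assign i (Const 0)) (Loop (Less (Reg i) e) (Seq c (Assign i (Add (Reg i) (Const 1)))))"

text \<open>The state \<open>s0\<close> stays fixed throughout, so the abbreviations keep denoting
  the input. In particular \<open>nN\<close> is the original number of nodes even when the register
  ''nodes'' has grown.\<close>

locale program_input = tc_decomp G D for G :: "nat sgraph" and D :: "(nat, nat) tcdecomp" +
  fixes s0 :: rstate
  assumes init: "initial_state s0 G D"
begin

abbreviation "nV \<equiv> sreg s0 ''vertices''"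
abbreviation "nE \<equiv> sreg s0 ''edges''"
abbreviation "nN \<equiv> sreg s0 ''nodes''"
abbreviation "rt \<equiv> sreg s0 ''root''"
abbreviation "par \<equiv> sarr s0 ''parent''"
abbreviation "node_of \<equiv> sarr s0 ''bag''"
abbreviation "fstend \<equiv> sarr s0 ''end1''"
abbreviation "sndend \<equiv> sarr s0 ''end2''"

lemma gverts_eq: "gverts G = {..<nV}"
  and edges_bij: "bij_betw (\<lambda>i. {fstend i, sndend i}) {..<nE} (gedges G)"
  using init by (simp_all add: initial_state_def stores_graph_def)

lemma nodes_eq: "tnodes D = {..<nN}" and root_eq: "troot D = rt"
  and par_eq: "t < nN \<Longrightarrow> t \<noteq> rt \<Longrightarrow> par t = tparent D t"
  and bag_eq: "t < nN \<Longrightarrow> v \<in> tbag D t \<Longrightarrow> node_of v = t"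
proof -
  have sd: "stores_decomp s0 D" using init by (simp add: initial_state_def)
  then show 1: "tnodes D = {..<nN}" and 2: "troot D = rt" by (simp_all add: stores_decomp_def)
  show "par t = tparent D t" if "t < nN" "t \<noteq> rt"
    using sd 1 2 that unfolding stores_decomp_def by blast
  show "node_of v = t" if "t < nN" "v \<in> tbag D t"
    using sd 1 that unfolding stores_decomp_def by blast
qed

lemma zero_reg: "x \<notin> {''vertices'', ''edges'', ''nodes'', ''root''} \<Longrightarrow> sreg s0 x = 0"
  and zero_arr: "a \<notin> {''end1'', ''end2'', ''parent'', ''bag''} \<Longrightarrow> sarr s0 a = (\<lambda>_. 0)"
proof -
  have rz: "rest_zero s0" using init by (simp add: initial_state_def)
  then show "x \<notin> {''vertices'', ''edges'', ''nodes'', ''root''} \<Longrightarrow> sreg s0 x = 0"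
    by (simp add: rest_zero_def)
  assume "a \<notin> {''end1'', ''end2'', ''parent'', ''bag''}"
  then show "sarr s0 a = (\<lambda>_. 0)" 
    using conjunct2[OF rz[unfolded rest_zero_def], THEN spec[of _ a]] by (intro ext) simp
qed

lemma rt_less: "rt < nN"
  using root_node unfolding nodes_eq root_eq by simp

lemma par_less: "t < nN \<Longrightarrow> t \<noteq> rt \<Longrightarrow> par t < nN"
  using parent_node[of t] par_eq[of t] unfolding nodes_eq root_eq by simp

lemma node_of_less: "v < nV \<Longrightarrow> node_of v < nN" and mem_bag: "t < nN \<Longrightarrow> v < nV \<Longrightarrow> v \<in> tbag D t \<longleftrightarrow> node_of v = t"
proof -
  have *: "node_of v < nN \<and> v \<in> tbag D (node_of v)" if "v < nV" for v
  proof -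
    have "v \<in> (\<Union>t\<in>tnodes D. tbag D t)" using that bags_cover gverts_eq by simp
    then obtain t where "t < nN" "v \<in> tbag D t" using nodes_eq by auto
    then show ?thesis using bag_eq by blast
  qed
  then show "v < nV \<Longrightarrow> node_of v < nN" by blast
  show "t < nN \<Longrightarrow> v < nV \<Longrightarrow> v \<in> tbag D t \<longleftrightarrow> node_of v = t" using * bag_eq by blast
qed

lemma bag_set: "t < nN \<Longrightarrow> tbag D t = {v. v < nV \<and> node_of v = t}"
proof -
  assume t: "t < nN"
  then have "tbag D t \<subseteq> {..<nV}" using bag_subset[of t] nodes_eq gverts_eq by simp
  then show ?thesis using mem_bag[OF t] by blast
qed

abbreviation "anc x y \<equiv> (x, y) \<in> (parent_rel D)\<^sup>*"

lemma mem_below_anc: "v < nV \<Longrightarrow> v \<in> below D t \<longleftrightarrow> anc (node_of v) t"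
  using mem_below[of "node_of v" v t] mem_bag[of "node_of v" v] node_of_less[of v] unfolding nodes_eq by simp

lemma anc_unfold: "t < nN \<Longrightarrow> anc t a \<longleftrightarrow> a = t \<or> t \<noteq> rt \<and> anc (par t) a"
  using anc_cases[of t a] anc_parent[of t a] par_eq[of t] unfolding nodes_eq root_eq by auto

lemma children_iff: "t < nN \<Longrightarrow> c \<in> tchildren D t \<longleftrightarrow> c < nN \<and> c \<noteq> rt \<and> par c = t"
  using par_eq[of c] unfolding tchildren_def nodes_eq root_eq by auto

text \<open>Holds up to the merging phase, which is the first to alter the stored
  decomposition.\<close>

definition input_ok :: "rstate \<Rightarrow> bool" where
  "input_ok t \<longleftrightarrow> sreg t ''vertices'' = nV \<and> sreg t ''edges'' = nE \<and> sreg t ''nodes'' = nN \<and> sreg t ''root'' = rt \<and>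
     sarr t ''parent'' = par \<and> sarr t ''bag'' = node_of \<and> sarr t ''end1'' = fstend \<and> sarr t ''end2'' = sndend"

end

section \<open>Nodes with a vertex in their subtree\<close>

text \<open>After the first phase \<open>cnt\<close> is twice the size of the bag plus the number of children with
  nonempty \<^const>\<open>below\<close>; the array \<open>mk\<close> marks the nodes with nonempty \<^const>\<open>below\<close>.\<close>

definition mark_walk :: rcom where
  "mark_walk = Loop (Equal (Load ''mk'' (Reg ''x'')) (Const 0))
     (Seq (Store ''mk'' (Reg ''x'') (Const 1))
       (Cond (Equal (Reg ''x'') (Reg ''root'')) Skip
         (Seq (Assign ''x'' (Load ''parent'' (Reg ''x'')))
           (Store ''cnt'' (Reg ''x'') (Add (Load ''cnt'' (Reg ''x'')) (Const 1))))))"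

definition mark_phase :: rcom where
  "mark_phase = for_upto ''v'' (Reg ''vertices'')
     (Seq (Assign ''x'' (Load ''bag'' (Reg ''v'')))
       (Seq (Store ''cnt'' (Reg ''x'') (Add (Load ''cnt'' (Reg ''x'')) (Const 2))) mark_walk))"

context program_input
begin

lemma input_ok_agree:
  assumes "input_ok s" "agree c s t"
    and "wregs c \<inter> {''vertices'', ''edges'', ''nodes'', ''root''} = {}"
    and "warrs c \<inter> {''parent'', ''bag'', ''end1'', ''end2''} = {}"
  shows "input_ok t"
  using assms unfolding input_ok_def agree_def by auto

text \<open>The potential of all walks that fill the array \<open>a\<close>: each of their steps
  overwrites a zero entry.\<close>

definition unset :: "ident \<Rightarrow> rstate \<Rightarrow> nat" where
  "unset a t = card {y. y < nN \<and> sarr t a y = 0}"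

lemma unset_update:
  assumes "x < nN" "sarr t a x = 0" "v \<noteq> 0" "sarr u a = (sarr t a)(x := v)"
  shows "Suc (unset a u) = unset a t"
proof -
  have "{y. y < nN \<and> sarr t a y = 0} = insert x {y. y < nN \<and> sarr u a y = 0}"
    "x \<notin> {y. y < nN \<and> sarr u a y = 0}" using assms by auto
  then show ?thesis unfolding unset_def by simp
qed

definition marked :: "rstate \<Rightarrow> nat set" where
  "marked t = {y. y < nN \<and> sarr t ''mk'' y \<noteq> 0}"

text \<open>Stated for the first \<open>i\<close> vertices. Bag elements count twice so that the
  single test whether the entry is at most 1 recognises an empty bag with at most one nonempty
  child.\<close>

definition cnt_ok :: "rstate \<Rightarrow> nat \<Rightarrow> bool" where
  "cnt_ok t i \<longleftrightarrow> (\<forall>y<nN. sarr t ''cnt'' y = 2 * card {v. v < i \<and> node_of v = y} + card {c \<in> tchildren D y. c \<in> marked t})"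

lemma marked_update: "x < nN \<Longrightarrow> v \<noteq> 0 \<Longrightarrow> sarr u ''mk'' = (sarr t ''mk'')(x := v) \<Longrightarrow> marked u = insert x (marked t)"
  by (auto simp: marked_def)

text \<open>Between walks the marked nodes are closed under parents, so a walk may stop at the first
  mark it meets. Each node is thus marked once in the whole phase, and \<open>unset\<close> pays for
  it. Within a walk the closure can fail only at the current node.\<close>

lemma mark_walk:
  assumes ok: "input_ok t" and x: "sreg t ''x'' < nN" and c: "cnt_ok t i"
    and closed: "\<And>y. y \<in> marked t \<Longrightarrow> y \<noteq> rt \<Longrightarrow> par y \<in> marked t"
  shows "wp mark_walk (\<lambda>k u. input_ok u \<and> cnt_ok u i \<and> marked u = marked t \<union> {a. anc (sreg t ''x'') a} \<and>
    k + 30 * unset ''mk'' u \<le> 30 * unset ''mk'' t + 10) t"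
proof -
  define I where "I u \<longleftrightarrow> sreg u ''x'' < nN \<and> cnt_ok u i \<and>
    (\<forall>y\<in>marked u. y \<noteq> rt \<longrightarrow> par y \<in> marked u \<or> par y = sreg u ''x'') \<and>
    marked u \<union> {a. anc (sreg u ''x'') a} = marked t \<union> {a. anc (sreg t ''x'') a}" for u
  show ?thesis
    unfolding mark_walk_def
  proof (rule wp_Loop[where I = I and \<phi> = "\<lambda>u. 30 * unset ''mk'' u"])
    show "I t" using x c closed by (auto simp: I_def)
  next
    fix u
    assume I: "I u" and ag: "agree (Seq (Store ''mk'' (Reg ''x'') (Const 1))
       (Cond (Equal (Reg ''x'') (Reg ''root'')) Skip
         (Seq (Assign ''x'' (Load ''parent'' (Reg ''x'')))
           (Store ''cnt'' (Reg ''x'') (Add (Load ''cnt'' (Reg ''x'')) (Const 1)))))) t u"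
      and "rval u (Equal (Load ''mk'' (Reg ''x'')) (Const 0)) \<noteq> 0"
    then have mk0: "sarr u ''mk'' (sreg u ''x'') = 0" by simp
    have ok: "input_ok u" by (rule input_ok_agree[OF ok ag]) auto
    define x where "x = sreg u ''x''"
    have xn: "x < nN" using I by (simp add: I_def x_def)
    have xm: "x \<notin> marked u" using mk0 by (simp add: marked_def x_def)
    show "wp (Seq (Store ''mk'' (Reg ''x'') (Const 1))
       (Cond (Equal (Reg ''x'') (Reg ''root'')) Skip
         (Seq (Assign ''x'' (Load ''parent'' (Reg ''x'')))
           (Store ''cnt'' (Reg ''x'') (Add (Load ''cnt'' (Reg ''x'')) (Const 1))))))
       (\<lambda>k v. I v \<and> k + 1 + rcost (Equal (Load ''mk'' (Reg ''x'')) (Const 0)) + 30 * unset ''mk'' v \<le> 30 * unset ''mk'' u) u"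
    proof (cases "x = rt")
      \<comment> \<open>At the root the walk stays where it is; the mark just set ends the
        loop.\<close>
      case True
      define v where "v = u\<lparr>sarr := (sarr u)(''mk'' := (sarr u ''mk'')(x := 1))\<rparr>"
      have mv: "marked v = insert x (marked u)" using xn by (intro marked_update[of x 1]) (auto simp: v_def)
      have uv: "Suc (unset ''mk'' v) = unset ''mk'' u"
        by (rule unset_update[of x _ _ 1]) (use xn mk0 in \<open>auto simp: v_def x_def\<close>)
      have "{c \<in> tchildren D y. c \<in> marked v} = {c \<in> tchildren D y. c \<in> marked u}" if "y < nN" for y
        using that children_iff[OF that] True mv by auto
      then have "cnt_ok v i" using I by (auto simp: I_def cnt_ok_def v_def)
      moreover have "anc x a \<longleftrightarrow> a = x" for a using anc_unfold[OF xn] True by auto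
      ultimately have "I v" using I mv xn True unfolding I_def by (auto simp: v_def x_def)
      then show ?thesis
        using True uv ok unfolding wp_simps by (simp add: v_def x_def input_ok_def)
    next
      case False
      define p where "p = par x"
      have pn: "p < nN" using par_less xn False by (simp add: p_def)
      define w where "w = u\<lparr>sreg := (sreg u)(''x'' := p),
        sarr := (sarr u)(''mk'' := (sarr u ''mk'')(x := 1), ''cnt'' := (sarr u ''cnt'')(p := sarr u ''cnt'' p + 1))\<rparr>"
      have mw: "marked w = insert x (marked u)" using xn by (intro marked_update[of x 1]) (auto simp: w_def)
      have uw: "Suc (unset ''mk'' w) = unset ''mk'' u"
        by (rule unset_update[of x _ _ 1]) (use xn mk0 in \<open>auto simp: w_def x_def\<close>)
      have "{c \<in> tchildren D y. c \<in> marked w} =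
          (if y = p then insert x {c \<in> tchildren D y. c \<in> marked u} else {c \<in> tchildren D y. c \<in> marked u})" if "y < nN" for y
        using that children_iff[OF that] False mw xn by (auto simp: p_def)
      then have "card {c \<in> tchildren D y. c \<in> marked w} = card {c \<in> tchildren D y. c \<in> marked u} + (if y = p then 1 else 0)" if "y < nN" for y
        using that xm finite_children by auto
      then have "cnt_ok w i" using I by (auto simp: I_def cnt_ok_def w_def)
      moreover have "anc x a \<longleftrightarrow> a = x \<or> anc p a" for a using anc_unfold[OF xn] False by (auto simp: p_def)
      ultimately have "I w" using I mw xn pn False unfolding I_def by (auto simp: w_def x_def p_def)
      then show ?thesis
        using False uw ok unfolding wp_simps by (simp add: w_def x_def p_def input_ok_def)
    qed
  next
    fix k u
    assume I: "I u" and ag: "agree (Seq (Store ''mk'' (Reg ''x'') (Const 1))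
       (Cond (Equal (Reg ''x'') (Reg ''root'')) Skip
         (Seq (Assign ''x'' (Load ''parent'' (Reg ''x'')))
           (Store ''cnt'' (Reg ''x'') (Add (Load ''cnt'' (Reg ''x'')) (Const 1)))))) t u"
      and mk: "rval u (Equal (Load ''mk'' (Reg ''x'')) (Const 0)) = 0"
      and k: "k + 30 * unset ''mk'' u \<le> 30 * unset ''mk'' t + 1 + rcost (Equal (Load ''mk'' (Reg ''x'')) (Const 0))"
    have closed': "\<And>y. y \<in> marked u \<Longrightarrow> y \<noteq> rt \<Longrightarrow> par y \<in> marked u \<or> par y = sreg u ''x''"
      and xn: "sreg u ''x'' < nN" and cu: "cnt_ok u i"
      and eq: "marked u \<union> {a. anc (sreg u ''x'') a} = marked t \<union> {a. anc (sreg t ''x'') a}"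
      using I unfolding I_def by blast+
    have "sarr u ''mk'' (sreg u ''x'') \<noteq> 0" using mk by simp
    then have xm: "sreg u ''x'' \<in> marked u" using xn by (simp add: marked_def)
    have ok: "input_ok u" by (rule input_ok_agree[OF ok ag]) auto
    have up: "a \<in> marked u" if "anc (sreg u ''x'') a" for a
      using that
    proof (induction rule: rtrancl_induct)
      case (step y z)
      then have yz: "y \<noteq> rt" "z = par y" using par_eq[of y] nodes_eq root_eq by (auto simp: parent_rel_iff)
      moreover have "par y \<in> marked u \<or> par y = sreg u ''x''"
        using closed'[OF step.IH yz(1)] .
      ultimately show ?case using xm yz(2) by auto
    qed (rule xm)
    then show "input_ok u \<and> cnt_ok u i \<and> marked u = marked t \<union> {a. anc (sreg t ''x'') a} \<and>
        k + 30 * unset ''mk'' u \<le> 30 * unset ''mk'' t + 10"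
    proof -
      have "marked u = marked t \<union> {a. anc (sreg t ''x'') a}" using eq up by blast
      then show ?thesis using ok k cu by simp
    qed
  qed
qed


lemma mark_phase:
  assumes ok: "input_ok s" and z: "sarr s ''cnt'' = (\<lambda>_. 0)" "sarr s ''mk'' = (\<lambda>_. 0)"
  shows "wp mark_phase (\<lambda>k u. input_ok u \<and>
    (\<forall>y<nN. sarr u ''cnt'' y = 2 * card (tbag D y) + card {c \<in> tchildren D y. below D c \<noteq> {}}) \<and>
    k \<le> 60 * (nV + nN + 1)) s"
proof -
  let ?b = "Seq (Seq (Assign ''x'' (Load ''bag'' (Reg ''v'')))
       (Seq (Store ''cnt'' (Reg ''x'') (Add (Load ''cnt'' (Reg ''x'')) (Const 2))) mark_walk)) (Assign ''v'' (Add (Reg ''v'') (Const 1)))"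
  define J where "J t \<longleftrightarrow> input_ok t \<and> sreg t ''v'' \<le> nV \<and> cnt_ok t (sreg t ''v'') \<and>
    marked t = {a. \<exists>v<sreg t ''v''. anc (node_of v) a}" for t
  define \<phi> where "\<phi> t = 30 * unset ''mk'' t + 30 * (nV - sreg t ''v'')" for t
  let ?s = "s\<lparr>sreg := (sreg s)(''v'' := 0)\<rparr>"
  have J0: "J ?s"
  proof -
    have "marked ?s = {}" using z by (simp add: marked_def)
    then have "cnt_ok ?s 0" using z by (simp add: cnt_ok_def)
    then show ?thesis using ok \<open>marked ?s = {}\<close> by (simp add: J_def input_ok_def)
  qed
  have body: "wp ?b (\<lambda>k u. J u \<and> k + 1 + rcost (Less (Reg ''v'') (Reg ''vertices'')) + \<phi> u \<le> \<phi> t) t"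
    if J: "J t" and lt: "sreg t ''v'' < nV" for t
  proof -
    define v where "v = sreg t ''v''"
    define x where "x = node_of v"
    have xn: "x < nN" using node_of_less lt by (simp add: x_def v_def)
    have ok: "input_ok t" and ct: "cnt_ok t v" and mt: "marked t = {a. \<exists>v'<v. anc (node_of v') a}"
      using J unfolding J_def v_def by blast+
    have main: "wp mark_walk (\<lambda>k u. J (u\<lparr>sreg := (sreg u)(''v'' := Suc (sreg u ''v''))\<rparr>) \<and>
        k + 20 + \<phi> (u\<lparr>sreg := (sreg u)(''v'' := Suc (sreg u ''v''))\<rparr>) \<le> \<phi> t) t'"
      if t': "sreg t' = (sreg t)(''x'' := x)" "sarr t' = (sarr t)(''cnt'' := (sarr t ''cnt'')(x := sarr t ''cnt'' x + 2))" for t'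
    proof -
      have ok': "input_ok t'" using ok t' by (simp add: input_ok_def)
      have m': "marked t' = marked t" using t' by (simp add: marked_def)
      have "card {v'. v' < Suc v \<and> node_of v' = y} = card {v'. v' < v \<and> node_of v' = y} + (if y = x then 1 else 0)" for y
      proof -
        have "{v'. v' < Suc v \<and> node_of v' = y} = (if y = x then insert v {v'. v' < v \<and> node_of v' = y} else {v'. v' < v \<and> node_of v' = y})"
          by (auto simp: x_def less_Suc_eq)
        then show ?thesis by simp
      qed
      then have c': "cnt_ok t' (Suc v)" using ct t' m' by (simp add: cnt_ok_def)
      have cl: "par y \<in> marked t'" if y: "y \<in> marked t'" "y \<noteq> rt" for y
      proof -
        have yn: "y < nN" using y(1) by (simp add: marked_def)
        obtain v' where v': "v' < v" "anc (node_of v') y" using y(1) unfolding m' mt by blast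
        have "anc y (par y)" using anc_unfold[OF yn] y(2) by simp
        then have "anc (node_of v') (par y)" by (rule rtrancl_trans[OF v'(2)])
        then show ?thesis using v'(1) unfolding m' mt by (intro CollectI exI[of _ v'] conjI)
      qed
      have x': "sreg t' ''x'' = x" using t' by simp
      show ?thesis
      proof (rule wp_frame[OF mark_walk[OF ok' _ c' cl]])
        show "sreg t' ''x'' < nN" using x' xn by simp
        fix k u
        assume u: "input_ok u \<and> cnt_ok u (Suc v) \<and> marked u = marked t' \<union> {a. anc (sreg t' ''x'') a} \<and>
            k + 30 * unset ''mk'' u \<le> 30 * unset ''mk'' t' + 10" and ag: "agree mark_walk t' u"
        have vu: "sreg u ''v'' = v" using ag t' by (simp add: agree_def mark_walk_def v_def)
        let ?u = "u\<lparr>sreg := (sreg u)(''v'' := Suc (sreg u ''v''))\<rparr>"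
        have mu: "marked ?u = marked u" by (simp add: marked_def)
        have "marked u = {a. \<exists>v'<v. anc (node_of v') a} \<union> {a. anc x a}" using u x' m' mt by simp
        then have "marked u = {a. \<exists>v'<Suc v. anc (node_of v') a}" by (auto simp: less_Suc_eq x_def)
        moreover have "cnt_ok ?u (Suc v)" using u unfolding cnt_ok_def mu by simp
        moreover have "input_ok ?u" using u by (simp add: input_ok_def)
        ultimately have "J ?u" using vu lt unfolding J_def mu by (simp add: v_def)
        moreover have "unset ''mk'' ?u = unset ''mk'' u" "unset ''mk'' t' = unset ''mk'' t"
          using t' by (simp_all add: unset_def)
        moreover have "nV - v = Suc (nV - Suc v)" using lt by (simp add: v_def Suc_diff_Suc)
        ultimately show "J ?u \<and> k + 20 + \<phi> ?u \<le> \<phi> t" using u vu by (simp add: \<phi>_def v_def)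
      qed
    qed
    show ?thesis
      unfolding wp_simps
      by (rule wp_mono[OF main]) (use ok in \<open>simp_all add: input_ok_def x_def v_def\<close>)
  qed
  have "wp (Loop (Less (Reg ''v'') (Reg ''vertices'')) ?b) (\<lambda>k u. input_ok u \<and>
    (\<forall>y<nN. sarr u ''cnt'' y = 2 * card (tbag D y) + card {c \<in> tchildren D y. below D c \<noteq> {}}) \<and>
    k + 2 \<le> 60 * (nV + nN + 1)) ?s"
  proof (rule wp_Loop[where I = J and \<phi> = \<phi>, OF J0])
    fix t assume J: "J t" and lt: "rval t (Less (Reg ''v'') (Reg ''vertices'')) \<noteq> 0"
    have "input_ok t" using J unfolding J_def by blast
    then have "sreg t ''v'' < nV" using lt by (simp add: input_ok_def)
    then show "wp ?b (\<lambda>k u. J u \<and> k + 1 + rcost (Less (Reg ''v'') (Reg ''vertices'')) + \<phi> u \<le> \<phi> t) t"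
      by (rule body[OF J])
  next
    fix k u assume J: "J u" and ge: "rval u (Less (Reg ''v'') (Reg ''vertices'')) = 0"
      and k: "k + \<phi> u \<le> \<phi> ?s + 1 + rcost (Less (Reg ''v'') (Reg ''vertices''))"
    have ok: "input_ok u" and le: "sreg u ''v'' \<le> nV" and cu: "cnt_ok u (sreg u ''v'')"
      and mu: "marked u = {a. \<exists>v<sreg u ''v''. anc (node_of v) a}"
      using J unfolding J_def by blast+
    have v: "sreg u ''v'' = nV" using ok le ge by (simp add: input_ok_def)
    have "unset ''mk'' ?s \<le> card {..<nN}" unfolding unset_def by (rule card_mono) auto
    then have "k + 2 \<le> 60 * (nV + nN + 1)" using k by (simp add: \<phi>_def)
    moreover have "sarr u ''cnt'' y = 2 * card (tbag D y) + card {c \<in> tchildren D y. below D c \<noteq> {}}" if y: "y < nN" for y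
    proof -
      have "c \<in> marked u \<longleftrightarrow> below D c \<noteq> {}" for c
      proof -
        have "below D c \<noteq> {} \<longleftrightarrow> (\<exists>v<nV. v \<in> below D c)" using below_subset[of c] gverts_eq by auto
        then show ?thesis using mem_below_anc unfolding mu v by auto
      qed
      then show ?thesis using cu y bag_set[OF y] unfolding v cnt_ok_def by simp
    qed
    ultimately show "input_ok u \<and> (\<forall>y<nN. sarr u ''cnt'' y = 2 * card (tbag D y) + card {c \<in> tchildren D y. below D c \<noteq> {}}) \<and>
      k + 2 \<le> 60 * (nV + nN + 1)" using ok by simp
  qed
  then show ?thesis unfolding mark_phase_def wp_Seq wp_Assign by (simp add: add.commute)
qed

text \<open>Parent pointers reach the root, so the nearest ancestor satisfying \<open>P\<close>
  exists, and \<open>F\<close> can be given explicitly by that ancestor and the number of steps to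
  it.\<close>

lemma ancestor_recursion:
  assumes P: "P rt"
  obtains F where "\<And>y. y < nN \<Longrightarrow> F y = (if P y then b y else F (par y) + (inc::nat))"
proof -
  define K where "K y = (LEAST k. P ((par ^^ k) y))" for y
  define F where "F y = b ((par ^^ K y) y) + inc * K y" for y
  have ex: "\<exists>k. P ((par ^^ k) y)" if "y < nN" for y
  proof -
    have "y \<in> tnodes D" using that nodes_eq by simp
    then show ?thesis
    proof (induction rule: node_induct)
      case root
      then show ?case using P root_eq by (intro exI[of _ 0]) simp
    next
      case (parent t)
      then obtain k where "P ((par ^^ k) (tparent D t))" by blast
      then have "P ((par ^^ Suc k) t)" using parent par_eq[of t] nodes_eq root_eq by (simp add: funpow_Suc_right del: funpow.simps)
      then show ?case by blast
    qed
  qed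
  have "F y = (if P y then b y else F (par y) + inc)" if y: "y < nN" for y
  proof (cases "P y")
    case True
    then have "K y = 0" unfolding K_def by (intro Least_equality) auto
    then show ?thesis using True by (simp add: F_def)
  next
    case False
    obtain k where k: "P ((par ^^ k) y)" using ex y by blast
    have "K y = Suc (LEAST k. P ((par ^^ Suc k) y))"
      unfolding K_def using k False by (intro Least_Suc[where n = k]) auto
    also have "(LEAST k. P ((par ^^ Suc k) y)) = K (par y)"
      unfolding K_def by (simp add: funpow_Suc_right del: funpow.simps)
    finally have "K y = Suc (K (par y))" .
    then show ?thesis using False by (simp add: F_def funpow_Suc_right del: funpow.simps)
  qed
  then show thesis using that by blast
qed

end

text \<open>Every node whose entry is 0 receives the entry of its nearest ancestor with a nonzero entry,
  increased by \<open>inc\<close> for every step. A node is climbed over once only, since it is filled afterwards.\<close>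

definition climb :: "ident \<Rightarrow> rcom" where
  "climb a = Loop (Equal (Load a (Reg ''y'')) (Const 0))
     (Seq (Assign ''y'' (Load ''parent'' (Reg ''y''))) (Assign ''j'' (Add (Reg ''j'') (Const 1))))"

text \<open>The machine has no multiplication, hence \<open>inc\<close> is added once for every step
  of the preceding climb.\<close>

definition add_up :: "nat \<Rightarrow> rcom" where
  "add_up inc = Loop (Reg ''j'') (Seq (Assign ''d'' (Add (Reg ''d'') (Const inc))) (Assign ''j'' (Sub (Reg ''j'') (Const 1))))"

text \<open>Walks the climbed path a second time from its start, where the entry is largest, and
  lowers \<open>d\<close> with every step.\<close>

definition fill :: "ident \<Rightarrow> nat \<Rightarrow> rcom" where
  "fill a inc = Loop (Equal (Load a (Reg ''y'')) (Const 0))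
     (Seq (Store a (Reg ''y'') (Reg ''d'')) (Seq (Assign ''d'' (Sub (Reg ''d'') (Const inc)))
       (Assign ''y'' (Load ''parent'' (Reg ''y'')))))"

definition propagate :: "ident \<Rightarrow> nat \<Rightarrow> rcom" where
  "propagate a inc = for_upto ''i'' (Reg ''nodes'')
     (Seq (Assign ''y'' (Reg ''i'')) (Seq (Assign ''j'' (Const 0)) (Seq (climb a)
       (Seq (Assign ''d'' (Load a (Reg ''y''))) (Seq (add_up inc) (Seq (Assign ''y'' (Reg ''i'')) (fill a inc)))))))"

section \<open>Filling an array along parent pointers\<close>

lemma add_up: "wp (add_up inc) (\<lambda>k u. sreg u ''d'' = sreg t ''d'' + inc * sreg t ''j'' \<and> k \<le> 20 * sreg t ''j'' + 2) t"
proof -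
  define I :: "rstate \<Rightarrow> bool" where "I u \<longleftrightarrow> sreg u ''d'' + inc * sreg u ''j'' = sreg t ''d'' + inc * sreg t ''j''" for u
  show ?thesis
    unfolding add_up_def
  proof (rule wp_Loop[where I = I and \<phi> = "\<lambda>u. 20 * sreg u ''j''"])
    fix u assume I: "I u" and "rval u (Reg ''j'') \<noteq> 0"
    then obtain j where j: "sreg u ''j'' = Suc j" by (auto simp: gr0_conv_Suc)
    show "wp (Seq (Assign ''d'' (Add (Reg ''d'') (Const inc))) (Assign ''j'' (Sub (Reg ''j'') (Const 1))))
       (\<lambda>k v. I v \<and> k + 1 + rcost (Reg ''j'') + 20 * sreg v ''j'' \<le> 20 * sreg u ''j'') u"
      using I j by (simp add: wp_simps I_def)
  qed (simp_all add: I_def)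
qed

context program_input
begin

context
  fixes a :: ident and inc :: nat and F :: "nat \<Rightarrow> nat" and b :: "nat \<Rightarrow> nat"
  assumes a: "a \<notin> {''parent'', ''bag'', ''end1'', ''end2''}" and b_rt: "b rt \<noteq> 0"
    and F: "\<And>y. y < nN \<Longrightarrow> F y = (if b y \<noteq> 0 then b y else F (par y) + inc)"
begin

definition partial_ok :: "(nat \<Rightarrow> nat) \<Rightarrow> bool" where
  "partial_ok A \<longleftrightarrow> (\<forall>y<nN. (A y = 0 \<or> A y = F y) \<and> (b y \<noteq> 0 \<longrightarrow> A y \<noteq> 0))"

lemma partial_step:
  assumes "partial_ok A" "y < nN" "A y = 0"
  shows "y \<noteq> rt" "par y < nN" "F y = F (par y) + inc"
proof -
  have b0: "b y = 0" using assms by (auto simp: partial_ok_def)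
  then show y: "y \<noteq> rt" using b_rt by auto
  show "par y < nN" using par_less[OF assms(2) y] .
  show "F y = F (par y) + inc" using F[OF assms(2)] b0 by simp
qed

lemma F_nonzero: "y < nN \<Longrightarrow> F y \<noteq> 0"
proof -
  assume "y < nN"
  then have "y \<in> tnodes D" using nodes_eq by simp
  then show ?thesis
  proof (induction rule: node_induct)
    case root
    then show ?case using F[OF rt_less] b_rt root_eq by simp
  next
    case (parent t)
    then show ?case using F[of t] par_eq[of t] nodes_eq root_eq by simp
  qed
qed

lemma climb:
  assumes ok: "input_ok t" and A: "partial_ok (sarr t a)" and y: "sreg t ''y'' < nN" and j: "sreg t ''j'' = 0"
    and dist: "\<And>y. y < nN \<Longrightarrow> dst y = (if sarr t a y \<noteq> 0 then 0 else dst (par y) + (1::nat))"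
  shows "wp (climb a) (\<lambda>k u. sarr u a (sreg u ''y'') + inc * sreg u ''j'' = F (sreg t ''y'') \<and>
    sreg u ''j'' = dst (sreg t ''y'') \<and> k \<le> 20 * dst (sreg t ''y'') + 5) t"
proof -
  define I :: "rstate \<Rightarrow> bool" where "I u \<longleftrightarrow> sreg u ''y'' < nN \<and> F (sreg u ''y'') + inc * sreg u ''j'' = F (sreg t ''y'') \<and>
    sreg u ''j'' + dst (sreg u ''y'') = dst (sreg t ''y'')" for u
  show ?thesis
    unfolding climb_def
  proof (rule wp_Loop[where I = I and \<phi> = "\<lambda>u. 20 * dst (sreg u ''y'')"])
    show "I t" using y j by (simp add: I_def)
  next
    fix u assume I: "I u" and ag: "agree (Seq (Assign ''y'' (Load ''parent'' (Reg ''y''))) (Assign ''j'' (Add (Reg ''j'') (Const 1)))) t u"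
      and "rval u (Equal (Load a (Reg ''y'')) (Const 0)) \<noteq> 0"
    then have 0: "sarr t a (sreg u ''y'') = 0" by (simp add: agree_def)
    have p: "sarr u ''parent'' = par" using ag ok by (simp add: agree_def input_ok_def)
    have yn: "sreg u ''y'' < nN" using I by (simp add: I_def)
    note st = partial_step[OF A yn 0]
    have "dst (sreg u ''y'') = dst (par (sreg u ''y'')) + 1" using dist[OF yn] 0 by simp
    then show "wp (Seq (Assign ''y'' (Load ''parent'' (Reg ''y''))) (Assign ''j'' (Add (Reg ''j'') (Const 1))))
        (\<lambda>k v. I v \<and> k + 1 + rcost (Equal (Load a (Reg ''y'')) (Const 0)) + 20 * dst (sreg v ''y'') \<le> 20 * dst (sreg u ''y'')) u"
      using I st p by (simp add: wp_simps I_def)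
  next
    fix k u assume I: "I u" and ag: "agree (Seq (Assign ''y'' (Load ''parent'' (Reg ''y''))) (Assign ''j'' (Add (Reg ''j'') (Const 1)))) t u"
      and e: "rval u (Equal (Load a (Reg ''y'')) (Const 0)) = 0"
      and k: "k + 20 * dst (sreg u ''y'') \<le> 20 * dst (sreg t ''y'') + 1 + rcost (Equal (Load a (Reg ''y'')) (Const 0))"
    have au: "sarr u a = sarr t a" using ag by (simp add: agree_def)
    have yn: "sreg u ''y'' < nN" using I by (simp add: I_def)
    have n0: "sarr u a (sreg u ''y'') \<noteq> 0" using e by simp
    then have "sarr u a (sreg u ''y'') = F (sreg u ''y'')" "dst (sreg u ''y'') = 0"
      using A yn au dist[OF yn] by (auto simp: partial_ok_def)
    then show "sarr u a (sreg u ''y'') + inc * sreg u ''j'' = F (sreg t ''y'') \<and>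
      sreg u ''j'' = dst (sreg t ''y'') \<and> k \<le> 20 * dst (sreg t ''y'') + 5"
      using I k unfolding I_def by (elim conjE) simp
  qed
qed

lemma fill:
  assumes ok: "input_ok t" and A: "partial_ok (sarr t a)" and y: "sreg t ''y'' < nN" and d: "sreg t ''d'' = F (sreg t ''y'')"
    and dist: "\<And>y. y < nN \<Longrightarrow> dst y = (if sarr t a y \<noteq> 0 then 0 else dst (par y) + (1::nat))"
  shows "wp (fill a inc) (\<lambda>k u. input_ok u \<and> partial_ok (sarr u a) \<and>
    (\<forall>z. sarr t a z \<noteq> 0 \<longrightarrow> sarr u a z \<noteq> 0) \<and> sarr u a (sreg t ''y'') \<noteq> 0 \<and>
    unset a u + dst (sreg t ''y'') = unset a t \<and> k \<le> 20 * dst (sreg t ''y'') + 5) t"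
proof -
  let ?b = "Seq (Store a (Reg ''y'') (Reg ''d'')) (Seq (Assign ''d'' (Sub (Reg ''d'') (Const inc)))
       (Assign ''y'' (Load ''parent'' (Reg ''y''))))"
  \<comment> \<open>Entries on levels not deeper than the current node are still the original ones.
    So \<open>dst\<close>, which refers to the array before the walk, remains correct for the rest
    of the path.\<close>
  define I :: "rstate \<Rightarrow> bool" where "I u \<longleftrightarrow> sreg u ''y'' < nN \<and> sreg u ''d'' = F (sreg u ''y'') \<and> partial_ok (sarr u a) \<and>
    (\<forall>z. sarr t a z \<noteq> 0 \<longrightarrow> sarr u a z \<noteq> 0) \<and>
    (\<forall>z. z < nN \<longrightarrow> level D z \<le> level D (sreg u ''y'') \<longrightarrow> sarr u a z = sarr t a z) \<and>
    (sreg u ''y'' = sreg t ''y'' \<or> sarr u a (sreg t ''y'') \<noteq> 0) \<and>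
    unset a u + dst (sreg t ''y'') = unset a t + dst (sreg u ''y'')" for u
  show ?thesis
    unfolding fill_def
  proof (rule wp_Loop[where I = I and \<phi> = "\<lambda>u. 20 * dst (sreg u ''y'')"])
    show "I t" using y d A by (simp add: I_def)
  next
    fix u assume I: "I u" and ag: "agree ?b t u" and r: "rval u (Equal (Load a (Reg ''y'')) (Const 0)) \<noteq> 0"
    define y where "y = sreg u ''y''"
    have 0: "sarr u a y = 0" using r by (simp add: y_def)
    have "input_ok u" by (rule input_ok_agree[OF ok ag]) (use a in auto)
    then have p: "sarr u ''parent'' = par" by (simp add: input_ok_def)
    have yn: "y < nN" and du: "sreg u ''d'' = F y" and pu: "partial_ok (sarr u a)"
      and keep': "\<forall>z. sarr t a z \<noteq> 0 \<longrightarrow> sarr u a z \<noteq> 0"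
      and lv': "\<forall>z. z < nN \<longrightarrow> level D z \<le> level D y \<longrightarrow> sarr u a z = sarr t a z"
      and i: "y = sreg t ''y'' \<or> sarr u a (sreg t ''y'') \<noteq> 0"
      and us: "unset a u + dst (sreg t ''y'') = unset a t + dst y"
      using I unfolding I_def y_def by - (elim conjE, assumption)+
    note keep = keep'[rule_format] and lv = lv'[rule_format]
    note st = partial_step[OF pu yn 0]
    have lvp: "level D y = Suc (level D (par y))"
      using level_parent[of y] yn st(1) par_eq[OF yn] nodes_eq root_eq by simp
    have dy: "dst y = dst (par y) + 1" using dist[OF yn] lv[OF yn] 0 by simp
    have main: "I v \<and> dst (sreg v ''y'') + 1 = dst y"
      if v: "sreg v ''y'' = par y" "sreg v ''d'' = F y - inc" "sarr v a = (sarr u a)(y := F y)" for v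
    proof -
      have "Suc (unset a v) = unset a u" by (rule unset_update[OF yn 0 F_nonzero[OF yn] v(3)])
      moreover have "partial_ok (sarr v a)" using pu F_nonzero v(3) by (simp add: partial_ok_def)
      moreover have "sarr v a z = sarr t a z" if "z < nN" "level D z \<le> level D (par y)" for z
      proof -
        have "z \<noteq> y" using that(2) lvp by auto
        then show ?thesis using lv[OF that(1)] that(2) lvp v(3) by simp
      qed
      moreover have "sarr v a z \<noteq> 0" if "sarr t a z \<noteq> 0" for z
        using keep[OF that] v(3) F_nonzero[OF yn] by simp
      moreover have "sarr v a (sreg t ''y'') \<noteq> 0" using i v(3) F_nonzero[OF yn] by auto
      ultimately show ?thesis using st v(1,2) us dy unfolding I_def by simp
    qed
    show "wp ?b (\<lambda>k v. I v \<and> k + 1 + rcost (Equal (Load a (Reg ''y'')) (Const 0)) + 20 * dst (sreg v ''y'') \<le> 20 * dst (sreg u ''y'')) u"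
    proof -
      let ?v = "u\<lparr>sarr := (sarr u)(a := (sarr u a)(y := F y)), sreg := (sreg u)(''d'' := F y - inc, ''y'' := par y)\<rparr>"
      have m: "I ?v \<and> dst (sreg ?v ''y'') + 1 = dst y" by (rule main) simp_all
      show ?thesis using m p du a unfolding wp_simps by (auto simp: y_def)
    qed
  next
    fix k u assume I: "I u" and ag: "agree ?b t u" and e: "rval u (Equal (Load a (Reg ''y'')) (Const 0)) = 0"
      and k: "k + 20 * dst (sreg u ''y'') \<le> 20 * dst (sreg t ''y'') + 1 + rcost (Equal (Load a (Reg ''y'')) (Const 0))"
    have n0: "sarr u a (sreg u ''y'') \<noteq> 0" using e by simp
    have yn: "sreg u ''y'' < nN" and pu: "partial_ok (sarr u a)"
      and keep: "\<forall>z. sarr t a z \<noteq> 0 \<longrightarrow> sarr u a z \<noteq> 0"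
      and lv: "\<forall>z. z < nN \<longrightarrow> level D z \<le> level D (sreg u ''y'') \<longrightarrow> sarr u a z = sarr t a z"
      and i: "sreg u ''y'' = sreg t ''y'' \<or> sarr u a (sreg t ''y'') \<noteq> 0"
      and us: "unset a u + dst (sreg t ''y'') = unset a t + dst (sreg u ''y'')"
      using I unfolding I_def by - (elim conjE, assumption)+
    have eq: "sarr u a (sreg u ''y'') = sarr t a (sreg u ''y'')" using lv[rule_format, OF yn order_refl] .
    have ok': "input_ok u" by (rule input_ok_agree[OF ok ag]) (use a in auto)
    have d0: "dst (sreg u ''y'') = 0" using dist[OF yn] n0 eq by simp
    have "sarr u a (sreg t ''y'') \<noteq> 0" using i n0 by auto
    then show "input_ok u \<and> partial_ok (sarr u a) \<and>
    (\<forall>z. sarr t a z \<noteq> 0 \<longrightarrow> sarr u a z \<noteq> 0) \<and> sarr u a (sreg t ''y'') \<noteq> 0 \<and>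
    unset a u + dst (sreg t ''y'') = unset a t \<and> k \<le> 20 * dst (sreg t ''y'') + 5"
      using ok' pu keep us d0 k by auto
  qed
qed

text \<open>Every node climbed over has a zero entry and is filled in the same iteration. The 60
  units that \<open>\<phi>\<close> reserves for it cover 20 units in each of the three inner loops;
  the other 60 pay for the iteration itself.\<close>

lemma propagate_loop:
  assumes ok: "input_ok s" and b: "sarr s a = b"
  shows "wp (propagate a inc) (\<lambda>k u. input_ok u \<and> (\<forall>y<nN. sarr u a y = F y) \<and> k \<le> 200 * (nN + 1)) s"
proof -
  let ?b = "Seq (Seq (Assign ''y'' (Reg ''i'')) (Seq (Assign ''j'' (Const 0)) (Seq (climb a)
       (Seq (Assign ''d'' (Load a (Reg ''y''))) (Seq (add_up inc) (Seq (Assign ''y'' (Reg ''i'')) (fill a inc)))))))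
       (Assign ''i'' (Add (Reg ''i'') (Const 1)))"
  define J where "J t \<longleftrightarrow> input_ok t \<and> sreg t ''i'' \<le> nN \<and> partial_ok (sarr t a) \<and> (\<forall>y<sreg t ''i''. sarr t a y \<noteq> 0)" for t
  define \<phi> where "\<phi> t = 60 * unset a t + 60 * (nN - sreg t ''i'')" for t
  let ?s = "s\<lparr>sreg := (sreg s)(''i'' := 0)\<rparr>"
  have J0: "J ?s"
    using ok F b by (simp add: J_def input_ok_def partial_ok_def)
  have body: "wp ?b (\<lambda>k u. J u \<and> k + 4 + \<phi> u \<le> \<phi> t) t"
    if J: "J t" and lt: "sreg t ''i'' < nN" for t
  proof -
    define i where "i = sreg t ''i''"
    have ok: "input_ok t" and pa: "partial_ok (sarr t a)" and fin: "\<And>y. y < i \<Longrightarrow> sarr t a y \<noteq> 0"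
      using J unfolding J_def i_def by blast+
    have "sarr t a rt \<noteq> 0" using pa b_rt rt_less by (simp add: partial_ok_def)
    then obtain dst where dst: "\<And>y. y < nN \<Longrightarrow> dst y = (if sarr t a y \<noteq> 0 then 0 else dst (par y) + (1::nat))"
      using ancestor_recursion[of "\<lambda>y. sarr t a y \<noteq> 0" "\<lambda>_. 0" 1] by blast
    have 3: "wp (fill a inc) (\<lambda>k v. J (v\<lparr>sreg := (sreg v)(''i'' := Suc (sreg v ''i''))\<rparr>) \<and>
        k + \<phi> (v\<lparr>sreg := (sreg v)(''i'' := Suc (sreg v ''i''))\<rparr>) + 40 * dst i + 55 \<le> \<phi> t) u"
      if u: "sreg u ''y'' = i" "sreg u ''d'' = F i" "sreg u ''i'' = i" "sarr u a = sarr t a" "input_ok u" for u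
    proof (rule wp_frame[OF fill[OF u(5)], where dst1 = dst])
      show "partial_ok (sarr u a)" using pa u by simp
      show "sreg u ''y'' < nN" "sreg u ''d'' = F (sreg u ''y'')" using u lt by (simp_all add: i_def)
      show "dst y = (if sarr u a y \<noteq> 0 then 0 else dst (par y) + 1)" if "y < nN" for y using dst[OF that] u by simp
      fix k v assume ag: "agree (fill a inc) u v" and
        v: "input_ok v \<and> partial_ok (sarr v a) \<and> (\<forall>z. sarr u a z \<noteq> 0 \<longrightarrow> sarr v a z \<noteq> 0) \<and> sarr v a (sreg u ''y'') \<noteq> 0 \<and>
          unset a v + dst (sreg u ''y'') = unset a u \<and> k \<le> 20 * dst (sreg u ''y'') + 5"
      let ?w = "v\<lparr>sreg := (sreg v)(''i'' := Suc (sreg v ''i''))\<rparr>"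
      have iv: "sreg v ''i'' = i" using ag u by (simp add: agree_def fill_def)
      have us: "unset a ?w = unset a v" "unset a u = unset a t" using u by (simp_all add: unset_def)
      have vv: "unset a v + dst i = unset a t" "k \<le> 20 * dst i + 5" "sarr v a i \<noteq> 0" using v u us by simp_all
      have "J ?w" using v u iv lt fin by (auto simp: J_def input_ok_def i_def less_Suc_eq)
      moreover have "k + \<phi> ?w + 40 * dst i + 55 \<le> \<phi> t"
      proof -
        obtain r where r: "nN - i = Suc r" using lt by (metis Suc_diff_Suc i_def)
        then have "nN - Suc i = r" by simp
        then have "\<phi> ?w = 60 * unset a v + 60 * r" "\<phi> t = 60 * (unset a v + dst i) + 60 + 60 * r"
          using us iv r vv(1) by (simp_all add: \<phi>_def i_def)
        then show ?thesis using vv(2) by simp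
      qed
      ultimately show "J ?w \<and> k + \<phi> ?w + 40 * dst i + 55 \<le> \<phi> t" by blast
    qed
    have 2: "wp (add_up inc) (\<lambda>k v. sreg v ''d'' = F i \<and> sreg v ''i'' = i \<and> sarr v a = sarr t a \<and> input_ok v \<and> k \<le> 20 * dst i + 2) u"
      if u: "sreg u ''d'' + inc * sreg u ''j'' = F i" "sreg u ''j'' = dst i" "sreg u ''i'' = i" "sarr u a = sarr t a" "input_ok u" for u
      by (rule wp_frame[OF add_up]) (use u in \<open>auto simp: agree_def add_up_def input_ok_def\<close>)
    have 1: "wp (climb a) (\<lambda>k v. sarr v a (sreg v ''y'') + inc * sreg v ''j'' = F i \<and> sreg v ''j'' = dst i \<and>
        sreg v ''i'' = i \<and> sarr v a = sarr t a \<and> input_ok v \<and> k \<le> 20 * dst i + 5) u"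
      if u: "sreg u ''y'' = i" "sreg u ''j'' = 0" "sreg u ''i'' = i" "sarr u a = sarr t a" "input_ok u" for u
    proof (rule wp_frame[OF climb[OF u(5)], where dst1 = dst])
      show "partial_ok (sarr u a)" using pa u by simp
      show "sreg u ''y'' < nN" "sreg u ''j'' = 0" using u lt by (simp_all add: i_def)
      show "dst y = (if sarr u a y \<noteq> 0 then 0 else dst (par y) + 1)" if "y < nN" for y using dst[OF that] u by simp
      fix k v assume ag: "agree (climb a) u v" and
        v: "sarr v a (sreg v ''y'') + inc * sreg v ''j'' = F (sreg u ''y'') \<and> sreg v ''j'' = dst (sreg u ''y'') \<and>
          k \<le> 20 * dst (sreg u ''y'') + 5"
      have "sreg v ''i'' = i" "sarr v a = sarr t a" "input_ok v"
        using ag u by (simp_all add: agree_def climb_def input_ok_def)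
      then show "sarr v a (sreg v ''y'') + inc * sreg v ''j'' = F i \<and> sreg v ''j'' = dst i \<and>
        sreg v ''i'' = i \<and> sarr v a = sarr t a \<and> input_ok v \<and> k \<le> 20 * dst i + 5"
        using v u(1) by auto
    qed
    show ?thesis
      unfolding wp_simps
      apply (rule wp_mono[OF 1])
           apply (use ok in \<open>simp_all add: i_def[symmetric] input_ok_def\<close>)[5]
      apply (rule wp_mono[OF 2])
           apply (auto simp: input_ok_def)[5]
      apply (rule wp_mono[OF 3])
           apply (auto simp: input_ok_def)
      done
  qed
  have "wp (Loop (Less (Reg ''i'') (Reg ''nodes'')) ?b) (\<lambda>k u. input_ok u \<and> (\<forall>y<nN. sarr u a y = F y) \<and> k + 2 \<le> 200 * (nN + 1)) ?s"
  proof (rule wp_Loop[where I = J and \<phi> = \<phi>, OF J0])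
    fix t assume J: "J t" and lt: "rval t (Less (Reg ''i'') (Reg ''nodes'')) \<noteq> 0"
    have "input_ok t" using J unfolding J_def by blast
    then have "sreg t ''i'' < nN" using lt by (simp add: input_ok_def)
    from body[OF J this] show "wp ?b (\<lambda>k u. J u \<and> k + 1 + rcost (Less (Reg ''i'') (Reg ''nodes'')) + \<phi> u \<le> \<phi> t) t"
      by (rule wp_mono) simp
  next
    fix k u assume J: "J u" and ge: "rval u (Less (Reg ''i'') (Reg ''nodes'')) = 0"
      and k: "k + \<phi> u \<le> \<phi> ?s + 1 + rcost (Less (Reg ''i'') (Reg ''nodes''))"
    have ok: "input_ok u" and le: "sreg u ''i'' \<le> nN" and pu: "partial_ok (sarr u a)"
      and fin: "\<forall>y<sreg u ''i''. sarr u a y \<noteq> 0"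
      using J unfolding J_def by blast+
    have v: "sreg u ''i'' = nN" using ok le ge by (simp add: input_ok_def)
    have "unset a ?s \<le> card {..<nN}" unfolding unset_def by (rule card_mono) auto
    then have "k + 2 \<le> 200 * (nN + 1)" using k by (simp add: \<phi>_def)
    then show "input_ok u \<and> (\<forall>y<nN. sarr u a y = F y) \<and> k + 2 \<le> 200 * (nN + 1)"
      using ok pu fin unfolding v partial_ok_def by blast
  qed
  then show ?thesis unfolding propagate_def wp_Seq wp_Assign by (simp add: add.commute)
qed

end

lemma propagate:
  assumes ok: "input_ok s" and a: "a \<notin> {''parent'', ''bag'', ''end1'', ''end2''}" and rt: "sarr s a rt \<noteq> 0"
  shows "wp (propagate a inc) (\<lambda>k u. input_ok u \<and>
    (\<forall>y<nN. sarr u a y = (if sarr s a y \<noteq> 0 then sarr s a y else sarr u a (par y) + inc)) \<and> k \<le> 200 * (nN + 1)) s"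
proof -
  obtain F where F: "\<And>y. y < nN \<Longrightarrow> F y = (if sarr s a y \<noteq> 0 then sarr s a y else F (par y) + inc)"
    using ancestor_recursion[of "\<lambda>y. sarr s a y \<noteq> 0" "sarr s a" inc] rt by blast
  show ?thesis
  proof (rule wp_mono[OF propagate_loop[OF a rt _ ok refl, of F inc]])
    fix k u assume "input_ok u \<and> (\<forall>y<nN. sarr u a y = F y) \<and> k \<le> 200 * (nN + 1)"
    moreover have "par y < nN" if "y < nN" "sarr s a y = 0" for y
      using par_less[OF that(1)] that(2) rt by metis
    ultimately show "input_ok u \<and> (\<forall>y<nN. sarr u a y = (if sarr s a y \<noteq> 0 then sarr s a y else sarr u a (par y) + inc)) \<and> k \<le> 200 * (nN + 1)"
      using F by auto
  qed (rule F)
qed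


section \<open>Walking along the edges\<close>

text \<open>A passing node has the same \<^const>\<open>below\<close> as its only nonempty child. A stop is the upper end of
  a chain of passing nodes.\<close>

definition passing :: "nat \<Rightarrow> bool" where
  "passing p \<longleftrightarrow> 2 * card (tbag D p) + card {c \<in> tchildren D p. below D c \<noteq> {}} \<le> 1"

definition stops :: "nat set" where
  "stops = {y. y < nN \<and> (y = rt \<or> \<not> passing (par y))}"

lemma finite_bag: "t < nN \<Longrightarrow> finite (tbag D t)"
  using bag_set[of t] by simp

lemma below_par:
  assumes "y < nN" "y \<noteq> rt"
  shows "below D y \<subseteq> below D (par y)"
proof -
  have "y \<in> tchildren D (par y)" using children_iff[OF par_less[OF assms]] assms by simp
  moreover have "par y \<in> tnodes D" using par_less[OF assms] nodes_eq by simp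
  ultimately show ?thesis using below_unfold by blast
qed

lemma below_passing_par:
  assumes y: "y < nN" "y \<noteq> rt" and p: "passing (par y)" and ne: "below D y \<noteq> {}"
  shows "below D (par y) = below D y"
proof -
  let ?p = "par y" and ?N = "{c \<in> tchildren D (par y). below D c \<noteq> {}}"
  have pn: "?p < nN" using par_less[OF y] .
  have yc: "y \<in> ?N" using children_iff[OF pn] y ne by simp
  have fin: "finite ?N" using finite_children by simp
  have "card (tbag D ?p) = 0" using p unfolding passing_def by linarith
  then have "tbag D ?p = {}" using finite_bag[OF pn] by simp
  moreover have "card ?N = 1"
    using p yc fin card_gt_0_iff[of ?N] by (auto simp: passing_def)
  then obtain a where a: "?N = {a}" by (rule card_1_singletonE)
  then have "?N = {y}" using yc by simp
  then have "(\<Union>c\<in>tchildren D ?p. below D c) = below D y" using yc by auto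
  ultimately show ?thesis using below_unfold[of ?p] pn nodes_eq by simp
qed

text \<open>The stops in question are the nonempty children of non-passing nodes. Among the nodes
  with nonempty \<open>below\<close>, all but the root are children, and a passing one has just one
  nonempty child; so the set \<open>N\<close> of non-passing ones has card N - 1 nonempty children
  in total. Those of \<open>N\<close> with an empty bag, collected in \<open>N2\<close>, have at
  least two each, while at most \<open>nV\<close> nodes have a nonempty bag. Hence \<open>N2\<close>
  has fewer elements than the rest of \<open>N\<close>, and the total stays below
  \<open>2 * nV\<close>.\<close>

lemma card_stops:
  "card {z \<in> stops. z \<noteq> rt \<and> below D z \<noteq> {}} \<le> 2 * nV"
proof (cases "nV = 0")
  case True
  then have "below D z = {}" for z using below_subset[of z] gverts_eq by simp
  then show ?thesis by simp
next
  case False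
  define M where "M = {y. y < nN \<and> below D y \<noteq> {}}"
  define ch where "ch p = {c \<in> tchildren D p. below D c \<noteq> {}}" for p
  define N where "N = {p \<in> M. \<not> passing p}"
  define N2 where "N2 = {p \<in> N. tbag D p = {}}"
  have finM: "finite M" by (simp add: M_def)
  have finch: "finite (ch p)" for p using finite_children by (simp add: ch_def)
  have chsub: "ch p \<subseteq> M" for p using children_node nodes_eq by (auto simp: ch_def M_def)
  have chdisj: "ch p \<inter> ch q = {}" if "p \<noteq> q" for p q
    using that by (auto simp: ch_def tchildren_def)
  have chpar: "c \<in> ch p \<longleftrightarrow> c \<in> M \<and> c \<noteq> rt \<and> par c = p" if "p < nN" for c p
    using children_iff[OF that] by (auto simp: ch_def M_def)
  have parM: "par c \<in> M" if "c \<in> M" "c \<noteq> rt" for c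
    using that below_par[of c] par_less[of c] by (auto simp: M_def)
  have Ml: "p < nN" if "p \<in> M" for p using that by (simp add: M_def)
  have all: "(\<Union>p\<in>M. ch p) = M - {rt}"
    using chpar parM Ml by blast
  have UN: "(\<Union>p\<in>N. ch p) = {z \<in> stops. z \<noteq> rt \<and> below D z \<noteq> {}}"
  proof (intro equalityI subsetI)
    fix z assume "z \<in> (\<Union>p\<in>N. ch p)"
    then obtain p where "p \<in> N" "z \<in> ch p" by blast
    then have "p \<in> M" "\<not> passing p" "z \<in> M" "z \<noteq> rt" "par z = p"
      using chpar[of p z] Ml by (auto simp: N_def)
    then show "z \<in> {z \<in> stops. z \<noteq> rt \<and> below D z \<noteq> {}}" by (auto simp: stops_def M_def)
  next
    fix z assume "z \<in> {z \<in> stops. z \<noteq> rt \<and> below D z \<noteq> {}}"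
    then have z: "z \<in> M" "z \<noteq> rt" "\<not> passing (par z)" by (auto simp: stops_def M_def)
    then have "par z \<in> N" "z \<in> ch (par z)" using parM[of z] chpar[of "par z" z] Ml by (auto simp: N_def)
    then show "z \<in> (\<Union>p\<in>N. ch p)" by blast
  qed
  have cardU: "card (\<Union>p\<in>A. ch p) = (\<Sum>p\<in>A. card (ch p))" if "A \<subseteq> M" for A
    by (rule card_UN_disjoint) (use that finM finch chdisj finite_subset in auto)
  have "below D rt = gverts G" using below_root root_eq by simp
  then have rtM: "rt \<in> M" using rt_less gverts_eq False by (auto simp: M_def)
  have pass1: "card (ch p) = 1" if "p \<in> M - N" for p
  proof -
    have p: "p < nN" "passing p" "below D p \<noteq> {}" using that by (auto simp: M_def N_def)
    have "card (tbag D p) = 0" using p(2) unfolding passing_def by linarith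
    then have "tbag D p = {}" using finite_bag[OF p(1)] by simp
    then have "ch p \<noteq> {}" using below_unfold[of p] p nodes_eq by (auto simp: ch_def)
    then show ?thesis using p(2) finch[of p] card_gt_0_iff[of "ch p"] by (auto simp: passing_def ch_def)
  qed
  have NM: "N \<subseteq> M" "N2 \<subseteq> N" by (auto simp: N_def N2_def)
  have finN: "finite N" by (rule finite_subset[OF NM(1) finM])
  have finN2: "finite N2" by (rule finite_subset[OF NM(2) finN])
  have "(\<Sum>p\<in>M. card (ch p)) = (\<Sum>p\<in>M - N. card (ch p)) + (\<Sum>p\<in>N. card (ch p))"
    by (rule sum.subset_diff[OF NM(1) finM])
  also have "(\<Sum>p\<in>M - N. card (ch p)) = card (M - N)" using pass1 by simp
  finally have "card (M - {rt}) = card (M - N) + (\<Sum>p\<in>N. card (ch p))" using cardU[OF order_refl] unfolding all by simp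
  moreover have "card (M - {rt}) + 1 = card M" using card.remove[OF finM rtM] by simp
  moreover have "card (M - N) + card N = card M"
    using card_Diff_subset[OF finN NM(1)] card_mono[OF finM NM(1)] by simp
  ultimately have eq: "(\<Sum>p\<in>N. card (ch p)) + 1 = card N" by linarith
  have "2 * card N2 = (\<Sum>p\<in>N2. 2)" by simp
  also have "\<dots> \<le> (\<Sum>p\<in>N2. card (ch p))"
  proof (rule sum_mono)
    fix p assume "p \<in> N2"
    then show "2 \<le> card (ch p)" by (auto simp: N2_def N_def passing_def ch_def)
  qed
  also have "\<dots> \<le> (\<Sum>p\<in>N. card (ch p))" using NM finN by (intro sum_mono2) auto
  finally have "2 * card N2 \<le> (\<Sum>p\<in>N. card (ch p))" .
  moreover have "card N = card (N - N2) + card N2"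
    using card_Diff_subset[OF finN2 NM(2)] card_mono[OF finN NM(2)] by simp
  moreover have "card (N - N2) \<le> nV"
  proof -
    have "N - N2 \<subseteq> node_of ` {..<nV}"
    proof
      fix p assume p: "p \<in> N - N2"
      then have "p < nN" "tbag D p \<noteq> {}" using Ml NM by (auto simp: N2_def)
      then show "p \<in> node_of ` {..<nV}" using bag_set[of p] by auto
    qed
    then have "card (N - N2) \<le> card (node_of ` {..<nV})" by (intro card_mono) auto
    also have "\<dots> \<le> nV" using card_image_le[of "{..<nV}" node_of] by simp
    finally show ?thesis .
  qed
  ultimately have "(\<Sum>p\<in>N. card (ch p)) \<le> 2 * nV" using eq by linarith
  then show ?thesis using cardU[OF NM(1)] unfolding UN by simp
qed

section \<open>Edges crossing a subtree, and jumps over chains\<close>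

definition cross :: "nat \<Rightarrow> nat \<Rightarrow> bool" where
  "cross e z \<longleftrightarrow> (fstend e \<in> below D z) \<noteq> (sndend e \<in> below D z)"

lemma edge_ends:
  assumes "e < nE"
  shows "fstend e < nV" "sndend e < nV" "fstend e \<noteq> sndend e" "{fstend e, sndend e} \<in> gedges G"
proof -
  show m: "{fstend e, sndend e} \<in> gedges G" using edges_bij assms by (auto simp: bij_betw_def)
  show "fstend e < nV" "sndend e < nV" using edge_subset[OF m] gverts_eq by auto
  show "fstend e \<noteq> sndend e" using edge_card[OF m] by auto
qed

lemma card_edges: "card (gedges G) = nE"
  using bij_betw_same_card[OF edges_bij] by simp

text \<open>Allows edges to be represented by their indices in the input list.\<close>

lemma card_edge_set: "card {e \<in> gedges G. P e} = card {e. e < nE \<and> P {fstend e, sndend e}}"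
proof -
  have g: "gedges G = (\<lambda>i. {fstend i, sndend i}) ` {..<nE}" and inj: "inj_on (\<lambda>i. {fstend i, sndend i}) {..<nE}"
    using edges_bij by (auto simp: bij_betw_def)
  have "inj_on (\<lambda>i. {fstend i, sndend i}) {e. e < nE \<and> P {fstend e, sndend e}}"
    by (rule inj_on_subset[OF inj]) auto
  then have "bij_betw (\<lambda>i. {fstend i, sndend i}) {e. e < nE \<and> P {fstend e, sndend e}} {e \<in> gedges G. P e}"
    unfolding bij_betw_def g by auto
  then show ?thesis by (rule bij_betw_same_card[symmetric])
qed

lemma card_edge_inter:
  assumes "e < nE"
  shows "card ({fstend e, sndend e} \<inter> Y) = 1 \<longleftrightarrow> (fstend e \<in> Y) \<noteq> (sndend e \<in> Y)"
  using edge_ends(3)[OF assms] by (cases "fstend e \<in> Y"; cases "sndend e \<in> Y") (simp_all add: Int_insert_left)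

lemma adhesion_card:
  "adhesion G D z = card {e. e < nE \<and> cross e z}"
  unfolding adhesion_def card_edge_set cross_def by (simp add: card_edge_inter[unfolded One_nat_def] cong: conj_cong)

text \<open>The entries are shifted by one because 0 marks an entry that is still to be filled; for
  the same reason depths start with 1 at the root in \<open>dep_ok\<close>.\<close>

definition top_ok :: "(nat \<Rightarrow> nat) \<Rightarrow> bool" where
  "top_ok tops \<longleftrightarrow> (\<forall>y<nN. tops y = (if y \<in> stops then y + 1 else tops (par y)))"

definition dep_ok :: "(nat \<Rightarrow> nat) \<Rightarrow> bool" where
  "dep_ok dep \<longleftrightarrow> (\<forall>y<nN. dep y = (if y = rt then 1 else dep (par y) + 1))"

lemma dep_anc:
  assumes "dep_ok dep" "anc x y" "x < nN" "x \<noteq> y"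
  shows "dep y < dep x"
proof -
  have "x = y \<or> dep y < dep x" using assms(2,3)
  proof (induction rule: converse_rtrancl_induct)
    case (step x z)
    then have "x \<noteq> rt" "z = par x" "z < nN" using par_eq[of x] par_less[of x] nodes_eq root_eq by (auto simp: parent_rel_iff)
    then have "dep x = dep z + 1" using assms(1) step.prems by (simp add: dep_ok_def)
    then show ?case using step.IH \<open>z < nN\<close> by auto
  qed simp
  then show ?thesis using assms(4) by simp
qed

text \<open>All nodes of a chain of passing nodes have the same \<open>below\<close>, so a jump from
  \<open>x\<close> to the end of its chain overlooks no stop and no change of
  \<open>below\<close>.\<close>

lemma top_path:
  assumes top: "top_ok tops" and x: "x < nN" and ne: "below D x \<noteq> {}"
  shows "tops x - 1 \<in> stops \<and> tops x = Suc (tops x - 1) \<and> anc x (tops x - 1) \<and> below D (tops x - 1) = below D x \<and>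
    (\<forall>a. anc x a \<longrightarrow> \<not> anc (tops x - 1) a \<longrightarrow> a \<notin> stops \<and> below D a = below D x)"
proof -
  have "x \<in> tnodes D" using x nodes_eq by simp
  then show ?thesis using ne
  proof (induction rule: node_induct)
    case root
    have "troot D \<in> stops" using root_eq rt_less by (simp add: stops_def)
    then have "tops (troot D) = Suc (troot D)" using top rt_less root_eq by (simp add: top_ok_def)
    then show ?case using \<open>troot D \<in> stops\<close> by auto
  next
    case (parent t)
    have t: "t < nN" "t \<noteq> rt" using parent nodes_eq root_eq by auto
    show ?case
    proof (cases "t \<in> stops")
      case True
      then have "tops t = Suc t" using top t by (simp add: top_ok_def)
      then show ?thesis using True by auto
    next
      case False
      then have "passing (par t)" using t by (simp add: stops_def)
      then have bel: "below D (par t) = below D t" using below_passing_par t parent.prems by blast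
      have tp: "tops t = tops (par t)" using top t False by (simp add: top_ok_def)
      have IH: "tops (par t) - 1 \<in> stops \<and> tops (par t) = Suc (tops (par t) - 1) \<and> anc (par t) (tops (par t) - 1) \<and>
          below D (tops (par t) - 1) = below D (par t) \<and>
          (\<forall>a. anc (par t) a \<longrightarrow> \<not> anc (tops (par t) - 1) a \<longrightarrow> a \<notin> stops \<and> below D a = below D (par t))"
        using parent.IH par_eq[OF t] bel parent.prems by simp
      show ?thesis
        unfolding tp
      proof (intro conjI allI impI)
        show "anc t (tops (par t) - 1)" using IH anc_unfold[OF t(1)] t(2) by blast
        fix a assume a: "anc t a" "\<not> anc (tops (par t) - 1) a"
        then have "a = t \<or> anc (par t) a" using anc_unfold[OF t(1)] by blast
        then show "a \<notin> stops" "below D a = below D t" using IH False bel a(2) by blast+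
      qed (use IH bel in auto)
    qed
  qed
qed

end

section \<open>Programs for the walks along the edges\<close>

definition top_init :: rcom where
  "top_init = for_upto ''i'' (Reg ''nodes'')
     (Cond (Equal (Reg ''i'') (Reg ''root''))
       (Store ''top'' (Reg ''i'') (Add (Reg ''i'') (Const 1)))
       (Cond (Less (Const 1) (Load ''cnt'' (Load ''parent'' (Reg ''i''))))
         (Store ''top'' (Reg ''i'') (Add (Reg ''i'') (Const 1))) Skip))"

text \<open>The node \<open>z\<close> keeps in \<open>rec\<close> the number of its crossing edges, of which the first four are
  listed from position \<open>4 * z\<close> on in the array \<open>E\<close>. For an edge joining two siblings, \<open>A\<close> and \<open>B\<close> are
  one more than these siblings; otherwise they are 0.\<close>

definition record_edge :: rcom where
  "record_edge = Seq
     (Cond (Less (Load ''rec'' (Reg ''z'')) (Const 4))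
       (Store ''E'' (Add (Add (Add (Reg ''z'') (Reg ''z'')) (Add (Reg ''z'') (Reg ''z''))) (Load ''rec'' (Reg ''z''))) (Reg ''e''))
       Skip)
     (Store ''rec'' (Reg ''z'') (Add (Load ''rec'' (Reg ''z'')) (Const 1)))"

text \<open>The register \<open>p\<close> receives one more than the node last left. When the two
  ends meet, nonzero \<open>p\<close> and \<open>q\<close> therefore denote children of the meeting
  node, and 0 means that the end has not moved.\<close>

definition move :: "ident \<Rightarrow> ident \<Rightarrow> rcom" where
  "move x p = Seq (Assign ''z'' (Sub (Load ''top'' (Reg x)) (Const 1)))
     (Seq record_edge (Seq (Assign p (Load ''top'' (Reg x))) (Assign x (Load ''parent'' (Reg ''z'')))))"

text \<open>It is the deeper end that moves, on a tie the first one; so neither end climbs past the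
  lowest common ancestor.\<close>

definition walk :: rcom where
  "walk = Loop (Equal (Equal (Reg ''x'') (Reg ''y'')) (Const 0))
     (Cond (Less (Load ''dep'' (Reg ''x'')) (Load ''dep'' (Reg ''y''))) (move ''y'' ''q'') (move ''x'' ''p''))"

definition edge_phase :: rcom where
  "edge_phase = for_upto ''e'' (Reg ''edges'')
     (Seq (Assign ''x'' (Load ''bag'' (Load ''end1'' (Reg ''e''))))
     (Seq (Assign ''y'' (Load ''bag'' (Load ''end2'' (Reg ''e''))))
     (Seq (Assign ''p'' (Const 0)) (Seq (Assign ''q'' (Const 0)) (Seq walk
       (Cond (Reg ''p'') (Cond (Reg ''q'')
         (Seq (Store ''A'' (Reg ''e'') (Reg ''p'')) (Store ''B'' (Reg ''e'') (Reg ''q''))) Skip) Skip))))))"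

context program_input
begin

lemma top_init:
  assumes ok: "input_ok s" and z: "sarr s ''top'' = (\<lambda>_. 0)"
    and cnt: "\<forall>y<nN. sarr s ''cnt'' y = 2 * card (tbag D y) + card {c \<in> tchildren D y. below D c \<noteq> {}}"
  shows "wp top_init (\<lambda>k u. input_ok u \<and> sarr u ''top'' = (\<lambda>y. if y \<in> stops then y + 1 else 0) \<and> k \<le> 40 * (nN + 1)) s"
proof -
  let ?b = "Seq (Cond (Equal (Reg ''i'') (Reg ''root''))
       (Store ''top'' (Reg ''i'') (Add (Reg ''i'') (Const 1)))
       (Cond (Less (Const 1) (Load ''cnt'' (Load ''parent'' (Reg ''i''))))
         (Store ''top'' (Reg ''i'') (Add (Reg ''i'') (Const 1))) Skip)) (Assign ''i'' (Add (Reg ''i'') (Const 1)))"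
  let ?s = "s\<lparr>sreg := (sreg s)(''i'' := 0)\<rparr>"
  define J :: "rstate \<Rightarrow> bool" where "J t \<longleftrightarrow> sreg t ''i'' \<le> nN \<and>
    sarr t ''top'' = (\<lambda>y. if y < sreg t ''i'' \<and> y \<in> stops then y + 1 else 0)" for t
  have "wp (Loop (Less (Reg ''i'') (Reg ''nodes'')) ?b)
      (\<lambda>k u. input_ok u \<and> sarr u ''top'' = (\<lambda>y. if y \<in> stops then y + 1 else 0) \<and> k + 2 \<le> 40 * (nN + 1)) ?s"
  proof (rule wp_Loop[where I = J and \<phi> = "\<lambda>t. 30 * (nN - sreg t ''i'')"])
    show "J ?s" using z by (simp add: J_def)
  next
    fix t assume J: "J t" and ag: "agree ?b ?s t" and lt: "rval t (Less (Reg ''i'') (Reg ''nodes'')) \<noteq> 0"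
    have okt: "input_ok t" using ok ag by (simp add: input_ok_def agree_def)
    define i where "i = sreg t ''i''"
    have i: "i < nN" using lt okt by (simp add: input_ok_def i_def)
    have top: "sarr t ''top'' = (\<lambda>y. if y < i \<and> y \<in> stops then y + 1 else 0)" using J by (simp add: J_def i_def)
    have c: "sarr t ''cnt'' = sarr s ''cnt''" using ag by (simp add: agree_def)
    have st: "i \<in> stops \<longleftrightarrow> i = rt \<or> 1 < sarr t ''cnt'' (par i)"
    proof (cases "i = rt")
      case False
      then show ?thesis using i c cnt[rule_format, OF par_less[OF i False]] by (auto simp: stops_def passing_def)
    qed (use i in \<open>simp add: stops_def\<close>)
    have new: "(\<lambda>y. if y < Suc i \<and> y \<in> stops then y + 1 else 0) =
        (if i \<in> stops then (sarr t ''top'')(i := i + 1) else sarr t ''top'')"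
      unfolding top by (auto simp: fun_eq_iff less_Suc_eq)
    have Jn: "J v" if "sreg v ''i'' = Suc i" "sarr v ''top'' = (if i \<in> stops then (sarr t ''top'')(i := i + 1) else sarr t ''top'')" for v
      using that i unfolding J_def that(1) new by simp
    obtain r where r: "nN - i = Suc r" using i by (metis Suc_diff_Suc)
    then have r': "nN - Suc i = r" by simp
    consider "i = rt" | "i \<noteq> rt" "1 < sarr t ''cnt'' (par i)" | "i \<noteq> rt" "\<not> 1 < sarr t ''cnt'' (par i)" by blast
    then show "wp ?b (\<lambda>k u. J u \<and> k + 1 + rcost (Less (Reg ''i'') (Reg ''nodes'')) + 30 * (nN - sreg u ''i'') \<le> 30 * (nN - sreg t ''i'')) t"
      by cases (use okt st r r' in \<open>simp_all add: wp_simps input_ok_def i_def[symmetric] Jn\<close>)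
  next
    fix k u assume J: "J u" and ag: "agree ?b ?s u" and ge: "rval u (Less (Reg ''i'') (Reg ''nodes'')) = 0"
      and k: "k + 30 * (nN - sreg u ''i'') \<le> 30 * (nN - sreg ?s ''i'') + 1 + rcost (Less (Reg ''i'') (Reg ''nodes''))"
    have oku: "input_ok u" using ok ag by (simp add: input_ok_def agree_def)
    then have "sreg u ''i'' = nN" using J ge by (simp add: J_def input_ok_def)
    then have "sarr u ''top'' = (\<lambda>y. if y \<in> stops then y + 1 else 0)"
      using J by (auto simp: J_def fun_eq_iff stops_def)
    then show "input_ok u \<and> sarr u ''top'' = (\<lambda>y. if y \<in> stops then y + 1 else 0) \<and> k + 2 \<le> 40 * (nN + 1)"
      using oku k by simp
  qed
  then show ?thesis unfolding top_init_def wp_Seq wp_Assign by (simp add: add.commute)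
qed

text \<open>\<open>C z\<close> is the set of edges recorded at \<open>z\<close> so far. Beyond four
  edges only their number is kept, as longer lists are truncated; and nodes that are no stops are
  never visited.\<close>

definition rec_ok :: "rstate \<Rightarrow> (nat \<Rightarrow> nat set) \<Rightarrow> bool" where
  "rec_ok t C \<longleftrightarrow> (\<forall>z. z \<notin> stops \<longrightarrow> sarr t ''rec'' z = 0) \<and> (\<forall>z\<in>stops. finite (C z) \<and> sarr t ''rec'' z = card (C z) \<and>
     (sarr t ''rec'' z \<le> 4 \<longrightarrow> (\<lambda>j. sarr t ''E'' (4 * z + j)) ` {..<sarr t ''rec'' z} = C z))"

lemma record_edge:
  assumes R: "rec_ok t C" and z: "sreg t ''z'' \<in> stops" and e: "sreg t ''e'' \<notin> C (sreg t ''z'')"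
  shows "wp record_edge (\<lambda>k u. rec_ok u (C(sreg t ''z'' := insert (sreg t ''e'') (C (sreg t ''z'')))) \<and> k \<le> 30 \<and>
    sarr u ''rec'' = (sarr t ''rec'')(sreg t ''z'' := Suc (sarr t ''rec'' (sreg t ''z'')))) t"
proof -
  define z where "z = sreg t ''z''"
  define e where "e = sreg t ''e''"
  define r where "r = sarr t ''rec'' z"
  have zs: "z \<in> stops" and eC: "e \<notin> C z" using z e by (simp_all add: z_def e_def)
  have Cz: "finite (C z)" "r = card (C z)" "r \<le> 4 \<Longrightarrow> (\<lambda>j. sarr t ''E'' (4 * z + j)) ` {..<r} = C z"
    using R zs unfolding rec_ok_def r_def by blast+
  have main: "rec_ok u (C(z := insert e (C z)))"
    if rec: "sarr u ''rec'' = (sarr t ''rec'')(z := Suc r)"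
      and E: "sarr u ''E'' = (if r < 4 then (sarr t ''E'')(4 * z + r := e) else sarr t ''E'')" for u
    unfolding rec_ok_def
  proof (intro conjI allI ballI impI)
    fix x assume "x \<notin> stops"
    then show "sarr u ''rec'' x = 0" using R zs rec by (auto simp: rec_ok_def)
  next
    fix x assume x: "x \<in> stops"
    then show "finite ((C(z := insert e (C z))) x)" using R Cz by (auto simp: rec_ok_def)
    show "sarr u ''rec'' x = card ((C(z := insert e (C z))) x)" using R x Cz eC rec by (auto simp: rec_ok_def)
    assume le: "sarr u ''rec'' x \<le> 4"
    show "(\<lambda>j. sarr u ''E'' (4 * x + j)) ` {..<sarr u ''rec'' x} = (C(z := insert e (C z))) x"
    proof (cases "x = z")
      case True
      then have r4: "r < 4" using le rec by simp
      have "(\<lambda>j. sarr u ''E'' (4 * z + j)) ` {..<Suc r} = insert e ((\<lambda>j. sarr t ''E'' (4 * z + j)) ` {..<r})"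
        unfolding lessThan_Suc image_insert using E r4 by auto
      then show ?thesis using True rec Cz(3) r4 by simp
    next
      case False
      then have rx: "sarr u ''rec'' x = sarr t ''rec'' x" using rec by simp
      have "sarr u ''E'' (4 * x + j) = sarr t ''E'' (4 * x + j)" if "j < sarr t ''rec'' x" for j
      proof -
        have "j < 4" using that le rx by simp
        then have "4 * x + j \<noteq> 4 * z + r" if "r < 4" using False that by presburger
        then show ?thesis using E by auto
      qed
      then have "(\<lambda>j. sarr u ''E'' (4 * x + j)) ` {..<sarr t ''rec'' x} = (\<lambda>j. sarr t ''E'' (4 * x + j)) ` {..<sarr t ''rec'' x}"
        by (intro image_cong) auto
      moreover have "(\<lambda>j. sarr t ''E'' (4 * x + j)) ` {..<sarr t ''rec'' x} = C x"
        using R x le unfolding rx rec_ok_def by blast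
      ultimately show ?thesis using rx False by simp
    qed
  qed
  have idx: "z + z + (z + z) + r = 4 * z + r" by simp
  show ?thesis
  proof (cases "r < 4")
    case True
    then show ?thesis
      unfolding record_edge_def wp_simps z_def[symmetric] e_def[symmetric]
      by (simp add: z_def[symmetric] e_def[symmetric] r_def[symmetric]) (rule main; simp add: idx)
  next
    case False
    then show ?thesis
      unfolding record_edge_def wp_simps z_def[symmetric] e_def[symmetric]
      by (simp add: z_def[symmetric] e_def[symmetric] r_def[symmetric]) (rule main; simp)
  qed
qed

text \<open>The number of records still to be made over all edges. It is the potential shared by all
  walks, since every move makes one record.\<close>

definition slack :: "rstate \<Rightarrow> nat" where
  "slack t = (\<Sum>z\<in>stops. adhesion G D z - sarr t ''rec'' z)"

lemma finite_stops: "finite stops"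
  by (simp add: stops_def)

lemma slack_update:
  assumes "z \<in> stops" "sarr t ''rec'' z < adhesion G D z"
    "sarr u ''rec'' = (sarr t ''rec'')(z := Suc (sarr t ''rec'' z))"
  shows "Suc (slack u) = slack t"
proof -
  have "slack u = (adhesion G D z - Suc (sarr t ''rec'' z)) + (\<Sum>x\<in>stops - {z}. adhesion G D x - sarr t ''rec'' x)"
    unfolding slack_def by (subst sum.remove[OF finite_stops assms(1)]) (simp add: assms(3))
  moreover have "slack t = (adhesion G D z - sarr t ''rec'' z) + (\<Sum>x\<in>stops - {z}. adhesion G D x - sarr t ''rec'' x)"
    unfolding slack_def by (rule sum.remove[OF finite_stops assms(1)])
  ultimately show ?thesis using assms(2) by simp
qed


text \<open>The stops on the two paths that have been left behind, where \<open>x\<close> and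
  \<open>y\<close> are the current nodes of the walks from \<open>u\<close> and
  \<open>v\<close>.\<close>

definition vis :: "nat \<Rightarrow> nat \<Rightarrow> nat \<Rightarrow> nat \<Rightarrow> nat set" where
  "vis u v x y = {z \<in> stops. (anc (node_of u) z \<and> \<not> anc x z) \<or> (anc (node_of v) z \<and> \<not> anc y z)}"

text \<open>The state of one of the two walks. That the remembered child \<open>p - 1\<close> is not
  above the other end makes the two remembered children distinct when the walks meet.\<close>

definition side :: "nat \<Rightarrow> nat \<Rightarrow> nat \<Rightarrow> nat \<Rightarrow> bool" where
  "side w w' x p \<longleftrightarrow> x < nN \<and> anc (node_of w) x \<and>
     (if p = 0 then x = node_of w
      else p - 1 < nN \<and> p - 1 \<noteq> rt \<and> par (p - 1) = x \<and> anc (node_of w) (p - 1) \<and> \<not> anc (node_of w') (p - 1))"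

text \<open>No common ancestor of the two ends has been left behind, so the walks can only meet at
  the lowest one.\<close>

definition common :: "nat \<Rightarrow> nat \<Rightarrow> nat \<Rightarrow> nat \<Rightarrow> bool" where
  "common u v x y \<longleftrightarrow> (\<forall>a. anc (node_of u) a \<longrightarrow> anc (node_of v) a \<longrightarrow> anc x a \<and> anc y a)"

lemma vis_sym: "vis v u y x = vis u v x y"
  by (auto simp: vis_def)

lemma common_sym: "common v u y x \<longleftrightarrow> common u v x y"
  by (auto simp: common_def)

lemma node_anc_root: "t < nN \<Longrightarrow> anc t rt"
  using to_root[of t] nodes_eq root_eq by simp

text \<open>One move, freed from machine states. As \<open>x\<close> is not above the end
  \<open>v\<close>, no node of its chain is, since they all share the same \<open>below\<close>.
  Hence \<open>z\<close> separates the ends, and jumping past the chain leaves no common ancestor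
  behind.\<close>

lemma move_pure:
  assumes top: "top_ok tops" and u: "u < nV" and v: "v < nV" and sd: "side u v x p" and cm: "common u v x y"
    and nx: "\<not> anc (node_of v) x" and z: "z = tops x - 1"
  shows "z \<in> stops" "z \<noteq> rt" "z < nN" "tops x = Suc z" "z \<notin> vis u v x y" "vis u v (par z) y = insert z (vis u v x y)"
    "side u v (par z) (Suc z)" "common u v (par z) y" "u \<in> below D z" "v \<notin> below D z"
proof -
  have x: "x < nN" "anc (node_of u) x" using sd by (simp_all add: side_def)
  have ux: "u \<in> below D x" using mem_below_anc[OF u] x by simp
  have vx: "v \<notin> below D x" using mem_below_anc[OF v] nx by simp
  have "below D x \<noteq> {}" using ux by blast
  note tp = top_path[OF top x(1) this, folded z]
  show zs: "z \<in> stops" and tz: "tops x = Suc z" using tp by simp_all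
  have xz: "anc x z" and bz: "below D z = below D x" using tp by simp_all
  have path: "a \<notin> stops" "below D a = below D x" if "anc x a" "\<not> anc z a" for a using tp that by blast+
  show zn: "z < nN" using zs by (simp add: stops_def)
  show uz: "u \<in> below D z" and vz: "v \<notin> below D z" using ux vx bz by simp_all
  have auz: "anc (node_of u) z" and avz: "\<not> anc (node_of v) z"
    using uz vz mem_below_anc[OF u] mem_below_anc[OF v] by simp_all
  show zr: "z \<noteq> rt" using avz node_anc_root[OF node_of_less[OF v]] by auto
  have pz: "anc z a \<longleftrightarrow> a = z \<or> anc (par z) a" for a using anc_unfold[OF zn] zr by blast
  have npz: "\<not> anc (par z) z"
  proof
    assume "anc (par z) z"
    moreover have "anc z (par z)" using pz by blast
    ultimately have "z = par z" by (rule anc_antisym[rotated])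
    moreover have "level D z = Suc (level D (par z))" using level_parent[of z] zn zr par_eq[OF zn zr] nodes_eq root_eq by simp
    ultimately show False by simp
  qed
  have xiff: "anc x a \<longleftrightarrow> a = z \<or> anc (par z) a" if "a \<in> stops" for a
  proof
    assume "anc x a"
    then have "anc z a" using path(1) that by blast
    then show "a = z \<or> anc (par z) a" using pz by blast
  next
    assume "a = z \<or> anc (par z) a"
    then have "anc z a" using pz by blast
    then show "anc x a" using xz by (rule rtrancl_trans[rotated])
  qed
  show "z \<notin> vis u v x y" using xz avz by (simp add: vis_def)
  show "vis u v (par z) y = insert z (vis u v x y)"
    using xiff zs auz npz by (auto simp: vis_def)
  have "anc (node_of u) (par z)" using auz pz by (blast intro: rtrancl_trans)
  then show "side u v (par z) (Suc z)" using zn zr auz avz par_less[OF zn zr] by (simp add: side_def)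
  show "common u v (par z) y"
    unfolding common_def
  proof (intro allI impI)
    fix a assume a: "anc (node_of u) a" "anc (node_of v) a"
    then have xa: "anc x a" "anc y a" using cm by (auto simp: common_def)
    have "v \<in> below D a" using a mem_below_anc[OF v] by simp
    then have "anc z a" using path(2)[OF xa(1)] vx by blast
    moreover have "a \<noteq> z" using a avz by blast
    ultimately show "anc (par z) a \<and> anc y a" using pz xa by blast
  qed
qed

text \<open>The two siblings joined by an edge, in the orientation of its stored ends. The
  decomposition is a parameter because the pairs have to be followed through the merges.\<close>

definition sib_pair :: "(nat, nat) tcdecomp \<Rightarrow> nat \<Rightarrow> nat \<Rightarrow> nat \<Rightarrow> bool" where
  "sib_pair D' e c c' \<longleftrightarrow> c \<in> tnodes D' - {troot D'} \<and> c' \<in> tnodes D' - {troot D'} \<and> c \<noteq> c' \<and>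
     tparent D' c = tparent D' c' \<and> fstend e \<in> below D' c \<and> sndend e \<in> below D' c'"

lemma siblings_no_common:
  assumes "c < nN" "c \<noteq> rt" "c' < nN" "c' \<noteq> rt" "c \<noteq> c'" "par c = par c'" "anc t c" "anc t c'" "t < nN"
  shows False
proof -
  have "c \<in> tchildren D (par c)" "c' \<in> tchildren D (par c)"
    using assms children_iff[OF par_less[OF assms(1,2)]] by auto
  then have "descendants D c \<inter> descendants D c' = {}" using descendants_children_disjoint assms(5) by blast
  moreover have "t \<in> descendants D c \<inter> descendants D c'" using assms nodes_eq by (simp add: mem_descendants)
  ultimately show False by blast
qed

lemma sib_pair_iff:
  assumes "e < nE"
  shows "sib_pair D e c c' \<longleftrightarrow> c < nN \<and> c \<noteq> rt \<and> c' < nN \<and> c' \<noteq> rt \<and> c \<noteq> c' \<and> par c = par c' \<and>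
    anc (node_of (fstend e)) c \<and> anc (node_of (sndend e)) c'"
  using par_eq[of c] par_eq[of c'] mem_below_anc edge_ends[OF assms] nodes_eq root_eq
  unfolding sib_pair_def by auto

text \<open>Both \<open>c'\<close> and the node of \<open>w\<close> are ancestors of the node of
  \<open>w'\<close>, hence comparable. Either order gives \<open>c\<close> and \<open>c'\<close> a
  common descendant.\<close>

lemma no_pair_at_end:
  assumes "w < nV" "w' < nV" "anc (node_of w') (node_of w)"
    and c: "c < nN" "c \<noteq> rt" "c' < nN" "c' \<noteq> rt" "c \<noteq> c'" "par c = par c'" "anc (node_of w) c" "anc (node_of w') c'"
  shows False
proof -
  from anc_linear[OF assms(3) c(8)] show False
  proof
    assume "anc (node_of w) c'"
    then show False using siblings_no_common[OF c(1-7)] node_of_less[OF assms(1)] by blast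
  next
    assume "anc c' (node_of w)"
    then have "anc c' c" using c(7) by (rule rtrancl_trans)
    then show False using siblings_no_common[OF c(1-6), of c'] c(3) by blast
  qed
qed

text \<open>Two candidates above the same end are comparable. If they differ, the upper one contains
  the parent of the lower one and thus also its sibling, so it is above both ends of the edge, which
  contradicts the role of its own sibling.\<close>

lemma sib_pair_unique:
  assumes e: "e < nE" and s: "sib_pair D e c c'" "sib_pair D e d d'"
  shows "c = d \<and> c' = d'"
proof -
  note i = s[unfolded sib_pair_iff[OF e]]
  have eq: "c = d" if "anc (node_of w) c" "anc (node_of w) d" "c < nN" "c \<noteq> rt" "c' < nN" "c' \<noteq> rt" "c \<noteq> c'" "par c = par c'"
    "d < nN" "d \<noteq> rt" "d' < nN" "d' \<noteq> rt" "d \<noteq> d'" "par d = par d'" "anc (node_of w') c'" "anc (node_of w') d'" "w < nV" "w' < nV"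
    for w w' c c' d d'
  proof (rule ccontr)
    assume ne: "c \<noteq> d"
    have *: False if "anc c d" "c \<noteq> d" "c < nN" "c \<noteq> rt" "c' < nN" "c' \<noteq> rt" "par c = par c'" "d < nN" "d \<noteq> rt" "d' < nN" "d' \<noteq> rt"
      "d \<noteq> d'" "par d = par d'" "anc (node_of w') c'" "anc (node_of w') d'" for c c' d d'
    proof -
      have "anc (par c) d" using anc_unfold[OF that(3), of d] that(1,2) by auto
      then have "anc c' d" using anc_unfold[OF that(5), of d] that(6,7) by auto
      then have "anc (node_of w') d" using that(14) by (rule rtrancl_trans[rotated])
      then show False using siblings_no_common[OF that(8-13) _ that(15)] node_of_less[OF \<open>w' < nV\<close>] by blast
    qed
    from anc_linear[OF that(1,2)] show False
      using *[of c d c' d'] *[of d c d' c'] ne that by metis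
  qed
  have "c = d" by (rule eq[of "fstend e" c d c' d' "sndend e"]) (use i edge_ends[OF e] in simp_all)
  moreover have "c' = d'" by (rule eq[of "sndend e" c' d' c d "fstend e"]) (use i edge_ends[OF e] in simp_all)
  ultimately show ?thesis by simp
qed

text \<open>Two nonempty children make their parent non-passing. Jumping over chains therefore never
  hides a sibling pair, and \<open>rec\<close> is maintained for both of its members.\<close>

lemma sib_pair_stops:
  assumes e: "e < nE" and s: "sib_pair D e c c'"
  shows "c \<in> stops" "c' \<in> stops"
proof -
  note i = s[unfolded sib_pair_iff[OF e]]
  let ?p = "par c" and ?N = "{x \<in> tchildren D (par c). below D x \<noteq> {}}"
  have pn: "?p < nN" using par_less i by blast
  have "below D c \<noteq> {}" "below D c' \<noteq> {}" using s by (auto simp: sib_pair_def)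
  then have "{c, c'} \<subseteq> ?N" using i children_iff[OF pn] by auto
  then have "card {c, c'} \<le> card ?N" using finite_children by (intro card_mono) auto
  then have "2 \<le> card ?N" using i by simp
  then have np: "\<not> passing ?p" by (simp add: passing_def)
  show "c \<in> stops" using i np by (simp add: stops_def)
  show "c' \<in> stops" using i np by (simp add: stops_def)
qed

definition AB_ok :: "(nat, nat) tcdecomp \<Rightarrow> nat \<Rightarrow> (nat \<Rightarrow> nat) \<Rightarrow> (nat \<Rightarrow> nat) \<Rightarrow> bool" where
  "AB_ok D' i A B \<longleftrightarrow> (\<forall>e<i. (\<forall>c c'. sib_pair D' e c c' \<longrightarrow> A e = Suc c \<and> B e = Suc c') \<and>
     (A e = 0 \<and> B e = 0 \<or> (\<exists>c c'. sib_pair D' e c c' \<and> A e = Suc c \<and> B e = Suc c')))"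

text \<open>If both ends have moved, the remembered nodes are distinct children of the meeting node.
  If one has not, the meeting node is its own node, which lies above the other end.\<close>

lemma walk_end:
  assumes e: "e < nE" and s: "side (fstend e) (sndend e) x p" "side (sndend e) (fstend e) x q"
  shows "p \<noteq> 0 \<Longrightarrow> q \<noteq> 0 \<Longrightarrow> sib_pair D e (p - 1) (q - 1)"
    and "p = 0 \<or> q = 0 \<Longrightarrow> \<not> sib_pair D e c c'"
proof -
  show "sib_pair D e (p - 1) (q - 1)" if "p \<noteq> 0" "q \<noteq> 0"
  proof -
    have "p - 1 < nN \<and> p - 1 \<noteq> rt \<and> par (p - 1) = x \<and> anc (node_of (fstend e)) (p - 1) \<and> \<not> anc (node_of (sndend e)) (p - 1)"
      "q - 1 < nN \<and> q - 1 \<noteq> rt \<and> par (q - 1) = x \<and> anc (node_of (sndend e)) (q - 1)"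
      using s that unfolding side_def by simp_all
    then show ?thesis unfolding sib_pair_iff[OF e] by metis
  qed
  assume pq: "p = 0 \<or> q = 0"
  show "\<not> sib_pair D e c c'"
  proof
    assume "sib_pair D e c c'"
    note i = this[unfolded sib_pair_iff[OF e]]
    show False
    proof (cases "p = 0")
      case True
      then have "anc (node_of (sndend e)) (node_of (fstend e))" using s by (simp add: side_def)
      then show False by (rule no_pair_at_end[of "fstend e" "sndend e" c c', rotated 2]) (use i edge_ends[OF e] in simp_all)
    next
      case False
      then have "anc (node_of (fstend e)) (node_of (sndend e))" using s pq by (simp add: side_def)
      then show False by (rule no_pair_at_end[of "sndend e" "fstend e" c' c, rotated 2]) (use i edge_ends[OF e] in simp_all)
    qed
  qed
qed

lemma rec_ok_sreg: "rec_ok (u\<lparr>sreg := r\<rparr>) C \<longleftrightarrow> rec_ok u C"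
  by (simp add: rec_ok_def)

lemma move:
  assumes R: "rec_ok t C" and tz: "sarr t ''top'' (sreg t xr) = Suc z" and z: "z \<in> stops" "sreg t ''e'' \<notin> C z"
    and par: "sarr t ''parent'' = par" and r: "xr \<notin> {''z'', ''e''}" "pr \<notin> {''z'', ''e''}" "xr \<noteq> pr"
  shows "wp (move xr pr) (\<lambda>k u. rec_ok u (C(z := insert (sreg t ''e'') (C z))) \<and>
    sarr u ''rec'' = (sarr t ''rec'')(z := Suc (sarr t ''rec'' z)) \<and> sreg u xr = par z \<and> sreg u pr = Suc z \<and>
    k \<le> 45) t"
proof -
  have main: "wp record_edge (\<lambda>k u. rec_ok u (C(z := insert (sreg t ''e'') (C z))) \<and> k \<le> 30 \<and>
    sarr u ''rec'' = (sarr t ''rec'')(z := Suc (sarr t ''rec'' z)) \<and> sreg u xr = sreg t xr \<and> sreg u ''z'' = z \<and>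
    sarr u ''top'' = sarr t ''top'' \<and> sarr u ''parent'' = par) t'"
    if t': "sreg t' = (sreg t)(''z'' := z)" "sarr t' = sarr t" for t'
  proof (rule wp_frame[OF record_edge[where C = C and t = t']])
    show "rec_ok t' C" using R unfolding rec_ok_def t'(2) .
    show "sreg t' ''z'' \<in> stops" "sreg t' ''e'' \<notin> C (sreg t' ''z'')" using z t' by simp_all
    fix k u assume u: "rec_ok u (C(sreg t' ''z'' := insert (sreg t' ''e'') (C (sreg t' ''z'')))) \<and> k \<le> 30 \<and>
      sarr u ''rec'' = (sarr t' ''rec'')(sreg t' ''z'' := Suc (sarr t' ''rec'' (sreg t' ''z'')))" and ag: "agree record_edge t' u"
    have regs: "sreg u = sreg t'" and arrs: "sarr u ''top'' = sarr t' ''top''" "sarr u ''parent'' = sarr t' ''parent''"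
      using ag by (simp_all add: agree_def record_edge_def fun_eq_iff)
    have t'z: "sreg t' ''z'' = z" "sreg t' ''e'' = sreg t ''e''" "sarr t' ''rec'' = sarr t ''rec''" "sreg t' xr = sreg t xr"
      using r by (simp_all add: t')
    show "rec_ok u (C(z := insert (sreg t ''e'') (C z))) \<and> k \<le> 30 \<and>
      sarr u ''rec'' = (sarr t ''rec'')(z := Suc (sarr t ''rec'' z)) \<and> sreg u xr = sreg t xr \<and> sreg u ''z'' = z \<and>
      sarr u ''top'' = sarr t ''top'' \<and> sarr u ''parent'' = par"
      using u unfolding t'z regs arrs t'(2) par by blast
  qed
  show ?thesis
    unfolding move_def wp_simps
    apply (rule wp_mono[OF main])
      apply (use tz in simp_all)[2]
    apply (use tz r in \<open>auto simp: rec_ok_sreg\<close>)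
    done
qed

text \<open>The records while edge \<open>e\<close> is being processed: complete for earlier edges,
  and restricted to the visited stops \<open>V\<close> for \<open>e\<close> itself.\<close>

definition edge_sets :: "nat \<Rightarrow> nat set \<Rightarrow> nat \<Rightarrow> nat set" where
  "edge_sets e V z = {e'. e' < e \<and> cross e' z} \<union> (if z \<in> V then {e} else {})"

lemma edge_sets_insert: "z \<notin> V \<Longrightarrow> (edge_sets e V)(z := insert e (edge_sets e V z)) = edge_sets e (insert z V)"
  by (auto simp: edge_sets_def fun_eq_iff)

lemma edge_sets_fresh: "z \<notin> V \<Longrightarrow> e \<notin> edge_sets e V z"
  by (simp add: edge_sets_def)

text \<open>The edge about to be recorded is still missing. This makes the truncated difference in
  \<open>slack\<close> positive, so that it really drops.\<close>

lemma rec_less_adhesion: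
  assumes R: "rec_ok t (edge_sets e V)" and z: "z \<in> stops" "z \<notin> V" "cross e z" "e < nE"
  shows "sarr t ''rec'' z < adhesion G D z"
proof -
  have "sarr t ''rec'' z = card (edge_sets e V z)" using R z(1) unfolding rec_ok_def by blast
  also have "\<dots> < card {e. e < nE \<and> cross e z}"
  proof (rule psubset_card_mono)
    show "edge_sets e V z \<subset> {e. e < nE \<and> cross e z}" using z by (auto simp: edge_sets_def)
  qed simp
  finally show ?thesis unfolding adhesion_card .
qed

definition walk_inv :: "nat \<Rightarrow> rstate \<Rightarrow> bool" where
  "walk_inv e t \<longleftrightarrow> rec_ok t (edge_sets e (vis (fstend e) (sndend e) (sreg t ''x'') (sreg t ''y''))) \<and>
     side (fstend e) (sndend e) (sreg t ''x'') (sreg t ''p'') \<and> side (sndend e) (fstend e) (sreg t ''y'') (sreg t ''q'') \<and>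
     common (fstend e) (sndend e) (sreg t ''x'') (sreg t ''y'')"

text \<open>At the meeting node, being above \<open>x\<close> and being above both ends are the
  same. So the stops left behind are exactly those above one end only.\<close>

lemma vis_end:
  assumes e: "e < nE" and s: "side (fstend e) (sndend e) x p" "side (sndend e) (fstend e) x q"
    and cm: "common (fstend e) (sndend e) x x" and z: "z \<in> stops"
  shows "z \<in> vis (fstend e) (sndend e) x x \<longleftrightarrow> cross e z"
proof -
  have m: "fstend e \<in> below D z \<longleftrightarrow> anc (node_of (fstend e)) z" "sndend e \<in> below D z \<longleftrightarrow> anc (node_of (sndend e)) z"
    using mem_below_anc edge_ends[OF e] by auto
  have x: "anc (node_of (fstend e)) x" "anc (node_of (sndend e)) x" using s by (simp_all add: side_def)
  have 1: "anc x z \<Longrightarrow> anc (node_of (fstend e)) z \<and> anc (node_of (sndend e)) z"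
    using x by (blast intro: rtrancl_trans)
  have 2: "anc (node_of (fstend e)) z \<Longrightarrow> anc (node_of (sndend e)) z \<Longrightarrow> anc x z"
    using cm unfolding common_def by blast
  show ?thesis unfolding cross_def m vis_def using z 1 2 by blast
qed

lemma walk:
  assumes W: "walk_inv e t" and e: "e < nE" "sreg t ''e'' = e" and ok: "input_ok t"
    and top: "top_ok (sarr t ''top'')" and dep: "dep_ok (sarr t ''dep'')"
  shows "wp walk (\<lambda>k u. sreg u ''x'' = sreg u ''y'' \<and> walk_inv e u \<and> k + 60 * slack u \<le> 60 * slack t + 6) t"
proof -
  let ?b = "Cond (Less (Load ''dep'' (Reg ''x'')) (Load ''dep'' (Reg ''y''))) (move ''y'' ''q'') (move ''x'' ''p'')"
  note ends = edge_ends[OF e(1)]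
  show ?thesis
    unfolding walk_def
  proof (rule wp_Loop[where I = "walk_inv e" and \<phi> = "\<lambda>u. 60 * slack u", OF W])
    fix s assume I: "walk_inv e s" and ag: "agree ?b t s" and ne: "rval s (Equal (Equal (Reg ''x'') (Reg ''y'')) (Const 0)) \<noteq> 0"
    have regs: "sreg s ''e'' = e" "sarr s ''top'' = sarr t ''top''" "sarr s ''dep'' = sarr t ''dep''" "sarr s ''parent'' = par"
      using ag e ok by (simp_all add: agree_def move_def record_edge_def input_ok_def)
    define x y p q where "x = sreg s ''x''" and "y = sreg s ''y''" and "p = sreg s ''p''" and "q = sreg s ''q''"
    have xy: "x \<noteq> y" using ne by (simp add: x_def y_def)
    have R: "rec_ok s (edge_sets e (vis (fstend e) (sndend e) x y))" and sx: "side (fstend e) (sndend e) x p"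
      and sy: "side (sndend e) (fstend e) y q" and cm: "common (fstend e) (sndend e) x y"
      using I unfolding walk_inv_def x_def y_def p_def q_def by - (elim conjE, assumption)+
    have xn: "x < nN" "anc (node_of (fstend e)) x" and yn: "y < nN" "anc (node_of (sndend e)) y"
      using sx sy by (simp_all add: side_def)
    show "wp ?b (\<lambda>k u. walk_inv e u \<and> k + 1 + rcost (Equal (Equal (Reg ''x'') (Reg ''y'')) (Const 0)) + 60 * slack u \<le> 60 * slack s) s"
    proof (cases "sarr t ''dep'' x < sarr t ''dep'' y")
      case True
      define z where "z = sarr t ''top'' y - 1"
      \<comment> \<open>If \<open>y\<close> were above the other end as well, \<open>common\<close>
        would place it above \<open>x\<close>, and it could not be deeper than
        \<open>x\<close>.\<close>
      have nu: "\<not> anc (node_of (fstend e)) y"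
      proof
        assume "anc (node_of (fstend e)) y"
        then have "anc x y" using cm yn unfolding common_def by blast
        then show False using dep_anc[OF dep _ xn(1) xy] True by fastforce
      qed
      have cm': "common (sndend e) (fstend e) y x" using cm common_sym by blast
      note mv = move_pure[OF top ends(2,1) sy cm' nu z_def]
      note mv' = mv[unfolded vis_sym[of "sndend e" "fstend e"]]
      have cr: "cross e z" using mv(9,10) by (simp add: cross_def)
      have "wp (move ''y'' ''q'') (\<lambda>(k::nat) u. walk_inv e u \<and> k + 15 + 60 * slack u \<le> 60 * slack s) s"
      proof (rule wp_frame[OF move[OF R]])
        show "sarr s ''top'' (sreg s ''y'') = Suc z" using mv(4) regs by (simp add: y_def)
        show "sreg s ''e'' \<notin> edge_sets e (vis (fstend e) (sndend e) x y) z" using edge_sets_fresh mv'(5) regs by simp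
        fix k :: nat and u assume u: "rec_ok u ((edge_sets e (vis (fstend e) (sndend e) x y))(z := insert (sreg s ''e'') (edge_sets e (vis (fstend e) (sndend e) x y) z))) \<and>
          sarr u ''rec'' = (sarr s ''rec'')(z := Suc (sarr s ''rec'' z)) \<and> sreg u ''y'' = par z \<and> sreg u ''q'' = Suc z \<and> k \<le> 45"
          and ag: "agree (move ''y'' ''q'') s u"
        have ur: "sreg u ''x'' = x" "sreg u ''p'' = p" using ag by (simp_all add: agree_def move_def record_edge_def x_def p_def)
        have "rec_ok u (edge_sets e (vis (fstend e) (sndend e) x (par z)))"
          using u unfolding mv'(6) regs(1) edge_sets_insert[OF mv'(5)] by blast
        then have "walk_inv e u" using ur u sx mv(7) mv(8) common_sym by (simp add: walk_inv_def)
        moreover have "Suc (slack u) = slack s"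
          by (rule slack_update[OF mv(1) rec_less_adhesion[OF R mv(1) mv'(5) cr e(1)]]) (use u in blast)
        ultimately show "walk_inv e u \<and> k + 15 + 60 * slack u \<le> 60 * slack s" using u by auto
      qed (use mv regs in auto)
      then show ?thesis
        unfolding wp_Cond using True regs by (simp add: x_def y_def) (erule wp_mono, simp)
    next
      case False
      define z where "z = sarr t ''top'' x - 1"
      have nv: "\<not> anc (node_of (sndend e)) x"
      proof
        assume "anc (node_of (sndend e)) x"
        then have "anc y x" using cm xn unfolding common_def by blast
        then show False using dep_anc[OF dep _ yn(1)] xy False by fastforce
      qed
      note mv = move_pure[OF top ends(1,2) sx cm nv z_def]
      have cr: "cross e z" using mv(9,10) by (simp add: cross_def)
      have "wp (move ''x'' ''p'') (\<lambda>(k::nat) u. walk_inv e u \<and> k + 15 + 60 * slack u \<le> 60 * slack s) s"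
      proof (rule wp_frame[OF move[OF R]])
        show "sarr s ''top'' (sreg s ''x'') = Suc z" using mv(4) regs by (simp add: x_def)
        show "sreg s ''e'' \<notin> edge_sets e (vis (fstend e) (sndend e) x y) z" using edge_sets_fresh mv(5) regs by simp
        fix k :: nat and u assume u: "rec_ok u ((edge_sets e (vis (fstend e) (sndend e) x y))(z := insert (sreg s ''e'') (edge_sets e (vis (fstend e) (sndend e) x y) z))) \<and>
          sarr u ''rec'' = (sarr s ''rec'')(z := Suc (sarr s ''rec'' z)) \<and> sreg u ''x'' = par z \<and> sreg u ''p'' = Suc z \<and> k \<le> 45"
          and ag: "agree (move ''x'' ''p'') s u"
        have ur: "sreg u ''y'' = y" "sreg u ''q'' = q" using ag by (simp_all add: agree_def move_def record_edge_def y_def q_def)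
        have "rec_ok u (edge_sets e (vis (fstend e) (sndend e) (par z) y))"
          using u unfolding mv(6) regs(1) edge_sets_insert[OF mv(5)] by blast
        then have "walk_inv e u" using ur u sy mv(7) mv(8) by (simp add: walk_inv_def)
        moreover have "Suc (slack u) = slack s"
          by (rule slack_update[OF mv(1) rec_less_adhesion[OF R mv(1) mv(5) cr e(1)]]) (use u in blast)
        ultimately show "walk_inv e u \<and> k + 15 + 60 * slack u \<le> 60 * slack s" using u by auto
      qed (use mv regs in auto)
      then show ?thesis
        unfolding wp_Cond using False regs by (simp add: x_def y_def) (erule wp_mono, simp)
    qed
  next
    fix k u assume "walk_inv e u" "rval u (Equal (Equal (Reg ''x'') (Reg ''y'')) (Const 0)) = 0"
      "k + 60 * slack u \<le> 60 * slack t + 1 + rcost (Equal (Equal (Reg ''x'') (Reg ''y'')) (Const 0))"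
    then show "sreg u ''x'' = sreg u ''y'' \<and> walk_inv e u \<and> k + 60 * slack u \<le> 60 * slack t + 6"
      by (simp split: if_splits)
  qed
qed


lemma rec_ok_cong:
  assumes eq: "\<And>z. z \<in> stops \<Longrightarrow> C z = C' z" and R: "rec_ok t C"
  shows "rec_ok t C'"
  unfolding rec_ok_def
proof (intro conjI ballI)
  show "\<forall>z. z \<notin> stops \<longrightarrow> sarr t ''rec'' z = 0" using R unfolding rec_ok_def by (rule conjunct1)
  fix z assume z: "z \<in> stops"
  have "finite (C z) \<and> sarr t ''rec'' z = card (C z) \<and>
     (sarr t ''rec'' z \<le> 4 \<longrightarrow> (\<lambda>j. sarr t ''E'' (4 * z + j)) ` {..<sarr t ''rec'' z} = C z)"
    using conjunct2[OF R[unfolded rec_ok_def]] z by (rule bspec)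
  then show "finite (C' z)" "sarr t ''rec'' z = card (C' z)"
     "sarr t ''rec'' z \<le> 4 \<longrightarrow> (\<lambda>j. sarr t ''E'' (4 * z + j)) ` {..<sarr t ''rec'' z} = C' z"
    unfolding eq[OF z] by blast+
qed

lemma AB_ok_Suc:
  assumes "AB_ok D' i A B" "A' = A \<and> B' = B \<and> A i = 0 \<and> B i = 0 \<and> (\<forall>c c'. \<not> sib_pair D' i c c') \<or>
    A' = A(i := Suc c) \<and> B' = B(i := Suc c') \<and> sib_pair D' i c c' \<and> (\<forall>d d'. sib_pair D' i d d' \<longrightarrow> d = c \<and> d' = c')"
  shows "AB_ok D' (Suc i) A' B'"
  unfolding AB_ok_def
proof (intro allI impI)
  fix e assume e: "e < Suc i"
  show "(\<forall>c c'. sib_pair D' e c c' \<longrightarrow> A' e = Suc c \<and> B' e = Suc c') \<and>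
     (A' e = 0 \<and> B' e = 0 \<or> (\<exists>c c'. sib_pair D' e c c' \<and> A' e = Suc c \<and> B' e = Suc c'))"
  proof (cases "e = i")
    case True
    from assms(2) show ?thesis
    proof (elim disjE conjE)
      assume "A' = A" "B' = B" "A i = 0" "B i = 0" "\<forall>c c'. \<not> sib_pair D' i c c'"
      then show ?thesis unfolding True by blast
    next
      assume a: "A' = A(i := Suc c)" "B' = B(i := Suc c')" "sib_pair D' i c c'" "\<forall>d d'. sib_pair D' i d d' \<longrightarrow> d = c \<and> d' = c'"
      have "A' i = Suc c" "B' i = Suc c'" using a(1,2) by simp_all
      then show ?thesis unfolding True using a(3,4) by blast
    qed
  next
    case False
    from assms(2) have AB: "A' e = A e \<and> B' e = B e"
    proof (elim disjE conjE)
      assume "A' = A(i := Suc c)" "B' = B(i := Suc c')"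
      then show ?thesis using False by simp
    qed blast
    have "e < i" using e False by simp
    then show ?thesis using assms(1) AB unfolding AB_ok_def by metis
  qed
qed

text \<open>In \<open>\<phi>\<close> the 60 units per missing record pay for the moves of all walks
  together, the 80 units per edge for what happens outside the walk. The number of moves made for a
  single edge is never bounded.\<close>

lemma edge_phase:
  assumes ok: "input_ok s" and top: "top_ok (sarr s ''top'')" and dep: "dep_ok (sarr s ''dep'')"
    and z: "sarr s ''rec'' = (\<lambda>_. 0)" "sarr s ''A'' = (\<lambda>_. 0)" "sarr s ''B'' = (\<lambda>_. 0)"
  shows "wp edge_phase (\<lambda>k u. input_ok u \<and> rec_ok u (\<lambda>z. {e. e < nE \<and> cross e z}) \<and>
    AB_ok D nE (sarr u ''A'') (sarr u ''B'') \<and>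
    k \<le> 60 * (\<Sum>z\<in>stops. adhesion G D z) + 80 * (nE + 1)) s"
proof -
  let ?fin = "Cond (Reg ''p'') (Cond (Reg ''q'')
         (Seq (Store ''A'' (Reg ''e'') (Reg ''p'')) (Store ''B'' (Reg ''e'') (Reg ''q''))) Skip) Skip"
  let ?b = "Seq (Seq (Assign ''x'' (Load ''bag'' (Load ''end1'' (Reg ''e''))))
     (Seq (Assign ''y'' (Load ''bag'' (Load ''end2'' (Reg ''e''))))
     (Seq (Assign ''p'' (Const 0)) (Seq (Assign ''q'' (Const 0)) (Seq walk ?fin))))) (Assign ''e'' (Add (Reg ''e'') (Const 1)))"
  let ?s = "s\<lparr>sreg := (sreg s)(''e'' := 0)\<rparr>"
  define J :: "rstate \<Rightarrow> bool" where "J t \<longleftrightarrow> sreg t ''e'' \<le> nE \<and> rec_ok t (\<lambda>z. {e. e < sreg t ''e'' \<and> cross e z}) \<and>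
    AB_ok D (sreg t ''e'') (sarr t ''A'') (sarr t ''B'') \<and> (\<forall>e\<ge>sreg t ''e''. sarr t ''A'' e = 0 \<and> sarr t ''B'' e = 0)" for t
  define \<phi> where "\<phi> t = 60 * slack t + 80 * (nE - sreg t ''e'')" for t
  have ag_ok: "input_ok t \<and> top_ok (sarr t ''top'') \<and> dep_ok (sarr t ''dep'')" if "agree ?b ?s t" for t
    using that ok top dep by (simp add: agree_def input_ok_def walk_def move_def record_edge_def)
  have J0: "J ?s" using z by (simp add: J_def rec_ok_def AB_ok_def)
  have body: "wp ?b (\<lambda>k u. J u \<and> k + 4 + \<phi> u \<le> \<phi> t) t"
    if J: "J t" and ag: "agree ?b ?s t" and lt: "sreg t ''e'' < nE" for t
  proof -
    define e where "e = sreg t ''e''"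
    define f g where "f = fstend e" and "g = sndend e"
    have e: "e < nE" using lt by (simp add: e_def)
    note ends = edge_ends[OF e, folded f_def g_def]
    have ok: "input_ok t" and top: "top_ok (sarr t ''top'')" and dep: "dep_ok (sarr t ''dep'')" using ag_ok[OF ag] by blast+
    have R: "rec_ok t (\<lambda>z. {e'. e' < e \<and> cross e' z})" and AB: "AB_ok D e (sarr t ''A'') (sarr t ''B'')"
      and zero: "\<forall>e'\<ge>e. sarr t ''A'' e' = 0 \<and> sarr t ''B'' e' = 0"
      using J unfolding J_def e_def by blast+
    have main: "wp walk (\<lambda>k u. sreg u ''x'' = sreg u ''y'' \<and> walk_inv e u \<and> sreg u ''e'' = e \<and>
        sarr u ''A'' = sarr t ''A'' \<and> sarr u ''B'' = sarr t ''B'' \<and> k + 60 * slack u \<le> 60 * slack t + 6) t'"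
      if t': "sreg t' = (sreg t)(''x'' := node_of f, ''y'' := node_of g, ''p'' := 0, ''q'' := 0)" "sarr t' = sarr t" for t'
    proof (rule wp_frame[OF walk[OF _ e]])
      have R': "rec_ok t' (\<lambda>z. {e'. e' < e \<and> cross e' z})" using R unfolding rec_ok_def t'(2) .
      have v0: "vis f g (node_of f) (node_of g) = {}" by (simp add: vis_def)
      have "edge_sets e {} = (\<lambda>z. {e'. e' < e \<and> cross e' z})" by (intro ext) (simp add: edge_sets_def)
      then have "rec_ok t' (edge_sets e (vis f g (sreg t' ''x'') (sreg t' ''y'')))" using R' t' v0 by simp
      then show "walk_inv e t'"
        using t' node_of_less[OF ends(1)] node_of_less[OF ends(2)]
        by (simp add: walk_inv_def side_def common_def f_def[symmetric] g_def[symmetric])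
      show "sreg t' ''e'' = e" using t' by (simp add: e_def)
      show "input_ok t'" using ok t' by (simp add: input_ok_def)
      show "top_ok (sarr t' ''top'')" "dep_ok (sarr t' ''dep'')" using top dep t' by simp_all
      fix k u assume u: "sreg u ''x'' = sreg u ''y'' \<and> walk_inv e u \<and> k + 60 * slack u \<le> 60 * slack t' + 6" and ag: "agree walk t' u"
      have "slack t' = slack t" using t' by (simp add: slack_def)
      moreover have "sreg u ''e'' = sreg t' ''e''" "sarr u ''A'' = sarr t' ''A''" "sarr u ''B'' = sarr t' ''B''"
        using ag by (simp_all add: agree_def walk_def move_def record_edge_def)
      ultimately show "sreg u ''x'' = sreg u ''y'' \<and> walk_inv e u \<and> sreg u ''e'' = e \<and>
        sarr u ''A'' = sarr t ''A'' \<and> sarr u ''B'' = sarr t ''B'' \<and> k + 60 * slack u \<le> 60 * slack t + 6"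
        using u t' by (simp add: e_def)
    qed
    have post: "J v \<and> slack v = slack u"
      if u: "sreg u ''x'' = sreg u ''y''" "walk_inv e u" "sarr u ''A'' = sarr t ''A''" "sarr u ''B'' = sarr t ''B''"
        and v: "sreg v ''e'' = Suc e" "sarr v ''rec'' = sarr u ''rec''" "sarr v ''E'' = sarr u ''E''"
          "sarr v ''A'' = (if sreg u ''p'' \<noteq> 0 \<and> sreg u ''q'' \<noteq> 0 then (sarr t ''A'')(e := sreg u ''p'') else sarr t ''A'')"
          "sarr v ''B'' = (if sreg u ''p'' \<noteq> 0 \<and> sreg u ''q'' \<noteq> 0 then (sarr t ''B'')(e := sreg u ''q'') else sarr t ''B'')"
      for u v
    proof -
      define x p q where "x = sreg u ''x''" and "p = sreg u ''p''" and "q = sreg u ''q''"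
      have y: "sreg u ''y'' = x" using u(1) by (simp add: x_def)
      have Ru: "rec_ok u (edge_sets e (vis f g x x))" and sx: "side f g x p" and sy: "side g f x q" and cm: "common f g x x"
        using u(2) unfolding walk_inv_def y x_def[symmetric] p_def[symmetric] q_def[symmetric] f_def[symmetric] g_def[symmetric]
        by - (elim conjE, assumption)+
      have "rec_ok u (\<lambda>z. {e'. e' < Suc e \<and> cross e' z})"
      proof (rule rec_ok_cong[OF _ Ru])
        fix z assume "z \<in> stops"
        from vis_end[OF e sx[unfolded f_def g_def] sy[unfolded f_def g_def] cm[unfolded f_def g_def] this]
        have "z \<in> vis f g x x \<longleftrightarrow> cross e z" by (simp add: f_def g_def)
        then show "edge_sets e (vis f g x x) z = {e'. e' < Suc e \<and> cross e' z}"
          by (auto simp: edge_sets_def less_Suc_eq)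
      qed
      then have Rv: "rec_ok v (\<lambda>z. {e'. e' < Suc e \<and> cross e' z})" unfolding rec_ok_def v(2,3) .
      have we: "p \<noteq> 0 \<Longrightarrow> q \<noteq> 0 \<Longrightarrow> sib_pair D e (p - 1) (q - 1)" "p = 0 \<or> q = 0 \<Longrightarrow> \<not> sib_pair D e c c'" for c c'
        using walk_end[OF e sx[unfolded f_def g_def] sy[unfolded f_def g_def]] by blast+
      have "AB_ok D (Suc e) (sarr v ''A'') (sarr v ''B'')"
      proof (rule AB_ok_Suc[OF AB, of _ _ "p - 1" "q - 1"])
        show "sarr v ''A'' = sarr t ''A'' \<and> sarr v ''B'' = sarr t ''B'' \<and> sarr t ''A'' e = 0 \<and> sarr t ''B'' e = 0 \<and>
            (\<forall>c c'. \<not> sib_pair D e c c') \<or>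
          sarr v ''A'' = (sarr t ''A'')(e := Suc (p - 1)) \<and> sarr v ''B'' = (sarr t ''B'')(e := Suc (q - 1)) \<and>
          sib_pair D e (p - 1) (q - 1) \<and> (\<forall>d d'. sib_pair D e d d' \<longrightarrow> d = p - 1 \<and> d' = q - 1)"
        proof (cases "p \<noteq> 0 \<and> q \<noteq> 0")
          case True
          then have "sib_pair D e (p - 1) (q - 1)" using we(1) by blast
          then show ?thesis using True v sib_pair_unique[OF e] by (auto simp: p_def q_def)
        next
          case False
          then have "p = 0 \<or> q = 0" by blast
          then have "\<forall>c c'. \<not> sib_pair D e c c'" using we(2) by blast
          then show ?thesis using False v(4,5) zero by (auto simp: p_def q_def)
        qed
      qed
      moreover have "\<forall>e'\<ge>Suc e. sarr v ''A'' e' = 0 \<and> sarr v ''B'' e' = 0" using v(4,5) zero by auto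
      moreover have "Suc e \<le> nE" using e by simp
      ultimately have "J v" using Rv unfolding J_def v(1) by blast
      moreover have "slack v = slack u" using v(2) by (simp add: slack_def)
      ultimately show ?thesis by simp
    qed
    have fin: "wp (Seq ?fin (Assign ''e'' (Add (Reg ''e'') (Const 1)))) (\<lambda>k v. J v \<and> k + \<phi> v + 60 * slack t + 50 \<le> \<phi> t + 60 * slack u) u"
      if u: "sreg u ''x'' = sreg u ''y''" "walk_inv e u" "sreg u ''e'' = e" "sarr u ''A'' = sarr t ''A''" "sarr u ''B'' = sarr t ''B''"
        and le: "slack u \<le> slack t" for u
    proof -
      have fit: "\<phi> v + 80 + 60 * slack t \<le> \<phi> t + 60 * slack u" if "slack v = slack u" "sreg v ''e'' = Suc e" for v
        using that e by (simp add: \<phi>_def e_def[symmetric])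
      let ?v0 = "u\<lparr>sreg := (sreg u)(''e'' := Suc e)\<rparr>"
      let ?v1 = "u\<lparr>sarr := (sarr u)(''A'' := (sarr u ''A'')(e := sreg u ''p''), ''B'' := (sarr u ''B'')(e := sreg u ''q'')), sreg := (sreg u)(''e'' := Suc e)\<rparr>"
      show ?thesis
      proof (cases "sreg u ''p'' \<noteq> 0 \<and> sreg u ''q'' \<noteq> 0")
        case True
        have "J ?v1 \<and> slack ?v1 = slack u" using post[OF u(1,2,4,5), of ?v1] True u by simp
        then show ?thesis using True u fit[of ?v1] by (simp add: wp_simps)
      next
        case False
        have "J ?v0 \<and> slack ?v0 = slack u" using post[OF u(1,2,4,5), of ?v0] False u by auto
        then show ?thesis using False u fit[of ?v0] by (auto simp: wp_simps)
      qed
    qed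
    have two: "wp (Seq walk (Seq ?fin (Assign ''e'' (Add (Reg ''e'') (Const 1))))) (\<lambda>k v. J v \<and> k + \<phi> v + 40 \<le> \<phi> t) t'"
      if t': "sreg t' = (sreg t)(''x'' := node_of f, ''y'' := node_of g, ''p'' := 0, ''q'' := 0)" "sarr t' = sarr t" for t'
      unfolding wp_Seq[of walk]
    proof (rule wp_mono[OF main[OF t']])
      fix k u assume u: "sreg u ''x'' = sreg u ''y'' \<and> walk_inv e u \<and> sreg u ''e'' = e \<and>
        sarr u ''A'' = sarr t ''A'' \<and> sarr u ''B'' = sarr t ''B'' \<and> k + 60 * slack u \<le> 60 * slack t + 6"
      then have le: "slack u \<le> slack t" by linarith
      show "wp (Seq ?fin (Assign ''e'' (Add (Reg ''e'') (Const 1)))) (\<lambda>l v. J v \<and> k + l + \<phi> v + 40 \<le> \<phi> t) u"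
        by (rule wp_mono[OF fin]) (use u le in auto)
    qed
    \<comment> \<open>Reassociation, so that the part starting with \<open>walk\<close> becomes one
      command and \<open>two\<close> applies to it.\<close>
    have assoc: "wp ?b Q t = wp (Seq (Assign ''x'' (Load ''bag'' (Load ''end1'' (Reg ''e''))))
     (Seq (Assign ''y'' (Load ''bag'' (Load ''end2'' (Reg ''e''))))
     (Seq (Assign ''p'' (Const 0)) (Seq (Assign ''q'' (Const 0)) (Seq walk (Seq ?fin (Assign ''e'' (Add (Reg ''e'') (Const 1))))))))) Q t" for Q
      by (simp add: wp_Seq add.assoc)
    show ?thesis
      unfolding assoc unfolding wp_Seq[of "Assign _ _"] wp_Assign
      by (rule wp_mono[OF two]) (use ok in \<open>auto simp: input_ok_def f_def g_def e_def\<close>)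
  qed
  have "wp (Loop (Less (Reg ''e'') (Reg ''edges'')) ?b) (\<lambda>k u. input_ok u \<and> rec_ok u (\<lambda>z. {e. e < nE \<and> cross e z}) \<and>
    AB_ok D nE (sarr u ''A'') (sarr u ''B'') \<and> k + 2 \<le> 60 * (\<Sum>z\<in>stops. adhesion G D z) + 80 * (nE + 1)) ?s"
  proof (rule wp_Loop[where I = J and \<phi> = \<phi>, OF J0])
    fix t assume J: "J t" and ag: "agree ?b ?s t" and lt: "rval t (Less (Reg ''e'') (Reg ''edges'')) \<noteq> 0"
    have "input_ok t" using ag_ok[OF ag] by blast
    then have "sreg t ''e'' < nE" using lt by (simp add: input_ok_def)
    from body[OF J ag this] show "wp ?b (\<lambda>k u. J u \<and> k + 1 + rcost (Less (Reg ''e'') (Reg ''edges'')) + \<phi> u \<le> \<phi> t) t"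
      by (rule wp_mono) simp
  next
    fix k u assume J: "J u" and ag: "agree ?b ?s u" and ge: "rval u (Less (Reg ''e'') (Reg ''edges'')) = 0"
      and k: "k + \<phi> u \<le> \<phi> ?s + 1 + rcost (Less (Reg ''e'') (Reg ''edges''))"
    have ok: "input_ok u" using ag_ok[OF ag] by blast
    have "sreg u ''e'' \<le> nE" using J unfolding J_def by blast
    then have e: "sreg u ''e'' = nE" using ok ge by (simp add: input_ok_def)
    have "rec_ok u (\<lambda>z. {e. e < nE \<and> cross e z})" "AB_ok D nE (sarr u ''A'') (sarr u ''B'')"
      using J unfolding J_def e by blast+
    moreover have "slack ?s = (\<Sum>z\<in>stops. adhesion G D z)" using z by (simp add: slack_def)
    then have "k + 2 \<le> 60 * (\<Sum>z\<in>stops. adhesion G D z) + 80 * (nE + 1)" using k by (simp add: \<phi>_def)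
    ultimately show "input_ok u \<and> rec_ok u (\<lambda>z. {e. e < nE \<and> cross e z}) \<and>
      AB_ok D nE (sarr u ''A'') (sarr u ''B'') \<and> k + 2 \<le> 60 * (\<Sum>z\<in>stops. adhesion G D z) + 80 * (nE + 1)" using ok by blast
  qed
  then show ?thesis unfolding edge_phase_def wp_Seq[of "Assign _ _"] wp_Assign by (simp add: add.commute)
qed

lemma adhesion_le_width: "z < nN \<Longrightarrow> adhesion G D z \<le> tcwidth G D"
proof -
  assume "z < nN"
  then have "max (adhesion G D z) (card (mverts (three_center G D z))) \<le> tcwidth G D"
    unfolding tcwidth_def using nodes_eq by (intro Max_ge) auto
  then show ?thesis by simp
qed

text \<open>No edge crosses the root or a node with empty \<open>below\<close>, and there are at
  most \<open>2 * nV\<close> other stops. This accounts for the product of width and graph size in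
  the running time.\<close>

lemma sum_adhesion: "(\<Sum>z\<in>stops. adhesion G D z) \<le> 2 * nV * tcwidth G D"
proof -
  let ?S = "{z \<in> stops. z \<noteq> rt \<and> below D z \<noteq> {}}"
  have "adhesion G D z = 0" if "z \<in> stops - ?S" for z
  proof -
    have "z = rt \<or> below D z = {}" using that by blast
    then have "{e. e < nE \<and> cross e z} = {}"
      using below_root root_eq gverts_eq edge_ends by (auto simp: cross_def)
    then show ?thesis unfolding adhesion_card by (simp only: card.empty)
  qed
  then have "(\<Sum>z\<in>stops. adhesion G D z) = (\<Sum>z\<in>?S. adhesion G D z)"
    using finite_stops by (intro sum.mono_neutral_right) auto
  also have "\<dots> \<le> card ?S * tcwidth G D"
    using adhesion_le_width sum_bounded_above[of ?S "adhesion G D" "tcwidth G D"] by (simp add: stops_def)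
  also have "\<dots> \<le> 2 * nV * tcwidth G D" using card_stops by (intro mult_le_mono1)
  finally show ?thesis .
qed

end

section \<open>Searching and merging pairs\<close>

text \<open>The address \<open>4 * c + j\<close>, written with additions since the machine has no
  multiplication.\<close>

abbreviation slot :: "ident \<Rightarrow> ident \<Rightarrow> rexp" where
  "slot c j \<equiv> Add (Add (Add (Reg c) (Reg c)) (Add (Reg c) (Reg c))) (Reg j)"

definition other_end :: rcom where
  "other_end = Cond (Equal (Load ''A'' (Reg ''e'')) (Add (Reg ''c'') (Const 1))) (Assign ''o'' (Load ''B'' (Reg ''e'')))
     (Cond (Equal (Load ''B'' (Reg ''e'')) (Add (Reg ''c'') (Const 1))) (Assign ''o'' (Load ''A'' (Reg ''e'')))
       (Assign ''o'' (Const 0)))"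

definition count_body :: rcom where
  "count_body = Seq (Assign ''e'' (Load ''E'' (slot ''c'' ''l''))) (Seq other_end
     (Seq (Cond (Equal (Reg ''o'') (Reg ''b'')) (Assign ''k'' (Add (Reg ''k'') (Const 1))) Skip)
       (Assign ''l'' (Add (Reg ''l'') (Const 1)))))"

definition count_common :: rcom where
  "count_common = Seq (Assign ''k'' (Const 0)) (Seq (Assign ''l'' (Const 0))
     (Loop (Less (Reg ''l'') (Load ''rec'' (Reg ''c''))) count_body))"

text \<open>A conjunction, expressed by comparing the sum of the truth values with their number. If
  \<open>o\<close> is 0, the truncated difference yields a legal address and the first summand makes
  the test fail.\<close>

definition search_test :: rexp where
  "search_test = Equal (Add (Less (Const 0) (Reg ''o''))
     (Add (Less (Const 2) (Load ''rec'' (Sub (Reg ''o'') (Const 1)))) (Less (Load ''rec'' (Sub (Reg ''o'') (Const 1))) (Const 5)))) (Const 3)"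

text \<open>With \<open>k\<close> shared edges the union has adhesion equal to the sum of both
  adhesions minus \<open>2 * k\<close>. The two comparisons place it between 2 and 5, exclusively,
  without any truncated subtraction.\<close>

definition size_test :: rexp where
  "size_test = Equal (Add
     (Less (Add (Const 2) (Add (Reg ''k'') (Reg ''k''))) (Add (Load ''rec'' (Reg ''c'')) (Load ''rec'' (Sub (Reg ''b'') (Const 1)))))
     (Less (Add (Load ''rec'' (Reg ''c'')) (Load ''rec'' (Sub (Reg ''b'') (Const 1)))) (Add (Const 5) (Add (Reg ''k'') (Reg ''k''))))) (Const 2)"

definition search_body :: rcom where
  "search_body = Seq (Assign ''e'' (Load ''E'' (slot ''c'' ''j''))) (Seq other_end
     (Seq (Cond search_test (Seq (Assign ''b'' (Reg ''o'')) (Seq count_common (Cond size_test (Assign ''f'' (Reg ''b'')) Skip))) Skip)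
       (Assign ''j'' (Add (Reg ''j'') (Const 1)))))"

definition search :: rcom where
  "search = Seq (Assign ''f'' (Const 0)) (Seq (Assign ''j'' (Const 0))
     (Loop (Less (Reg ''j'') (Load ''rec'' (Reg ''c''))) search_body))"

text \<open>Edges leading to \<open>b\<close> become internal to the new node. All others are copied
  to its list, and those that join \<open>c\<close> to a sibling are redirected to the new
  node.\<close>

definition absorb_body :: rcom where
  "absorb_body = Seq (Assign ''e'' (Load ''E'' (slot ''c'' ''l''))) (Seq other_end
     (Seq (Cond (Equal (Reg ''o'') (Reg ''b'')) Skip
       (Seq (Store ''E'' (Add (Add (Add (Reg ''p'') (Reg ''p'')) (Add (Reg ''p'') (Reg ''p''))) (Load ''rec'' (Reg ''p''))) (Reg ''e''))
       (Seq (Store ''rec'' (Reg ''p'') (Add (Load ''rec'' (Reg ''p'')) (Const 1)))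
       (Seq (Cond (Equal (Load ''A'' (Reg ''e'')) (Add (Reg ''c'') (Const 1))) (Store ''A'' (Reg ''e'') (Add (Reg ''p'') (Const 1))) Skip)
         (Cond (Equal (Load ''B'' (Reg ''e'')) (Add (Reg ''c'') (Const 1))) (Store ''B'' (Reg ''e'') (Add (Reg ''p'') (Const 1))) Skip)))))
       (Assign ''l'' (Add (Reg ''l'') (Const 1)))))"

definition absorb :: rcom where
  "absorb = Seq (Assign ''l'' (Const 0)) (Loop (Less (Reg ''l'') (Load ''rec'' (Reg ''c''))) absorb_body)"

text \<open>\<open>other A B c e\<close> is one more than the sibling of \<open>c\<close> containing the other end of the edge \<open>e\<close>,
  or 0 if there is none.\<close>

definition other :: "(nat \<Rightarrow> nat) \<Rightarrow> (nat \<Rightarrow> nat) \<Rightarrow> nat \<Rightarrow> nat \<Rightarrow> nat" where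
  "other A B c e = (if A e = Suc c then B e else if B e = Suc c then A e else 0)"

abbreviation oth :: "rstate \<Rightarrow> nat \<Rightarrow> nat \<Rightarrow> nat" where
  "oth t c e \<equiv> other (sarr t ''A'') (sarr t ''B'') c e"

abbreviation entry :: "rstate \<Rightarrow> nat \<Rightarrow> nat \<Rightarrow> nat" where
  "entry t c j \<equiv> sarr t ''E'' (4 * c + j)"

lemma other_end: "wp other_end (\<lambda>k u. u = t\<lparr>sreg := (sreg t)(''o'' := oth t (sreg t ''c'') (sreg t ''e''))\<rparr> \<and> k \<le> 20) t"
  unfolding other_end_def by (simp add: wp_simps other_def)

definition common_count :: "rstate \<Rightarrow> nat \<Rightarrow> nat \<Rightarrow> nat" where
  "common_count t c b = card {l. l < sarr t ''rec'' c \<and> oth t c (entry t c l) = b}"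

lemma card_less_Suc_if:
  "card {l'. l' < Suc l \<and> P l'} = card {l'. l' < l \<and> P l'} + (if P l then 1 else (0::nat))"
proof -
  have "{l'. l' < Suc l \<and> P l'} = (if P l then insert l {l'. l' < l \<and> P l'} else {l'. l' < l \<and> P l'})"
    by (auto simp: less_Suc_eq)
  then show ?thesis by simp
qed

lemma four_times: "c + c + (c + c) + j = 4 * c + (j::nat)"
  by simp

lemma count_common:
  "wp count_common (\<lambda>k u. sreg u ''k'' = common_count t (sreg t ''c'') (sreg t ''b'') \<and>
     k \<le> 60 * sarr t ''rec'' (sreg t ''c'') + 10) t"
proof -
  define c b where "c = sreg t ''c''" and "b = sreg t ''b''"
  let ?s = "t\<lparr>sreg := (sreg t)(''k'' := 0, ''l'' := 0)\<rparr>"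
  define I :: "rstate \<Rightarrow> bool" where "I u \<longleftrightarrow> sreg u ''l'' \<le> sarr t ''rec'' c \<and>
    sreg u ''k'' = card {l. l < sreg u ''l'' \<and> oth t c (entry t c l) = b}" for u
  have "wp (Loop (Less (Reg ''l'') (Load ''rec'' (Reg ''c''))) count_body)
      (\<lambda>k u. sreg u ''k'' = common_count t c b \<and> k + 4 \<le> 60 * sarr t ''rec'' c + 10) ?s"
  proof (rule wp_Loop[where I = I and \<phi> = "\<lambda>u. 60 * (sarr t ''rec'' c - sreg u ''l'')"])
    show "I ?s" by (simp add: I_def)
  next
    fix u assume I: "I u" and ag: "agree count_body ?s u" and lt: "rval u (Less (Reg ''l'') (Load ''rec'' (Reg ''c''))) \<noteq> 0"
    define l where "l = sreg u ''l''"
    have cb: "sreg u ''c'' = c" "sreg u ''b'' = b" "sarr u = sarr t"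
      using ag by (simp_all add: agree_def count_body_def other_end_def c_def b_def fun_eq_iff)
    have l: "l < sarr t ''rec'' c" using lt cb by (simp add: l_def)
    have k: "sreg u ''k'' = card {l'. l' < l \<and> oth t c (entry t c l') = b}" using I by (simp add: I_def l_def)
    obtain r where r: "sarr t ''rec'' c - l = Suc r" using l by (metis Suc_diff_Suc)
    then have r': "sarr t ''rec'' c - Suc l = r" by simp
    have new: "I v" if "sreg v ''l'' = Suc l" "sreg v ''k'' = (if oth t c (entry t c l) = b then Suc (sreg u ''k'') else sreg u ''k'')" for v
      using that l k by (simp add: I_def card_less_Suc_if)
    show "wp count_body (\<lambda>k v. I v \<and> k + 1 + rcost (Less (Reg ''l'') (Load ''rec'' (Reg ''c''))) +
        60 * (sarr t ''rec'' c - sreg v ''l'') \<le> 60 * (sarr t ''rec'' c - sreg u ''l'')) u"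
      unfolding count_body_def wp_Seq wp_Assign
      by (rule wp_mono[OF other_end])
        (use cb r r' new in \<open>auto simp: wp_simps four_times l_def[symmetric]\<close>)
  next
    fix k u assume I: "I u" and ag: "agree count_body ?s u" and ge: "rval u (Less (Reg ''l'') (Load ''rec'' (Reg ''c''))) = 0"
      and k: "k + 60 * (sarr t ''rec'' c - sreg u ''l'') \<le> 60 * (sarr t ''rec'' c - sreg ?s ''l'') + 1 + rcost (Less (Reg ''l'') (Load ''rec'' (Reg ''c'')))"
    have cb: "sreg u ''c'' = c" "sarr u = sarr t"
      using ag by (simp_all add: agree_def count_body_def other_end_def c_def fun_eq_iff)
    have "sreg u ''l'' = sarr t ''rec'' c" using I ge cb by (simp add: I_def)
    then show "sreg u ''k'' = common_count t c b \<and> k + 4 \<le> 60 * sarr t ''rec'' c + 10"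
      using I k by (simp add: I_def common_count_def)
  qed
  then show ?thesis unfolding count_common_def wp_Seq wp_Assign by (simp add: c_def b_def add.commute)
qed

text \<open>The condition for merging as the program sees it. As in \<open>other\<close>, the
  argument \<open>b\<close> is one more than the sibling.\<close>

definition good :: "rstate \<Rightarrow> nat \<Rightarrow> nat \<Rightarrow> bool" where
  "good t c b \<longleftrightarrow> b \<noteq> 0 \<and> sarr t ''rec'' (b - 1) \<in> {3, 4} \<and>
     sarr t ''rec'' c + sarr t ''rec'' (b - 1) \<in> {3 + 2 * common_count t c b, 4 + 2 * common_count t c b}"

lemma search_test: "rval u search_test \<noteq> 0 \<longleftrightarrow> sreg u ''o'' \<noteq> 0 \<and> sarr u ''rec'' (sreg u ''o'' - 1) \<in> {3, 4}"
  by (auto simp: search_test_def of_bool_def)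

lemma size_test: "rval u size_test \<noteq> 0 \<longleftrightarrow>
    sarr u ''rec'' (sreg u ''c'') + sarr u ''rec'' (sreg u ''b'' - 1) \<in> {3 + 2 * sreg u ''k'', 4 + 2 * sreg u ''k''}"
  by (auto simp: size_test_def of_bool_def)

text \<open>The list has at most four entries, so the search takes constant time. If several
  siblings qualify, the last one is kept, and a final \<open>f\<close> of 0 certifies that there is
  none.\<close>

lemma search:
  assumes r4: "sarr t ''rec'' (sreg t ''c'') \<le> 4"
  shows "wp search (\<lambda>k u. 
     (sreg u ''f'' = 0 \<longrightarrow> (\<forall>j<sarr t ''rec'' (sreg t ''c''). \<not> good t (sreg t ''c'') (oth t (sreg t ''c'') (entry t (sreg t ''c'') j)))) \<and>
     (sreg u ''f'' \<noteq> 0 \<longrightarrow> good t (sreg t ''c'') (sreg u ''f'') \<and>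
        (\<exists>j<sarr t ''rec'' (sreg t ''c''). oth t (sreg t ''c'') (entry t (sreg t ''c'') j) = sreg u ''f'')) \<and> k \<le> 2000) t"
proof -
  define c where "c = sreg t ''c''"
  let ?s = "t\<lparr>sreg := (sreg t)(''f'' := 0, ''j'' := 0)\<rparr>"
  define P where "P k u \<longleftrightarrow>
     (sreg u ''f'' = 0 \<longrightarrow> (\<forall>j<k. \<not> good t c (oth t c (entry t c j)))) \<and>
     (sreg u ''f'' \<noteq> 0 \<longrightarrow> good t c (sreg u ''f'') \<and> (\<exists>j<k. oth t c (entry t c j) = sreg u ''f''))" for k :: nat and u :: rstate
  define I :: "rstate \<Rightarrow> bool" where "I u \<longleftrightarrow> sreg u ''j'' \<le> sarr t ''rec'' c \<and> P (sreg u ''j'') u" for u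
  have "wp (Loop (Less (Reg ''j'') (Load ''rec'' (Reg ''c''))) search_body)
      (\<lambda>k u. P (sarr t ''rec'' c) u \<and> k + 4 \<le> 2000) ?s"
  proof (rule wp_Loop[where I = I and \<phi> = "\<lambda>u. 450 * (sarr t ''rec'' c - sreg u ''j'')"])
    show "I ?s" by (simp add: I_def P_def)
  next
    fix u assume I: "I u" and ag: "agree search_body ?s u" and lt: "rval u (Less (Reg ''j'') (Load ''rec'' (Reg ''c''))) \<noteq> 0"
    define j where "j = sreg u ''j''"
    define b where "b = oth t c (entry t c j)"
    have cb: "sreg u ''c'' = c" "sarr u = sarr t"
      using ag by (simp_all add: agree_def search_body_def count_common_def count_body_def other_end_def c_def fun_eq_iff)
    have j: "j < sarr t ''rec'' c" using lt cb by (simp add: j_def)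
    have Pj: "P j u" using I by (simp add: I_def j_def)
    obtain r where r: "sarr t ''rec'' c - j = Suc r" using j by (metis Suc_diff_Suc)
    then have r': "sarr t ''rec'' c - Suc j = r" by simp
    have new: "I v" if v: "sreg v ''j'' = Suc j" "sreg v ''f'' = (if good t c b then b else sreg u ''f'')" for v
    proof -
      have "P (Suc j) v"
      proof (cases "good t c b")
        case True
        then have "sreg v ''f'' \<noteq> 0" using v by (simp add: good_def)
        then show ?thesis using True v unfolding P_def b_def by (metis lessI)
      next
        case False
        then have "sreg v ''f'' = sreg u ''f''" using v by simp
        then show ?thesis using Pj False unfolding P_def b_def by (metis less_Suc_eq)
      qed
      then show ?thesis using v j by (simp add: I_def)
    qed
    let ?tail = "Seq (Cond search_test (Seq (Assign ''b'' (Reg ''o'')) (Seq count_common (Cond size_test (Assign ''f'' (Reg ''b'')) Skip))) Skip)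
       (Assign ''j'' (Add (Reg ''j'') (Const 1)))"
    have tail: "wp ?tail (\<lambda>k v. I v \<and> k \<le> 380 \<and> sreg v ''j'' = Suc j) w"
      if w: "sreg w ''o'' = b" "sreg w ''c'' = c" "sreg w ''j'' = j" "sreg w ''f'' = sreg u ''f''" "sarr w = sarr t" for w
    proof (cases "b \<noteq> 0 \<and> sarr t ''rec'' (b - 1) \<in> {3, 4}")
      case False
      then have "\<not> good t c b" by (auto simp: good_def)
      moreover have "\<not> rval w search_test \<noteq> 0" using False unfolding search_test w by blast
      moreover have "rcost search_test = 19" by (simp add: search_test_def)
      ultimately show ?thesis using w by (simp add: wp_simps new)
    next
      case True
      have st: "rval w search_test \<noteq> 0" using True unfolding search_test w by blast
      have cst: "rcost search_test = 19" "rcost size_test = 29" by (simp_all add: search_test_def size_test_def)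
      let ?w = "w\<lparr>sreg := (sreg w)(''b'' := b)\<rparr>"
      have cc: "wp count_common (\<lambda>k v. sreg v ''k'' = common_count t c b \<and> sreg v ''c'' = c \<and> sreg v ''b'' = b \<and>
          sreg v ''j'' = j \<and> sreg v ''f'' = sreg u ''f'' \<and> sarr v = sarr t \<and> k \<le> 250) ?w"
      proof (rule wp_frame[OF count_common])
        fix k v assume v: "sreg v ''k'' = common_count ?w (sreg ?w ''c'') (sreg ?w ''b'') \<and> k \<le> 60 * sarr ?w ''rec'' (sreg ?w ''c'') + 10"
          and ag: "agree count_common ?w v"
        have "common_count ?w (sreg ?w ''c'') (sreg ?w ''b'') = common_count t c b" using w by (simp add: common_count_def)
        moreover have "60 * sarr ?w ''rec'' (sreg ?w ''c'') + 10 \<le> 250" using w r4 by (simp add: c_def)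
        moreover have "sreg v ''c'' = c" "sreg v ''b'' = b" "sreg v ''j'' = j" "sreg v ''f'' = sreg u ''f''" "sarr v = sarr t"
          using ag w by (simp_all add: agree_def count_common_def count_body_def other_end_def fun_eq_iff)
        ultimately show "sreg v ''k'' = common_count t c b \<and> sreg v ''c'' = c \<and> sreg v ''b'' = b \<and>
          sreg v ''j'' = j \<and> sreg v ''f'' = sreg u ''f'' \<and> sarr v = sarr t \<and> k \<le> 250" using v by simp
      qed
      have fin: "wp (Cond size_test (Assign ''f'' (Reg ''b'')) Skip) (\<lambda>k x. sreg x ''f'' = (if good t c b then b else sreg u ''f'') \<and>
          sreg x ''j'' = j \<and> k \<le> 40) v"
        if v: "sreg v ''k'' = common_count t c b" "sreg v ''c'' = c" "sreg v ''b'' = b" "sreg v ''j'' = j" "sreg v ''f'' = sreg u ''f''" "sarr v = sarr t" for v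
      proof -
        have "rval v size_test \<noteq> 0 \<longleftrightarrow> good t c b" using True unfolding size_test v good_def by blast
        then show ?thesis using v cst by (cases "good t c b") (simp_all add: wp_simps)
      qed
      show ?thesis
        unfolding wp_Seq wp_Cond[of search_test] using st
        apply (simp add: wp_Assign wp_Seq w(1))
        apply (rule wp_mono[OF cc])
        apply (rule wp_mono[OF fin])
              apply (simp_all add: cst new wp_Assign)
        done
    qed
    show "wp search_body (\<lambda>k v. I v \<and> k + 1 + rcost (Less (Reg ''j'') (Load ''rec'' (Reg ''c''))) +
        450 * (sarr t ''rec'' c - sreg v ''j'') \<le> 450 * (sarr t ''rec'' c - sreg u ''j'')) u"
      unfolding search_body_def wp_Seq[of "Assign _ _"] wp_Seq[of other_end] wp_Assign
      apply (rule wp_mono[OF other_end])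
      apply (rule wp_mono[OF tail])
           apply (use cb r r' in \<open>auto simp: b_def four_times j_def[symmetric]\<close>)
      done
  next
    fix k u assume I: "I u" and ag: "agree search_body ?s u" and ge: "rval u (Less (Reg ''j'') (Load ''rec'' (Reg ''c''))) = 0"
      and k: "k + 450 * (sarr t ''rec'' c - sreg u ''j'') \<le> 450 * (sarr t ''rec'' c - sreg ?s ''j'') + 1 + rcost (Less (Reg ''j'') (Load ''rec'' (Reg ''c'')))"
    have cb: "sreg u ''c'' = c" "sarr u = sarr t"
      using ag by (simp_all add: agree_def search_body_def count_common_def count_body_def other_end_def c_def fun_eq_iff)
    have "sreg u ''j'' = sarr t ''rec'' c" using I ge cb by (simp add: I_def)
    then show "P (sarr t ''rec'' c) u \<and> k + 4 \<le> 2000"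
      using I k r4 by (simp add: I_def c_def)
  qed
  then show ?thesis unfolding search_def wp_Seq wp_Assign
    by (simp only: rval.simps c_def[symmetric]) (rule wp_mono, simp, simp add: P_def)
qed

definition absorbed :: "rstate \<Rightarrow> nat \<Rightarrow> nat \<Rightarrow> nat \<Rightarrow> nat set" where
  "absorbed t c b l = entry t c ` {j. j < l \<and> oth t c (entry t c j) \<noteq> b}"

text \<open>Because of \<open>c < p\<close>, writing to the block of \<open>p\<close> does not
  disturb the list of \<open>c\<close> that is being read. Injectivity of the list ensures that an
  edge is met only once, so its entries in \<open>A\<close> and \<open>B\<close> are still the
  original ones at that moment.\<close>

lemma absorb:
  assumes c: "sreg t ''c'' = c" and b: "sreg t ''b'' = b" and p: "sreg t ''p'' = p" and cp: "c < p"
    and r4: "sarr t ''rec'' c \<le> 4" and inj: "inj_on (entry t c) {..<sarr t ''rec'' c}"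
  defines "S \<equiv> absorbed t c b (sarr t ''rec'' c)"
  shows "wp absorb (\<lambda>k u. sarr u ''rec'' = (sarr t ''rec'')(p := sarr t ''rec'' p + card S) \<and>
     (\<forall>x<p. \<forall>j<4. entry u x j = entry t x j) \<and>
     entry u p ` {..<sarr u ''rec'' p} = entry t p ` {..<sarr t ''rec'' p} \<union> S \<and>
     sarr u ''A'' = (\<lambda>e. if e \<in> S \<and> sarr t ''A'' e = Suc c then Suc p else sarr t ''A'' e) \<and>
     sarr u ''B'' = (\<lambda>e. if e \<in> S \<and> sarr t ''B'' e = Suc c then Suc p else sarr t ''B'' e) \<and> k \<le> 500) t"
proof -
  define R where "R l u \<longleftrightarrow> sarr u ''rec'' = (sarr t ''rec'')(p := sarr t ''rec'' p + card (absorbed t c b l)) \<and>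
     (\<forall>x<p. \<forall>j<4. entry u x j = entry t x j) \<and>
     entry u p ` {..<sarr u ''rec'' p} = entry t p ` {..<sarr t ''rec'' p} \<union> absorbed t c b l \<and>
     sarr u ''A'' = (\<lambda>e. if e \<in> absorbed t c b l \<and> sarr t ''A'' e = Suc c then Suc p else sarr t ''A'' e) \<and>
     sarr u ''B'' = (\<lambda>e. if e \<in> absorbed t c b l \<and> sarr t ''B'' e = Suc c then Suc p else sarr t ''B'' e)" for l and u :: rstate
  let ?s = "t\<lparr>sreg := (sreg t)(''l'' := 0)\<rparr>"
  define I :: "rstate \<Rightarrow> bool" where "I u \<longleftrightarrow> sreg u ''l'' \<le> sarr t ''rec'' c \<and> R (sreg u ''l'') u" for u
  have "wp (Loop (Less (Reg ''l'') (Load ''rec'' (Reg ''c''))) absorb_body) (\<lambda>k u. R (sarr t ''rec'' c) u \<and> k + 2 \<le> 500) ?s"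
  proof (rule wp_Loop[where I = I and \<phi> = "\<lambda>u. 100 * (sarr t ''rec'' c - sreg u ''l'')"])
    show "I ?s" by (simp add: I_def R_def absorbed_def)
  next
    fix u assume I: "I u" and ag: "agree absorb_body ?s u" and lt: "rval u (Less (Reg ''l'') (Load ''rec'' (Reg ''c''))) \<noteq> 0"
    define l where "l = sreg u ''l''"
    define e where "e = entry t c l"
    have regs: "sreg u ''c'' = c" "sreg u ''b'' = b" "sreg u ''p'' = p"
      using ag c b p by (simp_all add: agree_def absorb_body_def other_end_def)
    have Rl: "R l u" using I by (simp add: I_def l_def)
    have rec: "sarr u ''rec'' = (sarr t ''rec'')(p := sarr t ''rec'' p + card (absorbed t c b l))"
      and Eold: "\<And>x j. x < p \<Longrightarrow> j < 4 \<Longrightarrow> entry u x j = entry t x j"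
      and Enew: "entry u p ` {..<sarr u ''rec'' p} = entry t p ` {..<sarr t ''rec'' p} \<union> absorbed t c b l"
      and A: "sarr u ''A'' = (\<lambda>e. if e \<in> absorbed t c b l \<and> sarr t ''A'' e = Suc c then Suc p else sarr t ''A'' e)"
      and B: "sarr u ''B'' = (\<lambda>e. if e \<in> absorbed t c b l \<and> sarr t ''B'' e = Suc c then Suc p else sarr t ''B'' e)"
      using Rl unfolding R_def by blast+
    have l: "l < sarr t ''rec'' c" using lt regs rec cp by (simp add: l_def)
    obtain r where r: "sarr t ''rec'' c - l = Suc r" using l by (metis Suc_diff_Suc)
    then have r': "sarr t ''rec'' c - Suc l = r" by simp
    have eu: "entry u c l = e" using Eold[OF cp, of l] l r4 by (simp add: e_def)
    have fresh: "e \<notin> absorbed t c b l"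
    proof
      assume "e \<in> absorbed t c b l"
      then obtain j where "j < l" "entry t c j = entry t c l" by (auto simp: absorbed_def e_def)
      then show False using inj_onD[OF inj, of j l] l by simp
    qed
    have oe: "oth u c e = oth t c e" using fresh by (simp add: other_def A B)
    have fin: "finite (absorbed t c b l)" by (simp add: absorbed_def)
    have next_S: "absorbed t c b (Suc l) = (if oth t c e \<noteq> b then insert e (absorbed t c b l) else absorbed t c b l)"
    proof -
      have "{j. j < Suc l \<and> oth t c (entry t c j) \<noteq> b} =
          (if oth t c e \<noteq> b then insert l {j. j < l \<and> oth t c (entry t c j) \<noteq> b} else {j. j < l \<and> oth t c (entry t c j) \<noteq> b})"
        by (auto simp: less_Suc_eq e_def)
      then show ?thesis by (simp add: absorbed_def e_def)
    qed
    have skip: "R (Suc l) v" if "oth t c e = b" "sarr v = sarr u" for v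
    proof -
      have S: "absorbed t c b (Suc l) = absorbed t c b l" using that(1) next_S by simp
      show ?thesis unfolding R_def S that(2) by (rule Rl[unfolded R_def])
    qed
    have take: "R (Suc l) v" if ob: "oth t c e \<noteq> b"
      and vE: "sarr v ''E'' = (sarr u ''E'')(4 * p + sarr u ''rec'' p := e)"
      and vr: "sarr v ''rec'' = (sarr u ''rec'')(p := Suc (sarr u ''rec'' p))"
      and vA: "sarr v ''A'' = (if sarr u ''A'' e = Suc c then (sarr u ''A'')(e := Suc p) else sarr u ''A'')"
      and vB: "sarr v ''B'' = (if sarr u ''B'' e = Suc c then (sarr u ''B'')(e := Suc p) else sarr u ''B'')" for v
      unfolding R_def
    proof (intro conjI allI impI)
      have S: "absorbed t c b (Suc l) = insert e (absorbed t c b l)" using ob next_S by simp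
      show "sarr v ''rec'' = (sarr t ''rec'')(p := sarr t ''rec'' p + card (absorbed t c b (Suc l)))"
        using vr rec fresh fin by (simp add: S)
      show "entry v x j = entry t x j" if "x < p" "j < 4" for x j
      proof -
        have "4 * x + j \<noteq> 4 * p + sarr u ''rec'' p" using that by linarith
        then show ?thesis using vE Eold[OF that] by simp
      qed
      have "entry v p ` {..<Suc (sarr u ''rec'' p)} = insert e (entry u p ` {..<sarr u ''rec'' p})"
        unfolding lessThan_Suc image_insert using vE by auto
      then show "entry v p ` {..<sarr v ''rec'' p} = entry t p ` {..<sarr t ''rec'' p} \<union> absorbed t c b (Suc l)"
        using vr Enew S by simp
      show "sarr v ''A'' = (\<lambda>x. if x \<in> absorbed t c b (Suc l) \<and> sarr t ''A'' x = Suc c then Suc p else sarr t ''A'' x)"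
        unfolding vA S using fresh by (auto simp: A fun_eq_iff)
      show "sarr v ''B'' = (\<lambda>x. if x \<in> absorbed t c b (Suc l) \<and> sarr t ''B'' x = Suc c then Suc p else sarr t ''B'' x)"
        unfolding vB S using fresh by (auto simp: B fun_eq_iff)
    qed
    have IR: "I v" if "R (Suc l) v" "sreg v ''l'' = Suc l" for v using that l by (simp add: I_def)
    let ?tail = "Seq (Cond (Equal (Reg ''o'') (Reg ''b'')) Skip
       (Seq (Store ''E'' (Add (Add (Add (Reg ''p'') (Reg ''p'')) (Add (Reg ''p'') (Reg ''p''))) (Load ''rec'' (Reg ''p''))) (Reg ''e''))
       (Seq (Store ''rec'' (Reg ''p'') (Add (Load ''rec'' (Reg ''p'')) (Const 1)))
       (Seq (Cond (Equal (Load ''A'' (Reg ''e'')) (Add (Reg ''c'') (Const 1))) (Store ''A'' (Reg ''e'') (Add (Reg ''p'') (Const 1))) Skip)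
         (Cond (Equal (Load ''B'' (Reg ''e'')) (Add (Reg ''c'') (Const 1))) (Store ''B'' (Reg ''e'') (Add (Reg ''p'') (Const 1))) Skip)))))
       (Assign ''l'' (Add (Reg ''l'') (Const 1)))"
    have tail: "wp ?tail (\<lambda>k v. I v \<and> sreg v ''l'' = Suc l \<and> k \<le> 60) w"
      if w: "sreg w ''o'' = oth t c e" "sreg w ''c'' = c" "sreg w ''b'' = b" "sreg w ''p'' = p" "sreg w ''e'' = e" "sreg w ''l'' = l" "sarr w = sarr u" for w
    proof (cases "oth t c e = b")
      case True
      have "I (w\<lparr>sreg := (sreg w)(''l'' := Suc l)\<rparr>)" by (intro IR skip) (use True w in simp_all)
      then show ?thesis using True w by (simp add: wp_simps)
    next
      case False
      have fit: "I v" if "sarr v ''E'' = (sarr u ''E'')(4 * p + sarr u ''rec'' p := e)"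
        "sarr v ''rec'' = (sarr u ''rec'')(p := Suc (sarr u ''rec'' p))"
        "sarr v ''A'' = (if sarr u ''A'' e = Suc c then (sarr u ''A'')(e := Suc p) else sarr u ''A'')"
        "sarr v ''B'' = (if sarr u ''B'' e = Suc c then (sarr u ''B'')(e := Suc p) else sarr u ''B'')"
        "sreg v ''l'' = Suc l" for v
        by (rule IR[OF take[OF False that(1-4)] that(5)])
      show ?thesis
        by (cases "sarr u ''A'' e = Suc c"; cases "sarr u ''B'' e = Suc c")
          (use False w in \<open>simp_all add: wp_simps four_times fit\<close>)
    qed
    show "wp absorb_body (\<lambda>k v. I v \<and> k + 1 + rcost (Less (Reg ''l'') (Load ''rec'' (Reg ''c''))) +
        100 * (sarr t ''rec'' c - sreg v ''l'') \<le> 100 * (sarr t ''rec'' c - sreg u ''l'')) u"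
      unfolding absorb_body_def wp_Seq[of "Assign _ _"] wp_Seq[of other_end] wp_Assign
      apply (rule wp_mono[OF other_end])
      apply (rule wp_mono[OF tail])
             apply (use regs r r' oe eu in \<open>auto simp: four_times l_def[symmetric]\<close>)
      done
  next
    fix k u assume I: "I u" and ag: "agree absorb_body ?s u" and ge: "rval u (Less (Reg ''l'') (Load ''rec'' (Reg ''c''))) = 0"
      and k: "k + 100 * (sarr t ''rec'' c - sreg u ''l'') \<le> 100 * (sarr t ''rec'' c - sreg ?s ''l'') + 1 + rcost (Less (Reg ''l'') (Load ''rec'' (Reg ''c'')))"
    have cu: "sreg u ''c'' = c" using ag c by (simp add: agree_def absorb_body_def other_end_def)
    have "sarr u ''rec'' c = sarr t ''rec'' c" using I cp by (simp add: I_def R_def)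
    then have "sreg u ''l'' = sarr t ''rec'' c" using I ge cu by (simp add: I_def)
    then show "R (sarr t ''rec'' c) u \<and> k + 2 \<le> 500" using I k r4 by (simp add: I_def)
  qed
  then show ?thesis unfolding absorb_def wp_Seq wp_Assign rval.simps
  proof (rule wp_mono)
    fix k :: nat and u assume u: "R (sarr t ''rec'' c) u \<and> k + 2 \<le> 500"
    then have "1 + rcost (Const 0) + k \<le> 500" by simp
    then show "sarr u ''rec'' = (sarr t ''rec'')(p := sarr t ''rec'' p + card S) \<and>
     (\<forall>x<p. \<forall>j<4. entry u x j = entry t x j) \<and>
     entry u p ` {..<sarr u ''rec'' p} = entry t p ` {..<sarr t ''rec'' p} \<union> S \<and>
     sarr u ''A'' = (\<lambda>e. if e \<in> S \<and> sarr t ''A'' e = Suc c then Suc p else sarr t ''A'' e) \<and>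
     sarr u ''B'' = (\<lambda>e. if e \<in> S \<and> sarr t ''B'' e = Suc c then Suc p else sarr t ''B'' e) \<and>
     1 + rcost (Const 0) + k \<le> 500"
      using u[THEN conjunct1, unfolded R_def] unfolding S_def by - (elim conjE, intro conjI; assumption)
  qed
qed

section \<open>Edge sets of a changing decomposition\<close>

context program_input
begin

definition crossing :: "(nat, nat) tcdecomp \<Rightarrow> nat \<Rightarrow> nat set" where
  "crossing D' x = {e. e < nE \<and> (fstend e \<in> below D' x) \<noteq> (sndend e \<in> below D' x)}"

definition shared :: "(nat, nat) tcdecomp \<Rightarrow> nat \<Rightarrow> nat \<Rightarrow> nat set" where
  "shared D' x y = {e. e < nE \<and> (sib_pair D' e x y \<or> sib_pair D' e y x)}"

definition siblings :: "(nat, nat) tcdecomp \<Rightarrow> nat \<Rightarrow> nat \<Rightarrow> bool" where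
  "siblings D' x y \<longleftrightarrow> x \<in> tnodes D' - {troot D'} \<and> y \<in> tnodes D' - {troot D'} \<and> x \<noteq> y \<and> tparent D' x = tparent D' y"

lemma finite_crossing: "finite (crossing D' x)"
  by (simp add: crossing_def)

lemma finite_shared: "finite (shared D' x y)"
  by (simp add: shared_def)

lemma card_crossing_set: "card {e \<in> gedges G. card (e \<inter> Y) = 1} = card {e. e < nE \<and> (fstend e \<in> Y) \<noteq> (sndend e \<in> Y)}"
  unfolding card_edge_set by (simp add: card_edge_inter[unfolded One_nat_def] cong: conj_cong)

lemma adhesion_crossing: "adhesion G D' x = card (crossing D' x)"
  unfolding adhesion_def card_crossing_set crossing_def ..

lemma siblings_disjoint:
  assumes "tc_decomp G D'" "siblings D' x y"
  shows "below D' x \<inter> below D' y = {}"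
proof -
  interpret D': tc_decomp G D' by fact
  have "x \<in> tchildren D' (tparent D' x)" "y \<in> tchildren D' (tparent D' x)"
    using assms(2) by (auto simp: siblings_def tchildren_def)
  then show ?thesis using D'.below_children_disjoint assms(2) by (auto simp: siblings_def)
qed

lemma shared_eq:
  assumes "siblings D' x y"
  shows "shared D' x y = {e. e < nE \<and> (fstend e \<in> below D' x \<and> sndend e \<in> below D' y \<or>
    fstend e \<in> below D' y \<and> sndend e \<in> below D' x)}"
  using assms unfolding shared_def sib_pair_def siblings_def by auto

lemma shared_sub:
  assumes "tc_decomp G D'" "siblings D' x y"
  shows "shared D' x y = crossing D' x \<inter> crossing D' y"
  unfolding shared_eq[OF assms(2)] crossing_def using siblings_disjoint[OF assms] by blast

lemma between_shared:
  assumes "tc_decomp G D'" "siblings D' x y"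
  shows "tc_decomp.between G D' x y = card (shared D' x y)"
proof -
  interpret D': tc_decomp G D' by fact
  have "D'.between x y = card {e. e < nE \<and> {fstend e, sndend e} \<inter> below D' x \<noteq> {} \<and> {fstend e, sndend e} \<inter> below D' y \<noteq> {}}"
    unfolding D'.between_def card_edge_set ..
  also have "{e. e < nE \<and> {fstend e, sndend e} \<inter> below D' x \<noteq> {} \<and> {fstend e, sndend e} \<inter> below D' y \<noteq> {}} = shared D' x y"
    unfolding shared_eq[OF assms(2)] using siblings_disjoint[OF assms] by blast
  finally show ?thesis .
qed

lemma crossing_union:
  assumes "tc_decomp G D'" "siblings D' x y"
  shows "{e. e < nE \<and> (fstend e \<in> below D' x \<union> below D' y) \<noteq> (sndend e \<in> below D' x \<union> below D' y)} =
    (crossing D' x - shared D' x y) \<union> (crossing D' y - shared D' x y)"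
  unfolding shared_eq[OF assms(2)] crossing_def using siblings_disjoint[OF assms] by blast

text \<open>A shared edge is counted for both siblings and vanishes in the union. Writing the
  equation as a sum avoids subtraction; the second part gives the form in which the program
  accumulates the value.\<close>

lemma card_crossing_union:
  assumes "tc_decomp G D'" "siblings D' x y"
  shows "card ((crossing D' x - shared D' x y) \<union> (crossing D' y - shared D' x y)) + 2 * card (shared D' x y) =
    card (crossing D' x) + card (crossing D' y)"
    "card ((crossing D' x - shared D' x y) \<union> (crossing D' y - shared D' x y)) =
      card (crossing D' x - shared D' x y) + card (crossing D' y - shared D' x y)"
proof -
  have sub: "shared D' x y \<subseteq> crossing D' x" "shared D' x y \<subseteq> crossing D' y" using shared_sub[OF assms] by auto
  show 1: "card ((crossing D' x - shared D' x y) \<union> (crossing D' y - shared D' x y)) =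
      card (crossing D' x - shared D' x y) + card (crossing D' y - shared D' x y)"
    by (rule card_Un_disjoint) (use finite_crossing shared_sub[OF assms] in auto)
  have "card (crossing D' x - shared D' x y) + card (shared D' x y) = card (crossing D' x)"
    "card (crossing D' y - shared D' x y) + card (shared D' x y) = card (crossing D' y)"
    using card_Diff_subset[OF finite_shared sub(1)] card_mono[OF finite_crossing sub(1)]
      card_Diff_subset[OF finite_shared sub(2)] card_mono[OF finite_crossing sub(2)] by simp_all
  then show "card ((crossing D' x - shared D' x y) \<union> (crossing D' y - shared D' x y)) + 2 * card (shared D' x y) =
    card (crossing D' x) + card (crossing D' y)" unfolding 1 by simp
qed

lemma sib_pair_siblings: "sib_pair D' e x y \<Longrightarrow> siblings D' x y"
  by (auto simp: sib_pair_def siblings_def)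

lemma siblings_sym: "siblings D' x y \<Longrightarrow> siblings D' y x"
  by (auto simp: siblings_def)

lemma other_iff:
  assumes "AB_ok D' nE A B" "e < nE"
  shows "other A B c e = Suc d \<longleftrightarrow> sib_pair D' e c d \<or> sib_pair D' e d c"
proof
  assume o: "other A B c e = Suc d"
  have "A e \<noteq> 0 \<or> B e \<noteq> 0" using o by (auto simp: other_def split: if_splits)
  then obtain x y where xy: "sib_pair D' e x y" "A e = Suc x" "B e = Suc y"
    using assms unfolding AB_ok_def by metis
  then show "sib_pair D' e c d \<or> sib_pair D' e d c" using o by (auto simp: other_def split: if_splits)
next
  assume "sib_pair D' e c d \<or> sib_pair D' e d c"
  then show "other A B c e = Suc d"
  proof
    assume p: "sib_pair D' e c d"
    then have "A e = Suc c" "B e = Suc d" using assms unfolding AB_ok_def by blast+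
    then show ?thesis by (simp add: other_def)
  next
    assume p: "sib_pair D' e d c"
    then have "A e = Suc d" "B e = Suc c" "c \<noteq> d" using assms unfolding AB_ok_def sib_pair_def by blast+
    then show ?thesis by (simp add: other_def)
  qed
qed

text \<open>\<open>rec\<close> is guaranteed only where it is 3 or 4 and for nodes occurring in
  \<open>A\<close> or \<open>B\<close>. The zero at other nodes does no harm, as they share no edge
  with a sibling. The last conjunct bounds the number of merges: each replaces two nodes with an
  input node as parent by one and adds one node, so the sum stays the same.\<close>

definition valid :: "(nat, nat) tcdecomp \<Rightarrow> rstate \<Rightarrow> bool" where
  "valid D' t \<longleftrightarrow> tc_decomp G D' \<and> nice G D' \<and> tcwidth G D' \<le> max 4 (tcwidth G D) \<and>
    nN \<le> sreg t ''nodes'' \<and> tnodes D' = {..<sreg t ''nodes''} \<and> troot D' = rt \<and>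
    (\<forall>x<sreg t ''nodes''. x \<noteq> rt \<longrightarrow> sarr t ''parent'' x = tparent D' x) \<and>
    (\<forall>x<sreg t ''nodes''. tbag D' x = (if x < nN then tbag D x else {})) \<and>
    (\<forall>x<sreg t ''nodes''. nN \<le> x \<longrightarrow> card (tchildren D' x) \<le> 2) \<and>
    (\<forall>x<sreg t ''nodes''. sarr t ''rec'' x \<in> {3, 4} \<longrightarrow>
       sarr t ''rec'' x = adhesion G D' x \<and> entry t x ` {..<sarr t ''rec'' x} = crossing D' x) \<and>
    (\<forall>x\<ge>sreg t ''nodes''. sarr t ''rec'' x = 0) \<and>
    AB_ok D' nE (sarr t ''A'') (sarr t ''B'') \<and>
    (\<forall>e<nE. \<forall>x. sarr t ''A'' e = Suc x \<or> sarr t ''B'' e = Suc x \<longrightarrow> sarr t ''rec'' x = adhesion G D' x) \<and>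
    card {x \<in> tnodes D' - {rt}. tparent D' x < nN} + sreg t ''nodes'' < 2 * nN"

lemma validD:
  assumes "valid D' t"
  shows "tc_decomp G D'" "nice G D'" "tcwidth G D' \<le> max 4 (tcwidth G D)"
    "nN \<le> sreg t ''nodes''" "tnodes D' = {..<sreg t ''nodes''}" "troot D' = rt"
    "\<And>x. x < sreg t ''nodes'' \<Longrightarrow> x \<noteq> rt \<Longrightarrow> sarr t ''parent'' x = tparent D' x"
    "\<And>x. x < sreg t ''nodes'' \<Longrightarrow> tbag D' x = (if x < nN then tbag D x else {})"
    "\<And>x. x < sreg t ''nodes'' \<Longrightarrow> nN \<le> x \<Longrightarrow> card (tchildren D' x) \<le> 2"
    "\<And>x. x < sreg t ''nodes'' \<Longrightarrow> sarr t ''rec'' x \<in> {3, 4} \<Longrightarrow> sarr t ''rec'' x = adhesion G D' x"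
    "\<And>x. x < sreg t ''nodes'' \<Longrightarrow> sarr t ''rec'' x \<in> {3, 4} \<Longrightarrow> entry t x ` {..<sarr t ''rec'' x} = crossing D' x"
    "\<And>x. x \<ge> sreg t ''nodes'' \<Longrightarrow> sarr t ''rec'' x = 0"
    "AB_ok D' nE (sarr t ''A'') (sarr t ''B'')"
    "\<And>e x. e < nE \<Longrightarrow> sarr t ''A'' e = Suc x \<or> sarr t ''B'' e = Suc x \<Longrightarrow> sarr t ''rec'' x = adhesion G D' x"
    "card {x \<in> tnodes D' - {rt}. tparent D' x < nN} + sreg t ''nodes'' < 2 * nN"
proof -
  show "tc_decomp G D'" "nice G D'" "tcwidth G D' \<le> max 4 (tcwidth G D)"
    "nN \<le> sreg t ''nodes''" "tnodes D' = {..<sreg t ''nodes''}" "troot D' = rt"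
    "AB_ok D' nE (sarr t ''A'') (sarr t ''B'')"
    "card {x \<in> tnodes D' - {rt}. tparent D' x < nN} + sreg t ''nodes'' < 2 * nN"
    using assms unfolding valid_def by - (elim conjE, assumption)+
  have all: "\<forall>x<sreg t ''nodes''. x \<noteq> rt \<longrightarrow> sarr t ''parent'' x = tparent D' x"
    "\<forall>x<sreg t ''nodes''. tbag D' x = (if x < nN then tbag D x else {})"
    "\<forall>x<sreg t ''nodes''. nN \<le> x \<longrightarrow> card (tchildren D' x) \<le> 2"
    "\<forall>x<sreg t ''nodes''. sarr t ''rec'' x \<in> {3, 4} \<longrightarrow>
       sarr t ''rec'' x = adhesion G D' x \<and> entry t x ` {..<sarr t ''rec'' x} = crossing D' x"
    "\<forall>x\<ge>sreg t ''nodes''. sarr t ''rec'' x = 0"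
    "\<forall>e<nE. \<forall>x. sarr t ''A'' e = Suc x \<or> sarr t ''B'' e = Suc x \<longrightarrow> sarr t ''rec'' x = adhesion G D' x"
    using assms unfolding valid_def by - (elim conjE, assumption)+
  note rules = all[rule_format]
  show "\<And>x. x < sreg t ''nodes'' \<Longrightarrow> x \<noteq> rt \<Longrightarrow> sarr t ''parent'' x = tparent D' x" by (rule rules(1))
  show "\<And>x. x < sreg t ''nodes'' \<Longrightarrow> tbag D' x = (if x < nN then tbag D x else {})" by (rule rules(2))
  show "\<And>x. x < sreg t ''nodes'' \<Longrightarrow> nN \<le> x \<Longrightarrow> card (tchildren D' x) \<le> 2" by (rule rules(3))
  show "\<And>x. x < sreg t ''nodes'' \<Longrightarrow> sarr t ''rec'' x \<in> {3, 4} \<Longrightarrow> sarr t ''rec'' x = adhesion G D' x"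
    by (rule conjunct1[OF all(4)[THEN spec, THEN mp, THEN mp]])
  show "\<And>x. x < sreg t ''nodes'' \<Longrightarrow> sarr t ''rec'' x \<in> {3, 4} \<Longrightarrow> entry t x ` {..<sarr t ''rec'' x} = crossing D' x"
    by (rule conjunct2[OF all(4)[THEN spec, THEN mp, THEN mp]])
  show "\<And>x. x \<ge> sreg t ''nodes'' \<Longrightarrow> sarr t ''rec'' x = 0" by (rule all(5)[rule_format])
  show "\<And>e x. e < nE \<Longrightarrow> sarr t ''A'' e = Suc x \<or> sarr t ''B'' e = Suc x \<Longrightarrow> sarr t ''rec'' x = adhesion G D' x"
    by (rule all(6)[THEN spec, THEN mp, THEN spec, THEN mp])
qed

definition mergeable :: "(nat, nat) tcdecomp \<Rightarrow> nat \<Rightarrow> nat \<Rightarrow> bool" where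
  "mergeable D' x y \<longleftrightarrow> adhesion G D' x \<in> {3, 4} \<and> adhesion G D' y \<in> {3, 4} \<and>
     adhesion G D' x + adhesion G D' y \<in> {3 + 2 * card (shared D' x y), 4 + 2 * card (shared D' x y)}"

lemma shared_sym: "shared D' x y = shared D' y x"
  by (auto simp: shared_def)

lemma mergeable_sym: "mergeable D' x y \<Longrightarrow> mergeable D' y x"
  unfolding mergeable_def shared_sym[of D' x y] by (simp add: add.commute)

text \<open>The list has as many positions as there are crossing edges, and it enumerates all of
  them.\<close>

lemma entry_inj:
  assumes v: "valid D' t" and c: "c < sreg t ''nodes''" "sarr t ''rec'' c \<in> {3, 4}"
  shows "inj_on (entry t c) {..<sarr t ''rec'' c}"
proof (rule eq_card_imp_inj_on)
  show "card (entry t c ` {..<sarr t ''rec'' c}) = card {..<sarr t ''rec'' c}"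
    unfolding validD(11)[OF v c] using validD(10)[OF v c] adhesion_crossing[of D' c] by simp
qed simp

lemma common_count_shared:
  assumes v: "valid D' t" and c: "c < sreg t ''nodes''" "sarr t ''rec'' c \<in> {3, 4}" and s: "siblings D' c d"
  shows "common_count t c (Suc d) = card (shared D' c d)"
proof -
  let ?L = "{l. l < sarr t ''rec'' c \<and> oth t c (entry t c l) = Suc d}"
  have img: "entry t c ` {..<sarr t ''rec'' c} = crossing D' c" by (rule validD(11)[OF v c])
  have "inj_on (entry t c) ?L" by (rule inj_on_subset[OF entry_inj[OF v c]]) auto
  then have "card ?L = card (entry t c ` ?L)" by (simp add: card_image)
  also have "entry t c ` ?L = {e \<in> crossing D' c. oth t c e = Suc d}" unfolding img[symmetric] by auto
  also have "\<dots> = shared D' c d"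
  proof (rule set_eqI)
    fix e
    have "e \<in> crossing D' c \<Longrightarrow> e < nE" by (simp add: crossing_def)
    then have "e \<in> crossing D' c \<and> oth t c e = Suc d \<longleftrightarrow> e \<in> crossing D' c \<and> e \<in> shared D' c d"
      using other_iff[OF validD(13)[OF v], of e c d] unfolding shared_def by blast
    then show "e \<in> {e \<in> crossing D' c. oth t c e = Suc d} \<longleftrightarrow> e \<in> shared D' c d"
      using shared_sub[OF validD(1)[OF v] s] by blast
  qed
  finally show ?thesis unfolding common_count_def .
qed

lemma good_mergeable:
  assumes v: "valid D' t" and c: "c < sreg t ''nodes''" "sarr t ''rec'' c \<in> {3, 4}"
    and j: "j < sarr t ''rec'' c" "oth t c (entry t c j) = Suc d"
  shows "siblings D' c d" "d < sreg t ''nodes''" "sarr t ''rec'' d = adhesion G D' d" "shared D' c d \<noteq> {}"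
    "good t c (Suc d) \<longleftrightarrow> mergeable D' c d"
proof -
  let ?e = "entry t c j"
  have "?e \<in> crossing D' c" using validD(11)[OF v c] j(1) by blast
  then have e: "?e < nE" by (simp add: crossing_def)
  then have p: "sib_pair D' ?e c d \<or> sib_pair D' ?e d c" using other_iff[OF validD(13)[OF v] e] j(2) by blast
  then show s: "siblings D' c d" using sib_pair_siblings siblings_sym by blast
  then show d: "d < sreg t ''nodes''" using validD(5)[OF v] by (simp add: siblings_def)
  have "sarr t ''A'' ?e = Suc d \<or> sarr t ''B'' ?e = Suc d" using j(2) by (auto simp: other_def split: if_splits)
  then show rd: "sarr t ''rec'' d = adhesion G D' d" using validD(14)[OF v e] by blast
  show "shared D' c d \<noteq> {}" using p e by (auto simp: shared_def)
  show "good t c (Suc d) \<longleftrightarrow> mergeable D' c d"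
    unfolding good_def mergeable_def common_count_shared[OF v c s] diff_Suc_1 rd
    using validD(10)[OF v c] c(2) by auto
qed

lemma sibling_merge:
  assumes v: "valid D' t" and s: "siblings D' c d" "shared D' c d \<noteq> {}" and m: "mergeable D' c d"
  shows "sibling_merge G D' (tparent D' c) c d (sreg t ''nodes'')"
proof -
  note tc = validD(1)[OF v]
  interpret D': tc_decomp G D' by (rule tc)
  show ?thesis
  proof
    show "c \<in> tchildren D' (tparent D' c)" "d \<in> tchildren D' (tparent D' c)" "c \<noteq> d"
      using s(1) by (auto simp: siblings_def tchildren_def)
    show "sreg t ''nodes'' \<notin> tnodes D'" using validD(5)[OF v] by simp
    show "D'.between c d \<noteq> 0" using between_shared[OF tc s(1)] s(2) finite_shared by simp
    show "bold G D' c" "bold G D' d" using m by (auto simp: mergeable_def)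
    show "card {e \<in> gedges G. card (e \<inter> (below D' c \<union> below D' d)) = 1} \<in> {3, 4}"
      using m card_crossing_union(1)[OF tc s(1)] unfolding card_crossing_set crossing_union[OF tc s(1)] mergeable_def adhesion_crossing
      by auto
  qed
qed


text \<open>Old nodes keep their \<open>below\<close>, so their adhesions and edge lists survive;
  only the sibling pairs involving \<open>c\<close> or \<open>d\<close> change. \<open>S1\<close>
  and \<open>S2\<close> are disjoint and together form the set of edges crossing the new
  node.\<close>

lemma valid_merge:
  assumes v: "valid D' t" and s: "siblings D' c d" "shared D' c d \<noteq> {}" and m: "mergeable D' c d"
    and cr: "sarr t ''rec'' c = adhesion G D' c" "sarr t ''rec'' d = adhesion G D' d" and low: "tparent D' c < nN"
  defines "N \<equiv> sreg t ''nodes''" and "S1 \<equiv> crossing D' c - shared D' c d" and "S2 \<equiv> crossing D' d - shared D' c d"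
  assumes u: "sreg u ''nodes'' = Suc N" "sarr u ''parent'' = (sarr t ''parent'')(N := tparent D' c, c := N, d := N)"
      "sarr u ''rec'' = (sarr t ''rec'')(N := card S1 + card S2)"
      "\<And>x j. x < N \<Longrightarrow> j < 4 \<Longrightarrow> entry u x j = entry t x j"
      "entry u N ` {..<sarr u ''rec'' N} = S1 \<union> S2"
      "\<And>e. sarr u ''A'' e = (if e \<in> S1 \<and> sarr t ''A'' e = Suc c \<or> e \<in> S2 \<and> sarr t ''A'' e = Suc d then Suc N else sarr t ''A'' e)"
      "\<And>e. sarr u ''B'' e = (if e \<in> S1 \<and> sarr t ''B'' e = Suc c \<or> e \<in> S2 \<and> sarr t ''B'' e = Suc d then Suc N else sarr t ''B'' e)"
  shows "valid (merge_siblings D' c d N) u"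
proof -
  have sm: "sibling_merge G D' (tparent D' c) c d N"
    unfolding N_def by (rule sibling_merge[OF v s m])
  have parD: "tparent D' x \<in> tnodes D'" if "x \<in> tnodes D'" "x \<noteq> troot D'" for x
    using tc_decomp.tcd[OF validD(1)[OF v]] that unfolding tree_cut_decomposition_def rooted_tree_def by blast
  let ?E = "merge_siblings D' c d N"
  note V = validD[OF v, folded N_def]
  have cd: "c < N" "d < N" "c \<noteq> rt" "d \<noteq> rt" "c \<noteq> d" "tparent D' d = tparent D' c"
    using s(1) V(5,6) by (auto simp: siblings_def)
  have ms: "tnodes ?E = insert N (tnodes D')" "troot ?E = troot D'" "tbag ?E = (tbag D')(N := {})"
    "tparent ?E = (tparent D')(c := N, d := N, N := tparent D' c)" by (simp_all add: merge_siblings_def)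
  have nodes: "tnodes ?E = {..<Suc N}" unfolding ms V(5) by (rule lessThan_Suc[symmetric])
  have bel: "below ?E x = below D' x" if "x < N" for x using sibling_merge.merge_below[OF sm] V(5) that by simp
  have adh: "adhesion G ?E x = adhesion G D' x" if "x < N" for x using sibling_merge.merge_adhesion[OF sm] V(5) that by simp
  have crs: "crossing ?E x = crossing D' x" if "x < N" for x using bel[OF that] by (simp add: crossing_def)
  have crN: "crossing ?E N = S1 \<union> S2"
    unfolding S1_def S2_def crossing_union[OF V(1) s(1), symmetric]
    unfolding crossing_def sibling_merge.merge_below_p[OF sm] ..
  have disj: "below D' c \<inter> below D' d = {}" by (rule siblings_disjoint[OF V(1) s(1)])
  have adhN: "adhesion G ?E N = card S1 + card S2"
    unfolding adhesion_crossing crN S1_def S2_def by (rule card_crossing_union(2)[OF V(1) s(1)])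
  have parE: "tparent ?E x = (if x = c \<or> x = d then N else if x = N then tparent D' c else tparent D' x)" for x
    using cd unfolding ms by simp
  have pN: "tparent ?E N = tparent D' c" and pcd: "\<And>x. x \<in> {c, d} \<Longrightarrow> tparent ?E x = N"
    and pold: "\<And>x. x < N \<Longrightarrow> x \<notin> {c, d} \<Longrightarrow> tparent ?E x = tparent D' x"
    using cd unfolding parE by auto
  have parlt: "tparent D' x < N" if "x < N" "x \<noteq> rt" for x
    using parD[of x] that unfolding V(5,6) by simp
  have pcN: "tparent D' c < N" using parlt[of c] cd by blast
  have pin: "tparent ?E x = N \<longleftrightarrow> x \<in> {c, d}" if "x < N" "x \<noteq> rt" for x
    using pcd[of x] pold[of x] parlt[of x] that by fastforce
  have sibc: "y < N \<and> y \<noteq> c \<and> y \<noteq> d \<and> tparent D' y = tparent D' c"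
    if "y < Suc N" "y \<noteq> rt" "y \<noteq> N" "tparent ?E y = tparent D' c" for y
    using pin[of y] pold[of y] pcN that by auto
  have belN: "below ?E N = below D' c \<union> below D' d" by (rule sibling_merge.merge_below_p[OF sm])
  have spE: "sib_pair ?E e x y \<longleftrightarrow> x < Suc N \<and> x \<noteq> rt \<and> y < Suc N \<and> y \<noteq> rt \<and> x \<noteq> y \<and> tparent ?E x = tparent ?E y \<and>
      fstend e \<in> below ?E x \<and> sndend e \<in> below ?E y" for e x y
    using V(6) unfolding sib_pair_def nodes ms(2) by auto
  have spD: "sib_pair D' e x y \<longleftrightarrow> x < N \<and> x \<noteq> rt \<and> y < N \<and> y \<noteq> rt \<and> x \<noteq> y \<and> tparent D' x = tparent D' y \<and>
      fstend e \<in> below D' x \<and> sndend e \<in> below D' y" for e x y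
    unfolding sib_pair_def V(5,6) by auto
  have rtN: "rt < N" using V(4) rt_less by simp
  have old_AB: "A e = Suc x \<and> B e = Suc y" if "sib_pair D' e x y" "e < nE" "A = sarr t ''A''" "B = sarr t ''B''" for A B e x y
    using V(13) that unfolding AB_ok_def by blast
  have S1_iff: "e \<in> S1 \<longleftrightarrow> e < nE \<and> (fstend e \<in> below D' c \<and> sndend e \<notin> below D' c \<and> sndend e \<notin> below D' d \<or>
      sndend e \<in> below D' c \<and> fstend e \<notin> below D' c \<and> fstend e \<notin> below D' d)" for e
    unfolding S1_def shared_eq[OF s(1)] crossing_def using disj by blast
  have S2_iff: "e \<in> S2 \<longleftrightarrow> e < nE \<and> (fstend e \<in> below D' d \<and> sndend e \<notin> below D' c \<and> sndend e \<notin> below D' d \<or>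
      sndend e \<in> below D' d \<and> fstend e \<notin> below D' c \<and> fstend e \<notin> below D' d)" for e
    unfolding S2_def shared_eq[OF s(1)] crossing_def using disj by blast
  have djc: "below D' x \<inter> below D' c = {}" "below D' x \<inter> below D' d = {}"
    if "x < N" "x \<noteq> rt" "x \<noteq> c" "x \<noteq> d" "tparent D' x = tparent D' c" for x
  proof -
    have "siblings D' x c" "siblings D' x d" using that cd V(5,6) by (auto simp: siblings_def)
    then show "below D' x \<inter> below D' c = {}" "below D' x \<inter> below D' d = {}" using siblings_disjoint[OF V(1)] by blast+
  qed
  \<comment> \<open>The map \<open>f\<close> replaces \<open>c\<close> and \<open>d\<close> by the
    new node, except for an edge between \<open>c\<close> and \<open>d\<close>: its ends remain
    siblings under the new node. Such an edge lies in neither \<open>S1\<close> nor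
    \<open>S2\<close>, so its entries are left alone.\<close>
  have new_pair: "sib_pair ?E e (f x) (f y) \<and> sarr u ''A'' e = Suc (f x) \<and> sarr u ''B'' e = Suc (f y)"
    if e: "e < nE" and p: "sib_pair D' e x y" and f: "f = (\<lambda>x'. if x \<in> {c, d} \<and> y \<in> {c, d} then x' else if x' = c \<or> x' = d then N else x')" for e x y f
  proof -
    note p' = p[unfolded spD]
    have AB: "sarr t ''A'' e = Suc x" "sarr t ''B'' e = Suc y" using old_AB[OF p e] by auto
    consider "x \<in> {c, d}" "y \<in> {c, d}" | "x \<in> {c, d}" "y \<notin> {c, d}" | "x \<notin> {c, d}" "y \<in> {c, d}" | "x \<notin> {c, d}" "y \<notin> {c, d}" by blast
    then show ?thesis
    proof cases
      case 1
      then have fx: "f x = x" "f y = y" by (auto simp: f)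
      have "e \<notin> S1" "e \<notin> S2" using 1 p' disj unfolding S1_iff S2_iff by auto
      moreover have "tparent ?E x = N" "tparent ?E y = N" using pcd 1 by blast+
      ultimately show ?thesis unfolding fx spE u(6,7) AB using p' bel by simp
    next
      case 2
      then have fx: "f x = N" "f y = y" by (auto simp: f)
      have ty: "tparent D' y = tparent D' c" using 2 p' cd by auto
      have "fstend e \<in> below D' x" "sndend e \<in> below D' y" "sndend e \<notin> below D' c" "sndend e \<notin> below D' d"
        using p' djc[of y] 2 ty by auto
      then have S: "x = c \<and> e \<in> S1 \<or> x = d \<and> e \<in> S2" "fstend e \<in> below D' c \<union> below D' d" using 2 e disj unfolding S1_iff S2_iff by auto
      have "sarr u ''A'' e = Suc N" "sarr u ''B'' e = Suc y" unfolding u(6,7) AB using S(1) 2 by auto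
      moreover have "tparent ?E y = tparent D' c" "y \<noteq> N" using pold[of y] 2 p' ty by auto
      ultimately show ?thesis unfolding fx spE pN belN using p' S(2) bel[of y] rtN by simp
    next
      case 3
      then have fx: "f x = x" "f y = N" by (auto simp: f)
      have tx: "tparent D' x = tparent D' c" using 3 p' cd by auto
      have "fstend e \<in> below D' x" "sndend e \<in> below D' y" "fstend e \<notin> below D' c" "fstend e \<notin> below D' d"
        using p' djc[of x] 3 tx by auto
      then have S: "y = c \<and> e \<in> S1 \<or> y = d \<and> e \<in> S2" "sndend e \<in> below D' c \<union> below D' d" using 3 e disj unfolding S1_iff S2_iff by auto
      have "sarr u ''B'' e = Suc N" "sarr u ''A'' e = Suc x" unfolding u(6,7) AB using S(1) 3 by auto
      moreover have "tparent ?E x = tparent D' c" "x \<noteq> N" using pold[of x] 3 p' tx by auto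
      ultimately show ?thesis unfolding fx spE pN belN using p' S(2) bel[of x] rtN by simp
    next
      case 4
      then have fx: "f x = x" "f y = y" by (auto simp: f)
      have "sarr u ''A'' e = Suc x" "sarr u ''B'' e = Suc y" unfolding u(6,7) AB using 4 by auto
      moreover have "tparent ?E x = tparent D' x" "tparent ?E y = tparent D' y" using pold 4 p' by blast+
      ultimately show ?thesis unfolding fx spE using p' bel by simp
    qed
  qed
  \<comment> \<open>Conversely, every pair of the new decomposition arises in this way; a pair with
    the new node is traced back to whichever of \<open>c\<close> and \<open>d\<close> contains the
    end of the edge.\<close>
  have old_pair: "\<exists>x' y'. sib_pair D' e x' y' \<and> x = (if x' \<in> {c, d} \<and> y' \<in> {c, d} then x' else if x' = c \<or> x' = d then N else x') \<and>
      y = (if x' \<in> {c, d} \<and> y' \<in> {c, d} then y' else if y' = c \<or> y' = d then N else y')"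
    if e: "e < nE" and p: "sib_pair ?E e x y" for e x y
  proof -
    note p' = p[unfolded spE]
    consider "x = N" | "y = N" | "x \<noteq> N" "y \<noteq> N" by blast
    then show ?thesis
    proof cases
      case 1
      then have y: "y < N" "y \<noteq> c" "y \<noteq> d" "tparent D' y = tparent D' c" using sibc[of y] p' 1 pN by auto
      have f: "fstend e \<in> below D' c \<or> fstend e \<in> below D' d" using p' 1 belN by auto
      then obtain x' where x': "x' \<in> {c, d}" "fstend e \<in> below D' x'" by blast
      have "sib_pair D' e x' y" unfolding spD using x' y p' bel[of y] cd by auto
      then show ?thesis using x' y 1 by (intro exI[of _ x'] exI[of _ y]) auto
    next
      case 2
      then have x: "x < N" "x \<noteq> c" "x \<noteq> d" "tparent D' x = tparent D' c" using sibc[of x] p' 2 pN by auto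
      have f: "sndend e \<in> below D' c \<or> sndend e \<in> below D' d" using p' 2 belN by auto
      then obtain y' where y': "y' \<in> {c, d}" "sndend e \<in> below D' y'" by blast
      have "sib_pair D' e x y'" unfolding spD using y' x p' bel[of x] cd by auto
      then show ?thesis using y' x 2 by (intro exI[of _ x] exI[of _ y']) auto
    next
      case 3
      then have xy: "x < N" "y < N" using p' by auto
      have xyc: "(x \<in> {c, d}) = (y \<in> {c, d})" using p' pin[of x] pin[of y] xy by simp
      moreover have "tparent D' x = tparent D' y"
      proof (cases "x \<in> {c, d}")
        case True
        then show ?thesis using xyc cd(6) by auto
      next
        case False
        then show ?thesis using xyc pold[OF xy(1)] pold[OF xy(2)] p' by simp
      qed
      then have "sib_pair D' e x y" unfolding spD using p' xy bel by auto
      ultimately show ?thesis using xy by (intro exI[of _ x] exI[of _ y]) auto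
    qed
  qed
  have AB: "AB_ok ?E nE (sarr u ''A'') (sarr u ''B'')"
    unfolding AB_ok_def
  proof (intro allI impI conjI)
    fix e x y assume e: "e < nE" and p: "sib_pair ?E e x y"
    from old_pair[OF e p] obtain x' y' where xy: "sib_pair D' e x' y'"
      "x = (if x' \<in> {c, d} \<and> y' \<in> {c, d} then x' else if x' = c \<or> x' = d then N else x')"
      "y = (if x' \<in> {c, d} \<and> y' \<in> {c, d} then y' else if y' = c \<or> y' = d then N else y')" by blast
    from new_pair[OF e xy(1) refl] show "sarr u ''A'' e = Suc x" "sarr u ''B'' e = Suc y"
      unfolding xy(2,3) by blast+
  next
    fix e assume e: "e < nE"
    show "sarr u ''A'' e = 0 \<and> sarr u ''B'' e = 0 \<or> (\<exists>x y. sib_pair ?E e x y \<and> sarr u ''A'' e = Suc x \<and> sarr u ''B'' e = Suc y)"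
    proof (cases "sarr t ''A'' e = 0 \<and> sarr t ''B'' e = 0")
      case True
      then show ?thesis unfolding u(6,7) by simp
    next
      case False
      then obtain x y where "sib_pair D' e x y" using V(13) e unfolding AB_ok_def by blast
      from new_pair[OF e this refl] show ?thesis by blast
    qed
  qed
  have sum4: "card S1 + card S2 \<in> {3, 4}" using sibling_merge.merge_adhesion_p[OF sm] adhN by simp
  show ?thesis
    unfolding valid_def u(1)
  proof (intro conjI allI impI)
    show "tc_decomp G ?E" by (rule tc_decomp.intro[OF simple sibling_merge.merge_tcd[OF sm]])
    show "nice G ?E" by (rule sibling_merge.merge_nice[OF sm V(2)])
    show "tcwidth G ?E \<le> max 4 (tcwidth G D)" using sibling_merge.merge_width[OF sm] V(3) by auto
    show "nN \<le> Suc N" using V(4) by simp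
    show "tnodes ?E = {..<Suc N}" by (rule nodes)
    show "troot ?E = rt" using V(6) unfolding ms by simp
    show "sarr u ''parent'' x = tparent ?E x" if "x < Suc N" "x \<noteq> rt" for x
      unfolding u(2) parE using that V(7)[of x] cd by auto
    show "tbag ?E x = (if x < nN then tbag D x else {})" if "x < Suc N" for x
      using that V(8)[of x] V(4) unfolding ms by auto
    show "card (tchildren ?E x) \<le> 2" if "x < Suc N" "nN \<le> x" for x
    proof (cases "x = N")
      case True
      then show ?thesis unfolding True sibling_merge.merge_children_p[OF sm] by (simp add: card_insert_if)
    next
      case False
      then have "tchildren ?E x = tchildren D' x" using sibling_merge.merge_children[OF sm, of x] that V(5) low by auto
      then show ?thesis using V(9)[of x] that False by simp
    qed
    show "sarr u ''rec'' x = adhesion G ?E x" if "x < Suc N" "sarr u ''rec'' x \<in> {3, 4}" for x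
    proof (cases "x = N")
      case True
      then show ?thesis using adhN unfolding u(3) by simp
    next
      case False
      then have "sarr u ''rec'' x = sarr t ''rec'' x" unfolding u(3) by simp
      then show ?thesis using that False adh[of x] V(10)[of x] by auto
    qed
    show "entry u x ` {..<sarr u ''rec'' x} = crossing ?E x" if "x < Suc N" "sarr u ''rec'' x \<in> {3, 4}" for x
    proof (cases "x = N")
      case True
      then show ?thesis using u(5) crN by simp
    next
      case False
      then have r: "sarr u ''rec'' x = sarr t ''rec'' x" unfolding u(3) by simp
      have xN: "x < N" using that False by simp
      have "entry u x ` {..<sarr t ''rec'' x} = entry t x ` {..<sarr t ''rec'' x}"
        by (rule image_cong[OF refl]) (use u(4)[OF xN] that(2) r in auto)
      then show ?thesis using V(11)[OF xN] that(2) crs[OF xN] unfolding r by simp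
    qed
    show "sarr u ''rec'' x = 0" if "Suc N \<le> x" for x unfolding u(3) using V(12)[of x] that by simp
    show "AB_ok ?E nE (sarr u ''A'') (sarr u ''B'')" by (rule AB)
    show "sarr u ''rec'' x = adhesion G ?E x" if e: "e < nE" and x: "sarr u ''A'' e = Suc x \<or> sarr u ''B'' e = Suc x" for e x
    proof (cases "x = N")
      case True
      then show ?thesis using adhN unfolding u(3) by simp
    next
      case False
      then have xt: "sarr t ''A'' e = Suc x \<or> sarr t ''B'' e = Suc x" using x unfolding u(6,7) by (auto split: if_splits)
      then have "sib_pair D' e x y \<or> sib_pair D' e y x" if "sib_pair D' e x' y'" "y = (if x = x' then y' else x')" for x' y' y
        using that old_AB[OF that(1) e refl refl] by auto
      moreover obtain x' y' where "sib_pair D' e x' y'" using V(13) e xt unfolding AB_ok_def by fastforce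
      ultimately have "x < N" unfolding spD by blast
      then show ?thesis using V(14)[OF e xt] adh False unfolding u(3) by simp
    qed
    show "card {x \<in> tnodes ?E - {rt}. tparent ?E x < nN} + Suc N < 2 * nN"
    proof -
      let ?F = "{x \<in> tnodes D' - {rt}. tparent D' x < nN}"
      have "{x \<in> tnodes ?E - {rt}. tparent ?E x < nN} = insert N (?F - {c, d})"
        unfolding nodes V(5) using parE cd rtN low V(4) by (auto simp: less_Suc_eq)
      moreover have "N \<notin> ?F" "finite ?F" using V(5) by simp_all
      moreover have sub: "{c, d} \<subseteq> ?F" using cd low V(5) by auto
      ultimately have "card {x \<in> tnodes ?E - {rt}. tparent ?E x < nN} = Suc (card ?F - card {c, d})" "card {c, d} \<le> card ?F"
        using card_Diff_subset[OF _ sub] card_mono[OF \<open>finite ?F\<close> sub] by (simp_all only: card_insert_disjoint finite_Diff finite.intros Diff_iff simp_thms)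
      moreover have "card {c, d} = 2" using cd(5) by simp
      ultimately show ?thesis using V(15) by linarith
    qed
  qed
qed

end

text \<open>Keeps the root, whose parent entry is meaningless, from passing the test on
  adhesions.\<close>

lemma (in tc_decomp) adhesion_root: "adhesion G D (troot D) = 0"
proof -
  have "e \<inter> below D (troot D) = e" if "e \<in> gedges G" for e using edge_subset[OF that] below_root by blast
  then have none: "{e \<in> gedges G. card (e \<inter> below D (troot D)) = 1} = {}" using edge_card by auto
  show ?thesis unfolding adhesion_def none by simp
qed

section \<open>The merging loop\<close>

definition do_merge :: rcom where
  "do_merge = Seq
     (Seq (Assign ''p'' (Reg ''nodes''))
     (Seq (Store ''parent'' (Reg ''p'') (Load ''parent'' (Reg ''c'')))
     (Seq (Store ''parent'' (Reg ''c'') (Reg ''p''))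
     (Seq (Assign ''b'' (Reg ''f''))
     (Seq (Store ''parent'' (Sub (Reg ''b'') (Const 1)) (Reg ''p''))
       (Assign ''nodes'' (Add (Reg ''nodes'') (Const 1))))))))
     (Seq absorb (Seq (Seq (Assign ''b'' (Add (Reg ''c'') (Const 1))) (Assign ''c'' (Sub (Reg ''f'') (Const 1)))) absorb))"

definition merge_test :: rexp where
  "merge_test = Equal (Add (Less (Load ''parent'' (Reg ''i'')) (Reg ''n''))
     (Add (Less (Const 2) (Load ''rec'' (Reg ''i''))) (Less (Load ''rec'' (Reg ''i'')) (Const 5)))) (Const 3)"

definition merge_iter :: rcom where
  "merge_iter = Cond merge_test (Seq (Assign ''c'' (Reg ''i'')) (Seq search (Cond (Reg ''f'') do_merge Skip))) Skip"

text \<open>\<open>n\<close> keeps the original number of nodes for the test on parents, while the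
  loop bound ''nodes'' is read anew in each iteration, so that new nodes are visited as
  well.\<close>

definition merge_phase :: rcom where
  "merge_phase = Seq (Assign ''n'' (Reg ''nodes'')) (for_upto ''i'' (Reg ''nodes'') merge_iter)"

lemma merge_test: "rval u merge_test \<noteq> 0 \<longleftrightarrow>
    sarr u ''parent'' (sreg u ''i'') < sreg u ''n'' \<and> sarr u ''rec'' (sreg u ''i'') \<in> {3, 4}"
  by (auto simp: merge_test_def of_bool_def)

lemma absorbed_cong:
  assumes "\<And>j. j < l \<Longrightarrow> entry u c j = entry t c j" "\<And>j. j < l \<Longrightarrow> oth u c (entry t c j) = oth t c (entry t c j)"
  shows "absorbed u c b l = absorbed t c b l"
  unfolding absorbed_def by (rule image_cong) (use assms in auto)

context program_input
begin

lemma absorbed_crossing: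
  assumes v: "valid D' t" and c: "c < sreg t ''nodes''" "sarr t ''rec'' c \<in> {3, 4}" and s: "siblings D' c d"
  shows "absorbed t c (Suc d) (sarr t ''rec'' c) = crossing D' c - shared D' c d"
proof -
  have "absorbed t c (Suc d) (sarr t ''rec'' c) = {e \<in> entry t c ` {..<sarr t ''rec'' c}. oth t c e \<noteq> Suc d}"
    unfolding absorbed_def by auto
  also have "\<dots> = {e \<in> crossing D' c. oth t c e \<noteq> Suc d}" unfolding validD(11)[OF v c] ..
  also have "\<dots> = crossing D' c - shared D' c d"
  proof (rule set_eqI)
    fix e
    have "e \<in> crossing D' c \<Longrightarrow> e < nE" by (simp add: crossing_def)
    then show "e \<in> {e \<in> crossing D' c. oth t c e \<noteq> Suc d} \<longleftrightarrow> e \<in> crossing D' c - shared D' c d"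
      using other_iff[OF validD(13)[OF v], of e c d] unfolding shared_def by blast
  qed
  finally show ?thesis .
qed

lemma do_merge:
  assumes v: "valid D' t" and c: "sreg t ''c'' = c" and f: "sreg t ''f'' = Suc d"
    and s: "siblings D' c d" "shared D' c d \<noteq> {}" and m: "mergeable D' c d"
    and cr: "sarr t ''rec'' c = adhesion G D' c" "sarr t ''rec'' d = adhesion G D' d" and low: "tparent D' c < nN"
  shows "wp do_merge (\<lambda>k u. valid (merge_siblings D' c d (sreg t ''nodes'')) u \<and>
     sreg u ''nodes'' = Suc (sreg t ''nodes'') \<and> k \<le> 2000) t"
proof -
  define N where "N = sreg t ''nodes''"
  define S1 where "S1 = crossing D' c - shared D' c d"
  define S2 where "S2 = crossing D' d - shared D' c d"
  have cN: "c < N" "c \<noteq> rt" and dN: "d < N" using s(1) validD(5,6)[OF v] by (auto simp: siblings_def N_def)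
  have rc: "sarr t ''rec'' c \<in> {3, 4}" "sarr t ''rec'' d \<in> {3, 4}" using m unfolding cr mergeable_def by blast+
  have pc: "sarr t ''parent'' c = tparent D' c" using validD(7)[OF v cN[unfolded N_def]] .
  have recN: "sarr t ''rec'' N = 0" using validD(12)[OF v, of N] by (simp add: N_def)
  define par' where "par' = (sarr t ''parent'')(N := tparent D' c, c := N, d := N)"
  define t1 where "t1 = t\<lparr>sreg := (sreg t)(''p'' := N, ''b'' := Suc d, ''nodes'' := Suc N), sarr := (sarr t)(''parent'' := par')\<rparr>"
  have t1: "sarr t1 ''rec'' = sarr t ''rec''" "sarr t1 ''E'' = sarr t ''E''" "sarr t1 ''A'' = sarr t ''A''" "sarr t1 ''B'' = sarr t ''B''"
    "sarr t1 ''parent'' = par'" "sreg t1 ''p'' = N" "sreg t1 ''b'' = Suc d" "sreg t1 ''nodes'' = Suc N" "sreg t1 ''c'' = c" "sreg t1 ''f'' = Suc d"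
    using c f by (simp_all add: t1_def)
  have abs1: "absorbed t1 c (Suc d) (sarr t ''rec'' c) = S1"
    using absorbed_crossing[OF v cN(1)[unfolded N_def] rc(1) s(1)] unfolding S1_def absorbed_def t1 .
  have abs2: "absorbed t d (Suc c) (sarr t ''rec'' d) = S2"
    using absorbed_crossing[OF v dN[unfolded N_def] rc(2) siblings_sym[OF s(1)]] unfolding S2_def shared_sym[of D' d c] .
  have r4: "sarr t ''rec'' c \<le> 4" "sarr t ''rec'' d \<le> 4" using rc by auto
  have inj: "inj_on (entry t c) {..<sarr t ''rec'' c}" "inj_on (entry t d) {..<sarr t ''rec'' d}"
    using entry_inj[OF v] cN(1) dN rc unfolding N_def by blast+
  \<comment> \<open>The second run of \<open>absorb\<close> reads \<open>A\<close> and
    \<open>B\<close> after the first has changed them, but only at edges of \<open>S1\<close>. None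
    of these crosses \<open>d\<close>, so the second run still finds the original entries.\<close>
  have S12: "e \<in> crossing D' d \<Longrightarrow> e \<notin> S1" for e
    using shared_sub[OF validD(1)[OF v] s(1)] unfolding S1_def by blast
  define Q1 where "Q1 u \<longleftrightarrow> sarr u ''rec'' = (sarr t ''rec'')(N := card S1) \<and> (\<forall>x<N. \<forall>j<4. entry u x j = entry t x j) \<and>
     entry u N ` {..<sarr u ''rec'' N} = S1 \<and>
     sarr u ''A'' = (\<lambda>e. if e \<in> S1 \<and> sarr t ''A'' e = Suc c then Suc N else sarr t ''A'' e) \<and>
     sarr u ''B'' = (\<lambda>e. if e \<in> S1 \<and> sarr t ''B'' e = Suc c then Suc N else sarr t ''B'' e)" for u :: rstate
  have Q1_upd: "Q1 (u\<lparr>sreg := r\<rparr>) = Q1 u" for u r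
  proof -
    have "sarr (u\<lparr>sreg := r\<rparr>) = sarr u" by simp
    then show ?thesis unfolding Q1_def by (simp only:)
  qed
  have one: "wp absorb (\<lambda>k u. Q1 u \<and> sreg u ''p'' = N \<and> sreg u ''c'' = c \<and> sreg u ''f'' = Suc d \<and> sreg u ''nodes'' = Suc N \<and>
      sarr u ''parent'' = par' \<and> k \<le> 500) t1"
  proof (rule wp_frame[OF absorb[OF t1(9,7,6) cN(1), unfolded t1(1-4) abs1 recN, OF r4(1) inj(1)]])
    fix k :: nat and u assume ag: "agree absorb t1 u"
    have regs: "sreg u ''p'' = N" "sreg u ''c'' = c" "sreg u ''f'' = Suc d" "sreg u ''nodes'' = Suc N" "sarr u ''parent'' = par'"
      using ag t1 by (simp_all add: agree_def absorb_def absorb_body_def other_end_def)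
    assume *: "sarr u ''rec'' = (sarr t ''rec'')(N := 0 + card S1) \<and>
     (\<forall>x<N. \<forall>j<4. entry u x j = entry t x j) \<and>
     entry u N ` {..<sarr u ''rec'' N} = entry t N ` {..<0} \<union> S1 \<and>
     sarr u ''A'' = (\<lambda>e. if e \<in> S1 \<and> sarr t ''A'' e = Suc c then Suc N else sarr t ''A'' e) \<and>
     sarr u ''B'' = (\<lambda>e. if e \<in> S1 \<and> sarr t ''B'' e = Suc c then Suc N else sarr t ''B'' e) \<and> k \<le> 500"
    have "Q1 u" "k \<le> 500"
      using *[unfolded add_0 lessThan_0 image_empty Un_empty_left] unfolding Q1_def by - (elim conjE, (intro conjI)?; assumption)+
    then show "Q1 u \<and> sreg u ''p'' = N \<and> sreg u ''c'' = c \<and> sreg u ''f'' = Suc d \<and> sreg u ''nodes'' = Suc N \<and>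
      sarr u ''parent'' = par' \<and> k \<le> 500" by (intro conjI regs)
  qed
  have two: "wp absorb (\<lambda>k u. valid (merge_siblings D' c d N) u \<and> sreg u ''nodes'' = Suc N \<and> k \<le> 500) w"
    if w: "Q1 w" "sreg w ''p'' = N" "sreg w ''c'' = d" "sreg w ''b'' = Suc c" "sreg w ''nodes'' = Suc N" "sarr w ''parent'' = par'" for w
  proof -
    note q = w(1)[unfolded Q1_def]
    have q1: "sarr w ''rec'' = (sarr t ''rec'')(N := card S1)" using q by (elim conjE)
    have q2: "\<And>x j. x < N \<Longrightarrow> j < 4 \<Longrightarrow> entry w x j = entry t x j" using q by (elim conjE) blast
    have q3: "entry w N ` {..<sarr w ''rec'' N} = S1" using q by (elim conjE)
    have q4: "sarr w ''A'' = (\<lambda>e. if e \<in> S1 \<and> sarr t ''A'' e = Suc c then Suc N else sarr t ''A'' e)"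
      "sarr w ''B'' = (\<lambda>e. if e \<in> S1 \<and> sarr t ''B'' e = Suc c then Suc N else sarr t ''B'' e)" using q by - (elim conjE, assumption)+
    have rd: "sarr w ''rec'' d = sarr t ''rec'' d" using q1 dN by simp
    have ent: "entry w d j = entry t d j" if "j < sarr t ''rec'' d" for j using q2[OF dN, of j] that r4(2) by simp
    have cross: "entry t d j \<in> crossing D' d" if "j < sarr t ''rec'' d" for j
      using validD(11)[OF v dN[unfolded N_def] rc(2)] that by blast
    have "absorbed w d (Suc c) (sarr t ''rec'' d) = absorbed t d (Suc c) (sarr t ''rec'' d)"
    proof (rule absorbed_cong[OF ent])
      fix j assume "j < sarr t ''rec'' d"
      then have "entry t d j \<notin> S1" using cross S12 by blast
      then show "oth w d (entry t d j) = oth t d (entry t d j)" unfolding other_def q4 by simp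
    qed
    then have abs: "absorbed w d (Suc c) (sarr w ''rec'' d) = S2" unfolding rd abs2 .
    have injw: "inj_on (entry w d) {..<sarr w ''rec'' d}"
      using inj(2) ent unfolding rd inj_on_def by simp
    have r4w: "sarr w ''rec'' d \<le> 4" unfolding rd by (rule r4(2))
    show ?thesis
    proof (rule wp_frame[OF absorb[OF w(3,4,2) dN r4w injw, unfolded abs]])
      fix k :: nat and u :: rstate assume ag: "agree absorb w u"
      have par: "sreg u ''nodes'' = Suc N" "sarr u ''parent'' = par'"
        using ag w by (simp_all add: agree_def absorb_def absorb_body_def other_end_def)
      assume *: "sarr u ''rec'' = (sarr w ''rec'')(N := sarr w ''rec'' N + card S2) \<and>
        (\<forall>x<N. \<forall>j<4. entry u x j = entry w x j) \<and>
        entry u N ` {..<sarr u ''rec'' N} = entry w N ` {..<sarr w ''rec'' N} \<union> S2 \<and>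
        sarr u ''A'' = (\<lambda>e. if e \<in> S2 \<and> sarr w ''A'' e = Suc d then Suc N else sarr w ''A'' e) \<and>
        sarr u ''B'' = (\<lambda>e. if e \<in> S2 \<and> sarr w ''B'' e = Suc d then Suc N else sarr w ''B'' e) \<and> k \<le> 500"
      have s1: "sarr u ''rec'' = (sarr w ''rec'')(N := sarr w ''rec'' N + card S2)"
        and s2': "\<forall>x<N. \<forall>j<4. entry u x j = entry w x j"
        and s3: "entry u N ` {..<sarr u ''rec'' N} = entry w N ` {..<sarr w ''rec'' N} \<union> S2"
        and s4: "sarr u ''A'' = (\<lambda>e. if e \<in> S2 \<and> sarr w ''A'' e = Suc d then Suc N else sarr w ''A'' e)"
          "sarr u ''B'' = (\<lambda>e. if e \<in> S2 \<and> sarr w ''B'' e = Suc d then Suc N else sarr w ''B'' e)"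
        and k: "k \<le> 500" using * by - (elim conjE, assumption)+
      have s2: "entry u x j = entry w x j" if "x < N" "j < 4" for x j using s2' that by blast
      have S2S1: "e \<in> S2 \<Longrightarrow> e \<notin> S1" for e using S12 unfolding S2_def by blast
      have "valid (merge_siblings D' c d (sreg t ''nodes'')) u"
      proof (rule valid_merge[OF v s m cr low]; fold N_def S1_def S2_def)
        show "sreg u ''nodes'' = Suc N" by (rule par(1))
        show "sarr u ''parent'' = (sarr t ''parent'')(N := tparent D' c, c := N, d := N)" unfolding par(2) par'_def ..
        show "sarr u ''rec'' = (sarr t ''rec'')(N := card S1 + card S2)" unfolding s1 q1 by simp
        show "entry u x j = entry t x j" if "x < N" "j < 4" for x j using s2[OF that] q2[OF that] by simp
        show "entry u N ` {..<sarr u ''rec'' N} = S1 \<union> S2" unfolding s3 q3 ..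
        show "sarr u ''A'' e = (if e \<in> S1 \<and> sarr t ''A'' e = Suc c \<or> e \<in> S2 \<and> sarr t ''A'' e = Suc d then Suc N else sarr t ''A'' e)" for e
          unfolding s4 q4 using S2S1[of e] dN by auto
        show "sarr u ''B'' e = (if e \<in> S1 \<and> sarr t ''B'' e = Suc c \<or> e \<in> S2 \<and> sarr t ''B'' e = Suc d then Suc N else sarr t ''B'' e)" for e
          unfolding s4 q4 using S2S1[of e] dN by auto
      qed
      then show "valid (merge_siblings D' c d N) u \<and> sreg u ''nodes'' = Suc N \<and> k \<le> 500"
        using par(1) k unfolding N_def by blast
    qed
  qed
  show ?thesis
    unfolding do_merge_def wp_Seq[of _ "Seq absorb _"] N_def[symmetric]
  proof (rule wp_mono)
    show "wp (Seq (Assign ''p'' (Reg ''nodes''))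
     (Seq (Store ''parent'' (Reg ''p'') (Load ''parent'' (Reg ''c'')))
     (Seq (Store ''parent'' (Reg ''c'') (Reg ''p''))
     (Seq (Assign ''b'' (Reg ''f''))
     (Seq (Store ''parent'' (Sub (Reg ''b'') (Const 1)) (Reg ''p''))
       (Assign ''nodes'' (Add (Reg ''nodes'') (Const 1)))))))) (\<lambda>k u. u = t1 \<and> k \<le> 50) t"
      unfolding wp_simps by (simp add: c f pc par'_def N_def[symmetric] t1_def)
  next
    fix k0 :: nat and u0 :: rstate assume u0: "u0 = t1 \<and> k0 \<le> (50::nat)"
    show "wp (Seq absorb (Seq (Seq (Assign ''b'' (Add (Reg ''c'') (Const 1))) (Assign ''c'' (Sub (Reg ''f'') (Const 1)))) absorb))
      (\<lambda>l u. valid (merge_siblings D' c d N) u \<and> sreg u ''nodes'' = Suc N \<and> k0 + l \<le> 2000) u0"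
      unfolding u0[THEN conjunct1] wp_Seq[of absorb]
    proof (rule wp_mono[OF one])
      fix k1 :: nat and u :: rstate assume u: "Q1 u \<and> sreg u ''p'' = N \<and> sreg u ''c'' = c \<and> sreg u ''f'' = Suc d \<and> sreg u ''nodes'' = Suc N \<and>
        sarr u ''parent'' = par' \<and> k1 \<le> 500"
      show "wp (Seq (Seq (Assign ''b'' (Add (Reg ''c'') (Const 1))) (Assign ''c'' (Sub (Reg ''f'') (Const 1)))) absorb)
        (\<lambda>l u. valid (merge_siblings D' c d N) u \<and> sreg u ''nodes'' = Suc N \<and> k0 + (k1 + l) \<le> 2000) u"
        unfolding wp_Seq wp_Assign
      proof (rule wp_mono[OF two])
        show "Q1 (u\<lparr>sreg := (sreg u)(''b'' := rval u (Add (Reg ''c'') (Const 1)))\<rparr>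
          \<lparr>sreg := (sreg (u\<lparr>sreg := (sreg u)(''b'' := rval u (Add (Reg ''c'') (Const 1)))\<rparr>))
             (''c'' := rval (u\<lparr>sreg := (sreg u)(''b'' := rval u (Add (Reg ''c'') (Const 1)))\<rparr>) (Sub (Reg ''f'') (Const 1)))\<rparr>)"
          unfolding Q1_upd using u by (elim conjE)
      qed (use u u0 in auto)
    qed
  qed
qed

text \<open>The invariant for visited nodes. A new node receives the largest number and is visited
  later, and merges do not affect adhesions or shared edges of other nodes, so pairs once rejected
  never have to be examined again.\<close>

definition unmergeable :: "(nat, nat) tcdecomp \<Rightarrow> nat \<Rightarrow> bool" where
  "unmergeable D' i \<longleftrightarrow> (\<forall>x y. x < i \<longrightarrow> y < i \<longrightarrow> siblings D' x y \<longrightarrow> shared D' x y \<noteq> {} \<longrightarrow> tparent D' x < nN \<longrightarrow> \<not> mergeable D' x y)"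

text \<open>A partner for merging shares an edge with \<open>i\<close>, and this edge is among the
  at most four listed at \<open>i\<close>. Inspecting the list thus rules out all siblings,
  including those with larger numbers.\<close>

lemma unmergeable_Suc:
  assumes v: "valid D' t" and i: "i < sreg t ''nodes''" and um: "unmergeable D' i"
    and no: "i \<noteq> rt \<Longrightarrow> tparent D' i < nN \<Longrightarrow> sarr t ''rec'' i \<in> {3, 4} \<Longrightarrow>
      \<forall>j<sarr t ''rec'' i. \<not> good t i (oth t i (entry t i j))"
  shows "unmergeable D' (Suc i)"
proof -
  have new: "\<not> mergeable D' i y" if s: "siblings D' i y" "shared D' i y \<noteq> {}" and low: "tparent D' i < nN" for y
  proof
    assume m: "mergeable D' i y"
    have irt: "i \<noteq> rt" using s(1) validD(6)[OF v] by (simp add: siblings_def)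
    obtain e where e: "e \<in> shared D' i y" using s(2) by blast
    then have eE: "e < nE" and p: "sib_pair D' e i y \<or> sib_pair D' e y i" by (simp_all add: shared_def)
    have o: "oth t i e = Suc y" using other_iff[OF validD(13)[OF v] eE] p by blast
    have "sarr t ''A'' e = Suc i \<or> sarr t ''B'' e = Suc i"
      using o by (auto simp: other_def split: if_splits)
    then have ri: "sarr t ''rec'' i = adhesion G D' i" by (rule validD(14)[OF v eE])
    then have r: "sarr t ''rec'' i \<in> {3, 4}" using m by (simp add: mergeable_def)
    have "e \<in> crossing D' i" using e shared_sub[OF validD(1)[OF v] s(1)] by blast
    then have "e \<in> entry t i ` {..<sarr t ''rec'' i}" unfolding validD(11)[OF v i r] .
    then obtain j where j: "j < sarr t ''rec'' i" "entry t i j = e" by blast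
    have oj: "oth t i (entry t i j) = Suc y" using o j(2) by simp
    have "good t i (Suc y)" using good_mergeable(5)[OF v i r j(1) oj] m by blast
    moreover have "\<not> good t i (oth t i (entry t i j))" by (rule no[OF irt low r, rule_format, OF j(1)])
    ultimately show False unfolding oj by contradiction
  qed
  show ?thesis
    unfolding unmergeable_def
  proof (intro allI impI)
    fix x y assume xy: "x < Suc i" "y < Suc i" "siblings D' x y" "shared D' x y \<noteq> {}" "tparent D' x < nN"
    have ty: "tparent D' y < nN" using xy(3,5) by (simp add: siblings_def)
    consider "x = i" | "y = i" | "x < i" "y < i" using xy(1,2) by linarith
    then show "\<not> mergeable D' x y"
    proof cases
      case 1
      then show ?thesis using new xy by blast
    next
      case 2
      then have "\<not> mergeable D' y x" using new[of x] siblings_sym[OF xy(3)] xy(4) ty shared_sym[of D' x y] by simp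
      then show ?thesis using mergeable_sym by blast
    next
      case 3
      then show ?thesis using um xy unfolding unmergeable_def by blast
    qed
  qed
qed


text \<open>The parent of \<open>c\<close> and \<open>d\<close> is now a new node, which takes them
  out of consideration. The remaining nodes keep their adhesions and shared edges.\<close>

lemma unmergeable_merge:
  assumes v: "valid D' t" and s: "siblings D' c d" "shared D' c d \<noteq> {}" and m: "mergeable D' c d" and um: "unmergeable D' c"
  shows "unmergeable (merge_siblings D' c d (sreg t ''nodes'')) (Suc c)"
proof -
  let ?N = "sreg t ''nodes''"
  let ?E = "merge_siblings D' c d ?N"
  have sm: "sibling_merge G D' (tparent D' c) c d ?N" by (rule sibling_merge[OF v s m])
  note V = validD[OF v]
  have c: "c < ?N" using s(1) V(5) by (simp add: siblings_def)
  show ?thesis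
    unfolding unmergeable_def
  proof (intro allI impI)
    fix x y assume xy: "x < Suc c" "y < Suc c" "siblings ?E x y" "shared ?E x y \<noteq> {}" "tparent ?E x < nN"
    have p: "tparent ?E z = (if z = ?N then tparent D' c else if z = c \<or> z = d then ?N else tparent D' z)" for z
      by (simp add: merge_siblings_def)
    have py: "tparent ?E y = tparent ?E x" using xy(3) by (simp add: siblings_def)
    have "x \<noteq> ?N" "y \<noteq> ?N" using xy(1,2) c by simp_all
    then have ne: "x \<noteq> c" "x \<noteq> d" "y \<noteq> c" "y \<noteq> d" using p[of x] p[of y] py xy(5) V(4) by (auto split: if_splits)
    have lt: "x < c" "y < c" using xy(1,2) ne by simp_all
    have N: "x < ?N" "y < ?N" using lt c by simp_all
    have par: "tparent ?E x = tparent D' x" "tparent ?E y = tparent D' y" using p[of x] p[of y] N ne by simp_all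
    have rtE: "troot ?E = rt" using V(6) by (simp add: merge_siblings_def)
    have sD: "siblings D' x y" using xy(3) py N unfolding siblings_def par rtE V(5,6) by simp
    have bel: "below ?E x = below D' x" "below ?E y = below D' y"
      using sibling_merge.merge_below[OF sm] V(5) N by simp_all
    have sh: "shared ?E x y = shared D' x y" unfolding shared_eq[OF xy(3)] shared_eq[OF sD] bel ..
    have ad: "adhesion G ?E x = adhesion G D' x" "adhesion G ?E y = adhesion G D' y" unfolding adhesion_def bel by simp_all
    have "\<not> mergeable D' x y" using um lt sD xy(4,5) unfolding unmergeable_def sh par by blast
    then show "\<not> mergeable ?E x y" unfolding mergeable_def sh ad .
  qed
qed

lemma merge_iter:
  assumes v: "valid D' t" and i: "sreg t ''i'' < sreg t ''nodes''" and n: "sreg t ''n'' = nN" and um: "unmergeable D' (sreg t ''i'')"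
  shows "wp merge_iter (\<lambda>k u. (\<exists>D''. valid D'' u \<and> unmergeable D'' (Suc (sreg t ''i''))) \<and>
     sreg t ''nodes'' \<le> sreg u ''nodes'' \<and> k \<le> 4900) t"
proof -
  define i where "i = sreg t ''i''"
  note i' = i[folded i_def] and um' = um[folded i_def]
  have cost: "rcost merge_test = 16" by (simp add: merge_test_def)
  have par: "sarr t ''parent'' i = tparent D' i" if "i \<noteq> rt" using validD(7)[OF v i' that] .
  have rest: "wp (Seq (Assign ''c'' (Reg ''i'')) (Seq search (Cond (Reg ''f'') do_merge Skip)))
     (\<lambda>k u. (\<exists>D''. valid D'' u \<and> unmergeable D'' (Suc i)) \<and> sreg t ''nodes'' \<le> sreg u ''nodes'' \<and> k \<le> 4800) t"
    if low: "sarr t ''parent'' i < nN" and r: "sarr t ''rec'' i \<in> {3, 4}"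
  proof -
    let ?t = "t\<lparr>sreg := (sreg t)(''c'' := i)\<rparr>"
    have ri: "sarr t ''rec'' i = adhesion G D' i" by (rule validD(10)[OF v i' r])
    have irt: "i \<noteq> rt"
    proof
      assume "i = rt"
      then have "adhesion G D' i = 0" using tc_decomp.adhesion_root[OF validD(1)[OF v]] validD(6)[OF v] by simp
      then show False using r ri by auto
    qed
    have low': "tparent D' i < nN" using low par[OF irt] by simp
    have cong: "valid D' u" if "sarr u = sarr t" "sreg u ''nodes'' = sreg t ''nodes''" for u
      using v unfolding valid_def that .
    have r4: "sarr ?t ''rec'' (sreg ?t ''c'') \<le> 4" using r by auto
    have "wp search (\<lambda>k u. sreg u ''c'' = i \<and> sreg u ''nodes'' = sreg t ''nodes'' \<and> sarr u = sarr t \<and>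
        (sreg u ''f'' = 0 \<longrightarrow> (\<forall>j<sarr t ''rec'' i. \<not> good t i (oth t i (entry t i j)))) \<and>
        (sreg u ''f'' \<noteq> 0 \<longrightarrow> good t i (sreg u ''f'') \<and> (\<exists>j<sarr t ''rec'' i. oth t i (entry t i j) = sreg u ''f'')) \<and> k \<le> 2000) ?t"
    proof (rule wp_frame[OF search[OF r4]])
      fix k :: nat and u :: rstate assume u: "(sreg u ''f'' = 0 \<longrightarrow> (\<forall>j<sarr ?t ''rec'' (sreg ?t ''c''). \<not> good ?t (sreg ?t ''c'') (oth ?t (sreg ?t ''c'') (entry ?t (sreg ?t ''c'') j)))) \<and>
       (sreg u ''f'' \<noteq> 0 \<longrightarrow> good ?t (sreg ?t ''c'') (sreg u ''f'') \<and>
        (\<exists>j<sarr ?t ''rec'' (sreg ?t ''c''). oth ?t (sreg ?t ''c'') (entry ?t (sreg ?t ''c'') j) = sreg u ''f'')) \<and> k \<le> 2000"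
        and ag: "agree search ?t u"
      have g: "good ?t = good t" by (intro ext) (simp add: good_def common_count_def)
      have "sreg u ''c'' = i" "sreg u ''nodes'' = sreg t ''nodes''" "sarr u = sarr t"
        using ag by (simp_all add: agree_def search_def search_body_def count_common_def count_body_def other_end_def fun_eq_iff)
      then show "sreg u ''c'' = i \<and> sreg u ''nodes'' = sreg t ''nodes'' \<and> sarr u = sarr t \<and>
        (sreg u ''f'' = 0 \<longrightarrow> (\<forall>j<sarr t ''rec'' i. \<not> good t i (oth t i (entry t i j)))) \<and>
        (sreg u ''f'' \<noteq> 0 \<longrightarrow> good t i (sreg u ''f'') \<and> (\<exists>j<sarr t ''rec'' i. oth t i (entry t i j) = sreg u ''f'')) \<and> k \<le> 2000"
        using u unfolding g by simp
    qed
    then show ?thesis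
      unfolding wp_Seq[of "Assign _ _"] wp_Assign rval.simps i_def[symmetric] wp_Seq[of search]
    proof (rule wp_mono)
      fix k :: nat and u :: rstate assume u: "sreg u ''c'' = i \<and> sreg u ''nodes'' = sreg t ''nodes'' \<and> sarr u = sarr t \<and>
        (sreg u ''f'' = 0 \<longrightarrow> (\<forall>j<sarr t ''rec'' i. \<not> good t i (oth t i (entry t i j)))) \<and>
        (sreg u ''f'' \<noteq> 0 \<longrightarrow> good t i (sreg u ''f'') \<and> (\<exists>j<sarr t ''rec'' i. oth t i (entry t i j) = sreg u ''f'')) \<and> k \<le> 2000"
      have k: "k \<le> 2000" using u by blast
      have vu: "valid D' u" using u cong by blast
      show "wp (Cond (Reg ''f'') do_merge Skip) (\<lambda>l x. (\<exists>D''. valid D'' x \<and> unmergeable D'' (Suc i)) \<and>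
          sreg t ''nodes'' \<le> sreg x ''nodes'' \<and> 1 + rcost (Reg ''i'') + (k + l) \<le> 4800) u"
      proof (cases "sreg u ''f''")
        case 0
        then have "\<forall>j<sarr t ''rec'' i. \<not> good t i (oth t i (entry t i j))" using u by blast
        then have "unmergeable D' (Suc i)" by (rule unmergeable_Suc[OF v i' um'])
        then show ?thesis using 0 vu u k by (auto simp: wp_simps)
      next
        case (Suc d)
        then obtain j where j: "j < sarr t ''rec'' i" "oth t i (entry t i j) = Suc d" and g: "good t i (Suc d)"
          using u by (metis Zero_not_Suc)
        note gm = good_mergeable[OF v i' r j]
        have m: "mergeable D' i d" using g gm(5) by blast
        have "wp do_merge (\<lambda>l x. valid (merge_siblings D' i d (sreg u ''nodes'')) x \<and> sreg x ''nodes'' = Suc (sreg u ''nodes'') \<and> l \<le> 2000) u"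
          by (rule do_merge[OF vu _ Suc gm(1,4) m _ _ low']) (use u ri gm(3) in simp_all)
        moreover have "unmergeable (merge_siblings D' i d (sreg u ''nodes'')) (Suc i)"
          by (rule unmergeable_merge[OF vu gm(1,4) m um'])
        ultimately show ?thesis
          unfolding wp_Cond using Suc
          by (simp del: One_nat_def) (erule wp_mono, use u k in auto)
      qed
    qed
  qed
  show ?thesis
    unfolding merge_iter_def wp_Cond merge_test n i_def[symmetric] cost
  proof (split if_split, intro conjI impI)
    assume "sarr t ''parent'' i < nN \<and> sarr t ''rec'' i \<in> {3, 4}"
    then show "wp (Seq (Assign ''c'' (Reg ''i'')) (Seq search (Cond (Reg ''f'') do_merge Skip)))
     (\<lambda>k u. (\<exists>D''. valid D'' u \<and> unmergeable D'' (Suc i)) \<and> sreg t ''nodes'' \<le> sreg u ''nodes'' \<and> 1 + 16 + k \<le> 4900) t"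
      by (intro wp_mono[OF rest]) auto
  next
    assume "\<not> (sarr t ''parent'' i < nN \<and> sarr t ''rec'' i \<in> {3, 4})"
    then have "unmergeable D' (Suc i)" using unmergeable_Suc[OF v i' um'] par by metis
    then show "wp Skip (\<lambda>k u. (\<exists>D''. valid D'' u \<and> unmergeable D'' (Suc i)) \<and> sreg t ''nodes'' \<le> sreg u ''nodes'' \<and> 1 + 16 + k \<le> 4900) t"
      unfolding wp_Skip using v by auto
  qed
qed

lemma merge_phase:
  assumes v: "valid D' t" and n: "sreg t ''nodes'' = nN"
  shows "wp merge_phase (\<lambda>k u. (\<exists>D''. valid D'' u \<and> unmergeable D'' (sreg u ''nodes'')) \<and> k \<le> 10000 * nN + 10) t"
proof -
  let ?s = "t\<lparr>sreg := (sreg t)(''n'' := nN, ''i'' := 0)\<rparr>"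
  define I :: "rstate \<Rightarrow> bool" where "I u \<longleftrightarrow> (\<exists>D''. valid D'' u \<and> unmergeable D'' (sreg u ''i'')) \<and>
    sreg u ''i'' \<le> sreg u ''nodes''" for u
  have cong: "valid D'' u" if "valid D'' w" "sarr u = sarr w" "sreg u ''nodes'' = sreg w ''nodes''" for D'' u w
    using that(1) unfolding valid_def that(2,3) .
  have "wp (Loop (Less (Reg ''i'') (Reg ''nodes'')) (Seq merge_iter (Assign ''i'' (Add (Reg ''i'') (Const 1)))))
     (\<lambda>k u. (\<exists>D''. valid D'' u \<and> unmergeable D'' (sreg u ''nodes'')) \<and> k \<le> 10000 * nN + 4) ?s"
  \<comment> \<open>\<open>valid\<close> bounds the number of nodes by \<open>2 * nN\<close>,
    including those added during the loop. An iteration costs at most 4900 plus the overhead of the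
    loop.\<close>
  proof (rule wp_Loop[where I = I and \<phi> = "\<lambda>u. 5000 * (2 * nN - sreg u ''i'')"])
    have "valid D' ?s" by (rule cong[OF v]) simp_all
    moreover have "unmergeable D' 0" by (simp add: unmergeable_def)
    ultimately show "I ?s" unfolding I_def by auto
  next
    fix u assume I: "I u" and ag: "agree (Seq merge_iter (Assign ''i'' (Add (Reg ''i'') (Const 1)))) ?s u"
      and lt: "rval u (Less (Reg ''i'') (Reg ''nodes'')) \<noteq> 0"
    obtain D'' where D'': "valid D'' u" "unmergeable D'' (sreg u ''i'')" using I unfolding I_def by blast
    have un: "sreg u ''n'' = nN"
      using ag by (simp add: agree_def merge_iter_def search_def search_body_def count_common_def count_body_def other_end_def
        do_merge_def absorb_def absorb_body_def)
    have lt': "sreg u ''i'' < sreg u ''nodes''" using lt by simp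
    have "sreg u ''i'' < 2 * nN" using validD(15)[OF D''(1)] lt' by linarith
    then obtain r where r: "2 * nN - sreg u ''i'' = Suc r" "2 * nN - Suc (sreg u ''i'') = r" by (metis Suc_diff_Suc)
    show "wp (Seq merge_iter (Assign ''i'' (Add (Reg ''i'') (Const 1))))
      (\<lambda>k v. I v \<and> k + 1 + rcost (Less (Reg ''i'') (Reg ''nodes'')) + 5000 * (2 * nN - sreg v ''i'') \<le> 5000 * (2 * nN - sreg u ''i'')) u"
      unfolding wp_Seq wp_Assign
    proof (rule wp_frame[OF merge_iter[OF D''(1) lt' un D''(2)]])
      fix k :: nat and w :: rstate assume w: "(\<exists>D3. valid D3 w \<and> unmergeable D3 (Suc (sreg u ''i''))) \<and> sreg u ''nodes'' \<le> sreg w ''nodes'' \<and> k \<le> 4900"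
        and agw: "agree merge_iter u w"
      obtain D3 where D3: "valid D3 w" "unmergeable D3 (Suc (sreg u ''i''))" using w by blast
      have wi: "sreg w ''i'' = sreg u ''i''"
        using agw by (simp add: agree_def merge_iter_def search_def search_body_def count_common_def count_body_def other_end_def
          do_merge_def absorb_def absorb_body_def)
      let ?w = "w\<lparr>sreg := (sreg w)(''i'' := rval w (Add (Reg ''i'') (Const 1)))\<rparr>"
      have "valid D3 ?w" by (rule cong[OF D3(1)]) simp_all
      moreover have iw: "sreg ?w ''i'' = Suc (sreg u ''i'')" using wi by simp
      moreover have "Suc (sreg u ''i'') \<le> sreg ?w ''nodes''" using w lt' by simp
      ultimately have "I ?w" using D3(2) unfolding I_def by metis
      moreover have "k \<le> 4900" using w by blast
      ultimately show "I ?w \<and> k + (1 + rcost (Add (Reg ''i'') (Const 1))) + 1 + rcost (Less (Reg ''i'') (Reg ''nodes'')) +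
          5000 * (2 * nN - sreg ?w ''i'') \<le> 5000 * (2 * nN - sreg u ''i'')"
        unfolding iw r by simp
    qed
  next
    fix k :: nat and u :: rstate assume I: "I u" and ge: "rval u (Less (Reg ''i'') (Reg ''nodes'')) = 0"
      and k: "k + 5000 * (2 * nN - sreg u ''i'') \<le> 5000 * (2 * nN - sreg ?s ''i'') + 1 + rcost (Less (Reg ''i'') (Reg ''nodes''))"
    have "sreg u ''i'' = sreg u ''nodes''" using I ge by (simp add: I_def)
    then show "(\<exists>D''. valid D'' u \<and> unmergeable D'' (sreg u ''nodes'')) \<and> k \<le> 10000 * nN + 4"
      using I k by (auto simp: I_def)
  qed
  then show ?thesis unfolding merge_phase_def wp_Seq wp_Assign
    by (simp add: n) (erule wp_mono, simp)
qed

lemma unmergeable_friendly: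
  assumes v: "valid D' t" and um: "unmergeable D' (sreg t ''nodes'')"
  shows "friendly G D'"
proof -
  note V = validD[OF v]
  interpret D': tc_decomp G D' by (rule V(1))
  have "card {x \<in> tchildren D' s. bold G D' x} + card (tbag D' s) \<le> tcwidth G D' + 2" if s: "s \<in> tnodes D'" for s
  proof (cases "s < nN")
    case True
    have "card {x \<in> tchildren D' s. bold G D' x} + card (tbag D' s) \<le> card (mverts (three_center G D' s)) + 2"
    proof (rule D'.bold_children_bound[OF V(2) s])
      fix c c' assume cc: "c \<in> tchildren D' s" "c' \<in> tchildren D' s" "c \<noteq> c'" "adhesion G D' c \<in> {3, 4}" "adhesion G D' c' \<in> {3, 4}" "D'.between c c' \<noteq> 0"
      have sib: "siblings D' c c'" using cc(1-3) by (auto simp: siblings_def tchildren_def)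
      have bs: "D'.between c c' = card (shared D' c c')" by (rule between_shared[OF V(1) sib])
      have "shared D' c c' \<noteq> {}" using cc(6) unfolding bs by auto
      moreover have "tparent D' c < nN" "c < sreg t ''nodes''" "c' < sreg t ''nodes''"
        using cc(1,2) True V(5) by (auto simp: tchildren_def)
      ultimately have "\<not> mergeable D' c c'" using um sib unfolding unmergeable_def by blast
      then show "adhesion G D' c + adhesion G D' c' \<notin> {3 + 2 * D'.between c c', 4 + 2 * D'.between c c'}"
        using cc(4,5) unfolding mergeable_def bs by blast
    qed
    also have "max (adhesion G D' s) (card (mverts (three_center G D' s))) \<le> tcwidth G D'"
      unfolding tcwidth_def using s D'.finite_nodes by (intro Max_ge) auto
    then have "card (mverts (three_center G D' s)) + 2 \<le> tcwidth G D' + 2" by simp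
    finally show ?thesis .
  next
    case False
    then have "s < sreg t ''nodes''" "nN \<le> s" using s V(5) by auto
    then have "tbag D' s = {}" "card (tchildren D' s) \<le> 2" using V(8,9) by auto
    moreover have "card {x \<in> tchildren D' s. bold G D' x} \<le> card (tchildren D' s)"
      by (rule card_mono) (use D'.finite_nodes in \<open>auto simp: tchildren_def\<close>)
    ultimately show ?thesis by simp
  qed
  then show ?thesis using V(2) by (simp add: friendly_def)
qed

end

section \<open>Running time and word size\<close>

lemma (in tc_decomp) card_three_center_le:
  assumes t: "t \<in> tnodes D"
  shows "card (mverts (three_center G D t)) \<le> card (gverts G) + card (tnodes D)"
proof -
  have "(center_step (Inl ` tbag D t))\<^sup>*\<^sup>* (torso G D t) (three_center G D t)"
    using three_center_is_center[OF t] by (simp add: is_center_def)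
  then have "mverts (three_center G D t) \<subseteq> mverts (torso G D t)" by (rule center_steps_mverts)
  then have "card (mverts (three_center G D t)) \<le> card (mverts (torso G D t))"
    using finite_torso[OF t] by (intro card_mono) auto
  also have "\<dots> \<le> card (Inl ` tbag D t :: ('v + 's set) set) + card (Inr ` node_components D t :: ('v + 's set) set)"
    unfolding torso_def by (simp add: card_Un_le)
  also have "\<dots> = card (tbag D t) + card (node_components D t)"
    by (simp add: card_image)
  also have "\<dots> \<le> card (gverts G) + card (tnodes D)"
  proof (rule add_mono)
    show "card (tbag D t) \<le> card (gverts G)" using bag_subset[OF t] finite_gverts by (intro card_mono) auto
    have "card (node_components D t) \<le> card (tnodes D - {t})"
      unfolding node_components_def Let_def using finite_nodes by (intro card_image_le) auto
    also have "\<dots> \<le> card (tnodes D)" using finite_nodes by (intro card_mono) auto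
    finally show "card (node_components D t) \<le> card (tnodes D)" .
  qed
  finally show ?thesis .
qed

text \<open>Makes the time bound a polynomial in the size of the input alone, so that one exponent
  for the word bound works for all widths.\<close>

lemma (in tc_decomp) tcwidth_le: "tcwidth G D \<le> gsize G + card (tnodes D)"
proof -
  have "max (adhesion G D t) (card (mverts (three_center G D t))) \<le> gsize G + card (tnodes D)" if t: "t \<in> tnodes D" for t
  proof -
    have "adhesion G D t \<le> card (gedges G)"
      unfolding adhesion_def using finite_gedges by (intro card_mono) auto
    then show ?thesis using card_three_center_le[OF t] by (simp add: gsize_def)
  qed
  then show ?thesis unfolding tcwidth_def using finite_nodes root_node by (subst Max_le_iff) auto
qed

text \<open>Lets costs linear in the size of the graph be absorbed by the product with the width. A
  graph without vertices has no such costs.\<close>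

lemma (in tc_decomp) tcwidth_pos:
  assumes "gverts G \<noteq> {}"
  shows "1 \<le> tcwidth G D"
proof -
  obtain t where t: "t \<in> tnodes D" "tbag D t \<noteq> {}" using assms bags_cover by blast
  have st: "(center_step (Inl ` tbag D t))\<^sup>*\<^sup>* (torso G D t) (three_center G D t)"
    using three_center_is_center[OF t(1)] by (simp add: is_center_def)
  have "Inl ` tbag D t \<subseteq> mverts (three_center G D t)"
    by (rule center_steps_keep[OF st]) (simp add: torso_def)
  moreover have "finite (mverts (three_center G D t))"
    using center_steps_mverts[OF st] finite_torso[OF t(1)] finite_subset by blast
  ultimately have "mverts (three_center G D t) \<noteq> {} \<and> finite (mverts (three_center G D t))" using t(2) by blast
  then have "1 \<le> card (mverts (three_center G D t))" by (simp add: Suc_le_eq card_gt_0_iff)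
  also have "\<dots> \<le> max (adhesion G D t) (card (mverts (three_center G D t)))" by simp
  also have "\<dots> \<le> tcwidth G D" unfolding tcwidth_def using t(1) finite_nodes by (intro Max_ge) auto
  finally show ?thesis .
qed

section \<open>The complete program\<close>

definition prepare :: rcom where
  "prepare = Seq mark_phase (Seq top_init (Seq (Store ''dep'' (Reg ''root'') (Const 1))
     (Seq (propagate ''top'' 0) (propagate ''dep'' 1))))"

definition friendly_program :: rcom where
  "friendly_program = Seq prepare (Seq edge_phase merge_phase)"

text \<open>\<open>x\<close> and \<open>y\<close> stand for the products of the width with the
  numbers of vertices and edges, which keeps the arithmetic linear. The additive constants are
  absorbed by \<open>b\<close>, as a rooted tree has at least one node.\<close>

lemma time_arith:
  fixes k :: nat
  assumes "k \<le> (60 * (a + b + 1) + 440 * (b + 1) + 10) + (60 * S + 80 * (e + 1)) + (10000 * b + 10)"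
    and "a \<le> x" "e \<le> y" "S \<le> 2 * x" "1 \<le> b"
  shows "k \<le> 12000 * (x + y + b)"
  using assms by simp

context program_input
begin

lemma prepare:
  "wp prepare (\<lambda>k u. input_ok u \<and> top_ok (sarr u ''top'') \<and> dep_ok (sarr u ''dep'') \<and>
     k \<le> 60 * (nV + nN + 1) + 440 * (nN + 1) + 10) s0"
proof -
  have ok0: "input_ok s0" by (simp add: input_ok_def)
  have 5: "wp (propagate ''dep'' 1) (\<lambda>k u. input_ok u \<and> top_ok (sarr u ''top'') \<and> dep_ok (sarr u ''dep'') \<and> k \<le> 200 * (nN + 1)) t"
    if t: "input_ok t" "top_ok (sarr t ''top'')" "sarr t ''dep'' = (\<lambda>y. if y = rt then 1 else 0)" for t
  proof (rule wp_frame[OF propagate[OF t(1), of "''dep''" 1]])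
    show "''dep'' \<notin> {''parent'', ''bag'', ''end1'', ''end2''}" by simp
    show "sarr t ''dep'' rt \<noteq> 0" using t(3) by simp
    fix k :: nat and u
    assume u: "input_ok u \<and> (\<forall>y<nN. sarr u ''dep'' y = (if sarr t ''dep'' y \<noteq> 0 then sarr t ''dep'' y else sarr u ''dep'' (par y) + 1)) \<and> k \<le> 200 * (nN + 1)"
      and ag: "agree (propagate ''dep'' 1) t u"
    have top: "sarr u ''top'' = sarr t ''top''" using ag by (simp add: agree_def propagate_def climb_def add_up_def fill_def)
    have "dep_ok (sarr u ''dep'')" using u unfolding dep_ok_def t(3) by auto
    then show "input_ok u \<and> top_ok (sarr u ''top'') \<and> dep_ok (sarr u ''dep'') \<and> k \<le> 200 * (nN + 1)"
      using u t(2) unfolding top by blast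
  qed
  have 4: "wp (propagate ''top'' 0) (\<lambda>k u. input_ok u \<and> top_ok (sarr u ''top'') \<and> sarr u ''dep'' = sarr t ''dep'' \<and> k \<le> 200 * (nN + 1)) t"
    if t: "input_ok t" "sarr t ''top'' = (\<lambda>y. if y \<in> stops then y + 1 else 0)" for t
  proof (rule wp_frame[OF propagate[OF t(1), of "''top''" 0]])
    show "''top'' \<notin> {''parent'', ''bag'', ''end1'', ''end2''}" by simp
    show "sarr t ''top'' rt \<noteq> 0" using t(2) rt_less by (simp add: stops_def)
    fix k :: nat and u
    assume u: "input_ok u \<and> (\<forall>y<nN. sarr u ''top'' y = (if sarr t ''top'' y \<noteq> 0 then sarr t ''top'' y else sarr u ''top'' (par y) + 0)) \<and> k \<le> 200 * (nN + 1)"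
      and ag: "agree (propagate ''top'' 0) t u"
    have dep: "sarr u ''dep'' = sarr t ''dep''" using ag by (simp add: agree_def propagate_def climb_def add_up_def fill_def)
    have "top_ok (sarr u ''top'')" using u unfolding top_ok_def t(2) by auto
    then show "input_ok u \<and> top_ok (sarr u ''top'') \<and> sarr u ''dep'' = sarr t ''dep'' \<and> k \<le> 200 * (nN + 1)"
      using u dep by blast
  qed
  have 2: "wp top_init (\<lambda>k u. input_ok u \<and> sarr u ''top'' = (\<lambda>y. if y \<in> stops then y + 1 else 0) \<and> sarr u ''dep'' = (\<lambda>_. 0) \<and> k \<le> 40 * (nN + 1)) t"
    if t: "input_ok t" "sarr t ''top'' = (\<lambda>_. 0)" "sarr t ''dep'' = (\<lambda>_. 0)"
      "\<forall>y<nN. sarr t ''cnt'' y = 2 * card (tbag D y) + card {c \<in> tchildren D y. below D c \<noteq> {}}" for t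
  proof (rule wp_frame[OF top_init[OF t(1,2,4)]])
    fix k :: nat and u
    assume u: "input_ok u \<and> sarr u ''top'' = (\<lambda>y. if y \<in> stops then y + 1 else 0) \<and> k \<le> 40 * (nN + 1)" and ag: "agree top_init t u"
    have "sarr u ''dep'' = (\<lambda>_. 0)" using ag t(3) by (simp add: agree_def top_init_def)
    then show "input_ok u \<and> sarr u ''top'' = (\<lambda>y. if y \<in> stops then y + 1 else 0) \<and> sarr u ''dep'' = (\<lambda>_. 0) \<and> k \<le> 40 * (nN + 1)"
      using u by (elim conjE, intro conjI)
  qed
  have 1: "wp mark_phase (\<lambda>k u. input_ok u \<and> sarr u ''top'' = (\<lambda>_. 0) \<and> sarr u ''dep'' = (\<lambda>_. 0) \<and>
      (\<forall>y<nN. sarr u ''cnt'' y = 2 * card (tbag D y) + card {c \<in> tchildren D y. below D c \<noteq> {}}) \<and> k \<le> 60 * (nV + nN + 1)) s0"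
  proof (rule wp_frame[OF mark_phase[OF ok0]])
    show "sarr s0 ''cnt'' = (\<lambda>_. 0)" "sarr s0 ''mk'' = (\<lambda>_. 0)" by (simp_all add: zero_arr)
    fix k :: nat and u
    assume u: "input_ok u \<and> (\<forall>y<nN. sarr u ''cnt'' y = 2 * card (tbag D y) + card {c \<in> tchildren D y. below D c \<noteq> {}}) \<and> k \<le> 60 * (nV + nN + 1)"
      and ag: "agree mark_phase s0 u"
    have "sarr u ''top'' = sarr s0 ''top''" "sarr u ''dep'' = sarr s0 ''dep''"
      using ag by (simp_all add: agree_def mark_phase_def mark_walk_def)
    then have "sarr u ''top'' = (\<lambda>_. 0)" "sarr u ''dep'' = (\<lambda>_. 0)" by (simp_all add: zero_arr)
    then show "input_ok u \<and> sarr u ''top'' = (\<lambda>_. 0) \<and> sarr u ''dep'' = (\<lambda>_. 0) \<and>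
      (\<forall>y<nN. sarr u ''cnt'' y = 2 * card (tbag D y) + card {c \<in> tchildren D y. below D c \<noteq> {}}) \<and> k \<le> 60 * (nV + nN + 1)"
      using u by (elim conjE, intro conjI)
  qed
  show ?thesis
    unfolding prepare_def wp_Seq
  proof (rule wp_mono[OF 1], elim conjE, rule wp_mono[OF 2], assumption+, elim conjE, unfold wp_Store)
    fix k1 k2 :: nat and t :: rstate
    assume k: "k1 \<le> 60 * (nV + nN + 1)" "k2 \<le> 40 * (nN + 1)"
      and t: "input_ok t" "sarr t ''top'' = (\<lambda>y. if y \<in> stops then y + 1 else 0)" "sarr t ''dep'' = (\<lambda>_. 0)"
    let ?t = "t\<lparr>sarr := (sarr t)(''dep'' := (sarr t ''dep'')(rval t (Reg ''root'') := rval t (Const 1)))\<rparr>"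
    have okt: "input_ok ?t" using t(1) by (simp add: input_ok_def)
    have topt: "sarr ?t ''top'' = (\<lambda>y. if y \<in> stops then y + 1 else 0)" using t(2) by simp
    have dept: "sarr ?t ''dep'' = (\<lambda>y. if y = rt then 1 else 0)" using t(1,3) by (auto simp: input_ok_def)
    show "wp (propagate ''top'' 0) (\<lambda>k t. wp (propagate ''dep'' 1) (\<lambda>l u. input_ok u \<and> top_ok (sarr u ''top'') \<and> dep_ok (sarr u ''dep'') \<and>
        k1 + (k2 + (1 + rcost (Reg ''root'') + rcost (Const 1) + (k + l))) \<le> 60 * (nV + nN + 1) + 440 * (nN + 1) + 10) t) ?t"
    proof (rule wp_mono[OF 4[OF okt topt]])
      fix k3 :: nat and v
      assume v: "input_ok v \<and> top_ok (sarr v ''top'') \<and> sarr v ''dep'' = sarr ?t ''dep'' \<and> k3 \<le> 200 * (nN + 1)"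
      have dv: "sarr v ''dep'' = (\<lambda>y. if y = rt then 1 else 0)" using v unfolding dept by blast
      show "wp (propagate ''dep'' 1) (\<lambda>l u. input_ok u \<and> top_ok (sarr u ''top'') \<and> dep_ok (sarr u ''dep'') \<and>
        k1 + (k2 + (1 + rcost (Reg ''root'') + rcost (Const 1) + (k3 + l))) \<le> 60 * (nV + nN + 1) + 440 * (nN + 1) + 10) v"
      proof (rule wp_mono[OF 5[OF _ _ dv]])
        fix l :: nat and u
        assume u: "input_ok u \<and> top_ok (sarr u ''top'') \<and> dep_ok (sarr u ''dep'') \<and> l \<le> 200 * (nN + 1)"
        have "k1 + (k2 + (1 + rcost (Reg ''root'') + rcost (Const 1) + (k3 + l))) \<le> 60 * (nV + nN + 1) + 440 * (nN + 1) + 10"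
          using k v u by simp
        then show "input_ok u \<and> top_ok (sarr u ''top'') \<and> dep_ok (sarr u ''dep'') \<and>
          k1 + (k2 + (1 + rcost (Reg ''root'') + rcost (Const 1) + (k3 + l))) \<le> 60 * (nV + nN + 1) + 440 * (nN + 1) + 10"
          using u by blast
      qed (use v in blast)+
    qed
  qed
qed

lemma valid_init:
  assumes nice: "nice G D" and ok: "input_ok u" and R: "rec_ok u (\<lambda>z. {e. e < nE \<and> cross e z})"
    and AB: "AB_ok D nE (sarr u ''A'') (sarr u ''B'')"
  shows "valid D u"
proof -
  have nodes: "sreg u ''nodes'' = nN" and par: "sarr u ''parent'' = par" using ok by (simp_all add: input_ok_def)
  have cr: "crossing D z = {e. e < nE \<and> cross e z}" for z by (simp add: crossing_def cross_def)
  have off: "sarr u ''rec'' z = 0" if "z \<notin> stops" for z using R that unfolding rec_ok_def by blast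
  have on: "sarr u ''rec'' z = adhesion G D z" "sarr u ''rec'' z \<le> 4 \<Longrightarrow> entry u z ` {..<sarr u ''rec'' z} = crossing D z"
    if "z \<in> stops" for z
    using R that unfolding rec_ok_def adhesion_card cr by blast+
  show ?thesis
    unfolding valid_def nodes
  proof (intro conjI allI impI)
    show "tc_decomp G D" by (rule tc_decomp_axioms)
    show "nice G D" by (rule nice)
    show "tcwidth G D \<le> max 4 (tcwidth G D)" by simp
    show "tnodes D = {..<nN}" "troot D = rt" by (rule nodes_eq, rule root_eq)
    show "sarr u ''parent'' x = tparent D x" if "x < nN" "x \<noteq> rt" for x unfolding par by (rule par_eq[OF that])
    show "tbag D x = (if x < nN then tbag D x else {})" if "x < nN" for x using that by simp
    show "sarr u ''rec'' x = 0" if "nN \<le> x" for x by (rule off) (use that in \<open>simp add: stops_def\<close>)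
    show "sarr u ''rec'' x = adhesion G D x" if "sarr u ''rec'' x \<in> {3, 4}" for x
      using on(1)[of x] off[of x] that by (cases "x \<in> stops") simp_all
    show "entry u x ` {..<sarr u ''rec'' x} = crossing D x" if "sarr u ''rec'' x \<in> {3, 4}" for x
    proof (rule on(2))
      show "x \<in> stops" using off[of x] that by fastforce
      show "sarr u ''rec'' x \<le> 4" using that by auto
    qed
    show "AB_ok D nE (sarr u ''A'') (sarr u ''B'')" by (rule AB)
    show "sarr u ''rec'' x = adhesion G D x" if e: "e < nE" and x: "sarr u ''A'' e = Suc x \<or> sarr u ''B'' e = Suc x" for e x
    proof -
      obtain c d where "sib_pair D e c d" "sarr u ''A'' e = Suc c" "sarr u ''B'' e = Suc d"
        using AB e x unfolding AB_ok_def by fastforce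
      then have "x \<in> stops" using sib_pair_stops[OF e] x by auto
      then show ?thesis by (rule on(1))
    qed
    have "card {x \<in> tnodes D - {rt}. tparent D x < nN} \<le> card ({..<nN} - {rt})"
      by (rule card_mono) (auto simp: nodes_eq)
    then show "card {x \<in> tnodes D - {rt}. tparent D x < nN} + nN < 2 * nN" using rt_less by simp
  qed simp_all
qed

text \<open>New nodes have empty bags, so the array that maps vertices to nodes is still the one of
  the input.\<close>

lemma stores_decomp_valid:
  assumes v: "valid D' u" and root: "sreg u ''root'' = rt" and bag: "sarr u ''bag'' = node_of"
  shows "stores_decomp u D'"
  unfolding stores_decomp_def
proof (intro conjI ballI)
  note V = validD[OF v]
  show "tnodes D' = {..<sreg u ''nodes''}" by (rule V(5))
  show "troot D' = sreg u ''root''" unfolding root by (rule V(6))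
  show "sarr u ''parent'' x = tparent D' x" if "x \<in> tnodes D' - {troot D'}" for x
    using that V(7)[of x] unfolding V(5,6) by simp
  show "sarr u ''bag'' y = x" if "x \<in> tnodes D'" "y \<in> tbag D' x" for x y
    using that V(8)[of x] bag_eq[of x y] unfolding V(5) bag by (simp split: if_splits)
qed

lemma friendly_program:
  assumes nice: "nice G D"
  shows "wp friendly_program (\<lambda>k u. \<exists>D'. stores_decomp u D' \<and> tree_cut_decomposition G D' \<and> friendly G D' \<and>
     tcwidth G D' \<le> max 4 (tcwidth G D) \<and> k \<le> 12000 * (tcwidth G D * gsize G + card (tnodes D))) s0"
proof -
  have final: "wp merge_phase (\<lambda>l v. \<exists>D'. stores_decomp v D' \<and> tree_cut_decomposition G D' \<and> friendly G D' \<and>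
     tcwidth G D' \<le> max 4 (tcwidth G D) \<and> l \<le> 10000 * nN + 10) u"
    if ok: "input_ok u" and R: "rec_ok u (\<lambda>z. {e. e < nE \<and> cross e z})" "AB_ok D nE (sarr u ''A'') (sarr u ''B'')" for u
  proof (rule wp_frame[OF merge_phase[OF valid_init[OF nice ok R]]])
    show "sreg u ''nodes'' = nN" using ok by (simp add: input_ok_def)
    fix k :: nat and v
    assume v: "(\<exists>D'. valid D' v \<and> unmergeable D' (sreg v ''nodes'')) \<and> k \<le> 10000 * nN + 10" and ag: "agree merge_phase u v"
    obtain D' where D': "valid D' v" "unmergeable D' (sreg v ''nodes'')" using v by blast
    have "sreg v ''root'' = rt" "sarr v ''bag'' = node_of"
      using ag ok by (simp_all add: agree_def merge_phase_def merge_iter_def search_def search_body_def count_common_def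
        count_body_def other_end_def do_merge_def absorb_def absorb_body_def input_ok_def)
    then have "stores_decomp v D'" by (rule stores_decomp_valid[OF D'(1)])
    moreover have "tree_cut_decomposition G D'" by (rule tc_decomp.tcd[OF validD(1)[OF D'(1)]])
    moreover have "friendly G D'" by (rule unmergeable_friendly[OF D'])
    moreover have "tcwidth G D' \<le> max 4 (tcwidth G D)" by (rule validD(3)[OF D'(1)])
    ultimately show "\<exists>D'. stores_decomp v D' \<and> tree_cut_decomposition G D' \<and> friendly G D' \<and>
      tcwidth G D' \<le> max 4 (tcwidth G D) \<and> k \<le> 10000 * nN + 10" using v by blast
  qed
  have prep: "wp prepare (\<lambda>k u. input_ok u \<and> top_ok (sarr u ''top'') \<and> dep_ok (sarr u ''dep'') \<and>
     sarr u ''rec'' = (\<lambda>_. 0) \<and> sarr u ''A'' = (\<lambda>_. 0) \<and> sarr u ''B'' = (\<lambda>_. 0) \<and> k \<le> 60 * (nV + nN + 1) + 440 * (nN + 1) + 10) s0"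
  proof (rule wp_frame[OF prepare])
    fix k :: nat and u
    assume u: "input_ok u \<and> top_ok (sarr u ''top'') \<and> dep_ok (sarr u ''dep'') \<and> k \<le> 60 * (nV + nN + 1) + 440 * (nN + 1) + 10"
      and ag: "agree prepare s0 u"
    have "sarr u ''rec'' = sarr s0 ''rec''" "sarr u ''A'' = sarr s0 ''A''" "sarr u ''B'' = sarr s0 ''B''"
      using ag by (simp_all add: agree_def prepare_def mark_phase_def mark_walk_def top_init_def propagate_def climb_def add_up_def fill_def)
    then have "sarr u ''rec'' = (\<lambda>_. 0)" "sarr u ''A'' = (\<lambda>_. 0)" "sarr u ''B'' = (\<lambda>_. 0)" by (simp_all add: zero_arr)
    then show "input_ok u \<and> top_ok (sarr u ''top'') \<and> dep_ok (sarr u ''dep'') \<and>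
     sarr u ''rec'' = (\<lambda>_. 0) \<and> sarr u ''A'' = (\<lambda>_. 0) \<and> sarr u ''B'' = (\<lambda>_. 0) \<and> k \<le> 60 * (nV + nN + 1) + 440 * (nN + 1) + 10"
      using u by (elim conjE, intro conjI)
  qed
  have time: "k \<le> 12000 * (tcwidth G D * gsize G + card (tnodes D))"
    if "k \<le> (60 * (nV + nN + 1) + 440 * (nN + 1) + 10) + (60 * (\<Sum>z\<in>stops. adhesion G D z) + 80 * (nE + 1)) + (10000 * nN + 10)" for k
  proof -
    have g: "gsize G = nV + nE" "card (tnodes D) = nN" using card_edges gverts_eq nodes_eq by (simp_all add: gsize_def)
    let ?w = "tcwidth G D"
    have VE: "nV \<le> ?w * nV" "nE \<le> ?w * nE"
    proof -
      have "nV = 0 \<and> nE = 0 \<or> 1 \<le> ?w"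
      proof (cases "nV = 0")
        case True
        then show ?thesis using edge_ends(1)[of 0] by auto
      next
        case False
        then show ?thesis using tcwidth_pos gverts_eq by auto
      qed
      then show "nV \<le> ?w * nV" "nE \<le> ?w * nE" by auto
    qed
    have ad: "(\<Sum>z\<in>stops. adhesion G D z) \<le> 2 * (?w * nV)" using sum_adhesion by (simp add: ac_simps)
    have "k \<le> 12000 * (x + y + nN)"
      if "nV \<le> x" "nE \<le> y" "(\<Sum>z\<in>stops. adhesion G D z) \<le> 2 * x" for x y
      by (rule time_arith[OF \<open>k \<le> _\<close> that]) (use rt_less in simp)
    from this[OF VE ad] have "k \<le> 12000 * (?w * nV + ?w * nE + nN)" .
    then show ?thesis unfolding g distrib_left[of ?w] .
  qed
  show ?thesis
    unfolding friendly_program_def wp_Seq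
  proof (rule wp_mono[OF prep])
    fix k1 :: nat and u
    assume u: "input_ok u \<and> top_ok (sarr u ''top'') \<and> dep_ok (sarr u ''dep'') \<and>
     sarr u ''rec'' = (\<lambda>_. 0) \<and> sarr u ''A'' = (\<lambda>_. 0) \<and> sarr u ''B'' = (\<lambda>_. 0) \<and> k1 \<le> 60 * (nV + nN + 1) + 440 * (nN + 1) + 10"
    have u': "input_ok u" "top_ok (sarr u ''top'')" "dep_ok (sarr u ''dep'')" "sarr u ''rec'' = (\<lambda>_. 0)" "sarr u ''A'' = (\<lambda>_. 0)"
      "sarr u ''B'' = (\<lambda>_. 0)" "k1 \<le> 60 * (nV + nN + 1) + 440 * (nN + 1) + 10"
      using u by - (elim conjE, assumption)+
    show "wp edge_phase (\<lambda>k t. wp merge_phase (\<lambda>l u. \<exists>D'. stores_decomp u D' \<and> tree_cut_decomposition G D' \<and> friendly G D' \<and>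
     tcwidth G D' \<le> max 4 (tcwidth G D) \<and> k1 + (k + l) \<le> 12000 * (tcwidth G D * gsize G + card (tnodes D))) t) u"
    proof (rule wp_mono[OF edge_phase[OF u'(1-6)]])
      fix k2 :: nat and t
      assume t: "input_ok t \<and> rec_ok t (\<lambda>z. {e. e < nE \<and> cross e z}) \<and> AB_ok D nE (sarr t ''A'') (sarr t ''B'') \<and>
        k2 \<le> 60 * (\<Sum>z\<in>stops. adhesion G D z) + 80 * (nE + 1)"
      have t': "input_ok t" "rec_ok t (\<lambda>z. {e. e < nE \<and> cross e z})" "AB_ok D nE (sarr t ''A'') (sarr t ''B'')"
        "k2 \<le> 60 * (\<Sum>z\<in>stops. adhesion G D z) + 80 * (nE + 1)"
        using t by - (elim conjE, assumption)+
      show "wp merge_phase (\<lambda>l u. \<exists>D'. stores_decomp u D' \<and> tree_cut_decomposition G D' \<and> friendly G D' \<and>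
       tcwidth G D' \<le> max 4 (tcwidth G D) \<and> k1 + (k2 + l) \<le> 12000 * (tcwidth G D * gsize G + card (tnodes D))) t"
      proof (rule wp_mono[OF final[OF t'(1-3)]])
        fix k3 :: nat and v
        assume v: "\<exists>D'. stores_decomp v D' \<and> tree_cut_decomposition G D' \<and> friendly G D' \<and>
          tcwidth G D' \<le> max 4 (tcwidth G D) \<and> k3 \<le> 10000 * nN + 10"
        then have "k3 \<le> 10000 * nN + 10" by blast
        then have "k1 + (k2 + k3) \<le> 12000 * (tcwidth G D * gsize G + card (tnodes D))"
          by (intro time) (use u'(7) t'(4) in linarith)
        then show "\<exists>D'. stores_decomp v D' \<and> tree_cut_decomposition G D' \<and> friendly G D' \<and>
          tcwidth G D' \<le> max 4 (tcwidth G D) \<and> k1 + (k2 + k3) \<le> 12000 * (tcwidth G D * gsize G + card (tnodes D))"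
          using v by blast
      qed
    qed
  qed
qed

lemma bounded_init: "bounded_state s0 (gsize G + card (tnodes D))"
proof -
  let ?M = "gsize G + card (tnodes D)"
  have M: "?M = nV + nE + nN" using card_edges gverts_eq nodes_eq by (simp add: gsize_def)
  have rz: "rest_zero s0" using init by (simp add: initial_state_def)
  have "sreg s0 x \<le> ?M" for x
  proof (cases "x \<in> {''vertices'', ''edges'', ''nodes'', ''root''}")
    case True
    then consider "x = ''vertices''" | "x = ''edges''" | "x = ''nodes''" | "x = ''root''" by blast
    then show ?thesis by cases (use rt_less in \<open>simp_all add: M\<close>)
  next
    case False
    then show ?thesis using zero_reg[OF False] by simp
  qed
  moreover have "sarr s0 a i \<le> ?M" for a i
  proof -
    have zero: "sarr s0 a i = 0" if "\<not> (a \<in> {''end1'', ''end2''} \<and> i < nE)" "\<not> (a = ''parent'' \<and> i < nN \<and> i \<noteq> rt)"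
      "\<not> (a = ''bag'' \<and> i < nV)"
      by (rule conjunct2[OF rz[unfolded rest_zero_def], THEN spec, THEN spec, THEN mp]) (intro conjI that)
    have ends: "sarr s0 a i \<le> nV" if "a \<in> {''end1'', ''end2''}" "i < nE"
    proof -
      have "a = ''end1'' \<or> a = ''end2''" using that(1) by blast
      then show ?thesis using edge_ends(1,2)[OF that(2)] by (elim disjE) simp_all
    qed
    have parent: "sarr s0 a i \<le> nN" if "a = ''parent''" "i < nN" "i \<noteq> rt"
      unfolding that(1) using par_less[OF that(2,3)] by simp
    have bag: "sarr s0 a i \<le> nN" if "a = ''bag''" "i < nV"
      unfolding that(1) using node_of_less[OF that(2)] by simp
    have "sarr s0 a i \<le> nV \<or> sarr s0 a i \<le> nN"
    proof (rule ccontr)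
      assume n: "\<not> (sarr s0 a i \<le> nV \<or> sarr s0 a i \<le> nN)"
      have "sarr s0 a i = 0"
      proof (rule zero; rule notI; elim conjE)
        assume "a \<in> {''end1'', ''end2''}" "i < nE"
        from ends[OF this] n show False by (elim notE disjI1)
      next
        assume "a = ''parent''" "i < nN" "i \<noteq> rt"
        from parent[OF this] n show False by (elim notE disjI2)
      next
        assume "a = ''bag''" "i < nV"
        from bag[OF this] n show False by (elim notE disjI2)
      qed
      then show False using n by simp
    qed
    then show ?thesis unfolding M by linarith
  qed
  ultimately show ?thesis by (simp add: bounded_state_def)
qed

end

text \<open>The values 100 and 10 are generous; they influence nothing but the exponent of the word
  bound.\<close>

lemma limits_friendly_program: "limits 100 10 friendly_program"
  by (simp add: friendly_program_def prepare_def mark_phase_def mark_walk_def top_init_def propagate_def climb_def add_up_def fill_def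
    edge_phase_def walk_def move_def record_edge_def merge_phase_def merge_iter_def merge_test_def search_def search_test_def size_test_def
    search_body_def count_common_def count_body_def other_end_def do_merge_def absorb_def absorb_body_def)

text \<open>With the base \<open>g + n + 2\<close> the time is at most \<open>c\<close> times its
  square. The remaining constant factor is absorbed by further powers, as any number is less than 2
  to that number; the summand 2 keeps the base large enough for this even on the smallest
  inputs.\<close>

lemma word_bound:
  assumes "T \<le> c * (w * g + n)" "w \<le> g + n"
  shows "A * (g + n + B * T + 1) < (g + n + 2 :: nat) ^ (A * (1 + B * c) + 2)"
proof -
  let ?N = "g + n + 2" and ?K = "A * (1 + B * c)"
  have "w * g + n \<le> (g + n) * g + n" using assms(2) by simp
  also have "\<dots> \<le> ?N * ?N" by (simp add: algebra_simps)
  finally have "c * (w * g + n) \<le> c * (?N * ?N)" by (rule mult_le_mono2)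
  then have "B * T \<le> B * (c * (?N * ?N))" using assms(1) le_trans by (intro mult_le_mono2) blast
  moreover have "g + n + 1 \<le> ?N * ?N" by (simp add: algebra_simps)
  ultimately have "g + n + B * T + 1 \<le> (1 + B * c) * (?N * ?N)" by (simp only: distrib_right mult_1 mult.assoc)
  then have "A * (g + n + B * T + 1) \<le> A * ((1 + B * c) * (?N * ?N))" by (rule mult_le_mono2)
  also have "\<dots> = ?K * (?N * ?N)" by (simp only: mult.assoc)
  also have "\<dots> < ?N ^ ?K * (?N * ?N)"
  proof -
    have "?K < 2 ^ ?K" by (rule less_exp)
    also have "\<dots> \<le> ?N ^ ?K" by (rule power_mono) simp_all
    finally show ?thesis by (rule mult_less_mono1) simp
  qed
  also have "\<dots> = ?N ^ (?K + 2)" by (simp only: power_add power2_eq_square)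
  finally show ?thesis .
qed

theorem theorem5p22:
  "\<exists>P c k. \<forall>(G :: nat sgraph) (D :: (nat, nat) tcdecomp) s w.
     simple_graph G \<longrightarrow> tree_cut_decomposition G D \<longrightarrow> nice G D \<longrightarrow> tcwidth G D = w \<longrightarrow>
     initial_state s G D \<longrightarrow>
     (\<exists>T s' D'.
        rexec ((gsize G + card (tnodes D) + 2) ^ k) P s T s' \<and>
        T \<le> c * (w * gsize G + card (tnodes D)) \<and>
        stores_decomp s' D' \<and>
        tree_cut_decomposition G D' \<and> friendly G D' \<and> tcwidth G D' \<le> max 4 w)"
proof -
  obtain A B where lim: "limits A B friendly_program" using limits_friendly_program by blast
  obtain c :: nat where c: "c = 12000" by simp
  show ?thesis
  proof (rule exI[of _ friendly_program], rule exI[of _ c], rule exI[of _ "A * (1 + B * c) + 2"], intro allI impI)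
    fix G :: "nat sgraph" and D :: "(nat, nat) tcdecomp" and s w
    assume asm: "simple_graph G" "tree_cut_decomposition G D" "nice G D" "tcwidth G D = w" "initial_state s G D"
    interpret program_input G D s by unfold_locales (rule asm)+
    obtain T s' D' where T: "uexec friendly_program s T s'" "T \<le> c * (w * gsize G + card (tnodes D))"
      and D': "stores_decomp s' D'" "tree_cut_decomposition G D'" "friendly G D'" "tcwidth G D' \<le> max 4 w"
      using friendly_program[OF asm(3)] unfolding wp_def c asm(4) by blast
    have "A * (gsize G + card (tnodes D) + B * T + 1) < (gsize G + card (tnodes D) + 2) ^ (A * (1 + B * c) + 2)"
      by (rule word_bound[OF T(2)]) (use tcwidth_le asm(4) in simp)
    then have "rexec ((gsize G + card (tnodes D) + 2) ^ (A * (1 + B * c) + 2)) friendly_program s T s'"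
      using uexec_rexec[OF T(1) lim bounded_init] by blast
    then show "\<exists>T s' D'. rexec ((gsize G + card (tnodes D) + 2) ^ (A * (1 + B * c) + 2)) friendly_program s T s' \<and>
        T \<le> c * (w * gsize G + card (tnodes D)) \<and> stores_decomp s' D' \<and>
        tree_cut_decomposition G D' \<and> friendly G D' \<and> tcwidth G D' \<le> max 4 w"
      using T(2) D' by blast
  qed
qed

end
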